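(* In the setting described in the context (a map $f:X\to X$ with a general return map $F=f^\varphi:Y\to Y$ that is Gibbs Markov with invariant probability measure $\mu_0$), assume that: (i) (finite measure tail) $\mu_0(y\in Y:\varphi(y)>n)=O(n^{-\beta})$ for some $\beta>1$; (ii) there is $C>0$ such that $\int_{\{\varphi>n\}}\rho\,d\mu_0\le C\,\mu_0(\varphi>n)$ for all $n\ge 0$. Let $\bar\varphi=\int_Y\varphi\,d\mu_0<\infty$ and let $\mu:=\frac1{\bar\varphi}\mu_X$. Then for all $v_X,w_X:X\to\mathbb{R}$ with $\|v_X\|_\theta^*<\infty$ and $\|w_X\|_\infty^*<\infty$ and all $n\ge 2$, $$\int_X v_X\, w_X\circ f^n\,d\mu-\int_X v_X\,d\mu\int_X w_X\,d\mu=\frac1{\bar\varphi}\sum_{j=n+1}^\infty\mu_0(\varphi>j)\int_X v_X\,d\mu\int_X w_X\,d\mu+O\big(\|v_X\|_\theta^*\,\|w_X\|_\infty^*\,d_n\big),$$ where the constant implied by $O$ does not depend on $n,v_X,w_X$, and $$d_n=\begin{cases}n^{-\beta}&\text{if }\beta>2,\\ n^{-2}\log n&\text{if }\beta=2,\\ n^{-(2\beta-2)}&\text{if }\beta<2.\end{cases}$$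
   Context: **Setting.** $f:X\to X$ is a measurable map that is conservative and ergodic with respect to an invariant (finite or infinite) measure, and $Y\subset X$ is a measurable set of positive finite measure. $\varphi:Y\to\mathbb{N}=\{1,2,\dots\}$ is a general (not necessarily first) return time to $Y$, so $F:=f^{\varphi}:Y\to Y$, $F(y)=f^{\varphi(y)}(y)$. $F$ preserves a probability measure $\mu_0$ on $Y$ and is Gibbs Markov in the following sense: there is a countable measurable partition $\alpha$ of $Y$ (mod $\mu_0$) such that $\varphi$ is constant on each $a\in\alpha$ and $F:a\to Y$ is a bijection mod $\mu_0$ (so in particular $\inf_{a}\mu_0(Fa)>0$); and with $p=\log\frac{d\mu_0}{d\mu_0\circ F}$ there are $\theta\in(0,1)$, $C_1>0$ with $$e^{p(y)}\le C_1\mu_0(a),\qquad |e^{p(y)}-e^{p(y')}|\le C_1\mu_0(a)\theta^{s(y,y')}\qquad\text{for all }y,y'\in a,\ a\in\alpha,$$ where $s(y,y')=\min\{n\ge 0: F^ny,F^ny'\text{ lie in different elements of }\alpha\}$ is the separation time. **First returns.** $\tau(y)=\min\{n\ge1:f^n(y)\in Y\}$ is the first return time to $Y$; $\tau_0=0$, $\tau_{k+1}(y)=\tau_k(y)+\tau(f^{\tau_k(y)}(y))$. The reinduce time $\rho:Y\to\mathbb{N}$ is defined by $\varphi(y)=\tau_{\rho(y)}(y)$. Null sets are ignored. **Standing condition on the inducing scheme.** For all $a\in\alpha$ and $0\le i<\varphi(a)$, either $f^i(a)\subset Y$ or $f^i(a)\cap Y=\emptyset$. **Standing spectral property.** Let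 $\mathcal{B}_\theta(Y)$ be the Banach space of functions $v$ on $Y$ that are Lipschitz with respect to $d_\theta(x,x')=\theta^{s(x,x')}$, with norm $\|v\|_\theta=\|v\|_{L^\infty(\mu_0)}+\mathrm{Lip}(v)$. Let $R^*$ be the transfer operator of $F$ with respect to $\mu_0$ and, for $|z|\le1$, $R^*(z)v=R^*(z^\varphi v)$. For every $z$ with $|z|\le 1$, $z\ne1$, the number $1$ is not in the spectrum of $R^*(z)$ on (complex-valued) $\mathcal{B}_\theta(Y)$. **Measure on $X$.** $\mu_X(A)=\sum_{j\ge0}\mu_0(f^{-j}A\cap\{\varphi>j\})$, which is $f$-invariant (not normalized). **Weighted norms.** Fix $\varepsilon>0$. Let $\tau^*(x)=1+\min\{i\ge0:f^i(x)\in Y\}$ for $x\in X$; $\tau^*$ is constant on each $f^i(a)$, $a\in\alpha$, $0\le i<\varphi(a)$, and $\tau^*\circ f^i(a)$ denotes this constant. For $v:X\to\mathbb{R}$, $$\|v\|_\infty^*=\sup_{x\in X}|v(x)|\,\tau^*(x)^{1+\varepsilon},\qquad |v|_\theta^*=\sup_{a\in\alpha}\ \sup_{0\le i<\varphi(a)}\ \sup_{x,x'\in a}\frac{(\tau^*\circ f^i(a))^{1+\varepsilon}}{\theta^{s(x,x')}}|v(f^ix)-v(f^ix')|,$$ and $\|v\|_\theta^*=\|v\|_\infty^*+|v|_\theta^*$. *)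

theory Defs
  imports "HOL-Probability.Probability"
begin

section \<open>Maps preserving a measure\<close>

definition measure_preserving_map :: "'a measure \<Rightarrow> ('a \<Rightarrow> 'a) \<Rightarrow> bool" where
  "measure_preserving_map M f \<longleftrightarrow> f \<in> measurable M M \<and> distr M M f = M"

definition conservative_map :: "'a measure \<Rightarrow> ('a \<Rightarrow> 'a) \<Rightarrow> bool" where
  "conservative_map M f \<longleftrightarrow>
     (\<forall>W \<in> sets M. disjoint_family (\<lambda>n::nat. (f ^^ n) -` W \<inter> space M) \<longrightarrow> emeasure M W = 0)"

definition ergodic_map :: "'a measure \<Rightarrow> ('a \<Rightarrow> 'a) \<Rightarrow> bool" where
  "ergodic_map M f \<longleftrightarrow>
     (\<forall>A \<in> sets M. f -` A \<inter> space M = A \<longrightarrow> emeasure M A = 0 \<or> emeasure M (space M - A) = 0)"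


section \<open>Return times\<close>

definition return_map :: "('a \<Rightarrow> 'a) \<Rightarrow> ('a \<Rightarrow> nat) \<Rightarrow> 'a \<Rightarrow> 'a" where
  "return_map f \<phi> y = (f ^^ \<phi> y) y"

definition first_return :: "('a \<Rightarrow> 'a) \<Rightarrow> 'a set \<Rightarrow> 'a \<Rightarrow> nat" where
  "first_return f Y y = (LEAST n. 1 \<le> n \<and> (f ^^ n) y \<in> Y)"

primrec kth_return :: "('a \<Rightarrow> 'a) \<Rightarrow> 'a set \<Rightarrow> nat \<Rightarrow> 'a \<Rightarrow> nat" where
  "kth_return f Y 0 y = 0"
| "kth_return f Y (Suc k) y =
     kth_return f Y k y + first_return f Y ((f ^^ kth_return f Y k y) y)"

(* On Y the return times kth_return f Y k y increase strictly with k and run through all times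
   n >= 1 with f^n(y) in Y, so if phi(y) is a return time, the k below exists and is unique. *)
definition reinduce_time :: "('a \<Rightarrow> 'a) \<Rightarrow> 'a set \<Rightarrow> ('a \<Rightarrow> nat) \<Rightarrow> 'a \<Rightarrow> nat" where
  "reinduce_time f Y \<phi> y = (THE k. \<phi> y = kth_return f Y k y)"


section \<open>Gibbs Markov maps\<close>

(* A partition mod 0 only determines itineraries on this set, which has full measure if F
   preserves the measure. Separation times are used on this set only. *)
definition itinerary_set :: "'a set set \<Rightarrow> ('a \<Rightarrow> 'a) \<Rightarrow> 'a set" where
  "itinerary_set \<alpha> F = {y. \<forall>n. (F ^^ n) y \<in> \<Union>\<alpha>}"

(* The infimum over the empty set is infinity. *)
definition separation_time :: "'a set set \<Rightarrow> ('a \<Rightarrow> 'a) \<Rightarrow> 'a \<Rightarrow> 'a \<Rightarrow> enat" where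
  "separation_time \<alpha> F y y' =
     (INF n \<in> {n. \<exists>a\<in>\<alpha>. \<exists>b\<in>\<alpha>. a \<noteq> b \<and> (F ^^ n) y \<in> a \<and> (F ^^ n) y' \<in> b}. enat n)"

definition d_theta :: "'a set set \<Rightarrow> ('a \<Rightarrow> 'a) \<Rightarrow> real \<Rightarrow> 'a \<Rightarrow> 'a \<Rightarrow> real" where
  "d_theta \<alpha> F \<theta> y y' = (case separation_time \<alpha> F y y' of enat n \<Rightarrow> \<theta> ^ n | \<infinity> \<Rightarrow> 0)"

definition countable_partition_mod :: "'a measure \<Rightarrow> 'a set set \<Rightarrow> bool" where
  "countable_partition_mod \<mu>\<^sub>0 \<alpha> \<longleftrightarrow>
     countable \<alpha> \<and> \<alpha> \<subseteq> sets \<mu>\<^sub>0 \<and> disjoint \<alpha> \<and> emeasure \<mu>\<^sub>0 (space \<mu>\<^sub>0 - \<Union>\<alpha>) = 0"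

(* F : a' -> Y' is a bijection between subsets of full measure of a and of the whole space.
   Images of measurable sets are required to be measurable (automatic in standard Borel spaces),
   as the measure A |-> mu0 (F A) has to make sense. *)
definition bijection_mod :: "'a measure \<Rightarrow> ('a \<Rightarrow> 'a) \<Rightarrow> 'a set \<Rightarrow> 'a set \<Rightarrow> 'a set \<Rightarrow> bool" where
  "bijection_mod \<mu>\<^sub>0 F a a' Y' \<longleftrightarrow>
     a' \<in> sets \<mu>\<^sub>0 \<and> a' \<subseteq> a \<and> emeasure \<mu>\<^sub>0 (a - a') = 0 \<and>
     Y' \<in> sets \<mu>\<^sub>0 \<and> emeasure \<mu>\<^sub>0 (space \<mu>\<^sub>0 - Y') = 0 \<and>
     bij_betw F a' Y' \<and> (\<forall>A \<in> sets \<mu>\<^sub>0. A \<subseteq> a' \<longrightarrow> F ` A \<in> sets \<mu>\<^sub>0)"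

(* The measure mu0 o F on a set a' on which F is injective. *)
definition image_measure :: "'a measure \<Rightarrow> ('a \<Rightarrow> 'a) \<Rightarrow> 'a set \<Rightarrow> 'a measure" where
  "image_measure \<mu>\<^sub>0 F a' =
     measure_of a' (sets (restrict_space \<mu>\<^sub>0 a')) (\<lambda>A. emeasure \<mu>\<^sub>0 (F ` A))"

(* The density equation says exp p = d mu0 / d (mu0 o F) on a. As exp p > 0, it also
   forces F to map null subsets of a' to null sets. *)
definition gibbs_markov :: "'a measure \<Rightarrow> ('a \<Rightarrow> 'a) \<Rightarrow> 'a set set \<Rightarrow> real \<Rightarrow> bool" where
  "gibbs_markov \<mu>\<^sub>0 F \<alpha> \<theta> \<longleftrightarrow>
     prob_space \<mu>\<^sub>0 \<and> measure_preserving_map \<mu>\<^sub>0 F \<and> countable_partition_mod \<mu>\<^sub>0 \<alpha> \<and> 0 < \<theta> \<and> \<theta> < 1 \<and>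
     (\<exists>p C\<^sub>1. p \<in> borel_measurable \<mu>\<^sub>0 \<and> C\<^sub>1 > 0 \<and>
       (\<forall>a\<in>\<alpha>. \<exists>a' Y'. bijection_mod \<mu>\<^sub>0 F a a' Y' \<and>
          density (image_measure \<mu>\<^sub>0 F a') (\<lambda>y. ennreal (exp (p y))) = restrict_space \<mu>\<^sub>0 a') \<and>
       (\<forall>a\<in>\<alpha>. \<forall>y \<in> a \<inter> itinerary_set \<alpha> F. \<forall>y' \<in> a \<inter> itinerary_set \<alpha> F.
          exp (p y) \<le> C\<^sub>1 * measure \<mu>\<^sub>0 a \<and>
          \<bar>exp (p y) - exp (p y')\<bar> \<le> C\<^sub>1 * measure \<mu>\<^sub>0 a * d_theta \<alpha> F \<theta> y y'))"


section \<open>The inducing scheme\<close>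

(* M is the conservative ergodic invariant measure of f (finite or infinite) on X = space M;
   mu0 is a measure on the trace of its sigma-algebra on Y. *)
locale inducing_scheme =
  fixes M :: "'a measure" and f :: "'a \<Rightarrow> 'a" and Y :: "'a set" and \<phi> :: "'a \<Rightarrow> nat"
    and \<mu>\<^sub>0 :: "'a measure" and \<alpha> :: "'a set set" and \<theta> :: real
  assumes invariant: "measure_preserving_map M f"
    and conservative: "conservative_map M f"
    and ergodic: "ergodic_map M f"
    and Y_sets: "Y \<in> sets M"
    and Y_measure: "0 < emeasure M Y" "emeasure M Y < \<infinity>"
    and sets_mu0: "sets \<mu>\<^sub>0 = sets (restrict_space M Y)"
    and phi_measurable: "\<phi> \<in> measurable \<mu>\<^sub>0 (count_space UNIV)"
    and phi_pos: "\<And>y. y \<in> Y \<Longrightarrow> 1 \<le> \<phi> y"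
    and phi_return: "\<And>y. y \<in> Y \<Longrightarrow> return_map f \<phi> y \<in> Y"
    and gibbs_markov: "gibbs_markov \<mu>\<^sub>0 (return_map f \<phi>) \<alpha> \<theta>"
    and phi_const: "\<And>a y y'. a \<in> \<alpha> \<Longrightarrow> y \<in> a \<Longrightarrow> y' \<in> a \<Longrightarrow> \<phi> y = \<phi> y'"
    and levels: "\<And>a y i. a \<in> \<alpha> \<Longrightarrow> y \<in> a \<Longrightarrow> i < \<phi> y \<Longrightarrow>
                   (f ^^ i) ` a \<subseteq> Y \<or> (f ^^ i) ` a \<inter> Y = {}"

definition phi_bar :: "'a measure \<Rightarrow> ('a \<Rightarrow> nat) \<Rightarrow> real" where
  "phi_bar \<mu>\<^sub>0 \<phi> = (\<integral>y. real (\<phi> y) \<partial>\<mu>\<^sub>0)"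

definition mu_X :: "'a measure \<Rightarrow> ('a \<Rightarrow> 'a) \<Rightarrow> ('a \<Rightarrow> nat) \<Rightarrow> 'a measure \<Rightarrow> 'a measure" where
  "mu_X M f \<phi> \<mu>\<^sub>0 = measure_of (space M) (sets M)
     (\<lambda>A. \<Sum>j. emeasure \<mu>\<^sub>0 ((f ^^ j) -` A \<inter> {y \<in> space \<mu>\<^sub>0. \<phi> y > j}))"

definition mu_normalized ::
    "'a measure \<Rightarrow> ('a \<Rightarrow> 'a) \<Rightarrow> ('a \<Rightarrow> nat) \<Rightarrow> 'a measure \<Rightarrow> 'a measure" where
  "mu_normalized M f \<phi> \<mu>\<^sub>0 = scale_measure (ennreal (1 / phi_bar \<mu>\<^sub>0 \<phi>)) (mu_X M f \<phi> \<mu>\<^sub>0)"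

lemma (in inducing_scheme) emeasure_mu_X:
  assumes "A \<in> sets M"
  shows "emeasure (mu_X M f \<phi> \<mu>\<^sub>0) A =
           (\<Sum>j. emeasure \<mu>\<^sub>0 ((f ^^ j) -` A \<inter> {y \<in> space \<mu>\<^sub>0. \<phi> y > j}))"
proof -
  have sp: "space \<mu>\<^sub>0 = Y"
    using sets_eq_imp_space_eq[OF sets_mu0] Y_sets sets.sets_into_space
    by (auto simp: space_restrict_space)
  have f: "f \<in> measurable M M"
    using invariant by (simp add: measure_preserving_map_def)
  have fj: "(f ^^ j) \<in> measurable \<mu>\<^sub>0 M" for j
  proof -
    have "(f ^^ j) \<in> measurable M M"
      using f by (induction j) auto
    then have "(f ^^ j) \<in> measurable (restrict_space M Y) M"
      by (rule measurable_restrict_space1)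
    then show ?thesis
      by (simp cong: measurable_cong_sets add: sets_mu0)
  qed
  have lev: "{y \<in> space \<mu>\<^sub>0. \<phi> y > j} \<in> sets \<mu>\<^sub>0" for j
    using phi_measurable by measurable
  have meas: "(f ^^ j) -` B \<inter> {y \<in> space \<mu>\<^sub>0. \<phi> y > j} \<in> sets \<mu>\<^sub>0" if "B \<in> sets M" for B j
  proof -
    have "(f ^^ j) -` B \<inter> {y \<in> space \<mu>\<^sub>0. \<phi> y > j} =
          ((f ^^ j) -` B \<inter> space \<mu>\<^sub>0) \<inter> {y \<in> space \<mu>\<^sub>0. \<phi> y > j}" by auto
    then show ?thesis
      using measurable_sets[OF fj that] lev by auto
  qed
  show ?thesis
  proof (rule emeasure_measure_of[OF mu_X_def])
    show "sets M \<subseteq> Pow (space M)" by (rule sets.space_closed)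
    show "A \<in> sets (mu_X M f \<phi> \<mu>\<^sub>0)"
      using assms by (simp add: mu_X_def sets.space_closed sets.sigma_sets_eq)
    show "positive (sets (mu_X M f \<phi> \<mu>\<^sub>0))
            (\<lambda>A. \<Sum>j. emeasure \<mu>\<^sub>0 ((f ^^ j) -` A \<inter> {y \<in> space \<mu>\<^sub>0. \<phi> y > j}))"
      by (simp add: positive_def)
    show "countably_additive (sets (mu_X M f \<phi> \<mu>\<^sub>0))
            (\<lambda>A. \<Sum>j. emeasure \<mu>\<^sub>0 ((f ^^ j) -` A \<inter> {y \<in> space \<mu>\<^sub>0. \<phi> y > j}))"
    proof (rule countably_additiveI)
      fix B :: "nat \<Rightarrow> 'a set"
      assume "range B \<subseteq> sets (mu_X M f \<phi> \<mu>\<^sub>0)" and disj: "disjoint_family B"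
      then have B: "B i \<in> sets M" for i
        by (auto simp: mu_X_def sets.space_closed sets.sigma_sets_eq)
      let ?E = "\<lambda>i j. (f ^^ j) -` B i \<inter> {y \<in> space \<mu>\<^sub>0. \<phi> y > j}"
      have union: "emeasure \<mu>\<^sub>0 ((f ^^ j) -` (\<Union>i. B i) \<inter> {y \<in> space \<mu>\<^sub>0. \<phi> y > j}) =
                   (\<Sum>i. emeasure \<mu>\<^sub>0 (?E i j))" for j
      proof -
        have "disjoint_family (\<lambda>i. ?E i j)"
          using disj by (auto simp: disjoint_family_on_def)
        moreover have "range (\<lambda>i. ?E i j) \<subseteq> sets \<mu>\<^sub>0"
          using meas[OF B] by blast
        moreover have "(f ^^ j) -` (\<Union>i. B i) \<inter> {y \<in> space \<mu>\<^sub>0. \<phi> y > j} = (\<Union>i. ?E i j)"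
          by auto
        ultimately show ?thesis
          by (simp add: suminf_emeasure)
      qed
      have "(\<Sum>i. \<Sum>j. emeasure \<mu>\<^sub>0 (?E i j)) =
            (\<integral>\<^sup>+i. (\<Sum>j. emeasure \<mu>\<^sub>0 (?E i j)) \<partial>count_space UNIV)"
        by (rule nn_integral_count_space_nat[symmetric])
      also have "\<dots> = (\<Sum>j. \<integral>\<^sup>+i. emeasure \<mu>\<^sub>0 (?E i j) \<partial>count_space UNIV)"
        by (rule nn_integral_suminf) simp
      also have "\<dots> = (\<Sum>j. \<Sum>i. emeasure \<mu>\<^sub>0 (?E i j))"
        by (simp only: nn_integral_count_space_nat)
      finally show "(\<Sum>i. \<Sum>j. emeasure \<mu>\<^sub>0 (?E i j)) =
            (\<Sum>j. emeasure \<mu>\<^sub>0 ((f ^^ j) -` (\<Union>i. B i) \<inter> {y \<in> space \<mu>\<^sub>0. \<phi> y > j}))"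
        by (simp only: union)
    qed
  qed
qed


section \<open>The spectral property\<close>

(* Complex-valued functions on Y. Null sets are ignored: the Lipschitz constant is taken on the
   set of points with a well-defined itinerary. In ennreal, c / 0 is infinity for c > 0
   and 0 / 0 = 0. *)
definition norm_theta ::
    "'a measure \<Rightarrow> 'a set set \<Rightarrow> ('a \<Rightarrow> 'a) \<Rightarrow> real \<Rightarrow> ('a \<Rightarrow> complex) \<Rightarrow> ennreal" where
  "norm_theta \<mu>\<^sub>0 \<alpha> F \<theta> v =
     esssup \<mu>\<^sub>0 (\<lambda>y. ennreal (norm (v y))) +
     (SUP (y, y') \<in> (space \<mu>\<^sub>0 \<inter> itinerary_set \<alpha> F) \<times> (space \<mu>\<^sub>0 \<inter> itinerary_set \<alpha> F).
        ennreal (norm (v y - v y')) / ennreal (d_theta \<alpha> F \<theta> y y'))"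

definition B_theta ::
    "'a measure \<Rightarrow> 'a set set \<Rightarrow> ('a \<Rightarrow> 'a) \<Rightarrow> real \<Rightarrow> ('a \<Rightarrow> complex) set" where
  "B_theta \<mu>\<^sub>0 \<alpha> F \<theta> = {v \<in> borel_measurable \<mu>\<^sub>0. norm_theta \<mu>\<^sub>0 \<alpha> F \<theta> v < \<infinity>}"

(* The transfer operator determines a function up to null sets only; the version in B is chosen.
   For Gibbs Markov F, B = B_theta and v in B it exists. *)
definition transfer_op ::
    "'a measure \<Rightarrow> ('a \<Rightarrow> 'a) \<Rightarrow> ('a \<Rightarrow> complex) set \<Rightarrow> ('a \<Rightarrow> complex) \<Rightarrow> 'a \<Rightarrow> complex" where
  "transfer_op \<mu>\<^sub>0 F B v =
     (SOME r. r \<in> B \<and>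
        (\<forall>A \<in> sets \<mu>\<^sub>0. (LINT y:A|\<mu>\<^sub>0. r y) = (LINT y:(F -` A \<inter> space \<mu>\<^sub>0)|\<mu>\<^sub>0. v y)))"

definition twisted_transfer_op ::
    "'a measure \<Rightarrow> ('a \<Rightarrow> 'a) \<Rightarrow> ('a \<Rightarrow> complex) set \<Rightarrow> ('a \<Rightarrow> nat) \<Rightarrow> complex
      \<Rightarrow> ('a \<Rightarrow> complex) \<Rightarrow> 'a \<Rightarrow> complex" where
  "twisted_transfer_op \<mu>\<^sub>0 F B \<phi> z v = transfer_op \<mu>\<^sub>0 F B (\<lambda>y. z ^ \<phi> y * v y)"

(* Bounded linear operators and spectrum on a space B of functions with seminorm N, where
   functions at distance 0 are identified. *)
definition bounded_linear_on ::
    "('a \<Rightarrow> complex) set \<Rightarrow> (('a \<Rightarrow> complex) \<Rightarrow> ennreal)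
      \<Rightarrow> (('a \<Rightarrow> complex) \<Rightarrow> 'a \<Rightarrow> complex) \<Rightarrow> bool" where
  "bounded_linear_on B N S \<longleftrightarrow>
     (\<forall>u\<in>B. S u \<in> B) \<and>
     (\<forall>u\<in>B. \<forall>v\<in>B. N (\<lambda>x. S (\<lambda>x. u x + v x) x - (S u x + S v x)) = 0) \<and>
     (\<forall>u\<in>B. \<forall>c. N (\<lambda>x. S (\<lambda>x. c * u x) x - c * S u x) = 0) \<and>
     (\<exists>K::real. \<forall>u\<in>B. N (S u) \<le> ennreal K * N u)"

definition spectrum_on ::
    "('a \<Rightarrow> complex) set \<Rightarrow> (('a \<Rightarrow> complex) \<Rightarrow> ennreal)
      \<Rightarrow> (('a \<Rightarrow> complex) \<Rightarrow> 'a \<Rightarrow> complex) \<Rightarrow> complex set" where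
  "spectrum_on B N T = {c. \<not> (\<exists>S. bounded_linear_on B N S \<and>
     (\<forall>v\<in>B. N (\<lambda>x. S (\<lambda>x. c * v x - T v x) x - v x) = 0 \<and>
            N (\<lambda>x. (c * S v x - T (S v) x) - v x) = 0))}"


section \<open>Weighted norms\<close>

definition tau_star :: "('a \<Rightarrow> 'a) \<Rightarrow> 'a set \<Rightarrow> 'a \<Rightarrow> nat" where
  "tau_star f Y x = 1 + (LEAST i. (f ^^ i) x \<in> Y)"

(* Points that never enter Y, where tau_star is undefined, form a null set and are ignored. *)
definition norm_inf_star ::
    "'a measure \<Rightarrow> ('a \<Rightarrow> 'a) \<Rightarrow> 'a set \<Rightarrow> real \<Rightarrow> ('a \<Rightarrow> real) \<Rightarrow> ennreal" where
  "norm_inf_star M f Y \<epsilon> v =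
     (SUP x \<in> {x \<in> space M. \<exists>i. (f ^^ i) x \<in> Y}. ennreal (\<bar>v x\<bar> * real (tau_star f Y x) powr (1 + \<epsilon>)))"

(* tau_star is constant on f^i(a), so its value at f^i(x) is the one on f^i(a). *)
definition seminorm_theta_star ::
    "('a \<Rightarrow> 'a) \<Rightarrow> 'a set \<Rightarrow> ('a \<Rightarrow> nat) \<Rightarrow> 'a set set \<Rightarrow> real \<Rightarrow> real \<Rightarrow> ('a \<Rightarrow> real) \<Rightarrow> ennreal" where
  "seminorm_theta_star f Y \<phi> \<alpha> \<theta> \<epsilon> v =
     (SUP a \<in> \<alpha>. SUP x \<in> a \<inter> itinerary_set \<alpha> (return_map f \<phi>).
      SUP x' \<in> a \<inter> itinerary_set \<alpha> (return_map f \<phi>). SUP i \<in> {..<\<phi> x}.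
        ennreal (real (tau_star f Y ((f ^^ i) x)) powr (1 + \<epsilon>))
          / ennreal (d_theta \<alpha> (return_map f \<phi>) \<theta> x x')
          * ennreal \<bar>v ((f ^^ i) x) - v ((f ^^ i) x')\<bar>)"

definition norm_theta_star ::
    "'a measure \<Rightarrow> ('a \<Rightarrow> 'a) \<Rightarrow> 'a set \<Rightarrow> ('a \<Rightarrow> nat) \<Rightarrow> 'a set set \<Rightarrow> real \<Rightarrow> real
      \<Rightarrow> ('a \<Rightarrow> real) \<Rightarrow> ennreal" where
  "norm_theta_star M f Y \<phi> \<alpha> \<theta> \<epsilon> v =
     norm_inf_star M f Y \<epsilon> v + seminorm_theta_star f Y \<phi> \<alpha> \<theta> \<epsilon> v"


section \<open>The error term\<close>

definition decay_rate :: "real \<Rightarrow> nat \<Rightarrow> real" where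
  "decay_rate \<beta> n =
     (if \<beta> > 2 then real n powr (- \<beta>)
      else if \<beta> = 2 then real n powr (- 2) * ln (real n)
      else real n powr (- (2 * \<beta> - 2)))"

end

theory Submission
  imports Defs "HOL-Complex_Analysis.Complex_Analysis" "HOL-Library.Function_Algebras" "HOL-Real_Asymp.Real_Asymp"
begin

text \<open>
  Write R for the transfer operator of the full branch map F and let R(z) v = R(z^\<phi> v) be the
  generating function of the operators R restricted to the level sets of \<phi>. Decomposing an
  orbit of f at its visits to Y under F expresses the correlations through the coefficients
  of T(z) = 1 / (1 - R(z)): a function on the tower enters through its contribution during
  the last part of its first excursion, and the test function through the initial part of the last
  one. Near z = 1 the operator 1 - R(z) is split by the projection P onto constants and its
  complement, on which 1 - R has a spectral gap; after dividing out the factor 1 - z everything is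
  invertible on the closed unit disc by the spectral hypothesis. A Wiener lemma for power series of
  operators with coefficients O(n^(-\<beta>)) then inverts the remaining factors without loss of
  decay. This gives T_n = P / m + (sum over j > n of \<mu>(\<phi> > j)) P / m^2 + O(d_n), where
  m is the mean of \<phi>; the term d_n comes from the square of the tail series.

  The weight tau_star^(-(1+\<epsilon>)) in the norms makes the sum of a function over a column of
  the tower bounded by a multiple of the reinduce time \<rho>, because between two visits to Y the
  weights are summable. Condition (ii) therefore turns the tails of all these column sums into
  O(n^(-\<beta>)), so that convolving them with T_n preserves the expansion.
\<close>

section \<open>The ring of linear operators\<close>

text \<open>T(z) has a pole at z = 1, and the coefficients of R(z) decay only polynomially, so
  nothing extends beyond the unit circle. Dividing by 1 - z on the range of P alone gives B(z) = (1
  - R(z)) (P/(1-z) + 1 - P). Because R(1) P = P, its P-part is the series of the tails of R, so the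
  coefficients of B are O(n^(-\<beta>)). The inverse b of B exists formally since \<phi> is at least
  1; the work lies in bounding its coefficients. For this b(rz) is continued from r = 0 to r = 1 in
  finitely many steps. Their length is governed by B and by a lower bound for B(z) that is uniform
  on the closed disc: it comes from the spectral hypothesis for z \<noteq> 1, from the spectral gap
  and the positive mean of \<phi> for z = 1, and from compactness. The rate d_n is the size of the
  coefficients of (1-z) t(z)^2, where t_n is the sum of \<mu>(\<phi> > j) over j > n. The factor 1 -
  z produces a cancellation, after which n^(-\<beta>) times the sum of l^(1-\<beta>) over l \<le> n
  remains. That sum converges, grows like a logarithm or grows like a power according to \<beta>,
  whence the three cases.\<close>

text \<open>Linear maps on all functions form a ring, which is what formal power series need; the
  Lipschitz functions are singled out only by the boundedness predicate bd below.\<close>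

typedef 'a endo = "{A :: ('a \<Rightarrow> complex) \<Rightarrow> ('a \<Rightarrow> complex).
  (\<forall>u v. A (u + v) = A u + A v) \<and> (\<forall>c u. A (\<lambda>x. c * u x) = (\<lambda>x. c * A u x))}"
  morphisms ap Abs_endo
  by (rule exI[of _ id]) auto

setup_lifting type_definition_endo

instantiation endo :: (type) ring_1
begin
lift_definition zero_endo :: "'a endo" is "\<lambda>u. 0" by (auto simp: fun_eq_iff)
lift_definition one_endo :: "'a endo" is "\<lambda>u. u" by auto
lift_definition plus_endo :: "'a endo \<Rightarrow> 'a endo \<Rightarrow> 'a endo" is "\<lambda>A B u. A u + B u"
  by (auto simp: algebra_simps fun_eq_iff)
lift_definition minus_endo :: "'a endo \<Rightarrow> 'a endo \<Rightarrow> 'a endo" is "\<lambda>A B u. A u - B u"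
  by (auto simp: algebra_simps fun_eq_iff)
lift_definition uminus_endo :: "'a endo \<Rightarrow> 'a endo" is "\<lambda>A u. - A u"
  by (auto simp: algebra_simps fun_eq_iff)
lift_definition times_endo :: "'a endo \<Rightarrow> 'a endo \<Rightarrow> 'a endo" is "\<lambda>A B u. A (B u)"
  by auto
instance
proof
  fix a b c :: "'a endo"
  show "a * b * c = a * (b * c)" by transfer auto
  show "1 * a = a" by transfer auto
  show "a * 1 = a" by transfer auto
  show "a + b + c = a + (b + c)" by transfer (auto simp: algebra_simps)
  show "a + b = b + a" by transfer (auto simp: algebra_simps)
  show "0 + a = a" by transfer auto
  show "- a + a = 0" by transfer auto
  show "a - b = a + - b" by transfer auto
  show "(a + b) * c = a * c + b * c" by transfer auto
  show "a * (b + c) = a * b + a * c" by transfer auto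
  show "(0::'a endo) \<noteq> 1"
  proof transfer
    show "(\<lambda>u::'a \<Rightarrow> complex. 0) \<noteq> (\<lambda>u. u)"
    proof
      assume "(\<lambda>u::'a \<Rightarrow> complex. 0) = (\<lambda>u. u)"
      from fun_cong[OF this, of "\<lambda>x. 1"] show False by (simp add: fun_eq_iff)
    qed
  qed
qed
end

text \<open>Scalars are embedded as central elements of the ring (\<open>cm_commute\<close>), so
  that scalar factors can be moved past operators inside a power series.\<close>

lift_definition cm :: "complex \<Rightarrow> 'a endo" is "\<lambda>c u x. c * u x"
  by (auto simp: algebra_simps fun_eq_iff)

lemma ap_simps [simp]:
  "ap 0 u = 0" "ap 1 u = u" "ap (A + B) u = ap A u + ap B u" "ap (A - B) u = ap A u - ap B u"
  "ap (- A) u = - ap A u" "ap (A * B) u = ap A (ap B u)" "ap (cm c) u = (\<lambda>x. c * u x)"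
  by (transfer, simp)+

lemma ap_add: "ap A (u + v) = ap A u + ap A v"
  by transfer simp

lemma ap_cmult: "ap A (\<lambda>x. c * u x) = (\<lambda>x. c * ap A u x)"
  by transfer simp

lemma ap_zero: "ap A 0 = 0"
  using ap_cmult[of A 0 0] by (simp add: zero_fun_def)

lemma ap_minus: "ap A (u - v) = ap A u - ap A v"
proof -
  have "ap A ((u - v) + v) = ap A (u - v) + ap A v" by (rule ap_add)
  then show ?thesis by (simp add: algebra_simps)
qed

lemma ap_sum_right: "ap A (\<lambda>x. \<Sum>i\<in>I. u i x) = (\<lambda>x. \<Sum>i\<in>I. ap A (u i) x)"
proof (induction I rule: infinite_finite_induct)
  case (insert i I)
  have "ap A (\<lambda>x. \<Sum>i\<in>insert i I. u i x) = ap A (u i + (\<lambda>x. \<Sum>i\<in>I. u i x))"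
    using insert by (simp add: plus_fun_def)
  then show ?case using insert by (simp only: ap_add) (simp add: plus_fun_def)
qed (use ap_zero[of A] in \<open>simp_all add: zero_fun_def\<close>)

lemma ap_sum: "ap (\<Sum>i\<in>I. A i) u x = (\<Sum>i\<in>I. ap (A i) u x)"
  by (induction I rule: infinite_finite_induct) auto

lemma endo_eqI: "(\<And>u. ap A u = ap B u) \<Longrightarrow> A = B"
  by (metis ap_inject ext)

lemma cm_commute: "cm c * A = A * cm c"
  by (rule endo_eqI) (simp add: ap_cmult)

lemma cm_add: "cm (a + b) = cm a + cm b" and cm_mult: "cm (a * b) = cm a * cm b"
  and cm_diff: "cm (a - b) = cm a - cm b" and cm_0: "cm 0 = 0" and cm_1: "cm 1 = 1"
  by (rule endo_eqI; simp add: fun_eq_iff algebra_simps)+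

lemma cm_sum: "cm (\<Sum>i\<in>I. c i) = (\<Sum>i\<in>I. cm (c i))"
  by (induction I rule: infinite_finite_induct) (auto simp: cm_add cm_0)

section \<open>Lipschitz functions and bounded operators\<close>

text \<open>Norms are taken over the points of \<open>\<Omega>\<close>, later a set of full measure
  that is invariant under \<open>F\<close> and under all inverse branches. This replaces classes
  modulo null sets by honest functions that can be evaluated at points.\<close>

locale lip_space =
  fixes \<mu> :: "'a measure" and \<Omega> :: "'a set" and d :: "'a \<Rightarrow> 'a \<Rightarrow> real"
  assumes Omega_ne: "\<Omega> \<noteq> {}" and d_nonneg: "\<And>x y. 0 \<le> d x y"
begin

text \<open>One number bounds both the values and the Lipschitz quotient, so \<open>nrm\<close> is
  the maximum of the sup norm and the Lipschitz constant. It is equivalent to their sum, and most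
  bounds on it reduce to numerical bounds at one or two points.\<close>

definition nb :: "real \<Rightarrow> ('a \<Rightarrow> complex) \<Rightarrow> bool" where
  "nb s v \<longleftrightarrow> (\<forall>x\<in>\<Omega>. cmod (v x) \<le> s) \<and> (\<forall>x\<in>\<Omega>. \<forall>y\<in>\<Omega>. cmod (v x - v y) \<le> s * d x y)"

definition V :: "('a \<Rightarrow> complex) set" where
  "V = {v \<in> borel_measurable \<mu>. \<exists>s. nb s v}"

definition nrm :: "('a \<Rightarrow> complex) \<Rightarrow> real" where
  "nrm v = Inf {s. nb s v}"

lemma nb_nonneg: "nb s v \<Longrightarrow> 0 \<le> s"
  using Omega_ne norm_ge_zero order_trans unfolding nb_def by blast

lemma nb_mono: "nb s v \<Longrightarrow> s \<le> t \<Longrightarrow> nb t v"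
  unfolding nb_def by (meson d_nonneg mult_right_mono order_trans)

text \<open>Closedness of the set of admissible bounds shows that the infimum in \<open>nrm\<close>
  is attained (\<open>nb_nrm\<close>).\<close>

lemma nb_closed:
  assumes "\<And>e. e > 0 \<Longrightarrow> nb (s + e) v"
  shows "nb s v"
proof -
  have "cmod (v x) \<le> s" if "x \<in> \<Omega>" for x
    by (rule field_le_epsilon) (use assms that in \<open>auto simp: nb_def\<close>)
  moreover have "cmod (v x - v y) \<le> s * d x y" if "x \<in> \<Omega>" "y \<in> \<Omega>" for x y
  proof (rule field_le_epsilon)
    fix e :: real assume e: "e > 0"
    have dp: "d x y + 1 > 0" using d_nonneg[of x y] by simp
    then have e': "e / (d x y + 1) > 0" using e by simp
    have "cmod (v x - v y) \<le> (s + e / (d x y + 1)) * d x y"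
      using assms[OF e'] that by (auto simp: nb_def)
    also have "\<dots> = s * d x y + e * (d x y / (d x y + 1))" by (simp add: algebra_simps)
    also have "\<dots> \<le> s * d x y + e * 1"
      using e d_nonneg[of x y] dp by (intro add_left_mono mult_left_mono) auto
    finally show "cmod (v x - v y) \<le> s * d x y + e" by simp
  qed
  ultimately show ?thesis by (auto simp: nb_def)
qed

lemma nrm_le: "nb s v \<Longrightarrow> nrm v \<le> s"
  unfolding nrm_def by (rule cInf_lower) (auto intro!: bdd_belowI[of _ 0] nb_nonneg)

lemma nb_nrm: assumes "v \<in> V" shows "nb (nrm v) v"
proof (rule nb_closed)
  fix e :: real assume "e > 0"
  moreover have "{s. nb s v} \<noteq> {}" using assms by (auto simp: V_def)
  ultimately obtain s where "nb s v" "s < nrm v + e"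
    using cInf_lessD[of "{s. nb s v}" "nrm v + e"] by (auto simp: nrm_def)
  then show "nb (nrm v + e) v" using nb_mono by force
qed

lemma nrm_nonneg: "v \<in> V \<Longrightarrow> 0 \<le> nrm v"
  using nb_nrm nb_nonneg by blast

lemma V_iff: "v \<in> V \<longleftrightarrow> v \<in> borel_measurable \<mu> \<and> (\<exists>s. nb s v)"
  by (auto simp: V_def)

lemma V_meas: "v \<in> V \<Longrightarrow> v \<in> borel_measurable \<mu>"
  by (auto simp: V_def)

lemma nrm_pt: "v \<in> V \<Longrightarrow> x \<in> \<Omega> \<Longrightarrow> cmod (v x) \<le> nrm v"
  and nrm_lip: "v \<in> V \<Longrightarrow> x \<in> \<Omega> \<Longrightarrow> y \<in> \<Omega> \<Longrightarrow> cmod (v x - v y) \<le> nrm v * d x y"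
  using nb_nrm by (auto simp: nb_def)

lemma nb_add: "nb s u \<Longrightarrow> nb t v \<Longrightarrow> nb (s + t) (u + v)"
proof -
  assume a: "nb s u" "nb t v"
  have "cmod (u x + v x - (u y + v y)) \<le> (s + t) * d x y" if "x \<in> \<Omega>" "y \<in> \<Omega>" for x y
  proof -
    have "cmod (u x + v x - (u y + v y)) \<le> cmod (u x - u y) + cmod (v x - v y)"
      using norm_triangle_ineq[of "u x - u y" "v x - v y"] by (simp add: algebra_simps)
    also have "\<dots> \<le> s * d x y + t * d x y" using a that by (intro add_mono) (auto simp: nb_def)
    finally show ?thesis by (simp add: algebra_simps)
  qed
  moreover have "cmod (u x + v x) \<le> s + t" if "x \<in> \<Omega>" for x
    using a that norm_triangle_mono unfolding nb_def by blast
  ultimately show ?thesis by (auto simp: nb_def)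
qed

lemma nb_cmult: "nb s u \<Longrightarrow> nb (cmod c * s) (\<lambda>x. c * u x)"
proof -
  assume a: "nb s u"
  have "cmod (c * u x - c * u y) \<le> cmod c * s * d x y" if "x \<in> \<Omega>" "y \<in> \<Omega>" for x y
  proof -
    have "cmod (c * u x - c * u y) = cmod c * cmod (u x - u y)"
      by (simp add: norm_mult[symmetric] algebra_simps)
    also have "\<dots> \<le> cmod c * (s * d x y)" using a that by (intro mult_left_mono) (auto simp: nb_def)
    finally show ?thesis by simp
  qed
  then show ?thesis using a by (auto simp: nb_def norm_mult intro: mult_left_mono)
qed

lemma V_add: "u \<in> V \<Longrightarrow> v \<in> V \<Longrightarrow> u + v \<in> V"
  and nrm_add: "u \<in> V \<Longrightarrow> v \<in> V \<Longrightarrow> nrm (u + v) \<le> nrm u + nrm v"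
  using nb_add[OF nb_nrm nb_nrm] nrm_le by (auto simp: V_iff plus_fun_def)

lemma V_cmult: "u \<in> V \<Longrightarrow> (\<lambda>x. c * u x) \<in> V"
  and nrm_cmult: "u \<in> V \<Longrightarrow> nrm (\<lambda>x. c * u x) \<le> cmod c * nrm u"
  using nb_cmult[OF nb_nrm] nrm_le by (auto simp: V_iff)

lemma V_zero: "0 \<in> V" and nrm_zero: "nrm 0 = 0"
proof -
  have "nb 0 (0 :: 'a \<Rightarrow> complex)" by (auto simp: nb_def)
  then show *: "0 \<in> V" by (auto simp: V_iff zero_fun_def)
  show "nrm 0 = 0" using nrm_nonneg[OF *] nrm_le[OF \<open>nb 0 0\<close>] by auto
qed

lemma V_uminus: "u \<in> V \<Longrightarrow> - u \<in> V" and nrm_uminus: "u \<in> V \<Longrightarrow> nrm (- u) \<le> nrm u"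
  using V_cmult[of u "-1"] nrm_cmult[of u "-1"] by (auto simp: fun_Compl_def)

lemma V_diff: "u \<in> V \<Longrightarrow> v \<in> V \<Longrightarrow> u - v \<in> V"
  and nrm_diff: "u \<in> V \<Longrightarrow> v \<in> V \<Longrightarrow> nrm (u - v) \<le> nrm u + nrm v"
  using V_add[of u "- v"] nrm_add[of u "- v"] V_uminus[of v] nrm_uminus[of v] by force+

lemma nrm_diff_ge: "u \<in> V \<Longrightarrow> v \<in> V \<Longrightarrow> nrm u \<le> nrm v + nrm (u - v)"
  using nrm_add[of v "u - v"] V_diff[of u v] by simp

lemma V_sum: "(\<And>i. i \<in> I \<Longrightarrow> u i \<in> V) \<Longrightarrow> (\<lambda>x. \<Sum>i\<in>I. u i x) \<in> V"
proof (induction I rule: infinite_finite_induct)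
  case (insert i I)
  then show ?case using V_add[of "u i" "\<lambda>x. \<Sum>i\<in>I. u i x"] by (simp add: plus_fun_def)
qed (use V_zero in \<open>simp_all add: zero_fun_def\<close>)

text \<open>A bound for the operator norm on \<open>V\<close>, stated as a predicate because an
  element of \<open>endo\<close> may be unbounded or may not preserve \<open>V\<close> at
  all.\<close>

definition bd :: "'a endo \<Rightarrow> real \<Rightarrow> bool" where
  "bd A K \<longleftrightarrow> 0 \<le> K \<and> (\<forall>v\<in>V. ap A v \<in> V \<and> nrm (ap A v) \<le> K * nrm v)"

lemma bd_V: "bd A K \<Longrightarrow> v \<in> V \<Longrightarrow> ap A v \<in> V"
  and bd_nrm: "bd A K \<Longrightarrow> v \<in> V \<Longrightarrow> nrm (ap A v) \<le> K * nrm v"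
  and bd_nonneg: "bd A K \<Longrightarrow> 0 \<le> K"
  by (auto simp: bd_def)

lemma bd_mono: "bd A K \<Longrightarrow> K \<le> L \<Longrightarrow> bd A L"
  unfolding bd_def by (meson mult_right_mono nrm_nonneg order_trans)

lemma bd_0: "bd 0 0"
  by (auto simp: bd_def V_zero nrm_zero)

lemma bd_1: "bd 1 1"
  by (auto simp: bd_def)

lemma bd_add: "bd A K \<Longrightarrow> bd B L \<Longrightarrow> bd (A + B) (K + L)"
  unfolding bd_def by (auto simp: V_add distrib_right intro!: order_trans[OF nrm_add] add_mono)

lemma bd_uminus: "bd A K \<Longrightarrow> bd (- A) K"
  unfolding bd_def by (auto simp: V_uminus intro!: order_trans[OF nrm_uminus])

lemma bd_diff: "bd A K \<Longrightarrow> bd B L \<Longrightarrow> bd (A - B) (K + L)"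
  using bd_add[OF _ bd_uminus] by fastforce

lemma bd_mult: "bd A K \<Longrightarrow> bd B L \<Longrightarrow> bd (A * B) (K * L)"
proof -
  assume a: "bd A K" "bd B L"
  have "nrm (ap A (ap B v)) \<le> K * L * nrm v" if "v \<in> V" for v
  proof -
    have "nrm (ap A (ap B v)) \<le> K * nrm (ap B v)" using a that by (auto simp: bd_def)
    also have "\<dots> \<le> K * (L * nrm v)" using a that by (intro mult_left_mono) (auto simp: bd_def)
    finally show ?thesis by simp
  qed
  then show ?thesis using a by (auto simp: bd_def)
qed

lemma bd_cm: "bd (cm c) (cmod c)"
  by (auto simp: bd_def V_cmult nrm_cmult)

lemma bd_sum: "(\<And>i. i \<in> I \<Longrightarrow> bd (A i) (K i)) \<Longrightarrow> bd (\<Sum>i\<in>I. A i) (\<Sum>i\<in>I. K i)"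
  by (induction I rule: infinite_finite_induct) (auto simp: bd_0 bd_add)

lemma bd_closed:
  assumes "\<And>e. e > 0 \<Longrightarrow> bd A (K + e)"
  shows "bd A K"
proof -
  have K: "K \<ge> 0" by (rule field_le_epsilon) (use assms bd_nonneg in auto)
  have "nrm (ap A v) \<le> K * nrm v" if v: "v \<in> V" for v
  proof (rule field_le_epsilon)
    fix e :: real assume e: "e > 0"
    have n: "nrm v + 1 > 0" using nrm_nonneg[OF v] by simp
    have "nrm (ap A v) \<le> (K + e / (nrm v + 1)) * nrm v"
      using assms[of "e / (nrm v + 1)"] e n v by (auto simp: bd_def)
    also have "\<dots> = K * nrm v + e * (nrm v / (nrm v + 1))" by (simp add: algebra_simps)
    also have "\<dots> \<le> K * nrm v + e * 1"
      using e n nrm_nonneg[OF v] by (intro add_left_mono mult_left_mono) auto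
    finally show "nrm (ap A v) \<le> K * nrm v + e" by simp
  qed
  then show ?thesis using K assms[of 1] by (auto simp: bd_def)
qed

lemma bd_fps_mult:
  assumes "\<And>i. i \<le> n \<Longrightarrow> bd (fps_nth a i) (x i)" "\<And>i. i \<le> n \<Longrightarrow> bd (fps_nth b i) (y i)"
  shows "bd (fps_nth (a * b) n) (\<Sum>i=0..n. x i * y (n - i))"
  unfolding fps_mult_nth by (intro bd_sum bd_mult assms) auto

end

section \<open>Numerical double series and power series\<close>

lemma infsum_UNIV_nat:
  fixes g :: "nat \<Rightarrow> 'b::banach"
  assumes "summable (\<lambda>n. norm (g n))"
  shows "infsum g UNIV = (\<Sum>n. g n)"
  using norm_summable_imp_has_sum[OF assms summable_sums[OF summable_norm_cancel[OF assms]]]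
  by (rule infsumI)

text \<open>Domination by a product of summable sequences gives absolute summability over all pairs,
  so rows may be exchanged for diagonals. This is the analytic content of the multiplicativity of
  evaluation.\<close>

lemma suminf_double_diag:
  fixes c :: "nat \<Rightarrow> nat \<Rightarrow> complex"
  assumes c: "\<And>n m. cmod (c n m) \<le> x n * y m" and x: "summable x" and y: "summable y"
  shows "(\<Sum>k. \<Sum>i=0..k. c i (k - i)) = (\<Sum>n. \<Sum>m. c n m)"
proof -
  have xy: "0 \<le> x n * y m" for n m using c norm_ge_zero order_trans by blast
  have sx: "summable (\<lambda>n. \<bar>x n * y m\<bar>)" "summable (\<lambda>n. \<bar>x m * y n\<bar>)" for m
    using summable_mult2[OF x, of "y m"] summable_mult[OF y, of "x m"] xy by auto
  let ?f = "\<lambda>(n, m). c n m"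
  have inner: "summable (\<lambda>m. cmod (c n m))" for n
    by (rule summable_comparison_test'[OF summable_mult[OF y, of "x n"], of 0]) (use c in auto)
  have inner_le: "(\<Sum>m. cmod (c n m)) \<le> x n * (\<Sum>m. y m)" for n
    using suminf_le[OF c inner summable_mult[OF y, of "x n"]] suminf_mult[OF y, of "x n"] by simp
  have out: "summable (\<lambda>n. \<Sum>m. cmod (c n m))"
    by (rule summable_comparison_test'[OF summable_mult2[OF x, of "\<Sum>m. y m"], of 0])
       (use inner_le inner in \<open>auto simp: suminf_nonneg\<close>)
  have abs: "(\<lambda>z. norm (?f z)) summable_on (UNIV \<times> UNIV)"
  proof (rule Infinite_Sum.abs_summable_on_Sigma_iff[THEN iffD2], intro conjI ballI)
    fix n :: nat
    show "(\<lambda>m. norm (?f (n, m))) summable_on UNIV"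
      using inner[of n] by (simp add: summable_on_UNIV_nonneg_real_iff)
    have "(\<Sum>\<^sub>\<infinity>m\<in>UNIV. norm (?f (n, m))) = (\<Sum>m. cmod (c n m))" for n
      using infsum_UNIV_nat[of "\<lambda>m. cmod (c n m)"] inner[of n] by simp
    then show "(\<lambda>n. norm (\<Sum>\<^sub>\<infinity>m\<in>UNIV. norm (?f (n, m)))) summable_on UNIV"
      using out inner by (simp add: summable_on_UNIV_nonneg_real_iff suminf_nonneg)
  qed
  have summ: "?f summable_on (UNIV \<times> UNIV)" by (rule abs_summable_summable[OF abs])
  have A: "infsum ?f (UNIV \<times> UNIV) = (\<Sum>n. \<Sum>m. c n m)"
  proof -
    have "infsum ?f (UNIV \<times> UNIV) = (\<Sum>\<^sub>\<infinity>n\<in>UNIV. \<Sum>\<^sub>\<infinity>m\<in>UNIV. c n m)"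
      using infsum_Sigma'_banach[of c UNIV "\<lambda>_. UNIV"] summ by simp
    also have "\<dots> = (\<Sum>\<^sub>\<infinity>n\<in>UNIV. \<Sum>m. c n m)"
      by (rule infsum_cong) (rule infsum_UNIV_nat[OF inner])
    also have "\<dots> = (\<Sum>n. \<Sum>m. c n m)"
    proof (rule infsum_UNIV_nat)
      show "summable (\<lambda>n. cmod (\<Sum>m. c n m))"
        by (rule summable_comparison_test'[OF out, of 0]) (use summable_norm[OF inner] in auto)
    qed
    finally show ?thesis .
  qed
  let ?h = "\<lambda>(k::nat, i). (i, k - i)"
  have bij: "bij_betw ?h (Sigma UNIV (\<lambda>k. {0..k})) (UNIV \<times> UNIV)"
    by (rule bij_betwI[of _ _ _ "\<lambda>(n, m). (n + m, n)"]) auto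
  have summ2: "(\<lambda>(k, i). c i (k - i)) summable_on (Sigma UNIV (\<lambda>k. {0..k}))"
    using summable_on_reindex_bij_betw[OF bij, of ?f] summ by (simp add: case_prod_unfold)
  have abs2: "(\<lambda>(k, i). cmod (c i (k - i))) summable_on (Sigma UNIV (\<lambda>k. {0..k}))"
    using summable_on_reindex_bij_betw[OF bij, of "\<lambda>z. norm (?f z)"] abs by (simp add: case_prod_unfold)
  have "infsum ?f (UNIV \<times> UNIV) = infsum (\<lambda>(k, i). c i (k - i)) (Sigma UNIV (\<lambda>k. {0..k}))"
    using infsum_reindex_bij_betw[OF bij, of ?f] by (simp add: case_prod_unfold)
  also have "\<dots> = (\<Sum>\<^sub>\<infinity>k\<in>UNIV. \<Sum>\<^sub>\<infinity>i\<in>{0..k}. c i (k - i))"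
    using infsum_Sigma'_banach[of "\<lambda>k i. c i (k - i)" UNIV "\<lambda>k. {0..k}"] summ2 by simp
  also have "\<dots> = (\<Sum>\<^sub>\<infinity>k\<in>UNIV. \<Sum>i=0..k. c i (k - i))" by simp
  also have "\<dots> = (\<Sum>k. \<Sum>i=0..k. c i (k - i))"
  proof (rule infsum_UNIV_nat)
    have "summable (\<lambda>k. \<Sum>i=0..k. cmod (c i (k - i)))"
      using abs2 summable_on_Sigma_banach[of "\<lambda>k i. cmod (c i (k - i))" UNIV "\<lambda>k. {0..k}"]
      by (simp add: case_prod_unfold summable_on_UNIV_nonneg_real_iff sum_nonneg)
    then show "summable (\<lambda>k. cmod (\<Sum>i=0..k. c i (k - i)))"
      by (rule summable_comparison_test'[of _ 0]) (use norm_sum in auto)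
  qed
  finally show ?thesis using A by simp
qed

text \<open>The series is controlled on the closed unit disc only, hence Cauchy's inequality is
  applied on circles of radius r < 1, and then r tends to 1.\<close>

lemma power_series_coeff_bound:
  fixes c :: "nat \<Rightarrow> complex"
  assumes c: "summable (\<lambda>n. cmod (c n))"
    and s: "\<And>z. cmod z \<le> 1 \<Longrightarrow> cmod (\<Sum>n. z ^ n * c n) \<le> s"
  shows "cmod (c n) \<le> s"
proof -
  define F where "F = Abs_fps c"
  have conv: "summable (\<lambda>n. z ^ n * c n)" if "cmod z \<le> 1" for z
  proof (rule summable_comparison_test'[OF c, of 0])
    fix n show "norm (z ^ n * c n) \<le> cmod (c n)"
      using that by (simp add: norm_mult norm_power mult_left_le_one_le power_le_one)
  qed
  have r1: "fps_conv_radius F \<ge> 1"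
    unfolding fps_conv_radius_def F_def fps_nth_Abs_fps
    by (rule conv_radius_geI_ex') (use conv[of "complex_of_real _"] in \<open>auto simp: mult.commute\<close>)
  have ev: "eval_fps F z = (\<Sum>n. z ^ n * c n)" for z
    by (simp add: eval_fps_def F_def mult.commute)
  have ball: "ball (0::complex) r \<subseteq> eball 0 (fps_conv_radius F)" if "r \<le> 1" for r
  proof
    fix z :: complex assume "z \<in> ball 0 r"
    then have "ereal (cmod z) < 1" using that by simp
    then have "ereal (cmod z) < fps_conv_radius F" using r1 by (rule less_le_trans)
    then show "z \<in> eball 0 (fps_conv_radius F)" by (simp add: in_eball_iff)
  qed
  have "cmod (c n) * r ^ n \<le> s" if r: "0 < r" "r < 1" for r :: real
  proof -
    have sub: "cball (0::complex) r \<subseteq> eball 0 (fps_conv_radius F)"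
      using ball[of 1] r by auto
    have "cmod ((deriv ^^ n) (eval_fps F) 0) \<le> fact n * s / r ^ n"
    proof (rule Cauchy_inequality)
      show "eval_fps F holomorphic_on ball 0 r" using sub by (intro holomorphic_intros) auto
      show "continuous_on (cball 0 r) (eval_fps F)" using sub by (intro continuous_intros) auto
      show "cmod (eval_fps F x) \<le> s" if "cmod (0 - x) = r" for x
        unfolding ev using s[of x] that r by simp
    qed (use r in auto)
    moreover have "eval_fps F has_fps_expansion F"
      using r1 by (intro eval_fps_has_fps_expansion) (auto intro: less_le_trans[of 0 1])
    then have "fps_nth F n = (deriv ^^ n) (eval_fps F) 0 / fact n"
      by (rule fps_nth_fps_expansion)
    ultimately have "cmod (c n) \<le> s / r ^ n" using r by (simp add: F_def norm_divide divide_le_eq mult.commute)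
    then show ?thesis using r by (simp add: field_simps)
  qed
  then have "\<forall>\<^sub>F r in at_left 1. cmod (c n) * r ^ n \<le> s"
    unfolding eventually_at_left_field by (intro exI[of _ 0]) auto
  moreover have "((\<lambda>r::real. cmod (c n) * r ^ n) \<longlongrightarrow> cmod (c n) * 1 ^ n) (at_left 1)"
    by (intro tendsto_intros)
  ultimately show ?thesis using tendsto_upperbound[of _ _ "at_left (1::real)" s] by auto
qed

section \<open>Evaluation of operator power series on the closed disc\<close>

context lip_space
begin

text \<open>The value at z is a numerical series for each function and each point, so limits of
  operators are never formed.\<close>

definition ev :: "'a endo fps \<Rightarrow> complex \<Rightarrow> ('a \<Rightarrow> complex) \<Rightarrow> 'a \<Rightarrow> complex" where
  "ev a z v = (\<lambda>x. \<Sum>n. z ^ n * ap (fps_nth a n) v x)"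

text \<open>Membership in the algebra of absolutely convergent operator series, with x as an
  explicit summable sequence of coefficient bounds.\<close>

definition ell :: "'a endo fps \<Rightarrow> (nat \<Rightarrow> real) \<Rightarrow> bool" where
  "ell a x \<longleftrightarrow> (\<forall>n. bd (fps_nth a n) (x n)) \<and> summable x"

lemma ell_bd: "ell a x \<Longrightarrow> bd (fps_nth a n) (x n)"
  by (simp add: ell_def)

lemma ell_nonneg: "ell a x \<Longrightarrow> 0 \<le> x n"
  using bd_nonneg by (auto simp: ell_def)

lemma ell_coeff: "ell a x \<Longrightarrow> v \<in> V \<Longrightarrow> y \<in> \<Omega> \<Longrightarrow> cmod (ap (fps_nth a n) v y) \<le> x n * nrm v"
  by (rule order_trans[OF nrm_pt[OF bd_V[OF ell_bd]] bd_nrm[OF ell_bd]])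

lemma ell_summable:
  assumes "ell a x" "v \<in> V" "y \<in> \<Omega>" "cmod z \<le> 1"
  shows "summable (\<lambda>n. cmod (z ^ n * ap (fps_nth a n) v y))"
proof (rule summable_comparison_test'[of "\<lambda>n. x n * nrm v" 0])
  show "summable (\<lambda>n. x n * nrm v)" using assms by (intro summable_mult2) (auto simp: ell_def)
  fix n
  have "cmod z ^ n * cmod (ap (fps_nth a n) v y) \<le> 1 * cmod (ap (fps_nth a n) v y)"
    using assms by (intro mult_right_mono power_le_one) auto
  then show "norm (cmod (z ^ n * ap (fps_nth a n) v y)) \<le> x n * nrm v"
    using ell_coeff[OF assms(1-3), of n] by (simp add: norm_mult norm_power)
qed

lemma nb_suminf:
  assumes u: "\<And>n. nb (t n) (u n)" and t: "summable t"
  shows "nb (suminf t) (\<lambda>x. \<Sum>n. u n x)"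
proof -
  have pt: "cmod (u n x) \<le> t n" if "x \<in> \<Omega>" for n x
    using u[of n] that unfolding nb_def by blast
  have lip: "cmod (u n x - u n y) \<le> t n * d x y" if "x \<in> \<Omega>" "y \<in> \<Omega>" for n x y
    using u[of n] that unfolding nb_def by blast
  have s: "summable (\<lambda>n. cmod (u n x))" if "x \<in> \<Omega>" for x
    by (rule summable_comparison_test'[OF t, of 0]) (simp add: pt[OF that])
  have "cmod (\<Sum>n. u n x) \<le> suminf t" if "x \<in> \<Omega>" for x
    by (rule order_trans[OF summable_norm[OF s[OF that]] suminf_le[OF pt[OF that] s[OF that] t]])
  moreover have "cmod ((\<Sum>n. u n x) - (\<Sum>n. u n y)) \<le> suminf t * d x y" if xy: "x \<in> \<Omega>" "y \<in> \<Omega>" for x y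
  proof -
    have s2: "summable (\<lambda>n. cmod (u n x - u n y))"
      by (rule summable_comparison_test'[OF summable_mult2[OF t, of "d x y"], of 0])
         (simp add: lip[OF xy])
    have "(\<Sum>n. u n x) - (\<Sum>n. u n y) = (\<Sum>n. u n x - u n y)"
      by (rule suminf_diff[OF summable_norm_cancel[OF s[OF xy(1)]] summable_norm_cancel[OF s[OF xy(2)]]])
    also have "cmod \<dots> \<le> (\<Sum>n. cmod (u n x - u n y))" by (rule summable_norm[OF s2])
    also have "\<dots> \<le> (\<Sum>n. t n * d x y)" by (rule suminf_le[OF lip[OF xy] s2 summable_mult2[OF t]])
    finally show ?thesis using suminf_mult2[OF t, of "d x y"] by simp
  qed
  ultimately show ?thesis unfolding nb_def by blast
qed

lemma measurable_suminf_complex: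
  fixes u :: "nat \<Rightarrow> 'a \<Rightarrow> complex"
  assumes [measurable]: "\<And>n. u n \<in> borel_measurable \<mu>"
  shows "(\<lambda>x. \<Sum>n. u n x) \<in> borel_measurable \<mu>"
  unfolding suminf_eq_lim by measurable

lemma ev_nb:
  assumes "ell a x" "v \<in> V" "cmod z \<le> 1"
  shows "nb (suminf x * nrm v) (ev a z v)"
proof -
  have "nb (\<Sum>n. x n * nrm v) (ev a z v)"
    unfolding ev_def
  proof (rule nb_suminf)
    show "summable (\<lambda>n. x n * nrm v)" using assms by (intro summable_mult2) (auto simp: ell_def)
    fix n
    have 1: "nb (cmod (z ^ n) * nrm (ap (fps_nth a n) v)) (\<lambda>y. z ^ n * ap (fps_nth a n) v y)"
      by (intro nb_cmult nb_nrm bd_V[OF ell_bd[OF assms(1)] assms(2)])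
    have 2: "cmod (z ^ n) * nrm (ap (fps_nth a n) v) \<le> 1 * (x n * nrm v)"
      using assms(3) bd_nrm[OF ell_bd[OF assms(1)] assms(2)] nrm_nonneg[OF bd_V[OF ell_bd[OF assms(1)] assms(2)]]
      by (intro mult_mono) (auto simp: norm_power power_le_one)
    from nb_mono[OF 1 2] show "nb (x n * nrm v) (\<lambda>y. z ^ n * ap (fps_nth a n) v y)" by simp
  qed
  moreover have "(\<Sum>n. x n * nrm v) = suminf x * nrm v"
    using assms(1) suminf_mult2[of x "nrm v"] by (simp add: ell_def)
  ultimately show ?thesis by simp
qed

lemma ev_V:
  assumes "ell a x" "v \<in> V" "cmod z \<le> 1"
  shows "ev a z v \<in> V"
proof -
  have m[measurable]: "ap (fps_nth a n) v \<in> borel_measurable \<mu>" for n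
    by (rule V_meas[OF bd_V[OF ell_bd[OF assms(1)] assms(2)]])
  have "ev a z v \<in> borel_measurable \<mu>"
    unfolding ev_def by (rule measurable_suminf_complex) (intro borel_measurable_times borel_measurable_const m)
  then show ?thesis unfolding V_iff using exI[where P = "\<lambda>s. nb s (ev a z v)", OF ev_nb[OF assms]] by (rule conjI)
qed

lemma ev_nrm: "ell a x \<Longrightarrow> v \<in> V \<Longrightarrow> cmod z \<le> 1 \<Longrightarrow> nrm (ev a z v) \<le> suminf x * nrm v"
  using ev_nb nrm_le by blast

lemma ev_add:
  assumes "ell a x" "ell b y" "v \<in> V" "cmod z \<le> 1" "p \<in> \<Omega>"
  shows "ev (a + b) z v p = ev a z v p + ev b z v p"
proof -
  have "ev a z v p + ev b z v p = (\<Sum>n. z ^ n * ap (fps_nth a n) v p + z ^ n * ap (fps_nth b n) v p)"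
    unfolding ev_def
    by (rule suminf_add[OF summable_norm_cancel[OF ell_summable[OF assms(1,3,5,4)]]
        summable_norm_cancel[OF ell_summable[OF assms(2,3,5,4)]]])
  also have "\<dots> = ev (a + b) z v p"
    unfolding ev_def by (simp only: fps_add_nth ap_simps plus_fun_apply minus_apply distrib_left)
  finally show ?thesis by simp
qed

lemma ev_diff:
  assumes "ell a x" "ell b y" "v \<in> V" "cmod z \<le> 1" "p \<in> \<Omega>"
  shows "ev (a - b) z v p = ev a z v p - ev b z v p"
proof -
  have "ev a z v p - ev b z v p = (\<Sum>n. z ^ n * ap (fps_nth a n) v p - z ^ n * ap (fps_nth b n) v p)"
    unfolding ev_def
    by (rule suminf_diff[OF summable_norm_cancel[OF ell_summable[OF assms(1,3,5,4)]]
        summable_norm_cancel[OF ell_summable[OF assms(2,3,5,4)]]])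
  also have "\<dots> = ev (a - b) z v p"
    unfolding ev_def by (simp only: fps_sub_nth ap_simps plus_fun_apply minus_apply right_diff_distrib)
  finally show ?thesis by simp
qed

lemma ev_const: "ev (fps_const A) z v = ap A v"
proof
  fix p
  have "(\<Sum>n. z ^ n * ap (fps_nth (fps_const A) n) v p) = (\<Sum>n\<in>{0}. z ^ n * ap (fps_nth (fps_const A) n) v p)"
    by (rule suminf_finite) (auto simp: fps_const_def)
  then show "ev (fps_const A) z v p = ap A v p" by (simp add: ev_def)
qed

lemma ev_1: "ev 1 z v = v"
  using ev_const[of 1 z v] by simp

text \<open>\<open>A\<close> is continuous for \<open>nrm\<close> and not for pointwise convergence,
  so the series has to converge in \<open>nrm\<close> before \<open>A\<close> can be applied
  termwise. The remainder after M terms is z^M times the evaluation of a shifted series, and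
  \<open>ev_nb\<close> bounds that.\<close>

lemma ap_ev:
  assumes A: "bd A K" and b: "ell b y" and v: "v \<in> V" and z: "cmod z \<le> 1" and p: "p \<in> \<Omega>"
  shows "(\<lambda>m. z ^ m * ap (A * fps_nth b m) v p) sums ap A (ev b z v) p"
proof -
  let ?S = "\<lambda>M x. \<Sum>m<M. z ^ m * ap (fps_nth b m) v x"
  have SV: "?S M \<in> V" for M
    by (intro V_sum V_cmult bd_V[OF ell_bd[OF b] v])
  have apS: "ap A (?S M) p = (\<Sum>m<M. z ^ m * ap (A * fps_nth b m) v p)" for M
    by (simp add: ap_sum_right ap_cmult)
  have tail: "nb ((\<Sum>m. y (m + M)) * nrm v) (ev b z v - ?S M)" for M
  proof -
    have "ell (Abs_fps (\<lambda>m. cm (z ^ M) * fps_nth b (m + M))) (\<lambda>m. y (m + M))"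
    proof -
      have "bd (cm (z ^ M) * fps_nth b (m + M)) (y (m + M))" for m
      proof (rule bd_mono[OF bd_mult[OF bd_cm, of _ "y (m+M)"]])
        show "bd (fps_nth b (m + M)) (y (m + M))" using b by (auto simp: ell_def)
        show "cmod (z ^ M) * y (m + M) \<le> y (m + M)"
          using z ell_nonneg[OF b] by (simp add: norm_power mult_left_le_one_le power_le_one)
      qed
      then show ?thesis using b by (auto simp: ell_def summable_iff_shift)
    qed
    from ev_nb[OF this v z]
    have "nb ((\<Sum>m. y (m + M)) * nrm v) (\<lambda>x. \<Sum>m. z ^ (m + M) * ap (fps_nth b (m + M)) v x)"
      by (simp add: ev_def power_add mult.assoc)
    moreover have "(\<Sum>m. z ^ (m + M) * ap (fps_nth b (m + M)) v x) = (ev b z v - ?S M) x" if "x \<in> \<Omega>" for x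
      using suminf_minus_initial_segment[OF summable_norm_cancel[OF ell_summable[OF b v that z]], of M]
      by (simp add: ev_def)
    ultimately show ?thesis by (simp add: nb_def)
  qed
  have "(\<lambda>M. ap A (ev b z v) p - ap A (?S M) p) \<longlonglongrightarrow> 0"
  proof (rule Lim_null_comparison)
    have "cmod (ap A (ev b z v) p - ap A (?S M) p) \<le> K * ((\<Sum>m. y (m + M)) * nrm v)" for M
    proof -
      have D: "ev b z v - ?S M \<in> V" by (intro V_diff SV ev_V[OF b v z])
      have "cmod (ap A (ev b z v) p - ap A (?S M) p) = cmod (ap A (ev b z v - ?S M) p)"
        by (simp add: ap_minus)
      also have "\<dots> \<le> nrm (ap A (ev b z v - ?S M))" by (rule nrm_pt[OF bd_V[OF A D] p])
      also have "\<dots> \<le> K * nrm (ev b z v - ?S M)" by (rule bd_nrm[OF A D])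
      also have "\<dots> \<le> K * ((\<Sum>m. y (m + M)) * nrm v)"
        using nrm_le[OF tail] bd_nonneg[OF A] by (intro mult_left_mono)
      finally show ?thesis .
    qed
    then show "\<forall>\<^sub>F M in sequentially. norm (ap A (ev b z v) p - ap A (?S M) p) \<le> K * ((\<Sum>m. y (m + M)) * nrm v)"
      by auto
    have "(\<lambda>M. \<Sum>m. y (m + M)) \<longlonglongrightarrow> 0" using b by (intro suminf_exist_split2) (auto simp: ell_def)
    then show "(\<lambda>M. K * ((\<Sum>m. y (m + M)) * nrm v)) \<longlonglongrightarrow> 0"
      by (auto intro!: tendsto_eq_intros)
  qed
  then have "(\<lambda>M. ap A (?S M) p) \<longlonglongrightarrow> ap A (ev b z v) p"
    using LIM_zero_iff[of "\<lambda>M. ap A (?S M) p"] tendsto_minus_cancel_left[of "\<lambda>M. ap A (?S M) p - ap A (ev b z v) p" 0]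
    by simp
  then show ?thesis unfolding sums_def apS .
qed

text \<open>The coefficients do not commute, but the powers of z do, so regrouping the double series
  along diagonals yields the Cauchy product.\<close>

lemma ev_mult:
  assumes a: "ell a x" and b: "ell b y" and v: "v \<in> V" and z: "cmod z \<le> 1" and p: "p \<in> \<Omega>"
  shows "ev (a * b) z v p = ev a z (ev b z v) p"
proof -
  let ?c = "\<lambda>n m. z ^ (n + m) * ap (fps_nth a n * fps_nth b m) v p"
  have "ev (a * b) z v p = (\<Sum>k. \<Sum>i=0..k. ?c i (k - i))"
    by (simp add: ev_def fps_mult_nth ap_sum sum_distrib_left)
  also have "\<dots> = (\<Sum>n. \<Sum>m. ?c n m)"
  proof (rule suminf_double_diag)
    show "summable (\<lambda>n. x n * nrm v)" "summable y" using a b by (auto simp: ell_def intro: summable_mult2)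
    fix n m
    have bdn: "bd (fps_nth a n * fps_nth b m) (x n * y m)" by (intro bd_mult ell_bd[OF a] ell_bd[OF b])
    have "cmod (ap (fps_nth a n * fps_nth b m) v p) \<le> x n * y m * nrm v"
      by (rule order_trans[OF nrm_pt[OF bd_V[OF bdn v] p] bd_nrm[OF bdn v]])
    moreover have "cmod (z ^ (n + m)) \<le> 1" using z by (simp add: norm_power power_le_one)
    ultimately have "cmod (?c n m) \<le> 1 * (x n * y m * nrm v)"
      unfolding norm_mult by (intro mult_mono) auto
    then show "cmod (?c n m) \<le> x n * nrm v * y m" by (simp add: algebra_simps)
  qed
  also have "\<dots> = (\<Sum>n. z ^ n * ap (fps_nth a n) (ev b z v) p)"
  proof (rule suminf_cong)
    fix n
    have "(\<lambda>m. z ^ m * ap (fps_nth a n * fps_nth b m) v p) sums ap (fps_nth a n) (ev b z v) p"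
      using a by (intro ap_ev[OF _ b v z p]) (auto simp: ell_def)
    from sums_mult[OF this, of "z ^ n"]
    show "(\<Sum>m. ?c n m) = z ^ n * ap (fps_nth a n) (ev b z v) p"
      by (intro sums_unique[symmetric]) (simp add: power_add mult.assoc)
  qed
  finally show ?thesis by (simp add: ev_def)
qed

text \<open>A bound on \<open>nrm\<close> of the values amounts to bounds on two kinds of scalar
  power series, the values at a point and the differences between two points. The Cauchy estimate
  applies to each of them.\<close>

lemma ev_coeff:
  assumes a: "ell a x" and s: "0 \<le> s"
    and ev: "\<And>z v. cmod z \<le> 1 \<Longrightarrow> v \<in> V \<Longrightarrow> nrm (ev a z v) \<le> s * nrm v"
  shows "bd (fps_nth a n) s"
proof -
  have "nb (s * nrm v) (ap (fps_nth a n) v)" if v: "v \<in> V" for v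
  proof -
    have sm: "summable (\<lambda>n. cmod (ap (fps_nth a n) v p))" if "p \<in> \<Omega>" for p
      using ell_summable[OF a v that, of 1] by simp
    have "cmod (ap (fps_nth a n) v p) \<le> s * nrm v" if p: "p \<in> \<Omega>" for p
    proof (rule power_series_coeff_bound[OF sm[OF p]])
      fix z :: complex assume z: "cmod z \<le> 1"
      show "cmod (\<Sum>n. z ^ n * ap (fps_nth a n) v p) \<le> s * nrm v"
        using nrm_pt[OF ev_V[OF a v z] p] ev[OF z v] by (simp add: ev_def)
    qed
    moreover have "cmod (ap (fps_nth a n) v p - ap (fps_nth a n) v q) \<le> s * nrm v * d p q"
      if p: "p \<in> \<Omega>" and q: "q \<in> \<Omega>" for p q
    proof (rule power_series_coeff_bound[where c = "\<lambda>n. ap (fps_nth a n) v p - ap (fps_nth a n) v q"])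
      show "summable (\<lambda>n. cmod (ap (fps_nth a n) v p - ap (fps_nth a n) v q))"
        by (rule summable_comparison_test'[OF summable_add[OF sm[OF p] sm[OF q]], of 0])
           (auto intro: norm_triangle_ineq4)
      fix z :: complex assume z: "cmod z \<le> 1"
      have "(\<Sum>n. z ^ n * (ap (fps_nth a n) v p - ap (fps_nth a n) v q)) = ev a z v p - ev a z v q"
        using suminf_diff[OF summable_norm_cancel[OF ell_summable[OF a v p z]]
            summable_norm_cancel[OF ell_summable[OF a v q z]]]
        by (simp add: ev_def algebra_simps)
      also have "cmod \<dots> \<le> nrm (ev a z v) * d p q" by (rule nrm_lip[OF ev_V[OF a v z] p q])
      also have "\<dots> \<le> s * nrm v * d p q" using ev[OF z v] d_nonneg by (rule mult_right_mono)
      finally show "cmod (\<Sum>n. z ^ n * (ap (fps_nth a n) v p - ap (fps_nth a n) v q)) \<le> s * nrm v * d p q" .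
    qed
    ultimately show ?thesis by (auto simp: nb_def)
  qed
  then show ?thesis using s nrm_le bd_V[OF ell_bd[OF a]] by (simp add: bd_def[of "fps_nth a n" s])
qed

end

text \<open>Of two indices with sum n one is at least n/2, and there the weight is worth 2^\<beta>
  times the weight at n. All convolution estimates below rest on this.\<close>

lemma powr_half_le:
  fixes \<beta> :: real assumes "\<beta> > 0" "n \<le> 2 * i"
  shows "(real i + 1) powr - \<beta> \<le> 2 powr \<beta> * (real n + 1) powr - \<beta>"
proof -
  have "(real i + 1) powr - \<beta> \<le> ((real n + 1) / 2) powr - \<beta>"
    using assms by (intro powr_mono2') auto
  also have "\<dots> = 2 powr \<beta> * (real n + 1) powr - \<beta>"
    by (simp add: powr_divide powr_minus field_simps)
  finally show ?thesis .
qed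

lemma summable_shifted_powr: "\<beta> > 1 \<Longrightarrow> summable (\<lambda>n. (real n + 1) powr - \<beta>)"
proof -
  assume "\<beta> > 1"
  then have "summable (\<lambda>n. real n powr - \<beta>)" by (simp add: summable_real_powr_iff)
  then have "summable (\<lambda>n. real (Suc n) powr - \<beta>)" by (subst summable_Suc_iff)
  then show ?thesis by (simp add: add.commute)
qed

section \<open>The algebra of operator series with coefficients O(n^(-\<beta>))\<close>

locale wiener = lip_space +
  fixes \<beta> :: real assumes beta: "\<beta> > 1"
begin

text \<open>The shift by one keeps the weight positive at n = 0, where
  \<open>0 powr - \<beta>\<close> would be 0.\<close>

definition q :: "nat \<Rightarrow> real" where "q n = (real n + 1) powr - \<beta>"

definition wt :: "'a endo fps \<Rightarrow> real \<Rightarrow> bool" where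
  "wt a x \<longleftrightarrow> 0 \<le> x \<and> (\<forall>n. bd (fps_nth a n) (x * q n))"

lemma q_pos: "q n > 0" and q_le_1: "q n \<le> 1" and q_sum: "summable q" and q0: "q 0 = 1"
proof -
  show "q n > 0" "q 0 = 1" by (simp_all add: q_def)
  show "q n \<le> 1" using beta by (simp add: q_def powr_minus_divide ge_one_powr_ge_zero)
  show "summable q" using summable_shifted_powr[OF beta] by (simp add: q_def[abs_def])
qed

lemma q_half: "n \<le> 2 * i \<Longrightarrow> q i \<le> 2 powr \<beta> * q n"
  unfolding q_def using beta by (intro powr_half_le) auto

lemma wt_bd: "wt a x \<Longrightarrow> bd (fps_nth a n) (x * q n)" and wt_nonneg: "wt a x \<Longrightarrow> 0 \<le> x"
  by (auto simp: wt_def)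

lemma wt_ell: "wt a x \<Longrightarrow> ell a (\<lambda>n. x * q n)"
  by (auto simp: wt_def ell_def q_sum intro: summable_mult)

lemma wt_mono: "wt a x \<Longrightarrow> x \<le> y \<Longrightarrow> wt a y"
  unfolding wt_def using bd_mono q_pos by (meson less_imp_le mult_right_mono order_trans)

lemma wt_add: "wt a x \<Longrightarrow> wt b y \<Longrightarrow> wt (a + b) (x + y)"
  by (auto simp: wt_def distrib_right intro!: bd_add)

lemma wt_diff: "wt a x \<Longrightarrow> wt b y \<Longrightarrow> wt (a - b) (x + y)"
  by (auto simp: wt_def distrib_right intro!: bd_diff)

lemma wt_const: "bd A K \<Longrightarrow> wt (fps_const A) K"
proof -
  assume A: "bd A K"
  have "bd 0 (K * q n)" for n
    by (rule bd_mono[OF bd_0]) (use bd_nonneg[OF A] q_pos[of n] in simp)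
  then show ?thesis using A bd_nonneg[OF A] by (auto simp: wt_def q0 fps_const_def)
qed

lemma wt_1: "wt 1 1"
  using wt_const[OF bd_1] by simp

text \<open>The convolution is split at n/2: the factor with the larger index supplies the weight,
  and the other one is merely summed. Keeping the summable bounds s and t apart from the weighted
  bounds x and y is what allows \<open>wt_square\<close> to insert better summable bounds.\<close>

lemma wt_mult_gen:
  assumes a: "wt a x" and b: "wt b y" and s: "ell a s" and t: "ell b t"
  shows "wt (a * b) (2 powr \<beta> * (x * suminf t + y * suminf s))"
proof -
  have x0: "0 \<le> x" and y0: "0 \<le> y" using a b by (auto simp: wt_def)
  have s0: "0 \<le> s n" and t0: "0 \<le> t n" for n using s t by (auto intro: ell_nonneg)
  have S: "summable s" "summable t" using s t by (auto simp: ell_def)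
  have c0: "0 \<le> x * suminf t + y * suminf s"
    using x0 y0 s0 t0 S by (intro add_nonneg_nonneg mult_nonneg_nonneg suminf_nonneg) auto
  have "bd (fps_nth (a * b) n) (2 powr \<beta> * (x * suminf t + y * suminf s) * q n)" for n
  proof -
    let ?K = "\<lambda>i. 2 powr \<beta> * q n * (x * t (n - i) + y * s i)"
    have "bd (fps_nth a i * fps_nth b (n - i)) (?K i)" if i: "i \<le> n" for i
    proof (cases "n \<le> 2 * i")
      case True
      have "bd (fps_nth a i * fps_nth b (n - i)) (x * q i * t (n - i))"
        by (intro bd_mult wt_bd[OF a] ell_bd[OF t])
      moreover have "x * q i * t (n - i) \<le> x * (2 powr \<beta> * q n) * t (n - i)"
        using q_half[OF True] x0 t0 by (intro mult_left_mono mult_right_mono) auto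
      moreover have "\<dots> \<le> ?K i" using q_pos[of n] y0 s0[of i] by (simp add: algebra_simps)
      ultimately show ?thesis by (meson bd_mono order_trans)
    next
      case False
      then have *: "n \<le> 2 * (n - i)" using i by auto
      have "bd (fps_nth a i * fps_nth b (n - i)) (s i * (y * q (n - i)))"
        by (intro bd_mult wt_bd[OF b] ell_bd[OF s])
      moreover have "s i * (y * q (n - i)) \<le> s i * (y * (2 powr \<beta> * q n))"
        using q_half[OF *] y0 s0 by (intro mult_left_mono) auto
      moreover have "\<dots> \<le> ?K i" using q_pos[of n] x0 t0[of "n - i"] by (simp add: algebra_simps)
      ultimately show ?thesis by (meson bd_mono order_trans)
    qed
    then have 1: "bd (fps_nth (a * b) n) (\<Sum>i=0..n. ?K i)"
      unfolding fps_mult_nth by (intro bd_sum) auto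
    have 2: "(\<Sum>i=0..n. ?K i) \<le> 2 powr \<beta> * q n * (x * suminf t + y * suminf s)"
    proof -
      have "(\<Sum>i=0..n. t (n - i)) = (\<Sum>i\<le>n. t i)"
        using sum.nat_diff_reindex[of t "Suc n"] by (simp add: atLeast0AtMost lessThan_Suc_atMost)
      then have "(\<Sum>i=0..n. ?K i) = 2 powr \<beta> * q n * (x * (\<Sum>i\<le>n. t i) + y * (\<Sum>i\<le>n. s i))"
        by (simp add: sum_distrib_left[symmetric] sum.distrib atLeast0AtMost)
      also have "\<dots> \<le> 2 powr \<beta> * q n * (x * suminf t + y * suminf s)"
        using q_pos[of n] x0 y0 S s0 t0
        by (intro mult_left_mono add_mono sum_le_suminf) auto
      finally show ?thesis .
    qed
    from bd_mono[OF 1 2] show ?thesis by (simp only: mult_ac)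
  qed
  then show ?thesis using c0 by (auto simp: wt_def)
qed

text \<open>The weighted norm is submultiplicative only up to this factor, which every argument with
  powers has to absorb.\<close>

definition CW :: real where "CW = 2 powr \<beta> * (2 * suminf q)"

lemma CW_pos: "CW > 0"
  unfolding CW_def using suminf_pos[OF q_sum q_pos] by simp

lemma wt_mult:
  assumes a: "wt a x" and b: "wt b y"
  shows "wt (a * b) (CW * x * y)"
  using wt_mult_gen[OF a b wt_ell[OF a] wt_ell[OF b]] suminf_mult[OF q_sum]
  by (simp add: CW_def algebra_simps)

text \<open>Bounding the coefficients by a geometric mean of the polynomial bound and of the sup bound
  makes the weighted norm of a square grow like a power less than 2 of the weighted norm. Hence the
  weighted spectral radius is controlled by the sup norm (Brandenburg's trick).\<close>

lemma wt_square:
  fixes l :: real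
  assumes l: "0 < l" "l < 1" "l * \<beta> > 1"
  obtains D where "D \<ge> 1" "\<And>a x s. wt a x \<Longrightarrow> 0 < x \<Longrightarrow> 0 < s \<Longrightarrow> (\<And>n. bd (fps_nth a n) s)
    \<Longrightarrow> wt (a * a) (D * x powr (1 + l) * s powr (1 - l))"
proof
  have ql: "summable (\<lambda>n. q n powr l)"
    using summable_shifted_powr[OF l(3)] by (simp add: q_def powr_powr mult.commute)
  let ?Z = "\<Sum>n. q n powr l"
  show "max 1 (2 powr \<beta> * 2 * ?Z) \<ge> 1" by simp
  fix a x s assume a: "wt a x" and x: "(0::real) < x" and s: "0 < s" and bs: "\<And>n. bd (fps_nth a n) s"
  have "bd (fps_nth a n) (x powr l * s powr (1 - l) * q n powr l)" for n
  proof -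
    have 1: "min (x * q n) s \<le> x powr l * s powr (1 - l) * q n powr l"
    proof -
      have m: "min (x * q n) s > 0" using x s q_pos by simp
      then have "min (x * q n) s = min (x * q n) s powr l * min (x * q n) s powr (1 - l)"
        by (simp add: powr_add[symmetric])
      also have "\<dots> \<le> (x * q n) powr l * s powr (1 - l)"
        using m l by (intro mult_mono powr_mono2) auto
      finally show ?thesis using x q_pos[of n] by (simp add: powr_mult mult_ac)
    qed
    have 2: "bd (fps_nth a n) (min (x * q n) s)" using wt_bd[OF a] bs by (auto simp: min_def)
    show ?thesis by (rule bd_mono[OF 2 1])
  qed
  then have e: "ell a (\<lambda>n. x powr l * s powr (1 - l) * q n powr l)"
    using ql by (auto simp: ell_def intro: summable_mult)
  have sm: "(\<Sum>n. x powr l * s powr (1 - l) * q n powr l) = x powr l * s powr (1 - l) * ?Z"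
    by (rule suminf_mult[OF ql])
  have "wt (a * a) (2 powr \<beta> * 2 * ?Z * (x powr (1 + l) * s powr (1 - l)))"
    using wt_mult_gen[OF a a e e] x unfolding sm by (simp add: powr_add algebra_simps)
  then show "wt (a * a) (max 1 (2 powr \<beta> * 2 * ?Z) * x powr (1 + l) * s powr (1 - l))"
    unfolding mult.assoc[of "max _ _"] by (rule wt_mono) (intro mult_right_mono, auto)
qed

text \<open>Repeated squaring makes the weighted norm follow the sup norm: along the powers e^(2^j),
  the logarithm of its bound divided by 2^j tends to - ln 2. So some power of e is small in the
  weighted norm although e itself may be large there.\<close>

lemma wt_power_small:
  assumes e: "wt e x" and sup: "\<And>m n. bd (fps_nth (e ^ m) n) ((1/2) ^ m)" and eta: "\<eta> > 0"
  obtains m where "m > 0" "wt (e ^ m) \<eta>"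
proof -
  \<comment> \<open>The midpoint between 1/\<beta> and 1, so that both l < 1 and l \<beta> > 1
    hold.\<close>
  define l where "l = (1 + 1 / \<beta>) / 2"
  have l: "0 < l" "l < 1" "l * \<beta> > 1" using beta by (auto simp: l_def field_simps)
  obtain D where D: "D \<ge> 1" and sq: "\<And>a x s. wt a x \<Longrightarrow> 0 < x \<Longrightarrow> 0 < s \<Longrightarrow> (\<And>n. bd (fps_nth a n) s)
    \<Longrightarrow> wt (a * a) (D * x powr (1 + l) * s powr (1 - l))"
    using wt_square[OF l] by metis
  \<comment> \<open>If g is the logarithm of the bound for e^(2^j) divided by 2^j, then squaring
    gives k g - (1 - k) ln 2 + ln D / 2^(j+1) for the next one. The fixed point without the last
    term is - ln 2. As k \<ge> 1/2, enlarging 1/2^(j+1) to k^(j+1) makes the recursion solvable in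
    closed form, and \<open>g\<close> is the solution.\<close>
  define k where "k = (1 + l) / 2"
  have k: "1/2 \<le> k" "k < 1" using l by (auto simp: k_def)
  define A where "A = ln (max x 1) + ln 2"
  define g where "g j = k ^ j * (A + ln D * real j) - ln 2" for j
  have "wt (e ^ (2 ^ j)) (exp (2 ^ j * g j))" for j
  proof (induction j)
    case 0
    show ?case using wt_mono[OF e, of "max x 1"] by (simp add: g_def A_def)
  next
    case (Suc j)
    let ?s = "(1/2::real) ^ (2 ^ j)"
    have 1: "wt (e ^ (2 ^ j) * e ^ (2 ^ j)) (D * exp (2 ^ j * g j) powr (1 + l) * ?s powr (1 - l))"
      by (rule sq[OF Suc]) (use sup in auto)
    have 2: "D * exp (2 ^ j * g j) powr (1 + l) * ?s powr (1 - l) \<le> exp (2 ^ Suc j * g (Suc j))"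
    proof -
      have s: "?s = exp (- (2 ^ j * ln 2))"
        using exp_of_nat_mult[of "2 ^ j" "ln (2::real)"] by (simp add: exp_minus power_divide inverse_eq_divide)
      have "D * exp (2 ^ j * g j) powr (1 + l) * ?s powr (1 - l)
        = exp (ln D + 2 ^ j * g j * (1 + l) - 2 ^ j * ln 2 * (1 - l))"
      proof -
        have "exp (ln D + 2 ^ j * g j * (1 + l) - 2 ^ j * ln 2 * (1 - l))
          = exp (ln D) * exp (2 ^ j * g j * (1 + l)) * exp (- (2 ^ j * ln 2) * (1 - l))"
          by (simp only: exp_add[symmetric]) simp
        then show ?thesis using D by (simp only: s exp_powr_real) simp
      qed
      also have "ln D + 2 ^ j * g j * (1 + l) - 2 ^ j * ln 2 * (1 - l) \<le> 2 ^ Suc j * g (Suc j)"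
      proof -
        have "1 = (2::real) ^ Suc j * (1/2) ^ Suc j" by (simp add: power_divide)
        also have "\<dots> \<le> 2 ^ Suc j * k ^ Suc j" using k by (intro mult_left_mono power_mono) auto
        finally have "ln D \<le> ln D * (2 ^ Suc j * k ^ Suc j)" using D by (simp add: mult_left_mono[of 1 _ "ln D", simplified])
        moreover have "2 ^ j * g j * (1 + l) - 2 ^ j * ln 2 * (1 - l)
          = 2 ^ Suc j * (k ^ Suc j * (A + ln D * real j) - ln 2)"
        proof -
          have lk: "l = 2 * k - 1" by (simp add: k_def field_simps)
          show ?thesis unfolding g_def lk by (simp add: algebra_simps)
        qed
        moreover have "2 ^ Suc j * g (Suc j)
          = 2 ^ Suc j * (k ^ Suc j * (A + ln D * real j) - ln 2) + ln D * (2 ^ Suc j * k ^ Suc j)"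
          unfolding g_def by (simp add: algebra_simps del: power_Suc)
        ultimately show ?thesis by linarith
      qed
      finally show ?thesis by simp
    qed
    have 3: "e ^ (2 ^ Suc j) = e ^ (2 ^ j) * e ^ (2 ^ j)" by (simp add: mult_2 power_add)
    show ?case unfolding 3 by (rule wt_mono[OF 1 2])
  qed
  note W = this
  have g: "g \<longlonglongrightarrow> - ln 2"
  proof -
    have nk: "norm k < 1" using k by simp
    have "(\<lambda>j. A * k ^ j + ln D * (real j * k ^ j) - ln 2) \<longlonglongrightarrow> A * 0 + ln D * 0 - ln 2"
      by (intro tendsto_diff tendsto_add tendsto_mult tendsto_const LIMSEQ_power_zero[OF nk] powser_times_n_limit_0[OF nk])
    moreover have "g = (\<lambda>j. A * k ^ j + ln D * (real j * k ^ j) - ln 2)"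
      by (simp add: g_def fun_eq_iff algebra_simps)
    ultimately show ?thesis by simp
  qed
  have "filterlim (\<lambda>j. 2 ^ j * g j) at_bot sequentially"
  proof (rule filterlim_tendsto_neg_mult_at_bot[OF g, of "\<lambda>j. 2 ^ j", simplified mult.commute[of "g _"]])
    show "- ln 2 < (0::real)" by simp
    show "filterlim (\<lambda>j. (2::real) ^ j) at_top sequentially"
      by real_asymp
  qed
  then have "((\<lambda>j. exp (2 ^ j * g j)) \<longlongrightarrow> 0) sequentially"
    by (rule filterlim_compose[OF exp_at_bot])
  then have "\<forall>\<^sub>F j in sequentially. exp (2 ^ j * g j) < \<eta>" using eta by (rule order_tendstoD)
  then obtain j where "exp (2 ^ j * g j) < \<eta>" by (auto simp: eventually_sequentially)
  then have "wt (e ^ (2 ^ j)) \<eta>" using W wt_mono less_imp_le by blast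
  then show thesis using that[of "2 ^ j"] by simp
qed

end

context lip_space
begin

lemma nrm_cong: "(\<And>x. x \<in> \<Omega> \<Longrightarrow> u x = v x) \<Longrightarrow> nrm u = nrm v"
  unfolding nrm_def nb_def by (metis (no_types, lifting))

text \<open>This is the series a(rz). Dilation is multiplicative, so b(rz) is the inverse of B(rz);
  it joins the constant term at r = 0 to the series itself at r = 1.\<close>

definition sc :: "real \<Rightarrow> 'a endo fps \<Rightarrow> 'a endo fps" where
  "sc r a = Abs_fps (\<lambda>n. cm (of_real r ^ n) * fps_nth a n)"

lemma sc_mult: "sc r (a * b) = sc r a * sc r b"
proof (rule fps_ext)
  fix n
  have "cm (of_real r ^ n) * (fps_nth a i * fps_nth b (n - i))
    = cm (of_real r ^ i) * fps_nth a i * (cm (of_real r ^ (n - i)) * fps_nth b (n - i))" if "i \<le> n" for i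
  proof -
    have "cm (of_real r ^ n) = cm (of_real r ^ i) * cm (of_real r ^ (n - i))"
      using that by (simp add: cm_mult[symmetric] power_add[symmetric])
    then show ?thesis by (metis cm_commute mult.assoc)
  qed
  then show "fps_nth (sc r (a * b)) n = fps_nth (sc r a * sc r b) n"
    by (auto simp: sc_def fps_mult_nth sum_distrib_left intro: sum.cong)
qed

lemma sc_1: "sc r 1 = 1"
  by (rule fps_ext) (auto simp: sc_def cm_1)

lemma sc_one: "sc 1 a = a"
  by (rule fps_ext) (auto simp: sc_def cm_1)

lemma ev_sc: "ev (sc r a) z v = ev a (of_real r * z) v"
  unfolding ev_def sc_def by (simp add: power_mult_distrib mult_ac)

end

context wiener
begin

lemma wt_sc:
  assumes a: "wt a x" and r: "0 \<le> r" "r \<le> 1" shows "wt (sc r a) x"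
proof -
  have "bd (cm (of_real r ^ n) * fps_nth a n) (x * q n)" for n
  proof (rule bd_mono[OF bd_mult[OF bd_cm wt_bd[OF a]]])
    show "cmod (of_real r ^ n) * (x * q n) \<le> x * q n"
      using r wt_nonneg[OF a] q_pos[of n] by (simp add: norm_power mult_left_le_one_le power_le_one)
  qed
  then show ?thesis using wt_nonneg[OF a] by (auto simp: wt_def sc_def)
qed

lemma wt_power: "wt e x \<Longrightarrow> \<exists>y. wt (e ^ m) y"
  by (induction m) (use wt_1 wt_mult in \<open>auto, blast\<close>)

lemma wt_sum: "(\<And>i. i \<in> I \<Longrightarrow> wt (a i) (x i)) \<Longrightarrow> wt (\<Sum>i\<in>I. a i) (\<Sum>i\<in>I. x i)"
proof (induction I rule: infinite_finite_induct)
  case (insert i I)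
  then show ?case by (auto intro: wt_add)
qed (auto simp: wt_def bd_0)

text \<open>The resolvent identity, substituted into itself m times. Only a power of e will be
  small, so the finite geometric sum becomes the new constant part.\<close>

lemma inverse_expand:
  fixes \<beta>' c e :: "'a endo fps"
  assumes "\<beta>' = c + \<beta>' * e"
  shows "\<beta>' = c * (\<Sum>i<m. e ^ i) + \<beta>' * e ^ m"
proof (induction m)
  case (Suc m)
  have "\<beta>' * e ^ m = c * e ^ m + \<beta>' * e ^ Suc m"
    by (subst assms) (simp add: algebra_simps)
  then show ?case using Suc by (simp add: algebra_simps)
qed simp

text \<open>The Neumann series is summed one coefficient at a time. For fixed n, the coefficient of
  \<open>\<beta>' * e ^ Suc J\<close> tends to 0 because finitely many coefficients of
  \<open>\<beta>'\<close> are involved and those of the powers of e shrink geometrically, while the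
  partial sums obey a weighted bound that is uniform in J.\<close>

lemma wt_of_small:
  assumes eq: "\<beta>' = c + \<beta>' * e" and c: "wt c X" and e: "wt e \<eta>" and \<eta>: "\<eta> = 1 / (2 * CW)"
    and bb: "\<And>n. \<exists>K. bd (fps_nth \<beta>' n) K"
  shows "\<exists>Y. wt \<beta>' Y"
proof -
  have \<eta>0: "\<eta> > 0" using CW_pos \<eta> by simp
  \<comment> \<open>The choice of \<open>\<eta>\<close> makes \<open>CW * \<eta>\<close> equal to
    1/2, so each further factor e gains 1/2 in spite of the constant \<open>CW\<close>.\<close>
  have pw: "wt (e ^ Suc J) (\<eta> * (1/2) ^ J)" for J
  proof (induction J)
    case (Suc J)
    have "wt (e * e ^ Suc J) (CW * \<eta> * (\<eta> * (1/2) ^ J))" by (rule wt_mult[OF e Suc])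
    moreover have "CW * \<eta> * (\<eta> * (1/2) ^ J) = \<eta> * (1/2) ^ Suc J" using CW_pos \<eta> by simp
    ultimately show ?case by (simp only: power_Suc)
  qed (use e in simp)
  have sm: "wt (\<Sum>i<Suc J. e ^ i) (1 + 2 * \<eta>)" for J
  proof -
    have 1: "wt (1 + (\<Sum>i<J. e ^ Suc i)) (1 + (\<Sum>i<J. \<eta> * (1/2) ^ i))"
      by (intro wt_add wt_1 wt_sum pw)
    have 2: "(\<Sum>i<J. \<eta> * (1/2) ^ i) \<le> 2 * \<eta>"
    proof -
      have "(\<Sum>i<J. (1/2::real) ^ i) \<le> 2" by (simp add: geometric_sum)
      then show ?thesis using \<eta>0 by (simp add: sum_distrib_left[symmetric])
    qed
    have "wt (1 + (\<Sum>i<J. e ^ Suc i)) (1 + 2 * \<eta>)" by (rule wt_mono[OF 1]) (use 2 in simp)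
    then show ?thesis by (simp only: sum.lessThan_Suc_shift power_0)
  qed
  let ?Y = "CW * X * (1 + 2 * \<eta>)"
  obtain k where k: "\<And>n. bd (fps_nth \<beta>' n) (k n)" using bb by metis
  have "bd (fps_nth \<beta>' n) (?Y * q n)" for n
  proof (rule bd_closed)
    fix \<epsilon> :: real assume \<epsilon>: "\<epsilon> > 0"
    define S where "S = (\<Sum>i=0..n. k i * \<eta>)"
    have "(\<lambda>J. S * (1/2) ^ J) \<longlonglongrightarrow> S * 0" by (intro tendsto_intros LIMSEQ_power_zero) simp
    then have "\<forall>\<^sub>F J in sequentially. S * (1/2) ^ J < \<epsilon>" using \<epsilon> by (intro order_tendstoD(2)) auto
    then obtain J where J: "S * (1/2) ^ J < \<epsilon>" by (auto simp: eventually_sequentially)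
    have "bd (fps_nth (\<beta>' * e ^ Suc J) n) (\<Sum>i=0..n. k i * (\<eta> * (1/2) ^ J))"
    proof (rule bd_fps_mult[OF k])
      fix i
      show "bd (fps_nth (e ^ Suc J) i) (\<eta> * (1/2) ^ J)"
        by (rule bd_mono[OF wt_bd[OF pw]]) (use q_le_1 \<eta>0 in simp)
    qed
    moreover have "(\<Sum>i=0..n. k i * (\<eta> * (1/2) ^ J)) = S * (1/2) ^ J"
      by (simp only: S_def sum_distrib_right mult.assoc)
    ultimately have "bd (fps_nth (\<beta>' * e ^ Suc J) n) \<epsilon>" using bd_mono[OF _ less_imp_le[OF J]] by simp
    moreover have "bd (fps_nth (c * (\<Sum>i<Suc J. e ^ i)) n) (?Y * q n)"
      by (rule wt_bd[OF wt_mult[OF c sm]])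
    ultimately have "bd (fps_nth (c * (\<Sum>i<Suc J. e ^ i) + \<beta>' * e ^ Suc J) n) (?Y * q n + \<epsilon>)"
      unfolding fps_add_nth by (intro bd_add)
    then show "bd (fps_nth \<beta>' n) (?Y * q n + \<epsilon>)" by (simp only: inverse_expand[OF eq, of "Suc J", symmetric])
  qed
  moreover have "?Y \<ge> 0" using CW_pos wt_nonneg[OF c] \<eta>0 by simp
  ultimately show ?thesis by (auto simp: wt_def)
qed

text \<open>A weighted bound for b(rz) yields one for b(sz) if B(rz) and B(sz) are close. The
  perturbation e is small in the sup norm because the lower bound on B controls b(rz) there by K;
  then \<open>wt_power_small\<close> makes a power of e small in the weighted norm. The admissible
  distance of r and s involves x and K but not y, so the steps do not shrink along the way.\<close>

lemma inverse_step:
  assumes B: "wt B x" and bb: "\<And>n. \<exists>k. bd (fps_nth b n) k" and inv: "B * b = 1" "b * B = 1"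
    and K: "K > 0" and lower: "\<And>z v. cmod z \<le> 1 \<Longrightarrow> v \<in> V \<Longrightarrow> nrm v \<le> K * nrm (ev B z v)"
    and r: "0 \<le> r" "r \<le> 1" and s: "0 \<le> s" "s \<le> 1" and y: "wt (sc r b) y"
    and close: "(\<Sum>n. \<bar>r ^ n - s ^ n\<bar> * (x * q n)) \<le> 1 / (2 * K)"
  shows "\<exists>y. wt (sc s b) y"
proof -
  define c where "c = sc r b"
  define e where "e = (sc r B - sc s B) * c"
  have Br: "sc r B * c = 1" and Bs: "sc s b * sc s B = 1"
    by (simp_all add: c_def sc_mult[symmetric] inv sc_1)
  have wc: "wt c y" using y by (simp add: c_def)
  have wBr: "wt (sc r B) x" and wBs: "wt (sc s B) x" using wt_sc[OF B] r s by auto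
  have we: "wt e (CW * (x + x) * y)" unfolding e_def by (intro wt_mult wt_diff wBr wBs wc)
  have eld: "ell (sc r B - sc s B) (\<lambda>n. \<bar>r ^ n - s ^ n\<bar> * (x * q n))"
  proof -
    have "bd (fps_nth (sc r B - sc s B) n) (\<bar>r ^ n - s ^ n\<bar> * (x * q n))" for n
    proof -
      have "fps_nth (sc r B - sc s B) n = cm (of_real (r ^ n - s ^ n)) * fps_nth B n"
        by (simp add: sc_def cm_diff left_diff_distrib)
      moreover have "bd \<dots> (cmod (of_real (r ^ n - s ^ n)) * (x * q n))"
        by (intro bd_mult bd_cm wt_bd[OF B])
      moreover have "cmod (of_real (r ^ n - s ^ n)) = \<bar>r ^ n - s ^ n\<bar>" by (rule norm_of_real)
      ultimately show ?thesis by (simp only:)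
    qed
    moreover have "summable (\<lambda>n. \<bar>r ^ n - s ^ n\<bar> * (x * q n))"
    proof (rule summable_comparison_test'[of "\<lambda>n. x * q n" 0])
      show "summable (\<lambda>n. x * q n)" using q_sum by (rule summable_mult)
      fix n
      have "\<bar>r ^ n - s ^ n\<bar> \<le> 1"
        using power_le_one[OF r, of n] power_le_one[OF s, of n] r s
        by (auto simp: abs_le_iff intro: add_nonneg_nonneg) (smt (verit) zero_le_power)+
      then show "norm (\<bar>r ^ n - s ^ n\<bar> * (x * q n)) \<le> x * q n"
        using wt_nonneg[OF B] q_pos[of n] by (simp add: abs_mult mult_left_le_one_le)
    qed
    ultimately show ?thesis by (auto simp: ell_def)
  qed
  have sup1: "nrm (ev e z v) \<le> 1/2 * nrm v" if z: "cmod z \<le> 1" and v: "v \<in> V" for z v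
  proof -
    let ?u = "ev c z v"
    have u: "?u \<in> V" by (rule ev_V[OF wt_ell[OF wc] v z])
    \<comment> \<open>B at the point rz undoes c at z, and rz lies in the closed disc; hence the
      lower bound at rz turns into the upper bound K for c.\<close>
    have "nrm (ev B (of_real r * z) ?u) = nrm v"
    proof (rule nrm_cong)
      fix p assume p: "p \<in> \<Omega>"
      have "ev (sc r B) z ?u p = ev (sc r B * c) z v p"
        by (rule ev_mult[OF wt_ell[OF wBr] wt_ell[OF wc] v z p, symmetric])
      then show "ev B (of_real r * z) ?u p = v p" by (simp add: Br ev_1 ev_sc)
    qed
    moreover have "cmod (of_real r * z) \<le> 1" using r z by (simp add: norm_mult mult_le_one)
    ultimately have uK: "nrm ?u \<le> K * nrm v" using lower[OF _ u] by metis
    have "nrm (ev e z v) = nrm (ev (sc r B - sc s B) z ?u)"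
      unfolding e_def by (rule nrm_cong) (rule ev_mult[OF eld wt_ell[OF wc] v z])
    also have "\<dots> \<le> 1 / (2 * K) * nrm ?u"
      by (rule order_trans[OF ev_nrm[OF eld u z]]) (intro mult_right_mono close nrm_nonneg[OF u])
    also have "\<dots> \<le> 1 / (2 * K) * (K * nrm v)" using uK K by (intro mult_left_mono) auto
    finally show ?thesis using K by simp
  qed
  have supm: "nrm (ev (e ^ m) z v) \<le> (1/2) ^ m * nrm v" if z: "cmod z \<le> 1" and v: "v \<in> V" for m z v
  proof (induction m)
    case (Suc m)
    obtain w where w: "wt (e ^ m) w" using wt_power[OF we] by blast
    have u: "ev (e ^ m) z v \<in> V" by (rule ev_V[OF wt_ell[OF w] v z])
    have "nrm (ev (e ^ Suc m) z v) = nrm (ev e z (ev (e ^ m) z v))"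
      unfolding power_Suc by (rule nrm_cong) (rule ev_mult[OF wt_ell[OF we] wt_ell[OF w] v z])
    also have "\<dots> \<le> 1/2 * nrm (ev (e ^ m) z v)" by (rule sup1[OF z u])
    also have "\<dots> \<le> 1/2 * ((1/2) ^ m * nrm v)" using Suc by simp
    finally show ?case by simp
  qed (simp add: ev_1)
  have sup: "bd (fps_nth (e ^ m) n) ((1/2) ^ m)" for m n
  proof -
    obtain w where w: "wt (e ^ m) w" using wt_power[OF we] by blast
    show ?thesis by (rule ev_coeff[OF wt_ell[OF w]]) (use supm in auto)
  qed
  obtain m where m: "wt (e ^ m) (1 / (2 * CW))"
    using wt_power_small[OF we sup, of "1 / (2 * CW)"] CW_pos by (metis divide_pos_pos mult_pos_pos zero_less_numeral zero_less_one)
  \<comment> \<open>The second resolvent identity: b(sz) - b(rz) = b(sz) (B(rz) - B(sz))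
    b(rz).\<close>
  have eq: "sc s b = c + sc s b * e"
  proof -
    have "sc s b * e = sc s b * (sc r B * c) - (sc s b * sc s B) * c"
      by (simp add: e_def algebra_simps)
    then show ?thesis by (simp add: Br Bs)
  qed
  obtain X where X: "wt (c * (\<Sum>i<m. e ^ i)) X"
  proof -
    obtain w where "\<And>i. wt (e ^ i) (w i)" using wt_power[OF we] by metis
    then have "wt (\<Sum>i<m. e ^ i) (\<Sum>i<m. w i)" by (intro wt_sum) auto
    from wt_mult[OF wc this] show thesis by (rule that)
  qed
  show ?thesis
  proof (rule wt_of_small[OF inverse_expand[OF eq] X m])
    fix n
    obtain k where "bd (fps_nth b n) k" using bb by blast
    then have "bd (fps_nth (sc s b) n) (cmod (of_real s ^ n) * k)"
      by (auto simp: sc_def intro: bd_mult bd_cm)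
    then show "\<exists>K. bd (fps_nth (sc s b) n) K" by blast
  qed simp
qed

text \<open>The radius walks from 0, where b(0) is a constant series, to 1 in steps of a fixed
  length \<delta>. That one \<delta> serves everywhere follows from the uniform continuity in r of
  B(rz) for the sum of the coefficient bounds.\<close>

theorem wiener_inverse:
  assumes B: "wt B x" and bb: "\<And>n. \<exists>k. bd (fps_nth b n) k" and inv: "B * b = 1" "b * B = 1"
    and lower: "\<And>z v. cmod z \<le> 1 \<Longrightarrow> v \<in> V \<Longrightarrow> nrm v \<le> K * nrm (ev B z v)"
  shows "\<exists>y. wt b y"
proof -
  define L where "L = max K 1"
  have L: "L > 0" by (simp add: L_def)
  have lowerL: "nrm v \<le> L * nrm (ev B z v)" if "cmod z \<le> 1" "v \<in> V" for z v
    using lower[OF that] nrm_nonneg[OF ev_V[OF wt_ell[OF B] that(2,1)]]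
    by (smt (verit) L_def mult_right_mono max.cobounded1)
  have xq: "summable (\<lambda>n. x * q n)" using q_sum by (rule summable_mult)
  have xq0: "0 \<le> x * q n" for n using wt_nonneg[OF B] q_pos[of n] by simp
  obtain \<delta> where \<delta>: "\<delta> > 0" and close: "\<And>r s. 0 \<le> r \<Longrightarrow> r \<le> 1 \<Longrightarrow> 0 \<le> s \<Longrightarrow> s \<le> 1 \<Longrightarrow> \<bar>r - s\<bar> \<le> \<delta>
    \<Longrightarrow> (\<Sum>n. \<bar>r ^ n - s ^ n\<bar> * (x * q n)) \<le> 1 / (2 * L)"
  proof -
    \<comment> \<open>The tolerance 1/(2L) is divided into 1/(4L) for the terms from N on, where the
      factor |r^n - s^n| is at most 1, and 1/(4L) for the first N terms, where it is at most n |r -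
      s|.\<close>
    have "(\<lambda>N. \<Sum>n. x * q (n + N)) \<longlonglongrightarrow> 0" by (rule suminf_exist_split2[OF xq])
    then have "\<forall>\<^sub>F N in sequentially. (\<Sum>n. x * q (n + N)) < 1 / (4 * L)"
      using L by (intro order_tendstoD(2)) auto
    then obtain N where N: "(\<Sum>n. x * q (n + N)) < 1 / (4 * L)" by (auto simp: eventually_sequentially)
    define S where "S = (\<Sum>n<N. real n * (x * q n)) + 1"
    have S: "S > 0" unfolding S_def using xq0 by (simp add: add_nonneg_pos sum_nonneg)
    show thesis
    proof (rule that[of "1 / (4 * L * S)"])
      show "1 / (4 * L * S) > 0" using L S by simp
      fix r s :: real assume rs: "0 \<le> r" "r \<le> 1" "0 \<le> s" "s \<le> 1" "\<bar>r - s\<bar> \<le> 1 / (4 * L * S)"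
      let ?t = "\<lambda>n. \<bar>r ^ n - s ^ n\<bar> * (x * q n)"
      have le1: "\<bar>r ^ n - s ^ n\<bar> \<le> 1" for n
        using power_le_one[of r n] power_le_one[of s n] zero_le_power[of r n] zero_le_power[of s n] rs by linarith
      have le: "?t n \<le> x * q n" for n using le1[of n] xq0[of n] by (simp add: mult_left_le_one_le)
      have st: "summable ?t"
      proof (rule summable_comparison_test'[OF xq, of 0])
        fix n
        have "0 \<le> ?t n" by (rule mult_nonneg_nonneg[OF abs_ge_zero xq0])
        then show "norm (?t n) \<le> x * q n" using le[of n] by (simp only: real_norm_def abs_of_nonneg)
      qed
      have "suminf ?t = (\<Sum>n. ?t (n + N)) + (\<Sum>n<N. ?t n)" by (rule suminf_split_initial_segment[OF st])
      moreover have "(\<Sum>n. ?t (n + N)) \<le> (\<Sum>n. x * q (n + N))"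
        using st xq by (intro suminf_le le) (auto simp: summable_iff_shift[of ?t N] summable_iff_shift[of "\<lambda>n. x * q n" N])
      moreover have "(\<Sum>n<N. ?t n) \<le> (\<Sum>n<N. (real n * (x * q n)) * (1 / (4 * L * S)))"
      proof (rule sum_mono)
        fix n
        have "\<bar>r ^ n - s ^ n\<bar> \<le> real n * \<bar>r - s\<bar>"
          using norm_power_diff[of r s n] rs by simp
        also have "\<dots> \<le> real n * (1 / (4 * L * S))" using rs by (intro mult_left_mono) auto
        finally show "?t n \<le> (real n * (x * q n)) * (1 / (4 * L * S))"
          using mult_right_mono[OF _ xq0[of n]] by (fastforce simp: mult_ac)
      qed
      moreover have "(\<Sum>n<N. (real n * (x * q n)) * (1 / (4 * L * S))) \<le> 1 / (4 * L)"
      proof -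
        have "(\<Sum>n<N. (real n * (x * q n)) * (1 / (4 * L * S))) = (S - 1) * (1 / (4 * L * S))"
          by (simp only: S_def sum_distrib_right[symmetric]) simp
        also have "\<dots> \<le> S * (1 / (4 * L * S))" using L S by (intro mult_right_mono) auto
        finally show ?thesis using L S by simp
      qed
      ultimately show "suminf ?t \<le> 1 / (2 * L)" using N by (simp add: field_simps)
    qed
  qed
  have "\<exists>y. wt (sc (min 1 (real i * \<delta>)) b) y" for i
  proof (induction i)
    case 0
    obtain k where k: "bd (fps_nth b 0) k" using bb by blast
    have "sc 0 b = fps_const (fps_nth b 0)"
      by (rule fps_ext) (auto simp: sc_def cm_0 cm_1 power_0_left)
    then show ?case using wt_const[OF k] by auto
  next
    case (Suc i)
    then obtain y where y: "wt (sc (min 1 (real i * \<delta>)) b) y" by blast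
    show ?case
      by (rule inverse_step[OF B bb inv L lowerL _ _ _ _ y close])
        (use \<delta> in \<open>auto simp: min_def algebra_simps\<close>)
  qed
  moreover obtain i where "real i * \<delta> \<ge> 1"
    using \<delta> ex_less_of_nat_mult[of \<delta> 1] by (auto intro: less_imp_le)
  ultimately have "\<exists>y. wt (sc 1 b) y" by (metis min.absorb1)
  then show ?thesis by (simp add: sc_one)
qed

end

section \<open>Full branch Gibbs Markov maps\<close>

text \<open>\<open>\<psi> a\<close> is the inverse branch into the cell a. \<open>G a\<close> is the
  Jacobian weight of that branch divided by the measure of the cell, which makes it bounded
  uniformly in a; \<open>change\<close> is the change of variables on one branch. On
  \<open>\<Omega>\<close> all relations hold at every point.\<close>

locale full_branch = prob_space \<mu> for \<mu> :: "'a measure" +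
  fixes F :: "'a \<Rightarrow> 'a" and \<Omega> :: "'a set" and \<alpha> :: "'a set set" and \<psi> :: "'a set \<Rightarrow> 'a \<Rightarrow> 'a"
    and G :: "'a set \<Rightarrow> 'a \<Rightarrow> real" and d :: "'a \<Rightarrow> 'a \<Rightarrow> real" and \<theta> C\<^sub>1 :: real
  assumes Om_sets [measurable]: "\<Omega> \<in> sets \<mu>" and Om_AE: "AE x in \<mu>. x \<in> \<Omega>"
    and alpha_countable: "countable \<alpha>" and alpha_sets: "\<And>a. a \<in> \<alpha> \<Longrightarrow> a \<in> sets \<mu>"
    and alpha_disj: "disjoint \<alpha>" and alpha_cover: "\<Omega> \<subseteq> \<Union>\<alpha>"
    and alpha_pos: "\<And>a. a \<in> \<alpha> \<Longrightarrow> measure \<mu> a > 0"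
    and psi_mem: "\<And>a y. a \<in> \<alpha> \<Longrightarrow> y \<in> \<Omega> \<Longrightarrow> \<psi> a y \<in> a \<inter> \<Omega>"
    and F_psi: "\<And>a y. a \<in> \<alpha> \<Longrightarrow> y \<in> \<Omega> \<Longrightarrow> F (\<psi> a y) = y"
    and F_Om: "\<And>x. x \<in> \<Omega> \<Longrightarrow> F x \<in> \<Omega>"
    and psi_F: "\<And>a x. a \<in> \<alpha> \<Longrightarrow> x \<in> a \<Longrightarrow> x \<in> \<Omega> \<Longrightarrow> \<psi> a (F x) = x"
    and psi_meas: "\<And>a. a \<in> \<alpha> \<Longrightarrow> \<psi> a \<in> measurable \<mu> \<mu>"
    and F_meas [measurable]: "F \<in> measurable \<mu> \<mu>" and F_inv: "distr \<mu> \<mu> F = \<mu>"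
    and G_meas: "\<And>a. a \<in> \<alpha> \<Longrightarrow> G a \<in> borel_measurable \<mu>"
    and G_out: "\<And>a y. y \<notin> \<Omega> \<Longrightarrow> G a y = 0"
    and G_pos: "\<And>a y. a \<in> \<alpha> \<Longrightarrow> y \<in> \<Omega> \<Longrightarrow> G a y > 0"
    and G_le: "\<And>a y. a \<in> \<alpha> \<Longrightarrow> y \<in> \<Omega> \<Longrightarrow> G a y \<le> C\<^sub>1"
    and G_lip: "\<And>a y y'. a \<in> \<alpha> \<Longrightarrow> y \<in> \<Omega> \<Longrightarrow> y' \<in> \<Omega> \<Longrightarrow> \<bar>G a y - G a y'\<bar> \<le> C\<^sub>1 * d y y'"
    and change: "\<And>a A. a \<in> \<alpha> \<Longrightarrow> A \<in> sets \<mu> \<Longrightarrow>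
      emeasure \<mu> (A \<inter> a) = ennreal (measure \<mu> a) * (\<integral>\<^sup>+ y. ennreal (G a y) * indicator A (\<psi> a y) \<partial>\<mu>)"
    and theta: "0 < \<theta>" "\<theta> < 1" and C1: "0 < C\<^sub>1"
    and d_range: "\<And>x y. 0 \<le> d x y" "\<And>x y. d x y \<le> 1"
    and d_psi: "\<And>a y y'. a \<in> \<alpha> \<Longrightarrow> y \<in> \<Omega> \<Longrightarrow> y' \<in> \<Omega> \<Longrightarrow> d (\<psi> a y) (\<psi> a y') = \<theta> * d y y'"
    and d_cell: "\<And>a b x y. a \<in> \<alpha> \<Longrightarrow> b \<in> \<alpha> \<Longrightarrow> a \<noteq> b \<Longrightarrow> x \<in> a \<inter> \<Omega> \<Longrightarrow> y \<in> b \<inter> \<Omega> \<Longrightarrow> d x y = 1"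
begin

lemma Om_ne: "\<Omega> \<noteq> {}"
  using Om_AE emeasure_space_1 AE_iff_measurable[of "space \<mu>" \<mu> "\<lambda>x. x \<in> \<Omega>"] by force

sublocale lip_space \<mu> \<Omega> d
  using Om_ne d_range by unfold_locales

definition y0 :: 'a where "y0 = (SOME y. y \<in> \<Omega>)"

lemma y0: "y0 \<in> \<Omega>"
  unfolding y0_def using Om_ne by (simp add: some_in_eq)

text \<open>Points outside all cells are assigned some fixed cell, so that \<open>cell\<close> is a
  total measurable map into \<open>\<alpha>\<close> and its distribution is a probability
  measure.\<close>

definition cell :: "'a \<Rightarrow> 'a set" where
  "cell x = (if \<exists>a\<in>\<alpha>. x \<in> a then SOME a. a \<in> \<alpha> \<and> x \<in> a else SOME a. a \<in> \<alpha>)"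

lemma alpha_ne: "\<alpha> \<noteq> {}"
  using y0 alpha_cover by auto

lemma cell_in: "cell x \<in> \<alpha>"
proof (cases "\<exists>a\<in>\<alpha>. x \<in> a")
  case True
  then have "\<exists>a. a \<in> \<alpha> \<and> x \<in> a" by blast
  from someI_ex[OF this] show ?thesis using True by (simp add: cell_def)
qed (use alpha_ne in \<open>auto simp: cell_def some_in_eq\<close>)

lemma cell_eq: assumes "a \<in> \<alpha>" "x \<in> a" shows "cell x = a"
proof -
  have "\<exists>a. a \<in> \<alpha> \<and> x \<in> a" using assms by blast
  from someI_ex[OF this] have "cell x \<in> \<alpha> \<and> x \<in> cell x" using assms by (auto simp: cell_def)
  then show ?thesis using alpha_disj assms by (auto simp: disjoint_def)
qed

lemma cell_mem: "x \<in> \<Omega> \<Longrightarrow> x \<in> cell x"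
  using alpha_cover cell_eq by (metis UnionE subsetD)

lemma psi_cell_F: "x \<in> \<Omega> \<Longrightarrow> \<psi> (cell x) (F x) = x"
  using psi_F cell_in cell_mem by blast

lemma cell_psi: "a \<in> \<alpha> \<Longrightarrow> y \<in> \<Omega> \<Longrightarrow> cell (\<psi> a y) = a"
  using psi_mem cell_eq by blast

lemma psi_Om: "a \<in> \<alpha> \<Longrightarrow> y \<in> \<Omega> \<Longrightarrow> \<psi> a y \<in> \<Omega>"
  using psi_mem by blast

lemma Om_space: "x \<in> \<Omega> \<Longrightarrow> x \<in> space \<mu>"
  using Om_sets sets.sets_into_space by blast

lemma cell_meas [measurable]: "cell \<in> measurable \<mu> (count_space \<alpha>)"
proof (subst measurable_count_space_eq_countable[OF alpha_countable], intro conjI ballI)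
  show "cell \<in> space \<mu> \<rightarrow> \<alpha>" using cell_in by auto
  fix a assume a: "a \<in> \<alpha>"
  have U: "\<Union>\<alpha> \<in> sets \<mu>" using alpha_countable alpha_sets by auto
  have "cell -` {a} \<inter> space \<mu> = a \<union> (if (SOME a. a \<in> \<alpha>) = a then space \<mu> - \<Union>\<alpha> else {})"
    (is "_ = ?B")
  proof (intro set_eqI iffI)
    fix x assume x: "x \<in> cell -` {a} \<inter> space \<mu>"
    show "x \<in> ?B"
    proof (cases "x \<in> \<Union>\<alpha>")
      case True
      then obtain b where "b \<in> \<alpha>" "x \<in> b" by blast
      then show ?thesis using cell_eq[of b x] x by auto
    next
      case False
      then show ?thesis using x by (auto simp: cell_def)
    qed
  next
    fix x assume x: "x \<in> ?B"
    show "x \<in> cell -` {a} \<inter> space \<mu>"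
    proof (cases "x \<in> a")
      case True
      then show ?thesis using cell_eq[OF a True] alpha_sets[OF a] sets.sets_into_space by auto
    next
      case False
      then show ?thesis using x by (auto simp: cell_def split: if_splits)
    qed
  qed
  then show "cell -` {a} \<inter> space \<mu> \<in> sets \<mu>" using alpha_sets[OF a] U by auto
qed

definition m :: "'a set measure" where "m = distr \<mu> (count_space \<alpha>) cell"

lemma sets_m: "sets m = Pow \<alpha>" and space_m [simp]: "space m = \<alpha>"
  by (simp_all add: m_def)

sublocale m: prob_space m
  unfolding m_def by (rule prob_space_distr) measurable

lemma meas_m [measurable, simp]: "(f :: 'a set \<Rightarrow> 'b::topological_space) \<in> borel_measurable m"
proof -
  have "measurable m borel = measurable (count_space \<alpha>) (borel :: 'b measure)"
    by (rule measurable_cong_sets) (simp_all add: sets_m)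
  then show ?thesis by simp
qed

lemma integral_m:
  fixes h :: "'a set \<Rightarrow> 'b::{banach, second_countable_topology}"
  shows "(\<integral>a. h a \<partial>m) = (\<integral>x. h (cell x) \<partial>\<mu>)"
  unfolding m_def by (rule integral_distr) measurable

lemma emeasure_m: assumes a: "a \<in> \<alpha>" shows "emeasure m {a} = emeasure \<mu> a"
proof -
  have "emeasure m {a} = emeasure \<mu> (cell -` {a} \<inter> space \<mu>)"
    unfolding m_def using a by (intro emeasure_distr) auto
  also have "\<dots> = emeasure \<mu> a"
  proof (rule emeasure_eq_AE)
    show "AE x in \<mu>. x \<in> cell -` {a} \<inter> space \<mu> \<longleftrightarrow> x \<in> a"
      using Om_AE AE_space by eventually_elim (use cell_mem cell_eq[OF a] in auto)
    show "cell -` {a} \<inter> space \<mu> \<in> sets \<mu>"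
      using a by (intro measurable_sets[OF cell_meas]) auto
  qed (rule alpha_sets[OF a])
  finally show ?thesis .
qed

text \<open>Each cell has positive mass, so a statement that holds almost everywhere for
  \<open>m\<close> holds for every cell.\<close>

lemma AE_m_D: assumes "AE a in m. P a" "a \<in> \<alpha>" shows "P a"
proof (rule ccontr)
  assume n: "\<not> P a"
  obtain N where N: "{a \<in> space m. \<not> P a} \<subseteq> N" "emeasure m N = 0" "N \<in> sets m"
    using assms(1) by (rule AE_E)
  have "emeasure m {a} \<le> emeasure m N" using N n assms(2) by (intro emeasure_mono) auto
  then show False using N emeasure_m[OF assms(2)] alpha_pos[OF assms(2)] by (simp add: emeasure_eq_measure)
qed

lemma AE_m_I: "(\<And>a. a \<in> \<alpha> \<Longrightarrow> P a) \<Longrightarrow> AE a in m. P a"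
  by (rule AE_I2) simp

lemma m_eq: "m = density (count_space \<alpha>) (\<lambda>a. emeasure \<mu> a)"
proof (rule measure_eqI_countable[OF _ _ alpha_countable])
  fix a assume a: "a \<in> \<alpha>"
  then show "emeasure m {a} = emeasure (density (count_space \<alpha>) (\<lambda>a. emeasure \<mu> a)) {a}"
    by (simp add: emeasure_m emeasure_density nn_integral_count_space_indicator
        nn_integral_count_space'[of "{a}"] split: split_indicator)
qed (simp_all add: sets_m)

text \<open>The transfer operator of F; every function on the countable set of cells is measurable, so
  the measure m of the cells turns the sum over the branches into an integral.\<close>

definition R :: "('a \<Rightarrow> 'b::{banach, second_countable_topology}) \<Rightarrow> 'a \<Rightarrow> 'b" where
  "R u y = (\<integral>a. G a y *\<^sub>R u (\<psi> a y) \<partial>m)"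

lemma pair_meas:
  assumes "\<And>a. a \<in> \<alpha> \<Longrightarrow> (\<lambda>y. f (a, y)) \<in> measurable \<mu> K"
  shows "f \<in> measurable (m \<Otimes>\<^sub>M \<mu>) K"
proof -
  have "sets (m \<Otimes>\<^sub>M \<mu>) = sets (count_space \<alpha> \<Otimes>\<^sub>M \<mu>)"
    by (rule sets_pair_measure_cong) (simp_all add: sets_m)
  moreover have "f \<in> measurable (count_space \<alpha> \<Otimes>\<^sub>M \<mu>) K"
    by (rule measurable_pair_measure_countable1[OF alpha_countable assms])
  ultimately show ?thesis using measurable_cong_sets by blast
qed

lemma G_pair [measurable]: "(\<lambda>(a, y). G a y) \<in> borel_measurable (m \<Otimes>\<^sub>M \<mu>)"
  by (rule pair_meas) (simp add: G_meas)

lemma psi_pair [measurable]: "(\<lambda>(a, y). \<psi> a y) \<in> measurable (m \<Otimes>\<^sub>M \<mu>) \<mu>"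
  by (rule pair_meas) (simp add: psi_meas)

lemma G_nonneg: "a \<in> \<alpha> \<Longrightarrow> 0 \<le> G a y"
  using G_pos G_out by (cases "y \<in> \<Omega>") (auto intro: less_imp_le)

text \<open>The changes of variables on all branches, assembled into one identity of measures. The
  invariance of integrals under \<open>R\<close> then becomes Fubini's theorem.\<close>

lemma mu_eq: "\<mu> = distr (density (m \<Otimes>\<^sub>M \<mu>) (\<lambda>(a, y). ennreal (G a y))) \<mu> (\<lambda>(a, y). \<psi> a y)" (is "_ = ?D")
proof (rule measure_eqI)
  fix A assume A: "A \<in> sets \<mu>"
  have "emeasure ?D A = (\<integral>\<^sup>+ z. (case z of (a, y) \<Rightarrow> ennreal (G a y)) * indicator A (case z of (a, y) \<Rightarrow> \<psi> a y) \<partial>(m \<Otimes>\<^sub>M \<mu>))"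
    using A by (subst emeasure_distr, simp_all)
      (subst emeasure_density, simp_all, auto intro!: nn_integral_cong split: split_indicator simp: case_prod_unfold space_pair_measure)
  also have "\<dots> = (\<integral>\<^sup>+ a. \<integral>\<^sup>+ y. ennreal (G a y) * indicator A (\<psi> a y) \<partial>\<mu> \<partial>m)"
    using A by (subst nn_integral_fst[symmetric]) (simp_all add: case_prod_unfold)
  also have "\<dots> = (\<integral>\<^sup>+ a. emeasure \<mu> (A \<inter> a) / ennreal (measure \<mu> a) \<partial>m)"
  proof (rule nn_integral_cong)
    fix a assume "a \<in> space m"
    then have a: "a \<in> \<alpha>" by simp
    show "(\<integral>\<^sup>+ y. ennreal (G a y) * indicator A (\<psi> a y) \<partial>\<mu>) = emeasure \<mu> (A \<inter> a) / ennreal (measure \<mu> a)"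
      unfolding change[OF a A] using alpha_pos[OF a]
      by (simp add: ennreal_mult_divide_eq mult.commute[of "ennreal (measure \<mu> a)"])
  qed
  also have "\<dots> = (\<integral>\<^sup>+ a. emeasure \<mu> (A \<inter> a) \<partial>count_space \<alpha>)"
    unfolding m_eq
  proof (subst nn_integral_density, simp, simp, rule nn_integral_cong)
    fix a assume "a \<in> space (count_space \<alpha>)"
    then have a: "a \<in> \<alpha>" by simp
    show "emeasure \<mu> a * (emeasure \<mu> (A \<inter> a) / ennreal (measure \<mu> a)) = emeasure \<mu> (A \<inter> a)"
      using alpha_pos[OF a] by (simp add: emeasure_eq_measure divide_ennreal ennreal_mult[symmetric])
  qed
  also have "\<dots> = emeasure \<mu> (\<Union>a\<in>\<alpha>. A \<inter> a)"
    using A alpha_sets alpha_disj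
    by (intro emeasure_UN_countable[symmetric] alpha_countable) (auto simp: disjoint_family_on_def disjoint_def)
  also have "\<dots> = emeasure \<mu> A"
  proof (rule emeasure_eq_AE)
    show "AE x in \<mu>. x \<in> (\<Union>a\<in>\<alpha>. A \<inter> a) \<longleftrightarrow> x \<in> A"
      using Om_AE by eventually_elim (use alpha_cover in auto)
    show "(\<Union>a\<in>\<alpha>. A \<inter> a) \<in> sets \<mu>" using A alpha_sets alpha_countable by auto
  qed (rule A)
  finally show "emeasure \<mu> A = emeasure ?D A" by simp
qed simp

sublocale P: pair_sigma_finite m \<mu> ..

lemma R_integral:
  fixes u :: "'a \<Rightarrow> 'b::{banach, second_countable_topology}"
  assumes u: "integrable \<mu> u"
  shows "integrable \<mu> (R u)" "(\<integral>y. R u y \<partial>\<mu>) = (\<integral>x. u x \<partial>\<mu>)"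
proof -
  have um[measurable]: "u \<in> borel_measurable \<mu>" using u by simp
  let ?f = "\<lambda>z. (case z of (a, y) \<Rightarrow> G a y) *\<^sub>R u (case z of (a, y) \<Rightarrow> \<psi> a y)"
  have nn: "AE z in m \<Otimes>\<^sub>M \<mu>. 0 \<le> (case z of (a, y) \<Rightarrow> G a y)"
    by (rule AE_I2) (auto simp: space_pair_measure G_nonneg)
  have dens: "density (m \<Otimes>\<^sub>M \<mu>) (\<lambda>(a, y). ennreal (G a y)) = density (m \<Otimes>\<^sub>M \<mu>) (\<lambda>z. ennreal (case z of (a, y) \<Rightarrow> G a y))"
    by (simp add: case_prod_unfold)
  have "integrable (distr (density (m \<Otimes>\<^sub>M \<mu>) (\<lambda>(a, y). ennreal (G a y))) \<mu> (\<lambda>(a, y). \<psi> a y)) u"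
    using u mu_eq by simp
  then have int: "integrable (m \<Otimes>\<^sub>M \<mu>) ?f"
    unfolding dens by (subst (asm) integrable_distr_eq, simp, simp) (subst (asm) integrable_density, simp_all add: nn)
  have "(\<integral>x. u x \<partial>\<mu>) = (\<integral>x. u x \<partial>distr (density (m \<Otimes>\<^sub>M \<mu>) (\<lambda>(a, y). ennreal (G a y))) \<mu> (\<lambda>(a, y). \<psi> a y))"
    using mu_eq by simp
  also have "\<dots> = (\<integral>z. ?f z \<partial>(m \<Otimes>\<^sub>M \<mu>))"
    unfolding dens by (subst integral_distr, simp, simp) (subst integral_density, simp_all add: nn)
  finally have 1: "(\<integral>x. u x \<partial>\<mu>) = (\<integral>z. ?f z \<partial>(m \<Otimes>\<^sub>M \<mu>))" .
  have cs: "?f = (\<lambda>(a, y). G a y *\<^sub>R u (\<psi> a y))" by (simp add: case_prod_unfold)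
  show "integrable \<mu> (R u)"
    using P.integrable_snd[of "\<lambda>a y. G a y *\<^sub>R u (\<psi> a y)"] int unfolding cs R_def[abs_def] .
  show "(\<integral>y. R u y \<partial>\<mu>) = (\<integral>x. u x \<partial>\<mu>)"
    using P.integral_snd[of "\<lambda>a y. G a y *\<^sub>R u (\<psi> a y)"] int unfolding 1 cs R_def[abs_def] .
qed

lemma R_mult:
  fixes q w :: "'a \<Rightarrow> complex"
  assumes y: "y \<in> \<Omega>"
  shows "R (\<lambda>x. q x * w (F x)) y = R q y * w y"
proof -
  have "R (\<lambda>x. q x * w (F x)) y = (\<integral>a. (G a y *\<^sub>R q (\<psi> a y)) * w y \<partial>m)"
    unfolding R_def by (rule Bochner_Integration.integral_cong) (use y F_psi in auto)
  then show ?thesis by (simp only: R_def integral_mult_left_zero)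
qed

text \<open>\<open>R\<close> is the adjoint of composition with \<open>F\<close>. The product rule
  behind it holds at all points, since off \<open>\<Omega>\<close> both sides vanish.\<close>

lemma R_dual:
  fixes q w :: "'a \<Rightarrow> complex"
  assumes "integrable \<mu> (\<lambda>x. q x * w (F x))"
  shows "integrable \<mu> (\<lambda>y. R q y * w y)" "(\<integral>y. R q y * w y \<partial>\<mu>) = (\<integral>x. q x * w (F x) \<partial>\<mu>)"
proof -
  have eq: "R (\<lambda>x. q x * w (F x)) y = R q y * w y" for y
    by (cases "y \<in> \<Omega>") (simp_all add: R_mult, simp add: R_def G_out)
  show "integrable \<mu> (\<lambda>y. R q y * w y)" "(\<integral>y. R q y * w y \<partial>\<mu>) = (\<integral>x. q x * w (F x) \<partial>\<mu>)"
    using R_integral[OF assms] unfolding eq by simp_all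
qed

lemma R_measurable:
  fixes u :: "'a \<Rightarrow> 'b::{banach, second_countable_topology}"
  assumes u: "u \<in> borel_measurable \<mu>" shows "R u \<in> borel_measurable \<mu>"
proof -
  have "(\<lambda>z. (case z of (a, y) \<Rightarrow> G a y) *\<^sub>R u (case z of (a, y) \<Rightarrow> \<psi> a y)) \<in> borel_measurable (m \<Otimes>\<^sub>M \<mu>)"
    using u by measurable
  then have "(\<lambda>(y, a). G a y *\<^sub>R u (\<psi> a y)) \<in> borel_measurable (\<mu> \<Otimes>\<^sub>M m)"
    by (subst (asm) measurable_pair_swap_iff) (simp add: case_prod_unfold)
  then show ?thesis unfolding R_def[abs_def] by (intro m.borel_measurable_lebesgue_integral) simp
qed

lemma R_int:
  fixes u :: "'a \<Rightarrow> 'b::{banach, second_countable_topology}"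
  assumes y: "y \<in> \<Omega>" and h: "integrable m h" "\<And>a. a \<in> \<alpha> \<Longrightarrow> norm (u (\<psi> a y)) \<le> h a"
  shows "integrable m (\<lambda>a. G a y *\<^sub>R u (\<psi> a y))"
proof (rule Bochner_Integration.integrable_bound)
  show "integrable m (\<lambda>a. C\<^sub>1 * h a)" using h by simp
  show "AE a in m. norm (G a y *\<^sub>R u (\<psi> a y)) \<le> norm (C\<^sub>1 * h a)"
  proof (rule AE_m_I)
    fix a assume a: "a \<in> \<alpha>"
    have "norm (G a y *\<^sub>R u (\<psi> a y)) \<le> C\<^sub>1 * h a"
      using a y G_le G_nonneg h(2) C1 by (auto intro!: mult_mono)
    then show "norm (G a y *\<^sub>R u (\<psi> a y)) \<le> norm (C\<^sub>1 * h a)" by simp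
  qed
qed simp

lemma R_add:
  fixes u v :: "'a \<Rightarrow> 'b::{banach, second_countable_topology}"
  assumes y: "y \<in> \<Omega>" and h: "integrable m h" "\<And>a. a \<in> \<alpha> \<Longrightarrow> norm (u (\<psi> a y)) \<le> h a"
    and k: "integrable m k" "\<And>a. a \<in> \<alpha> \<Longrightarrow> norm (v (\<psi> a y)) \<le> k a"
  shows "R (\<lambda>x. u x + v x) y = R u y + R v y" "R (\<lambda>x. u x - v x) y = R u y - R v y"
  unfolding R_def using R_int[OF y h] R_int[OF y k] by (simp_all add: scaleR_add_right scaleR_diff_right)

lemma R_cmult: "R (\<lambda>x. c * u x) y = c * R u y" for u :: "'a \<Rightarrow> complex"
  unfolding R_def by (simp flip: integral_mult_right_zero mult_scaleR_right)

lemma R_norm_le: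
  fixes u :: "'a \<Rightarrow> 'b::{banach, second_countable_topology}"
  shows "norm (R u y) \<le> R (\<lambda>x. norm (u x)) y"
proof -
  have "norm (R u y) \<le> (\<integral>a. norm (G a y *\<^sub>R u (\<psi> a y)) \<partial>m)"
    unfolding R_def by (rule integral_norm_bound)
  also have "\<dots> = R (\<lambda>x. norm (u x)) y"
    unfolding R_def by (rule Bochner_Integration.integral_cong) (auto simp: G_nonneg)
  finally show ?thesis .
qed

lemma R_mono:
  fixes u v :: "'a \<Rightarrow> real"
  assumes y: "y \<in> \<Omega>" and uv: "\<And>x. x \<in> \<Omega> \<Longrightarrow> 0 \<le> u x" "\<And>x. x \<in> \<Omega> \<Longrightarrow> u x \<le> v x"
    and h: "integrable m h" "\<And>a. a \<in> \<alpha> \<Longrightarrow> v (\<psi> a y) \<le> h a"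
  shows "R u y \<le> R v y"
  unfolding R_def
proof (rule integral_mono)
  have b: "norm (u (\<psi> a y)) \<le> h a" "norm (v (\<psi> a y)) \<le> h a" if a: "a \<in> \<alpha>" for a
    using uv(1)[OF psi_Om[OF a y]] uv(2)[OF psi_Om[OF a y]] h(2)[OF a] by auto
  show "integrable m (\<lambda>a. G a y *\<^sub>R u (\<psi> a y))" "integrable m (\<lambda>a. G a y *\<^sub>R v (\<psi> a y))"
    by (rule R_int[OF y h(1)], rule b, assumption)+
  show "G a y *\<^sub>R u (\<psi> a y) \<le> G a y *\<^sub>R v (\<psi> a y)" if "a \<in> space m" for a
    using that uv(2)[OF psi_Om[OF _ y]] G_nonneg by (auto intro!: mult_left_mono)
qed

lemma R_cong: "(\<And>x. x \<in> \<Omega> \<Longrightarrow> u x = v x) \<Longrightarrow> R u y = R v y"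
  unfolding R_def
  by (rule Bochner_Integration.integral_cong[OF refl]) (cases "y \<in> \<Omega>", auto simp: psi_Om G_out)

lemma R_out: "y \<notin> \<Omega> \<Longrightarrow> R u y = 0"
  by (simp add: R_def G_out)

lemma R_lip:
  fixes q :: "'a \<Rightarrow> complex"
  assumes qm: "q \<in> borel_measurable \<mu>" and h: "integrable m h"
    and qb: "\<And>a x. a \<in> \<alpha> \<Longrightarrow> x \<in> a \<Longrightarrow> x \<in> \<Omega> \<Longrightarrow> cmod (q x) \<le> h a"
    and ql: "\<And>a x x'. a \<in> \<alpha> \<Longrightarrow> x \<in> a \<Longrightarrow> x \<in> \<Omega> \<Longrightarrow> x' \<in> a \<Longrightarrow> x' \<in> \<Omega> \<Longrightarrow> cmod (q x - q x') \<le> h a * d x x'"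
  shows "R q \<in> V" "nb (2 * C\<^sub>1 * (\<integral>a. h a \<partial>m)) (R q)" "nrm (R q) \<le> 2 * C\<^sub>1 * (\<integral>a. h a \<partial>m)"
proof -
  have h0: "0 \<le> h a" if "a \<in> \<alpha>" for a
    using qb[OF that _ _, of "\<psi> a y0"] psi_mem[OF that y0] norm_ge_zero order_trans by blast
  have b: "cmod (q (\<psi> a y)) \<le> h a" if "a \<in> \<alpha>" "y \<in> \<Omega>" for a y
    using psi_mem[OF that] qb[OF that(1)] by blast
  note int = R_int[OF _ h b]
  have H0: "0 \<le> (\<integral>a. h a \<partial>m)" using h0 by (intro integral_nonneg_AE AE_m_I)
  have bound: "cmod (R q y) \<le> 2 * C\<^sub>1 * (\<integral>a. h a \<partial>m)" if y: "y \<in> \<Omega>" for y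
  proof -
    have "cmod (R q y) \<le> (\<integral>a. norm (G a y *\<^sub>R q (\<psi> a y)) \<partial>m)" unfolding R_def by (rule integral_norm_bound)
    also have "\<dots> \<le> (\<integral>a. C\<^sub>1 * h a \<partial>m)"
    proof (rule integral_mono)
      show "integrable m (\<lambda>a. norm (G a y *\<^sub>R q (\<psi> a y)))" using int[OF y _ y] by (intro integrable_norm)
      show "integrable m (\<lambda>a. C\<^sub>1 * h a)" using h by simp
      fix a assume "a \<in> space m"
      then show "norm (G a y *\<^sub>R q (\<psi> a y)) \<le> C\<^sub>1 * h a"
        using y b G_le G_nonneg C1 by (auto intro!: mult_mono)
    qed
    also have "\<dots> = C\<^sub>1 * (\<integral>a. h a \<partial>m)" by simp
    also have "\<dots> \<le> 2 * C\<^sub>1 * (\<integral>a. h a \<partial>m)" using H0 C1 by (intro mult_right_mono) auto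
    finally show ?thesis .
  qed
  have lip: "cmod (R q y - R q y') \<le> 2 * C\<^sub>1 * (\<integral>a. h a \<partial>m) * d y y'" if y: "y \<in> \<Omega>" and y': "y' \<in> \<Omega>" for y y'
  proof -
    have "R q y - R q y' = (\<integral>a. G a y *\<^sub>R q (\<psi> a y) - G a y' *\<^sub>R q (\<psi> a y') \<partial>m)"
      unfolding R_def using int[OF y _ y] int[OF y' _ y'] by simp
    also have "cmod \<dots> \<le> (\<integral>a. norm (G a y *\<^sub>R q (\<psi> a y) - G a y' *\<^sub>R q (\<psi> a y')) \<partial>m)"
      by (rule integral_norm_bound)
    also have "\<dots> \<le> (\<integral>a. 2 * C\<^sub>1 * h a * d y y' \<partial>m)"
    proof (rule integral_mono)
      show "integrable m (\<lambda>a. norm (G a y *\<^sub>R q (\<psi> a y) - G a y' *\<^sub>R q (\<psi> a y')))"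
        using int[OF y _ y] int[OF y' _ y'] by simp
      show "integrable m (\<lambda>a. 2 * C\<^sub>1 * h a * d y y')" using h by simp
      fix a assume "a \<in> space m"
      then have a: "a \<in> \<alpha>" by simp
      have "G a y *\<^sub>R q (\<psi> a y) - G a y' *\<^sub>R q (\<psi> a y')
          = G a y *\<^sub>R (q (\<psi> a y) - q (\<psi> a y')) + (G a y - G a y') *\<^sub>R q (\<psi> a y')"
        by (simp add: algebra_simps)
      also have "norm \<dots> \<le> G a y * cmod (q (\<psi> a y) - q (\<psi> a y')) + \<bar>G a y - G a y'\<bar> * cmod (q (\<psi> a y'))"
        using G_nonneg[OF a, of y] norm_triangle_ineq[of "G a y *\<^sub>R (q (\<psi> a y) - q (\<psi> a y'))" "(G a y - G a y') *\<^sub>R q (\<psi> a y')"]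
        by simp
      also have "\<dots> \<le> C\<^sub>1 * (h a * d y y') + (C\<^sub>1 * d y y') * h a"
      proof -
        have "cmod (q (\<psi> a y) - q (\<psi> a y')) \<le> h a * d (\<psi> a y) (\<psi> a y')"
          using psi_mem[OF a y] psi_mem[OF a y'] by (intro ql[OF a]) auto
        also have "\<dots> = \<theta> * (h a * d y y')" by (simp add: d_psi[OF a y y'])
        also have "\<dots> \<le> 1 * (h a * d y y')"
          using h0[OF a] theta d_range by (intro mult_right_mono) auto
        finally have 1: "cmod (q (\<psi> a y) - q (\<psi> a y')) \<le> h a * d y y'" by simp
        show ?thesis
          by (rule add_mono[OF mult_mono[OF G_le[OF a y] 1] mult_mono[OF G_lip[OF a y y'] b[OF a y']]])
            (use C1 h0[OF a] d_range in auto)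
      qed
      finally show "norm (G a y *\<^sub>R q (\<psi> a y) - G a y' *\<^sub>R q (\<psi> a y')) \<le> 2 * C\<^sub>1 * h a * d y y'"
        by (simp add: algebra_simps)
    qed
    finally show ?thesis by simp
  qed
  show nb: "nb (2 * C\<^sub>1 * (\<integral>a. h a \<partial>m)) (R q)" using bound lip by (auto simp: nb_def)
  then show "R q \<in> V" using R_measurable[OF qm] V_iff by blast
  show "nrm (R q) \<le> 2 * C\<^sub>1 * (\<integral>a. h a \<partial>m)" by (rule nrm_le[OF nb])
qed

end

context lip_space
begin

lemma nb_mult:
  assumes u: "nb s u" and v: "nb t v" shows "nb (2 * s * t) (\<lambda>x. u x * v x)"
proof -
  have s: "0 \<le> s" and t: "0 \<le> t" using u v nb_nonneg by auto
  have "cmod (u x * v x) \<le> 2 * s * t" if "x \<in> \<Omega>" for x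
  proof -
    have "cmod (u x * v x) \<le> s * t"
      unfolding norm_mult using u v that s t by (intro mult_mono) (auto simp: nb_def)
    also have "\<dots> \<le> 2 * s * t" using s t by simp
    finally show ?thesis .
  qed
  moreover have "cmod (u x * v x - u y * v y) \<le> 2 * s * t * d x y" if "x \<in> \<Omega>" "y \<in> \<Omega>" for x y
  proof -
    have "u x * v x - u y * v y = u x * (v x - v y) + (u x - u y) * v y" by (simp add: algebra_simps)
    also have "cmod \<dots> \<le> cmod (u x) * cmod (v x - v y) + cmod (u x - u y) * cmod (v y)"
      by (metis norm_mult norm_triangle_ineq)
    also have "\<dots> \<le> s * (t * d x y) + s * d x y * t"
      using u v that s t d_nonneg[of x y] by (intro add_mono mult_mono) (auto simp: nb_def)
    finally show ?thesis by (simp add: algebra_simps)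
  qed
  ultimately show ?thesis by (auto simp: nb_def)
qed

lemma nb_cnj: "nb s u \<Longrightarrow> nb s (\<lambda>x. cnj (u x))"
  by (auto simp: nb_def complex_cnj_diff[symmetric] simp del: complex_cnj_diff)

end

section \<open>The transfer operator on Lipschitz functions\<close>

context full_branch
begin

lemma m_alpha [simp]: "measure m \<alpha> = 1"
  using m.prob_space by simp

lemma null_I: "N \<in> sets \<mu> \<Longrightarrow> AE x in \<mu>. x \<notin> N \<Longrightarrow> emeasure \<mu> N = 0"
  using AE_iff_null_sets[of N \<mu>] by auto

lemma cnj_measurable: "u \<in> borel_measurable \<mu> \<Longrightarrow> (\<lambda>x. cnj (u x)) \<in> borel_measurable \<mu>"
  by (rule measurable_compose[of u _ _ cnj], assumption)
     (intro borel_measurable_continuous_onI continuous_intros)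

lemma const_V: "(\<lambda>x. c) \<in> V"
proof -
  have "nb (cmod c) (\<lambda>x. c)" using d_range by (auto simp: nb_def)
  then show ?thesis by (auto simp: V_iff)
qed

lemma V_integrable: assumes "v \<in> V" shows "integrable \<mu> v"
proof (rule integrable_const_bound)
  show "AE x in \<mu>. norm (v x) \<le> nrm v" using Om_AE by eventually_elim (rule nrm_pt[OF assms])
qed (rule V_meas[OF assms])

lemma V_integral_le: assumes "v \<in> V" shows "cmod (\<integral>x. v x \<partial>\<mu>) \<le> nrm v"
proof -
  have "cmod (\<integral>x. v x \<partial>\<mu>) \<le> (\<integral>x. norm (v x) \<partial>\<mu>)" by (rule integral_norm_bound)
  also have "\<dots> \<le> (\<integral>x. nrm v \<partial>\<mu>)"
    using V_integrable[OF assms] Om_AE nrm_pt[OF assms] by (intro integral_mono_AE) auto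
  finally show ?thesis by (simp add: prob_space)
qed

lemma R_V: assumes v: "v \<in> V" shows "R v \<in> V" "nrm (R v) \<le> 2 * C\<^sub>1 * nrm v"
  using R_lip[OF V_meas[OF v], of "\<lambda>_. nrm v"] nrm_pt[OF v] nrm_lip[OF v]
  by simp_all

text \<open>The points of \<open>\<Omega>\<close> that share the first n cells of their itinerary
  with x.\<close>

primrec cyl :: "nat \<Rightarrow> 'a \<Rightarrow> 'a set" where
  "cyl 0 x = \<Omega>"
| "cyl (Suc n) x = \<Omega> \<inter> cell x \<inter> (F -` cyl n (F x) \<inter> space \<mu>)"

lemma cyl_sub: "cyl n x \<subseteq> \<Omega>"
  by (cases n) auto

lemma cyl_sets: "cyl n x \<in> sets \<mu>"
proof (induction n arbitrary: x)
  case (Suc n)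
  show ?case unfolding cyl.simps
    by (intro sets.Int Om_sets alpha_sets cell_in measurable_sets[OF F_meas Suc])
qed simp

lemma cyl_d: "x \<in> \<Omega> \<Longrightarrow> x' \<in> cyl n x \<Longrightarrow> d x x' \<le> \<theta> ^ n"
proof (induction n arbitrary: x x')
  case (Suc n)
  have x': "x' \<in> \<Omega>" "x' \<in> cell x" "F x' \<in> cyl n (F x)" using Suc.prems by auto
  have "d x x' = d (\<psi> (cell x) (F x)) (\<psi> (cell x) (F x'))"
    using psi_cell_F[OF Suc.prems(1)] psi_F[OF cell_in x'(2,1)] by simp
  also have "\<dots> = \<theta> * d (F x) (F x')" by (intro d_psi cell_in F_Om Suc.prems x')
  also have "\<dots> \<le> \<theta> * \<theta> ^ n" using Suc.IH[OF F_Om[OF Suc.prems(1)] x'(3)] theta by simp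
  finally show ?case by simp
qed (simp add: d_range)

text \<open>By induction: the inverse branch into the first cell carries the shorter cylinder into
  the longer one with a strictly positive Jacobian weight.\<close>

lemma cyl_pos: "x \<in> \<Omega> \<Longrightarrow> emeasure \<mu> (cyl n x) > 0"
proof (induction n arbitrary: x)
  case 0
  have "emeasure \<mu> \<Omega> = emeasure \<mu> (space \<mu>)"
    by (rule emeasure_eq_AE) (use Om_AE Om_space in auto)
  then show ?case by (simp add: emeasure_space_1)
next
  case (Suc n)
  let ?a = "cell x" let ?B = "cyl n (F x)"
  have B: "?B \<in> sets \<mu>" by (rule cyl_sets)
  have eq: "cyl (Suc n) x = (\<Omega> \<inter> (F -` ?B \<inter> space \<mu>)) \<inter> ?a" by auto
  have A: "\<Omega> \<inter> (F -` ?B \<inter> space \<mu>) \<in> sets \<mu>" using B by (auto simp: measurable_sets[OF F_meas])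
  have "(\<integral>\<^sup>+ y. ennreal (G ?a y) * indicator (\<Omega> \<inter> (F -` ?B \<inter> space \<mu>)) (\<psi> ?a y) \<partial>\<mu>) \<noteq> 0"
  proof
    assume "(\<integral>\<^sup>+ y. ennreal (G ?a y) * indicator (\<Omega> \<inter> (F -` ?B \<inter> space \<mu>)) (\<psi> ?a y) \<partial>\<mu>) = 0"
    then have "AE y in \<mu>. ennreal (G ?a y) * indicator (\<Omega> \<inter> (F -` ?B \<inter> space \<mu>)) (\<psi> ?a y) = 0"
      using G_meas[OF cell_in] psi_meas[OF cell_in] A by (subst (asm) nn_integral_0_iff_AE) auto
    then have "AE y in \<mu>. y \<notin> ?B"
    proof eventually_elim
      case (elim y)
      show ?case
      proof
        assume y: "y \<in> ?B"
        then have yO: "y \<in> \<Omega>" using cyl_sub by blast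
        have "\<psi> ?a y \<in> \<Omega> \<inter> (F -` ?B \<inter> space \<mu>)"
          using psi_mem[OF cell_in yO] F_psi[OF cell_in yO] y Om_space by auto
        then show False using elim G_pos[OF cell_in yO, of x] by simp
      qed
    qed
    then have "emeasure \<mu> ?B = 0" by (rule null_I[OF B])
    then show False using Suc.IH[OF F_Om[OF Suc.prems]] by simp
  qed
  then show ?case
    unfolding eq change[OF cell_in A] using alpha_pos[OF cell_in, of x]
    by (simp add: zero_less_iff_neq_zero)
qed

text \<open>Cylinders of arbitrarily small diameter around x have positive measure, so each contains
  a zero of v, and the Lipschitz bound brings it to x. This upgrades identities that duality yields
  almost everywhere to identities on \<open>\<Omega>\<close>.\<close>

lemma V_AE_zero:
  assumes v: "v \<in> V" and ae: "AE x in \<mu>. v x = 0" and x: "x \<in> \<Omega>" shows "v x = 0"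
proof -
  have "cmod (v x) \<le> nrm v * \<theta> ^ n" for n
  proof -
    have "\<exists>y\<in>cyl n x. v y = 0"
    proof (rule ccontr)
      assume "\<not> ?thesis"
      then have "AE y in \<mu>. y \<notin> cyl n x" using ae by auto
      then have "emeasure \<mu> (cyl n x) = 0" by (rule null_I[OF cyl_sets])
      then show False using cyl_pos[OF x, of n] by simp
    qed
    then obtain y where y: "y \<in> cyl n x" "v y = 0" by blast
    have "cmod (v x - v y) \<le> nrm v * d x y" using cyl_sub y by (intro nrm_lip v x) auto
    also have "\<dots> \<le> nrm v * \<theta> ^ n" using cyl_d[OF x y(1)] nrm_nonneg[OF v] by (rule mult_left_mono)
    finally show ?thesis using y by simp
  qed
  moreover have "(\<lambda>n. nrm v * \<theta> ^ n) \<longlonglongrightarrow> nrm v * 0" using theta by (intro tendsto_intros LIMSEQ_power_zero) auto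
  ultimately have "cmod (v x) \<le> nrm v * 0" by (intro LIMSEQ_le_const) auto
  then show ?thesis by simp
qed

text \<open>Invariance of the measure under \<open>F\<close> gives R 1 = 1 almost everywhere by
  duality, and \<open>V_AE_zero\<close> gives it everywhere on \<open>\<Omega>\<close>. From here on
  \<open>R\<close> averages with the probability weights \<open>G a y\<close>.\<close>

lemma R_one:
  assumes y: "y \<in> \<Omega>" shows "R (\<lambda>x. 1 :: complex) y = 1" "(\<integral>a. G a y \<partial>m) = 1" "R (\<lambda>x. 1 :: real) y = 1"
proof -
  have V1: "R (\<lambda>x. 1 :: complex) - (\<lambda>x. 1) \<in> V" by (intro V_diff R_V const_V)
  have "AE x in \<mu>. R (\<lambda>x. 1 :: complex) x = 1"
  proof (rule density_unique_banach)
    show "integrable \<mu> (R (\<lambda>x. 1 :: complex))" by (rule V_integrable[OF R_V(1)[OF const_V]])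
    show "integrable \<mu> (\<lambda>x. 1 :: complex)" by simp
    fix A assume A: "A \<in> sets \<mu>"
    let ?w = "\<lambda>x. indicator A x :: complex"
    have FA: "F -` A \<inter> space \<mu> \<in> sets \<mu>" by (rule measurable_sets[OF F_meas A])
    have "integrable \<mu> (\<lambda>x. 1 * ?w (F x))"
      by (rule integrable_const_bound[of _ 1]) (use A in \<open>auto split: split_indicator\<close>)
    from R_dual(2)[OF this] have "(\<integral>y. R (\<lambda>x. 1) y * ?w y \<partial>\<mu>) = (\<integral>x. ?w (F x) \<partial>\<mu>)" by simp
    also have "\<dots> = (\<integral>x. ?w x \<partial>distr \<mu> \<mu> F)" using A by (subst integral_distr) auto
    also have "\<dots> = set_lebesgue_integral \<mu> A (\<lambda>x. 1)"
      unfolding F_inv set_lebesgue_integral_def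
      by (rule Bochner_Integration.integral_cong) (auto split: split_indicator)
    finally have 1: "(\<integral>y. R (\<lambda>x. 1) y * ?w y \<partial>\<mu>) = set_lebesgue_integral \<mu> A (\<lambda>x. 1)" .
    have "(\<integral>y. R (\<lambda>x. 1) y * ?w y \<partial>\<mu>) = set_lebesgue_integral \<mu> A (R (\<lambda>x. 1))"
      unfolding set_lebesgue_integral_def
      by (rule Bochner_Integration.integral_cong) (auto split: split_indicator)
    with 1 show "set_lebesgue_integral \<mu> A (R (\<lambda>x. 1 :: complex)) = set_lebesgue_integral \<mu> A (\<lambda>x. 1 :: complex)" by simp
  qed
  then have "AE x in \<mu>. (R (\<lambda>x. 1 :: complex) - (\<lambda>x. 1)) x = 0" by auto
  from V_AE_zero[OF V1 this y] show 1: "R (\<lambda>x. 1 :: complex) y = 1" by simp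
  have "complex_of_real (\<integral>a. G a y \<partial>m) = 1"
    using 1 unfolding R_def by (simp add: scaleR_conv_of_real)
  then show "(\<integral>a. G a y \<partial>m) = 1" using of_real_eq_1_iff by blast
  then show "R (\<lambda>x. 1 :: real) y = 1" by (simp add: R_def)
qed

lemma G_integrable: assumes y: "y \<in> \<Omega>" shows "integrable m (\<lambda>a. G a y)"
  by (rule m.integrable_const_bound[of _ C\<^sub>1]) (use y G_le G_nonneg in \<open>auto intro!: AE_m_I\<close>)

lemma R_sup:
  fixes u :: "'a \<Rightarrow> 'b::{banach, second_countable_topology}"
  assumes y: "y \<in> \<Omega>" and s: "\<And>x. x \<in> \<Omega> \<Longrightarrow> norm (u x) \<le> s"
  shows "norm (R u y) \<le> s"
proof -
  have "norm (R u y) \<le> (\<integral>a. norm (G a y *\<^sub>R u (\<psi> a y)) \<partial>m)" unfolding R_def by (rule integral_norm_bound)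
  also have "\<dots> \<le> (\<integral>a. G a y * s \<partial>m)"
  proof (rule integral_mono)
    show "integrable m (\<lambda>a. norm (G a y *\<^sub>R u (\<psi> a y)))"
      by (intro integrable_norm R_int[OF y, of "\<lambda>_. s"]) (use s y psi_Om in auto)
    show "integrable m (\<lambda>a. G a y * s)" using G_integrable[OF y] by simp
    show "norm (G a y *\<^sub>R u (\<psi> a y)) \<le> G a y * s" if "a \<in> space m" for a
      using that s[OF psi_Om[OF _ y]] G_nonneg by (auto intro!: mult_left_mono)
  qed
  finally show ?thesis using R_one(2)[OF y] by simp
qed

text \<open>Inverse branches contract by \<theta> and the weights have total mass 1, so the
  Lipschitz constant shrinks by \<theta>; the distortion of the weights costs only a multiple of the
  sup norm.\<close>

lemma lasota_yorke:
  fixes v :: "'a \<Rightarrow> complex"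
  assumes S: "\<And>x. x \<in> \<Omega> \<Longrightarrow> cmod (v x) \<le> S"
    and L: "\<And>x x'. x \<in> \<Omega> \<Longrightarrow> x' \<in> \<Omega> \<Longrightarrow> cmod (v x - v x') \<le> L * d x x'"
    and y: "y \<in> \<Omega>" "y' \<in> \<Omega>"
  shows "cmod (R v y - R v y') \<le> (\<theta> * L + C\<^sub>1 * S) * d y y'"
proof -
  note int = R_int[where h = "\<lambda>_. S" and u = v]
  have i1: "integrable m (\<lambda>a. G a y *\<^sub>R v (\<psi> a y))" "integrable m (\<lambda>a. G a y' *\<^sub>R v (\<psi> a y'))"
    using y S psi_Om by (auto intro!: int)
  have "R v y - R v y' = (\<integral>a. G a y *\<^sub>R v (\<psi> a y) - G a y' *\<^sub>R v (\<psi> a y') \<partial>m)"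
    unfolding R_def using i1 by simp
  also have "cmod \<dots> \<le> (\<integral>a. norm (G a y *\<^sub>R v (\<psi> a y) - G a y' *\<^sub>R v (\<psi> a y')) \<partial>m)"
    by (rule integral_norm_bound)
  also have "\<dots> \<le> (\<integral>a. G a y * (\<theta> * L * d y y') + C\<^sub>1 * S * d y y' \<partial>m)"
  proof (rule integral_mono)
    show "integrable m (\<lambda>a. norm (G a y *\<^sub>R v (\<psi> a y) - G a y' *\<^sub>R v (\<psi> a y')))" using i1 by simp
    show "integrable m (\<lambda>a. G a y * (\<theta> * L * d y y') + C\<^sub>1 * S * d y y')" using G_integrable[OF y(1)] by simp
    fix a assume "a \<in> space m"
    then have a: "a \<in> \<alpha>" by simp
    have S0: "0 \<le> S" using S[OF y(1)] norm_ge_zero order_trans by blast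
    have "G a y *\<^sub>R v (\<psi> a y) - G a y' *\<^sub>R v (\<psi> a y')
        = G a y *\<^sub>R (v (\<psi> a y) - v (\<psi> a y')) + (G a y - G a y') *\<^sub>R v (\<psi> a y')"
      by (simp add: algebra_simps)
    also have "norm \<dots> \<le> G a y * cmod (v (\<psi> a y) - v (\<psi> a y')) + \<bar>G a y - G a y'\<bar> * cmod (v (\<psi> a y'))"
      using G_nonneg[OF a, of y] norm_triangle_ineq[of "G a y *\<^sub>R (v (\<psi> a y) - v (\<psi> a y'))" "(G a y - G a y') *\<^sub>R v (\<psi> a y')"]
      by simp
    also have "\<dots> \<le> G a y * (L * (\<theta> * d y y')) + C\<^sub>1 * d y y' * S"
      using L[OF psi_Om[OF a y(1)] psi_Om[OF a y(2)]] d_psi[OF a y] a y G_lip[OF a y] C1 d_range G_nonneg[OF a] S[OF psi_Om[OF a y(2)]] S0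
      by (intro add_mono mult_mono) auto
    finally show "norm (G a y *\<^sub>R v (\<psi> a y) - G a y' *\<^sub>R v (\<psi> a y')) \<le> G a y * (\<theta> * L * d y y') + C\<^sub>1 * S * d y y'"
      by (simp add: algebra_simps)
  qed
  also have "\<dots> = (\<theta> * L + C\<^sub>1 * S) * d y y'"
    using G_integrable[OF y(1)] R_one(2)[OF y(1)] by (simp add: algebra_simps)
  finally show ?thesis .
qed

text \<open>Fixed points of R are constant: equality in Cauchy--Schwarz makes them invariant under all
  inverse branches, and these contract.\<close>

lemma R_fixed_const:
  assumes v: "v \<in> V" and fp: "\<And>y. y \<in> \<Omega> \<Longrightarrow> R v y = v y" and y: "y \<in> \<Omega>" "y' \<in> \<Omega>"
  shows "v y = v y'"
proof -
  let ?v2 = "\<lambda>x. v x * cnj (v x)"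
  have nb2: "nb (2 * nrm v * nrm v) ?v2" using nb_mult[OF nb_nrm[OF v] nb_cnj[OF nb_nrm[OF v]]] .
  moreover have "?v2 \<in> borel_measurable \<mu>" by (intro borel_measurable_times cnj_measurable V_meas[OF v])
  ultimately have V2: "?v2 \<in> V" unfolding V_iff by blast
  \<comment> \<open>At x this is the variance of the values of v at the preimages of x under the
    weights \<open>G a x\<close>. Its integral is 0 because \<open>R\<close> preserves integrals,
    and being nonnegative it must vanish.\<close>
  define E where "E = R ?v2 - ?v2"
  have DV: "E \<in> V" unfolding E_def by (intro V_diff R_V V2)
  have D: "E x = complex_of_real (\<integral>a. G a x * (cmod (v (\<psi> a x) - v x))\<^sup>2 \<partial>m)" if x: "x \<in> \<Omega>" for x
  proof -
    have i: "integrable m (\<lambda>a. G a x *\<^sub>R v (\<psi> a x))" "integrable m (\<lambda>a. G a x *\<^sub>R ?v2 (\<psi> a x))"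
      by (rule R_int[OF x, of "\<lambda>_. nrm v"], simp, rule nrm_pt[OF v psi_Om[OF _ x]], assumption)
         (rule R_int[OF x, of "\<lambda>_. nrm ?v2"], simp, rule nrm_pt[OF V2 psi_Om[OF _ x]], assumption)
    have ic: "integrable m (\<lambda>a. cnj (G a x *\<^sub>R v (\<psi> a x)))" using i(1) by (simp only: complex_integrable_cnj)
    have iG: "integrable m (\<lambda>a. complex_of_real (G a x))" using G_integrable[OF x] by simp
    have "complex_of_real (\<integral>a. G a x * (cmod (v (\<psi> a x) - v x))\<^sup>2 \<partial>m)
      = (\<integral>a. complex_of_real (G a x * (cmod (v (\<psi> a x) - v x))\<^sup>2) \<partial>m)"
      by (rule integral_complex_of_real[symmetric])
    also have "\<dots> = (\<integral>a. G a x *\<^sub>R ?v2 (\<psi> a x) - cnj (v x) * (G a x *\<^sub>R v (\<psi> a x))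
        - v x * cnj (G a x *\<^sub>R v (\<psi> a x)) + v x * cnj (v x) * complex_of_real (G a x) \<partial>m)"
      by (rule Bochner_Integration.integral_cong[OF refl])
        (simp add: complex_norm_square scaleR_conv_of_real algebra_simps del: of_real_power)
    also have "\<dots> = (\<integral>a. G a x *\<^sub>R ?v2 (\<psi> a x) \<partial>m) - cnj (v x) * (\<integral>a. G a x *\<^sub>R v (\<psi> a x) \<partial>m)
        - v x * (\<integral>a. cnj (G a x *\<^sub>R v (\<psi> a x)) \<partial>m) + v x * cnj (v x) * (\<integral>a. complex_of_real (G a x) \<partial>m)"
    proof -
      have lin: "(\<integral>a. f a - c * g a - c' * g' a + c'' * g'' a \<partial>m)
        = (\<integral>a. f a \<partial>m) - c * (\<integral>a. g a \<partial>m) - c' * (\<integral>a. g' a \<partial>m) + c'' * (\<integral>a. g'' a \<partial>m)"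
        if "integrable m f" "integrable m g" "integrable m g'" "integrable m g''"
        for f g g' g'' :: "'a set \<Rightarrow> complex" and c c' c''
        using that by simp
      show ?thesis by (rule lin[OF i(2,1) ic iG])
    qed
    also have "\<dots> = R ?v2 x - cnj (v x) * R v x - v x * cnj (R v x) + v x * cnj (v x) * complex_of_real (\<integral>a. G a x \<partial>m)"
    proof -
      have "(\<integral>a. cnj (G a x *\<^sub>R v (\<psi> a x)) \<partial>m) = cnj (\<integral>a. G a x *\<^sub>R v (\<psi> a x) \<partial>m)"
        by (rule integral_bounded_linear[OF bounded_linear_cnj i(1)])
      then show ?thesis unfolding R_def by (simp only: integral_complex_of_real)
    qed
    also have "\<dots> = E x" using fp[OF x] R_one(2)[OF x] by (simp add: E_def)
    finally show ?thesis by simp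
  qed
  have "(\<integral>x. E x \<partial>\<mu>) = 0"
    using R_integral[OF V_integrable[OF V2]] V_integrable[OF V2] by (simp add: E_def)
  moreover have "(\<integral>x. E x \<partial>\<mu>) = complex_of_real (\<integral>x. Re (E x) \<partial>\<mu>)"
  proof -
    have "(\<integral>x. E x \<partial>\<mu>) = (\<integral>x. complex_of_real (Re (E x)) \<partial>\<mu>)"
    proof (rule integral_cong_AE)
      show "E \<in> borel_measurable \<mu>" by (rule V_meas[OF DV])
      then show "(\<lambda>x. complex_of_real (Re (E x))) \<in> borel_measurable \<mu>" by measurable
      show "AE x in \<mu>. E x = complex_of_real (Re (E x))" using Om_AE by eventually_elim (simp add: D)
    qed
    then show ?thesis by (simp only: integral_complex_of_real)
  qed
  ultimately have int0: "(\<integral>x. Re (E x) \<partial>\<mu>) = 0" by simp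
  have Dnn: "0 \<le> Re (E x)" if "x \<in> \<Omega>" for x
    unfolding D[OF that] Re_complex_of_real by (intro integral_nonneg_AE AE_m_I mult_nonneg_nonneg G_nonneg) auto
  have "AE x in \<mu>. Re (E x) = 0"
  proof (subst integral_nonneg_eq_0_iff_AE[symmetric])
    show "integrable \<mu> (\<lambda>x. Re (E x))" by (rule integrable_Re[OF V_integrable[OF DV]])
    show "AE x in \<mu>. 0 \<le> Re (E x)" using Om_AE by eventually_elim (rule Dnn)
  qed (rule int0)
  then have "AE x in \<mu>. E x = 0" using Om_AE by eventually_elim (use D in auto)
  then have D0: "E x = 0" if "x \<in> \<Omega>" for x using V_AE_zero[OF DV _ that] by blast
  have inv: "v (\<psi> a x) = v x" if a: "a \<in> \<alpha>" and x: "x \<in> \<Omega>" for a x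
  proof -
    have b: "cmod (v (\<psi> a x) - v x) \<le> 2 * nrm v" if "a \<in> \<alpha>" for a
      using norm_triangle_ineq4[of "v (\<psi> a x)" "v x"] nrm_pt[OF v psi_Om[OF that x]] nrm_pt[OF v x] by linarith
    have "(\<integral>a. G a x * (cmod (v (\<psi> a x) - v x))\<^sup>2 \<partial>m) = 0" using D[OF x] D0[OF x] by (metis of_real_eq_0_iff)
    moreover have "integrable m (\<lambda>a. G a x * (cmod (v (\<psi> a x) - v x))\<^sup>2)"
    proof -
      have "norm ((cmod (v (\<psi> a x) - v x))\<^sup>2) \<le> (2 * nrm v)\<^sup>2" if "a \<in> \<alpha>" for a
        using power_mono[OF b[OF that], of 2] by simp
      then show ?thesis
        using R_int[OF x, of "\<lambda>_. (2 * nrm v)\<^sup>2" "\<lambda>z. (cmod (v z - v x))\<^sup>2"] by (simp del: power_mult_distrib)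
    qed
    ultimately have "AE a in m. G a x * (cmod (v (\<psi> a x) - v x))\<^sup>2 = 0"
      by (subst integral_nonneg_eq_0_iff_AE[symmetric]) (auto intro!: AE_m_I mult_nonneg_nonneg G_nonneg)
    from AE_m_D[OF this a] show ?thesis using G_pos[OF a x] by simp
  qed
  obtain a where a: "a \<in> \<alpha>" using alpha_ne by blast
  have "(\<psi> a ^^ n) x \<in> \<Omega> \<and> v ((\<psi> a ^^ n) x) = v x" if "x \<in> \<Omega>" for n x
    by (induction n) (use that inv[OF a] psi_Om[OF a] in auto)
  note it = this
  have dn: "d ((\<psi> a ^^ n) y) ((\<psi> a ^^ n) y') \<le> \<theta> ^ n" for n
  proof (induction n)
    case (Suc n)
    then show ?case using d_psi[OF a, of "(\<psi> a ^^ n) y" "(\<psi> a ^^ n) y'"] it y theta by simp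
  qed (simp add: d_range)
  have "cmod (v y - v y') \<le> nrm v * \<theta> ^ n" for n
  proof -
    have "cmod (v y - v y') = cmod (v ((\<psi> a ^^ n) y) - v ((\<psi> a ^^ n) y'))" using it y by simp
    also have "\<dots> \<le> nrm v * d ((\<psi> a ^^ n) y) ((\<psi> a ^^ n) y')" using it y by (intro nrm_lip v) auto
    also have "\<dots> \<le> nrm v * \<theta> ^ n" using dn nrm_nonneg[OF v] by (rule mult_left_mono)
    finally show ?thesis .
  qed
  moreover have "(\<lambda>n. nrm v * \<theta> ^ n) \<longlonglongrightarrow> nrm v * 0" using theta by (intro tendsto_intros LIMSEQ_power_zero) auto
  ultimately have "cmod (v y - v y') \<le> nrm v * 0" by (intro LIMSEQ_le_const) auto
  then show ?thesis by simp
qed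

end

section \<open>Finite codings and the spectral gap\<close>

context full_branch
begin

text \<open>The point with the first n symbols of x followed by the itinerary of \<open>y0\<close>.
  It lies in \<open>\<Omega>\<close> for every x and takes countably many values, which makes
  diagonal sequences possible.\<close>

primrec prj :: "nat \<Rightarrow> 'a \<Rightarrow> 'a" where
  "prj 0 x = y0"
| "prj (Suc n) x = \<psi> (cell x) (prj n (F x))"

lemma prj_Om: "prj n x \<in> \<Omega>"
  by (induction n arbitrary: x) (auto simp: y0 psi_Om cell_in)

lemma prj_psi: "a \<in> \<alpha> \<Longrightarrow> y \<in> \<Omega> \<Longrightarrow> prj (Suc n) (\<psi> a y) = \<psi> a (prj n y)"
  by (simp add: cell_psi F_psi)

lemma prj_d: "x \<in> \<Omega> \<Longrightarrow> d x (prj n x) \<le> \<theta> ^ n"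
proof (induction n arbitrary: x)
  case (Suc n)
  have "d x (prj (Suc n) x) = d (\<psi> (cell x) (F x)) (\<psi> (cell x) (prj n (F x)))"
    using psi_cell_F[OF Suc.prems] by simp
  also have "\<dots> = \<theta> * d (F x) (prj n (F x))" by (intro d_psi cell_in F_Om Suc.prems prj_Om)
  also have "\<dots> \<le> \<theta> * \<theta> ^ n" using Suc.IH[OF F_Om[OF Suc.prems]] theta by simp
  finally show ?case by simp
qed (simp add: d_range)

lemma countable_prj: "countable (range (prj n))"
proof (induction n)
  case 0
  have "range (prj 0) \<subseteq> {y0}" by auto
  then show ?case by (rule countable_subset) simp
next
  case (Suc n)
  have "range (prj (Suc n)) \<subseteq> (\<Union>a\<in>\<alpha>. \<psi> a ` range (prj n))" using cell_in by auto
  then show ?case by (rule countable_subset) (use Suc alpha_countable in auto)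
qed

text \<open>Dependence on the first n symbols only, phrased through the inverse branches so that
  inductions can strip one symbol at a time.\<close>

primrec clev :: "nat \<Rightarrow> ('a \<Rightarrow> real) \<Rightarrow> bool" where
  "clev 0 f \<longleftrightarrow> (\<forall>x\<in>\<Omega>. \<forall>y\<in>\<Omega>. f x = f y)"
| "clev (Suc n) f \<longleftrightarrow> (\<forall>a\<in>\<alpha>. clev n (\<lambda>y. f (\<psi> a y)))"

lemma clev_cong: "(\<And>x. x \<in> \<Omega> \<Longrightarrow> f x = g x) \<Longrightarrow> clev n f = clev n g"
proof (induction n arbitrary: f g)
  case (Suc n)
  have "clev n (\<lambda>y. f (\<psi> a y)) = clev n (\<lambda>y. g (\<psi> a y))" if "a \<in> \<alpha>" for a
    by (rule Suc.IH) (use Suc.prems psi_Om that in auto)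
  then show ?case by simp
qed auto

lemma clev_prj: "clev n (\<lambda>x. f (prj n x))"
proof (induction n arbitrary: f)
  case (Suc n)
  have "clev n (\<lambda>y. f (prj (Suc n) (\<psi> a y)))" if a: "a \<in> \<alpha>" for a
    using Suc[of "\<lambda>x. f (\<psi> a x)"] clev_cong[of "\<lambda>y. f (prj (Suc n) (\<psi> a y))" "\<lambda>y. f (\<psi> a (prj n y))" n]
      prj_psi[OF a] by simp
  then show ?case by simp
qed simp

lemma clev_integral: "(\<And>a. a \<in> \<alpha> \<Longrightarrow> clev n (f a)) \<Longrightarrow> clev n (\<lambda>y. \<integral>a. f a y \<partial>m)"
proof (induction n arbitrary: f)
  case 0
  then have e: "f a x = f a y" if "a \<in> \<alpha>" "x \<in> \<Omega>" "y \<in> \<Omega>" for a x y using that unfolding clev.simps by blast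
  show ?case unfolding clev.simps
    by (intro ballI Bochner_Integration.integral_cong refl, rule e) simp_all
next
  case (Suc n)
  show ?case unfolding clev.simps
  proof
    fix b assume b: "b \<in> \<alpha>"
    show "clev n (\<lambda>y. \<integral>a. f a (\<psi> b y) \<partial>m)"
      using Suc.prems b by (intro Suc.IH[of "\<lambda>a y. f a (\<psi> b y)"]) simp
  qed
qed

lemma clev_cmult: "clev n f \<Longrightarrow> clev n (\<lambda>y. c * f y)"
proof (induction n arbitrary: f)
  case 0
  show ?case unfolding clev.simps
  proof (intro ballI)
    fix x y assume "x \<in> \<Omega>" "y \<in> \<Omega>"
    with 0 have "f x = f y" unfolding clev.simps by blast
    then show "c * f x = c * f y" by simp
  qed
qed simp

lemma R_nonneg:
  fixes u :: "'a \<Rightarrow> real"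
  assumes "y \<in> \<Omega>" "\<And>x. x \<in> \<Omega> \<Longrightarrow> 0 \<le> u x" shows "0 \<le> R u y"
  unfolding R_def using assms psi_Om G_nonneg by (intro integral_nonneg_AE AE_m_I) auto

text \<open>Pointwise convergence to 0 of functions that depend on finitely many symbols becomes uniform
  after applying R sufficiently often, as the kernel of R is dominated by the measure m.\<close>

lemma R_uniform:
  fixes r :: "nat \<Rightarrow> 'a \<Rightarrow> real"
  assumes "\<And>k. clev n (r k)" "\<And>k x. x \<in> \<Omega> \<Longrightarrow> 0 \<le> r k x" "\<And>k x. x \<in> \<Omega> \<Longrightarrow> r k x \<le> B"
    and "\<And>x. x \<in> \<Omega> \<Longrightarrow> (\<lambda>k. r k x) \<longlonglongrightarrow> 0"
  shows "\<exists>s. s \<longlonglongrightarrow> 0 \<and> (\<forall>k. \<forall>y\<in>\<Omega>. (R ^^ n) (r k) y \<le> s k)"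
  using assms
proof (induction n arbitrary: r B)
  case 0
  have "r k y = r k y0" if "y \<in> \<Omega>" for k y using 0(1)[of k] that y0 unfolding clev.simps by blast
  then have "r k y \<le> r k y0" if "y \<in> \<Omega>" for k y using that by (metis order_refl)
  then show ?case using 0(4)[OF y0] by (auto intro!: exI[of _ "\<lambda>k. r k y0"])
next
  case (Suc n)
  define r' where "r' k y = C\<^sub>1 * (\<integral>a. r k (\<psi> a y) \<partial>m)" for k y
  have B: "0 \<le> B" using Suc.prems(2,3)[OF y0] order_trans by blast
  have nrm_r: "norm (r k (\<psi> a y)) \<le> B" if "a \<in> \<alpha>" "y \<in> \<Omega>" for k a y
    using Suc.prems(2,3)[OF psi_Om[OF that]] by simp
  have ri: "integrable m (\<lambda>a. r k (\<psi> a y))" if "y \<in> \<Omega>" for k y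
    by (rule m.integrable_const_bound[of _ B]) (use nrm_r that in \<open>auto intro!: AE_m_I\<close>)
  have r1: "clev n (r' k)" for k
    unfolding r'_def using Suc.prems(1)[of k] by (intro clev_cmult clev_integral) simp
  have r2: "0 \<le> r' k y" if "y \<in> \<Omega>" for k y
    unfolding r'_def using C1 Suc.prems(2)[OF psi_Om[OF _ that]]
    by (intro mult_nonneg_nonneg integral_nonneg_AE AE_m_I) auto
  have r3: "r' k y \<le> C\<^sub>1 * B" if "y \<in> \<Omega>" for k y
  proof -
    have "(\<integral>a. r k (\<psi> a y) \<partial>m) \<le> (\<integral>a. B \<partial>m)"
      by (rule integral_mono[OF ri[OF that]]) (use Suc.prems(3)[OF psi_Om[OF _ that]] in auto)
    then show ?thesis unfolding r'_def using C1 by (intro mult_left_mono) auto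
  qed
  have r4: "(\<lambda>k. r' k y) \<longlonglongrightarrow> 0" if y: "y \<in> \<Omega>" for y
  proof -
    have "(\<lambda>k. \<integral>a. r k (\<psi> a y) \<partial>m) \<longlonglongrightarrow> (\<integral>a. 0 \<partial>m)"
      by (rule integral_dominated_convergence[where w = "\<lambda>_. B"])
        (use Suc.prems(4)[OF psi_Om[OF _ y]] nrm_r[OF _ y] in \<open>auto intro!: AE_m_I\<close>)
    then show ?thesis unfolding r'_def by (intro tendsto_mult_right_zero) simp
  qed
  obtain s where s: "s \<longlonglongrightarrow> 0" "\<And>k y. y \<in> \<Omega> \<Longrightarrow> (R ^^ n) (r' k) y \<le> s k"
    using Suc.IH[of r', OF r1 r2 r3 r4] by blast
  have le1: "R (r k) y \<le> r' k y" and ge1: "0 \<le> R (r k) y" if y: "y \<in> \<Omega>" for k y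
  proof -
    have ri': "integrable m (\<lambda>a. G a y *\<^sub>R r k (\<psi> a y))"
      by (rule R_int[OF y, of "\<lambda>_. B"]) (use nrm_r[OF _ y] in auto)
    have "R (r k) y \<le> (\<integral>a. C\<^sub>1 * r k (\<psi> a y) \<partial>m)"
      unfolding R_def using G_le[OF _ y] Suc.prems(2)[OF psi_Om[OF _ y]] ri[OF y]
      by (intro integral_mono ri') (auto intro: mult_right_mono)
    then show "R (r k) y \<le> r' k y" by (simp add: r'_def)
    show "0 \<le> R (r k) y"
      unfolding R_def using Suc.prems(2)[OF psi_Om[OF _ y]] G_nonneg
      by (intro integral_nonneg_AE AE_m_I) auto
  qed
  have mono: "0 \<le> (R ^^ j) (R (r k)) y \<and> (R ^^ j) (R (r k)) y \<le> (R ^^ j) (r' k) y \<and> (R ^^ j) (r' k) y \<le> C\<^sub>1 * B"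
    if "y \<in> \<Omega>" for j k y
    using that
  proof (induction j arbitrary: y)
    case 0
    then show ?case using le1 ge1 r3 by simp
  next
    case (Suc j)
    have h: "(R ^^ j) (r' k) (\<psi> a y) \<le> C\<^sub>1 * B" if "a \<in> \<alpha>" for a using Suc.IH[OF psi_Om[OF that Suc.prems]] by simp
    have 1: "R ((R ^^ j) (R (r k))) y \<le> R ((R ^^ j) (r' k)) y"
      by (rule R_mono[OF Suc.prems, of _ _ "\<lambda>_. C\<^sub>1 * B"]) (use Suc.IH h in auto)
    have 2: "norm (R ((R ^^ j) (r' k)) y) \<le> C\<^sub>1 * B"
      by (rule R_sup[OF Suc.prems]) (use Suc.IH in fastforce)
    have 3: "0 \<le> R ((R ^^ j) (R (r k))) y"
      by (rule R_nonneg[OF Suc.prems]) (use Suc.IH in auto)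
    show ?case using 1 2 3 by simp
  qed
  have "(R ^^ Suc n) (r k) y \<le> s k" if "y \<in> \<Omega>" for k y
    using mono[OF that, of n k] s(2)[OF that, of k] by (simp add: funpow_swap1)
  then show ?case using s(1) by blast
qed

lemma R_diff_V: "u \<in> V \<Longrightarrow> v \<in> V \<Longrightarrow> y \<in> \<Omega> \<Longrightarrow> R (u - v) y = R u y - R v y"
  unfolding fun_diff_def
  by (rule R_add(2)[of y "\<lambda>_. nrm u" u "\<lambda>_. nrm v" v]) (auto intro: nrm_pt psi_Om)

text \<open>The contradiction behind the spectral gap. The pointwise limit is a fixed point of
  \<open>R\<close>, hence constant on \<open>\<Omega>\<close>, and it is 0 because the means tend to
  0. The convergence is then made uniform, and one application of the Lasota-Yorke inequality pushes
  the Lipschitz constant below 1 as well.\<close>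

lemma bounded_below_seq:
  fixes u :: "nat \<Rightarrow> 'a \<Rightarrow> complex"
  assumes u: "\<And>k. u k \<in> V" "\<And>k. nrm (u k) \<le> 1" "\<And>k. e k \<ge> nrm (u k - R (u k))"
    and e: "e \<longlonglongrightarrow> 0" and mean: "(\<lambda>k. \<integral>x. u k x \<partial>\<mu>) \<longlonglongrightarrow> 0"
    and pt: "\<And>x. x \<in> \<Omega> \<Longrightarrow> convergent (\<lambda>k. u k x)"
  shows "\<exists>k. nrm (u k) < 1"
proof -
  have e0: "0 \<le> e k" for k using u(3)[of k] nrm_nonneg[OF V_diff[OF u(1) R_V(1)[OF u(1)]]] order_trans by blast
  have upt: "cmod (u k x) \<le> 1" if "x \<in> \<Omega>" for k x using nrm_pt[OF u(1) that, of k] u(2)[of k] by linarith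
  have ulip: "cmod (u k x - u k y) \<le> 1 * d x y" if "x \<in> \<Omega>" "y \<in> \<Omega>" for k x y
    using nrm_lip[OF u(1) that, of k] mult_right_mono[OF u(2)[of k] d_nonneg[of x y]] by linarith
  have eR: "cmod (u k x - R (u k) x) \<le> e k" if "x \<in> \<Omega>" for k x
    using nrm_pt[OF V_diff[OF u(1) R_V(1)[OF u(1)]] that, of k k] u(3)[of k] by simp
  define v where "v x = lim (\<lambda>k. u k x)" for x
  have vlim: "(\<lambda>k. u k x) \<longlonglongrightarrow> v x" if "x \<in> \<Omega>" for x
    unfolding v_def using pt[OF that] by (simp add: convergent_LIMSEQ_iff)
  have vm: "v \<in> borel_measurable \<mu>"
    unfolding v_def[abs_def] by (rule borel_measurable_lim_metric) (rule V_meas[OF u(1)])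
  have nbv: "nb 1 v" unfolding nb_def
  proof (intro conjI ballI)
    fix x assume x: "x \<in> \<Omega>"
    show "cmod (v x) \<le> 1" by (rule LIMSEQ_le_const2[OF tendsto_norm[OF vlim[OF x]]]) (use upt x in auto)
    fix y assume y: "y \<in> \<Omega>"
    show "cmod (v x - v y) \<le> 1 * d x y"
      by (rule LIMSEQ_le_const2[OF tendsto_norm[OF tendsto_diff[OF vlim[OF x] vlim[OF y]]]]) (use ulip x y in auto)
  qed
  have vV: "v \<in> V" unfolding V_iff using vm nbv by blast
  have fixed: "R v y = v y" if y: "y \<in> \<Omega>" for y
  proof -
    have "(\<lambda>k. R (u k) y) \<longlonglongrightarrow> R v y"
      unfolding R_def
    proof (rule integral_dominated_convergence[where w = "\<lambda>_. C\<^sub>1"])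
      show "AE a in m. (\<lambda>k. G a y *\<^sub>R u k (\<psi> a y)) \<longlonglongrightarrow> G a y *\<^sub>R v (\<psi> a y)"
        by (intro AE_m_I tendsto_scaleR tendsto_const vlim psi_Om y)
      show "AE a in m. norm (G a y *\<^sub>R u k (\<psi> a y)) \<le> C\<^sub>1" for k
      proof (rule AE_m_I)
        fix a assume a: "a \<in> \<alpha>"
        have "G a y * cmod (u k (\<psi> a y)) \<le> C\<^sub>1 * 1"
          using C1 by (intro mult_mono G_le[OF a y] upt psi_Om a y) auto
        then show "norm (G a y *\<^sub>R u k (\<psi> a y)) \<le> C\<^sub>1" using G_nonneg[OF a] by simp
      qed
    qed auto
    moreover have "(\<lambda>k. u k y - R (u k) y) \<longlonglongrightarrow> 0"
      by (rule Lim_null_comparison[OF _ e]) (use eR[OF y] in auto)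
    ultimately have "(\<lambda>k. u k y) \<longlonglongrightarrow> R v y" using tendsto_add by fastforce
    then show ?thesis using vlim[OF y] LIMSEQ_unique by blast
  qed
  have cst: "v x = v y0" if "x \<in> \<Omega>" for x by (rule R_fixed_const[OF vV fixed that y0])
  have "(\<lambda>k. \<integral>x. u k x \<partial>\<mu>) \<longlonglongrightarrow> (\<integral>x. v x \<partial>\<mu>)"
  proof (rule integral_dominated_convergence[where w = "\<lambda>_. 1"])
    show "AE x in \<mu>. (\<lambda>k. u k x) \<longlonglongrightarrow> v x" using Om_AE by eventually_elim (rule vlim)
    show "AE x in \<mu>. norm (u k x) \<le> 1" for k using Om_AE by eventually_elim (rule upt)
  qed (use vm V_meas u in auto)
  then have "(\<integral>x. v x \<partial>\<mu>) = 0" using mean LIMSEQ_unique by blast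
  moreover have "(\<integral>x. v x \<partial>\<mu>) = (\<integral>x. v y0 \<partial>\<mu>)"
    by (rule integral_cong_AE) (use vm Om_AE cst in auto)
  ultimately have "v y0 = 0" by (simp add: prob_space)
  then have lim0: "(\<lambda>k. u k x) \<longlonglongrightarrow> 0" if "x \<in> \<Omega>" for x using vlim[OF that] cst[OF that] by simp
  \<comment> \<open>Up to \<theta>^n the function u_k depends on n symbols; R^n makes that part
    uniformly small, and u_k differs from R^n u_k by at most n e_k, which tends to 0 for fixed
    n.\<close>
  have sup0: "\<exists>K. \<forall>k\<ge>K. \<forall>x\<in>\<Omega>. cmod (u k x) \<le> \<delta>" if \<delta>: "\<delta> > 0" for \<delta>
  proof -
    have "(\<lambda>n. \<theta> ^ n) \<longlonglongrightarrow> 0" using theta by (intro LIMSEQ_power_zero) auto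
    then have "\<forall>\<^sub>F n in sequentially. \<theta> ^ n < \<delta> / 3" using \<delta> by (intro order_tendstoD(2)) auto
    then obtain n where n: "\<theta> ^ n < \<delta> / 3" by (auto simp: eventually_sequentially)
    define r where "r k x = cmod (u k (prj n x))" for k x
    obtain s where s: "s \<longlonglongrightarrow> 0" "\<And>k y. y \<in> \<Omega> \<Longrightarrow> (R ^^ n) (r k) y \<le> s k"
    proof -
      have "\<exists>s. s \<longlonglongrightarrow> 0 \<and> (\<forall>k. \<forall>y\<in>\<Omega>. (R ^^ n) (r k) y \<le> s k)"
      proof (rule R_uniform[where B = 1])
        show "clev n (r k)" for k unfolding r_def by (rule clev_prj)
        show "(\<lambda>k. r k x) \<longlonglongrightarrow> 0" for x unfolding r_def by (rule tendsto_norm_zero[OF lim0[OF prj_Om]])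
      qed (auto simp: r_def upt prj_Om)
      then show thesis using that by blast
    qed
    have step: "cmod ((R ^^ j) (u k) y) \<le> (R ^^ j) (r k) y + \<theta> ^ n \<and> 0 \<le> (R ^^ j) (r k) y \<and> (R ^^ j) (r k) y \<le> 1
        \<and> cmod (u k y - (R ^^ j) (u k) y) \<le> real j * e k \<and> cmod ((R ^^ j) (u k) y) \<le> 1"
      if "y \<in> \<Omega>" for j k y
      using that
    proof (induction j arbitrary: y)
      case 0
      have "cmod (u k y - u k (prj n y)) \<le> 1 * \<theta> ^ n"
        using ulip[OF 0 prj_Om, of k n y] prj_d[OF 0, of n] by linarith
      then show ?case using norm_triangle_ineq2[of "u k y" "u k (prj n y)"] upt[OF prj_Om] upt[OF 0]
        by (auto simp: r_def)
    next
      case (Suc j)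
      let ?U = "(R ^^ j) (u k)" and ?r = "(R ^^ j) (r k)"
      have "cmod (R ?U y) \<le> R (\<lambda>x. cmod (?U x)) y" by (rule R_norm_le)
      also have "\<dots> \<le> R (\<lambda>x. ?r x + \<theta> ^ n) y"
        by (rule R_mono[OF Suc.prems, of _ _ "\<lambda>_. 1 + \<theta> ^ n"]) (use Suc.IH psi_Om Suc.prems in auto)
      also have "\<dots> = R ?r y + R (\<lambda>x. \<theta> ^ n) y"
        by (rule R_add(1)[OF Suc.prems, of "\<lambda>_. 1" _ "\<lambda>_. \<theta> ^ n"]) (use Suc.IH psi_Om Suc.prems theta in auto)
      also have "R (\<lambda>x. \<theta> ^ n) y = \<theta> ^ n" using R_one(2)[OF Suc.prems] by (simp add: R_def)
      finally have 1: "cmod (R ?U y) \<le> R ?r y + \<theta> ^ n" .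
      have 2: "norm (R ?r y) \<le> 1" by (rule R_sup[OF Suc.prems]) (use Suc.IH in auto)
      have 3: "0 \<le> R ?r y" by (rule R_nonneg[OF Suc.prems]) (use Suc.IH in auto)
      have 4: "norm (R ?U y) \<le> 1" by (rule R_sup[OF Suc.prems]) (use Suc.IH in auto)
      have "R (u k) y - R ?U y = R (\<lambda>x. u k x - ?U x) y"
        by (rule R_add(2)[OF Suc.prems, of "\<lambda>_. 1" _ "\<lambda>_. 1", symmetric]) (use Suc.IH psi_Om Suc.prems upt in auto)
      moreover have "norm (R (\<lambda>x. u k x - ?U x) y) \<le> real j * e k"
        by (rule R_sup[OF Suc.prems]) (use Suc.IH in auto)
      ultimately have "cmod (R (u k) y - R ?U y) \<le> real j * e k" by simp
      then have "cmod (u k y - R ?U y) \<le> real (Suc j) * e k"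
        using eR[OF Suc.prems, of k] norm_triangle_ineq[of "u k y - R (u k) y" "R (u k) y - R ?U y"]
        by (simp add: algebra_simps)
      then show ?case using 1 2 3 4 by simp
    qed
    have "(\<lambda>k. s k + real n * e k) \<longlonglongrightarrow> 0 + real n * 0" by (intro tendsto_intros s e)
    then have "\<forall>\<^sub>F k in sequentially. s k + real n * e k < \<delta> / 3" using \<delta> by (intro order_tendstoD(2)) auto
    then obtain K where K: "\<And>k. k \<ge> K \<Longrightarrow> s k + real n * e k < \<delta> / 3" by (auto simp: eventually_sequentially)
    have "cmod (u k x) \<le> \<delta>" if k: "k \<ge> K" and x: "x \<in> \<Omega>" for k x
      using step[OF x, of n k] s(2)[OF x, of k] K[OF k] n \<delta>
        norm_triangle_ineq2[of "u k x" "(R ^^ n) (u k) x"] by simp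
    then show ?thesis by blast
  qed
  \<comment> \<open>Chosen so that \<open>\<theta> + C\<^sub>1 * \<delta> + e k\<close> falls below
    1 for large k: each of the last two terms takes less than a third of 1 - \<theta>.\<close>
  define \<delta> where "\<delta> = (1 - \<theta>) / (4 * (C\<^sub>1 + 1))"
  have \<delta>: "\<delta> > 0" "C\<^sub>1 * \<delta> < (1 - \<theta>) / 3" "\<delta> < 1"
  proof -
    show 0: "\<delta> > 0" using theta C1 by (simp add: \<delta>_def)
    have s1: "C\<^sub>1 * \<delta> + \<delta> = (1 - \<theta>) / 4"
      unfolding \<delta>_def using C1 by (simp add: divide_simps) (simp add: algebra_simps)
    have s2: "C\<^sub>1 * \<delta> > 0" using 0 C1 by simp
    show "C\<^sub>1 * \<delta> < (1 - \<theta>) / 3" using 0 s1 s2 theta by linarith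
    have "1 - \<theta> < 1 * (4 * (C\<^sub>1 + 1))" using theta C1 by simp
    then show "\<delta> < 1" unfolding \<delta>_def using C1 by (subst pos_divide_less_eq) auto
  qed
  obtain K where K: "\<And>k x. k \<ge> K \<Longrightarrow> x \<in> \<Omega> \<Longrightarrow> cmod (u k x) \<le> \<delta>" using sup0[OF \<delta>(1)] by blast
  have "\<forall>\<^sub>F k in sequentially. e k < (1 - \<theta>) / 3" using e theta by (intro order_tendstoD(2)) auto
  then obtain K' where K': "\<And>k. k \<ge> K' \<Longrightarrow> e k < (1 - \<theta>) / 3" by (auto simp: eventually_sequentially)
  define k where "k = max K K'"
  have kK: "k \<ge> K" "k \<ge> K'" by (auto simp: k_def)
  have "nb (max \<delta> (\<theta> + C\<^sub>1 * \<delta> + e k)) (u k)"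
    unfolding nb_def
  proof (intro conjI ballI)
    fix x assume x: "x \<in> \<Omega>"
    show "cmod (u k x) \<le> max \<delta> (\<theta> + C\<^sub>1 * \<delta> + e k)" using K[OF kK(1) x] by simp
    fix y assume y: "y \<in> \<Omega>"
    let ?w = "u k - R (u k)"
    have w: "?w \<in> V" by (intro V_diff R_V u)
    have "cmod (?w x - ?w y) \<le> nrm ?w * d x y" by (rule nrm_lip[OF w x y])
    also have "\<dots> \<le> e k * d x y" using u(3) d_nonneg by (rule mult_right_mono)
    finally have 1: "cmod (?w x - ?w y) \<le> e k * d x y" .
    have 2: "cmod (R (u k) x - R (u k) y) \<le> (\<theta> * 1 + C\<^sub>1 * \<delta>) * d x y"
      by (rule lasota_yorke[OF K[OF kK(1)] ulip x y])
    have "cmod ((?w x - ?w y) + (R (u k) x - R (u k) y)) \<le> e k * d x y + (\<theta> * 1 + C\<^sub>1 * \<delta>) * d x y"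
      by (rule norm_triangle_le[OF add_mono[OF 1 2]])
    moreover have "(?w x - ?w y) + (R (u k) x - R (u k) y) = u k x - u k y" by simp
    ultimately have "cmod (u k x - u k y) \<le> e k * d x y + (\<theta> * 1 + C\<^sub>1 * \<delta>) * d x y" by (simp only:)
    also have "\<dots> = (\<theta> + C\<^sub>1 * \<delta> + e k) * d x y" by (simp add: algebra_simps)
    also have "\<dots> \<le> max \<delta> (\<theta> + C\<^sub>1 * \<delta> + e k) * d x y" using d_nonneg by (intro mult_right_mono) auto
    finally show "cmod (u k x - u k y) \<le> max \<delta> (\<theta> + C\<^sub>1 * \<delta> + e k) * d x y" .
  qed
  from nrm_le[OF this] have "nrm (u k) < 1" using \<delta> K'[OF kK(2)] theta by (auto simp: max_def split: if_splits)
  then show ?thesis by blast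
qed

text \<open>This is the spectral gap of R at the eigenvalue 1.\<close>

lemma bounded_below:
  obtains K where "K > 0" "\<And>v. v \<in> V \<Longrightarrow> nrm v \<le> K * (nrm (v - R v) + cmod (\<integral>x. v x \<partial>\<mu>))"
proof -
  have "\<exists>K>0. \<forall>v\<in>V. nrm v \<le> K * (nrm (v - R v) + cmod (\<integral>x. v x \<partial>\<mu>))"
  proof (rule ccontr)
    assume neg: "\<not> ?thesis"
    have "\<exists>v\<in>V. nrm v > real (Suc k) * (nrm (v - R v) + cmod (\<integral>x. v x \<partial>\<mu>))" for k
      using neg by (metis of_nat_0_less_iff zero_less_Suc not_le)
    then obtain v where v: "\<And>k. v k \<in> V" "\<And>k. nrm (v k) > real (Suc k) * (nrm (v k - R (v k)) + cmod (\<integral>x. v k x \<partial>\<mu>))"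
      by metis
    have vR: "v k - R (v k) \<in> V" for k by (intro V_diff R_V v)
    have pos: "nrm (v k) > 0" for k
      using v(2)[of k] nrm_nonneg[OF vR] by (smt (verit) mult_nonneg_nonneg norm_ge_zero of_nat_0_le_iff)
    define u where "u k = (\<lambda>x. complex_of_real (1 / nrm (v k)) * v k x)" for k
    have uV: "u k \<in> V" for k unfolding u_def by (intro V_cmult v)
    have ule: "nrm (u k) \<le> 1" for k
      using nrm_cmult[OF v(1), of "complex_of_real (1 / nrm (v k))" k] pos[of k] by (simp add: u_def norm_of_real norm_divide)
    have uge: "nrm (u k) \<ge> 1" for k
    proof -
      have "v k = (\<lambda>x. complex_of_real (nrm (v k)) * u k x)" using pos[of k] by (simp add: u_def)
      then have "nrm (v k) \<le> cmod (complex_of_real (nrm (v k))) * nrm (u k)" using nrm_cmult[OF uV] by metis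
      then show ?thesis using pos[of k] by (simp add: norm_of_real)
    qed
    have sc: "c * (nrm (v k - R (v k)) + cmod (\<integral>x. v k x \<partial>\<mu>)) \<le> 1 / real (Suc k)" if "c = 1 / nrm (v k)" for c k
    proof -
      let ?X = "nrm (v k - R (v k)) + cmod (\<integral>x. v k x \<partial>\<mu>)"
      have "?X \<le> nrm (v k) / real (Suc k)"
        using v(2)[of k] by (subst pos_le_divide_eq) (simp_all only: mult.commute less_imp_le of_nat_0_less_iff zero_less_Suc)
      then have "1 / nrm (v k) * ?X \<le> 1 / nrm (v k) * (nrm (v k) / real (Suc k))"
        using pos[of k] by (intro mult_left_mono) auto
      then show ?thesis using pos[of k] that by simp
    qed
    have ue: "nrm (u k - R (u k)) \<le> 1 / real (Suc k)" and um: "cmod (\<integral>x. u k x \<partial>\<mu>) \<le> 1 / real (Suc k)" for k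
    proof -
      have "u k - R (u k) = (\<lambda>x. complex_of_real (1 / nrm (v k)) * (v k - R (v k)) x)"
      proof
        fix x
        have "R (u k) x = complex_of_real (1 / nrm (v k)) * R (v k) x" unfolding u_def by (rule R_cmult)
        then show "(u k - R (u k)) x = complex_of_real (1 / nrm (v k)) * (v k - R (v k)) x"
          by (simp only: minus_apply right_diff_distrib) (simp only: u_def)
      qed
      then have "nrm (u k - R (u k)) \<le> cmod (complex_of_real (1 / nrm (v k))) * nrm (v k - R (v k))"
        using nrm_cmult[OF vR] by metis
      also have "\<dots> = 1 / nrm (v k) * nrm (v k - R (v k))" using pos[of k] by (simp add: norm_divide norm_of_real)
      finally have 1: "nrm (u k - R (u k)) \<le> 1 / nrm (v k) * nrm (v k - R (v k))" .
      have "(\<integral>x. u k x \<partial>\<mu>) = complex_of_real (1 / nrm (v k)) * (\<integral>x. v k x \<partial>\<mu>)" by (simp add: u_def)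
      then have 2: "cmod (\<integral>x. u k x \<partial>\<mu>) = 1 / nrm (v k) * cmod (\<integral>x. v k x \<partial>\<mu>)"
        using pos[of k] by (simp add: norm_mult norm_divide norm_of_real)
      have p: "0 \<le> 1 / nrm (v k) * nrm (v k - R (v k))" "0 \<le> 1 / nrm (v k) * cmod (\<integral>x. v k x \<partial>\<mu>)"
        using pos[of k] nrm_nonneg[OF vR] by auto
      show "nrm (u k - R (u k)) \<le> 1 / real (Suc k)" "cmod (\<integral>x. u k x \<partial>\<mu>) \<le> 1 / real (Suc k)"
        using sc[OF refl, of k] 1 2 p unfolding distrib_left by linarith+
    qed
    \<comment> \<open>A subsequence converges on this countable set. It is dense for
      \<open>d\<close>, and the u_k have a common Lipschitz bound, so convergence extends to all of
      \<open>\<Omega>\<close>.\<close>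
    let ?S = "\<Union>n. range (prj n)"
    have "countable ?S" using countable_prj by auto
    moreover have "norm (u k x) \<le> 1" if "x \<in> ?S" for k x
      using that nrm_pt[OF uV, of x k] ule[of k] prj_Om by fastforce
    ultimately obtain \<kappa> where \<kappa>: "strict_mono (\<kappa> :: nat \<Rightarrow> nat)" "\<And>x. x \<in> ?S \<Longrightarrow> \<exists>l. (\<lambda>n. u (\<kappa> n) x) \<longlonglongrightarrow> l"
      using function_convergent_subsequence[of ?S u 1] by metis
    have conv: "convergent (\<lambda>k. u (\<kappa> k) x)" if x: "x \<in> \<Omega>" for x
    proof (rule Cauchy_convergent, rule metric_CauchyI)
      fix \<epsilon> :: real assume \<epsilon>: "\<epsilon> > 0"
      have "(\<lambda>n. \<theta> ^ n) \<longlonglongrightarrow> 0" using theta by (intro LIMSEQ_power_zero) auto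
      then have "\<forall>\<^sub>F n in sequentially. \<theta> ^ n < \<epsilon> / 3" using \<epsilon> by (intro order_tendstoD(2)) auto
      then obtain n where n: "\<theta> ^ n < \<epsilon> / 3" by (auto simp: eventually_sequentially)
      let ?p = "prj n x"
      have "Cauchy (\<lambda>k. u (\<kappa> k) ?p)" using \<kappa>(2)[of ?p] LIMSEQ_imp_Cauchy by blast
      then obtain M where M: "\<And>i j. i \<ge> M \<Longrightarrow> j \<ge> M \<Longrightarrow> dist (u (\<kappa> i) ?p) (u (\<kappa> j) ?p) < \<epsilon> / 3"
        using metric_CauchyD[of _ "\<epsilon> / 3"] \<epsilon> by (metis zero_less_divide_iff zero_less_numeral)
      have near: "dist (u i x) (u i ?p) < \<epsilon> / 3" for i
      proof -
        have "cmod (u i x - u i ?p) \<le> nrm (u i) * d x ?p" by (rule nrm_lip[OF uV x prj_Om])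
        also have "\<dots> \<le> 1 * \<theta> ^ n" using ule prj_d[OF x] d_nonneg by (intro mult_mono) auto
        finally show ?thesis using n by (simp add: dist_norm)
      qed
      show "\<exists>M. \<forall>i\<ge>M. \<forall>j\<ge>M. dist (u (\<kappa> i) x) (u (\<kappa> j) x) < \<epsilon>"
      proof (intro exI allI impI)
        fix i j assume "i \<ge> M" "j \<ge> M"
        then show "dist (u (\<kappa> i) x) (u (\<kappa> j) x) < \<epsilon>"
          using M[of i j] near[of "\<kappa> i"] near[of "\<kappa> j"]
            dist_triangle[of "u (\<kappa> i) x" "u (\<kappa> j) x" "u (\<kappa> i) ?p"]
            dist_triangle[of "u (\<kappa> i) ?p" "u (\<kappa> j) x" "u (\<kappa> j) ?p"]
            dist_commute[of "u (\<kappa> j) x" "u (\<kappa> j) ?p"] by linarith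
      qed
    qed
    have sub: "(\<lambda>k. 1 / real (Suc (\<kappa> k))) \<longlonglongrightarrow> 0"
      using LIMSEQ_subseq_LIMSEQ[OF LIMSEQ_inverse_real_of_nat \<kappa>(1)] by (simp add: o_def inverse_eq_divide)
    have "\<exists>k. nrm (u (\<kappa> k)) < 1"
    proof (rule bounded_below_seq[where u = "\<lambda>k. u (\<kappa> k)" and e = "\<lambda>k. 1 / real (Suc (\<kappa> k))", OF uV ule ue sub _ conv])
      show "(\<lambda>k. \<integral>x. u (\<kappa> k) x \<partial>\<mu>) \<longlonglongrightarrow> 0"
        by (rule Lim_null_comparison[OF _ sub]) (use um in auto)
    qed
    then show False using uge by (meson not_le)
  qed
  then show thesis using that by blast
qed

end

section \<open>Polynomially decaying sequences\<close>

lemma powr_mvt: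
  fixes x s :: real assumes x: "x > 0"
  obtains \<xi> where "x < \<xi>" "\<xi> < x + 1" "(x + 1) powr s - x powr s = s * \<xi> powr (s - 1)"
proof -
  have "\<exists>\<xi>. x < \<xi> \<and> \<xi> < x + 1 \<and> (x + 1) powr s - x powr s = (x + 1 - x) * (s * \<xi> powr (s - 1))"
    using x by (intro MVT2) (auto intro!: derivative_eq_intros simp: powr_diff)
  then show thesis using that by auto
qed

lemma powr_tail_step:
  fixes x \<beta> :: real assumes "x > 0" "\<beta> > 1"
  shows "(\<beta> - 1) * (x + 1) powr - \<beta> \<le> x powr (1 - \<beta>) - (x + 1) powr (1 - \<beta>)"
proof -
  obtain \<xi> where \<xi>: "x < \<xi>" "\<xi> < x + 1" "(x + 1) powr (1 - \<beta>) - x powr (1 - \<beta>) = (1 - \<beta>) * \<xi> powr (1 - \<beta> - 1)"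
    using powr_mvt[OF assms(1)] by blast
  have "(x + 1) powr - \<beta> \<le> \<xi> powr - \<beta>" using \<xi> assms by (intro powr_mono2') auto
  then have "(\<beta> - 1) * (x + 1) powr - \<beta> \<le> (\<beta> - 1) * \<xi> powr - \<beta>" using assms by (intro mult_left_mono) auto
  then show ?thesis using \<xi>(3) by (simp add: algebra_simps)
qed

lemma powr_sum_step:
  fixes x \<beta> :: real assumes "x > 0" "1 < \<beta>" "\<beta> < 2"
  shows "(2 - \<beta>) * (x + 1) powr (1 - \<beta>) \<le> (x + 1) powr (2 - \<beta>) - x powr (2 - \<beta>)"
proof -
  obtain \<xi> where \<xi>: "x < \<xi>" "\<xi> < x + 1" "(x + 1) powr (2 - \<beta>) - x powr (2 - \<beta>) = (2 - \<beta>) * \<xi> powr (2 - \<beta> - 1)"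
    using powr_mvt[OF assms(1)] by blast
  have "(x + 1) powr (1 - \<beta>) \<le> \<xi> powr (1 - \<beta>)" using \<xi> assms by (intro powr_mono2') auto
  then have "(2 - \<beta>) * (x + 1) powr (1 - \<beta>) \<le> (2 - \<beta>) * \<xi> powr (1 - \<beta>)" using assms by (intro mult_left_mono) auto
  then show ?thesis using \<xi>(3) by simp
qed

locale poly_decay =
  fixes \<beta> :: real assumes beta: "\<beta> > 1"
begin

definition qq :: "nat \<Rightarrow> real" where "qq n = (real n + 1) powr - \<beta>"
definition rr :: "nat \<Rightarrow> real" where "rr n = (real n + 1) powr (1 - \<beta>)"
text \<open>The shift by 2 keeps the rate positive for all n; for \<beta> = 2 the logarithm vanishes
  at 1.\<close>

definition dd :: "nat \<Rightarrow> real" where "dd n = decay_rate \<beta> (n + 2)"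

lemma qq_pos: "qq n > 0" and rr_pos: "rr n > 0" and qq_sum: "summable qq"
proof -
  show "qq n > 0" "rr n > 0" by (simp_all add: qq_def rr_def)
  show "summable qq" using summable_shifted_powr[OF beta] by (simp add: qq_def[abs_def])
qed

lemma qq_half: "n \<le> 2 * i \<Longrightarrow> qq i \<le> 2 powr \<beta> * qq n"
  unfolding qq_def using beta by (intro powr_half_le) auto

lemma qq_antimono: "i \<le> n \<Longrightarrow> qq n \<le> qq i"
  unfolding qq_def using beta by (intro powr_mono2') auto

lemma qq_rr: "real (n + 1) * qq n = rr n"
proof -
  have "rr n = (real n + 1) powr 1 * qq n" unfolding rr_def qq_def by (subst powr_add[symmetric]) simp
  then show ?thesis by simp
qed

lemma dd_pos: "dd n > 0"
  by (auto simp: dd_def decay_rate_def)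

lemma dd_two: "\<beta> = 2 \<Longrightarrow> dd n = (real n + 2) powr - 2 * ln (real n + 2)"
  unfolding dd_def decay_rate_def by (simp add: add.commute)

lemma qq_two: "\<beta> = 2 \<Longrightarrow> qq n = (real n + 1) powr - 2" and rr_two: "\<beta> = 2 \<Longrightarrow> rr n = (real n + 1) powr - 1"
  unfolding qq_def rr_def by simp_all

lemma powr_shift: "(real n + 1) powr - g \<le> 2 powr g * (real n + 2) powr - g" if "g \<ge> 0" for g
proof -
  have "(real n + 1) powr - g \<le> ((real n + 2) / 2) powr - g" using that by (intro powr_mono2') auto
  also have "\<dots> = 2 powr g * (real n + 2) powr - g" by (simp add: powr_divide powr_minus field_simps)
  finally show ?thesis .
qed

lemma dd_powr_half:
  fixes g :: real assumes "g \<ge> 0" "n \<le> 2 * l"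
  shows "(real l + 2) powr - g \<le> 2 powr g * (real n + 2) powr - g"
proof -
  have "(real l + 2) powr - g \<le> ((real n + 2) / 2) powr - g" using assms by (intro powr_mono2') auto
  also have "\<dots> = 2 powr g * (real n + 2) powr - g" by (simp add: powr_divide powr_minus field_simps)
  finally show ?thesis .
qed

lemma dd_half: "\<exists>C>0. \<forall>n l. l \<le> n \<longrightarrow> n \<le> 2 * l \<longrightarrow> dd l \<le> C * dd n"
proof -
  define g where "g = (if \<beta> > 2 then \<beta> else 2 * \<beta> - 2)"
  have g: "g \<ge> 0" using beta by (auto simp: g_def)
  have "dd l \<le> 2 powr g * dd n" if "l \<le> n" "n \<le> 2 * l" for n l
  proof (cases "\<beta> = 2")
    case False
    then have "dd m = (real m + 2) powr - g" for m by (auto simp: dd_def decay_rate_def g_def add.commute)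
    then show ?thesis using dd_powr_half[OF g that(2)] by simp
  next
    case True
    have e: "dd m = (real m + 2) powr - g * ln (real m + 2)" for m
      unfolding dd_two[OF True] using True by (simp add: g_def)
    have "dd l \<le> (2 powr g * (real n + 2) powr - g) * ln (real n + 2)"
      unfolding e using dd_powr_half[OF g that(2)] that(1) by (intro mult_mono) auto
    then show ?thesis by (simp add: e)
  qed
  then show ?thesis by (intro exI[of _ "2 powr g"]) auto
qed

text \<open>The return from the shifted rate to the one of the theorem, and the source of the
  restriction to n \<ge> 2: there n + 2 \<le> 2n \<le> n^2, so the logarithms compare.\<close>

lemma dd_shift:
  assumes n: "n \<ge> 2" shows "dd n \<le> 2 * decay_rate \<beta> n"
proof -
  have 1: "(real n + 2) powr - g \<le> real n powr - g" if "g \<ge> 0" for g using that n by (intro powr_mono2') auto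
  show ?thesis
  proof (cases "\<beta> = 2")
    case True
    have "real n + 2 \<le> 2 * real n" using n by simp
    also have "\<dots> \<le> real n ^ 2" unfolding power2_eq_square using n by (intro mult_right_mono) auto
    finally have "ln (real n + 2) \<le> ln (real n ^ 2)" using n by (subst ln_le_cancel_iff) auto
    also have "\<dots> = 2 * ln (real n)" using n by (simp add: ln_realpow)
    finally have 2: "ln (real n + 2) \<le> 2 * ln (real n)" .
    have "(real n + 2) powr - 2 * ln (real n + 2) \<le> real n powr - 2 * (2 * ln (real n))"
      using 1[of 2] 2 by (intro mult_mono) auto
    moreover have "decay_rate \<beta> n = real n powr - 2 * ln (real n)" using True unfolding decay_rate_def by simp
    ultimately show ?thesis unfolding dd_two[OF True] by simp
  next
    case False
    have "dd n \<le> decay_rate \<beta> n"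
      using False 1[of \<beta>] 1[of "2 * \<beta> - 2"] beta by (auto simp: dd_def decay_rate_def add.commute)
    moreover have "0 \<le> decay_rate \<beta> n" using False by (auto simp: decay_rate_def)
    ultimately show ?thesis by simp
  qed
qed

lemma qq_dd: "\<exists>C>0. \<forall>n. qq n \<le> C * dd n"
proof -
  have P: "qq n \<le> 2 powr \<beta> * (real n + 2) powr - \<beta>" for n unfolding qq_def using beta by (intro powr_shift) simp
  consider "\<beta> > 2" | "\<beta> = 2" | "\<beta> < 2" by linarith
  then show ?thesis
  proof cases
    case 1
    then show ?thesis using P by (intro exI[of _ "2 powr \<beta>"]) (auto simp: dd_def decay_rate_def add.commute)
  next
    case 2
    have "qq n \<le> (4 / ln 2) * dd n" for n
    proof -
      have l: "ln 2 \<le> ln (real n + 2)" by simp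
      have "qq n * ln 2 \<le> 4 * (real n + 2) powr - 2 * ln (real n + 2)"
        using powr_shift[of 2 n] l unfolding qq_two[OF 2] by (intro mult_mono) auto
      then show ?thesis unfolding dd_two[OF 2] by (simp add: field_simps)
    qed
    then show ?thesis by (intro exI[of _ "4 / ln 2"]) auto
  next
    case 3
    have "qq n \<le> 2 powr \<beta> * dd n" for n
    proof -
      have "(real n + 2) powr - \<beta> \<le> (real n + 2) powr - (2 * \<beta> - 2)" using 3 by (intro powr_mono) auto
      from order_trans[OF P mult_left_mono[OF this]] show ?thesis using 3 by (simp add: dd_def decay_rate_def add.commute)
    qed
    then show ?thesis by (intro exI[of _ "2 powr \<beta>"]) auto
  qed
qed

lemma dd_rr: "\<exists>C>0. \<forall>n. dd n \<le> C * rr n"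
proof -
  have 1: "(real n + 2) powr - g \<le> rr n" if "g \<ge> \<beta> - 1" for g n
  proof -
    have "(real n + 2) powr - g \<le> (real n + 2) powr (1 - \<beta>)" using that by (intro powr_mono) auto
    also have "\<dots> \<le> rr n" unfolding rr_def using beta by (intro powr_mono2') auto
    finally show ?thesis .
  qed
  have "dd n \<le> 1 * rr n" for n
  proof (cases "\<beta> = 2")
    case True
    have "ln (real n + 2) \<le> real n + 1" using ln_le_minus_one[of "real n + 2"] by simp
    then have "dd n \<le> (real n + 2) powr - 2 * (real n + 2)"
      unfolding dd_two[OF True] by (intro mult_left_mono) auto
    also have "\<dots> = (real n + 2) powr - 1"
      using powr_add[of "real n + 2" "- 2" 1] by simp
    also have "\<dots> \<le> rr n" using True by (intro 1) simp
    finally show ?thesis by simp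
  next
    case False
    then show ?thesis using 1[of \<beta> n] 1[of "2 * \<beta> - 2" n] beta by (auto simp: dd_def decay_rate_def add.commute)
  qed
  then show ?thesis by (intro exI[of _ 1]) auto
qed

lemma rr_square_dd: "\<exists>C>0. \<forall>n. rr n * rr n \<le> C * dd n"
proof -
  have sq: "rr n * rr n = (real n + 1) powr - (2 * \<beta> - 2)" for n
    unfolding rr_def by (simp add: powr_add[symmetric] algebra_simps)
  have g: "2 * \<beta> - 2 \<ge> 0" using beta by simp
  have s: "rr n * rr n \<le> 2 powr (2 * \<beta> - 2) * (real n + 2) powr - (2 * \<beta> - 2)" for n
    unfolding sq by (rule powr_shift[OF g])
  obtain C where C: "C > 0" "\<And>n. qq n \<le> C * dd n" using qq_dd by blast
  consider "\<beta> > 2" | "\<beta> = 2" | "\<beta> < 2" by linarith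
  then show ?thesis
  proof cases
    case 1
    have "rr n * rr n \<le> qq n" for n unfolding sq qq_def using 1 by (intro powr_mono) auto
    then show ?thesis using C order_trans by blast
  next
    case 2
    have "rr n * rr n = qq n" for n unfolding sq qq_def using 2 by simp
    then show ?thesis using C by auto
  next
    case 3
    then show ?thesis using s by (intro exI[of _ "2 powr (2 * \<beta> - 2)"]) (auto simp: dd_def decay_rate_def add.commute)
  qed
qed

text \<open>The origin of the three cases of d_n: the sum of l^(1-\<beta>) over l \<le> n is bounded
  for \<beta> > 2, logarithmic for \<beta> = 2 and of order n^(2-\<beta>) for \<beta> < 2.\<close>

lemma key_sum: "\<exists>C>0. \<forall>n. qq n * (\<Sum>l\<le>n. rr l) \<le> C * dd n"
proof -
  obtain C where C: "C > 0" "\<And>n. qq n \<le> C * dd n" using qq_dd by blast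
  consider "\<beta> > 2" | "\<beta> = 2" | "\<beta> < 2" by linarith
  then show ?thesis
  proof cases
    case 1
    have s: "summable rr" using summable_shifted_powr[of "\<beta> - 1"] 1 by (simp add: rr_def[abs_def])
    have p: "suminf rr > 0" by (rule suminf_pos[OF s rr_pos])
    have "qq n * (\<Sum>l\<le>n. rr l) \<le> (C * suminf rr) * dd n" for n
    proof -
      have "qq n * (\<Sum>l\<le>n. rr l) \<le> (C * dd n) * suminf rr"
        using C qq_pos rr_pos s dd_pos[of n] by (intro mult_mono sum_le_suminf sum_nonneg) (auto intro: less_imp_le)
      then show ?thesis by (simp add: algebra_simps)
    qed
    then show ?thesis using C p by (intro exI[of _ "C * suminf rr"]) auto
  next
    case 2
    have "qq n * (\<Sum>l\<le>n. rr l) \<le> (4 * (1 / ln 2 + 1)) * dd n" for n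
    proof -
      have "(\<Sum>l\<le>n. rr l) = harm (Suc n)"
      proof -
        have "rr l = inverse (real (Suc l))" for l
          unfolding rr_two[OF 2] using powr_minus[of "real l + 1" 1] by (simp add: add.commute)
        then show ?thesis
          unfolding harm_def One_nat_def sum.atLeast_Suc_atMost_Suc_shift atMost_atLeast0 by (simp add: o_def)
      qed
      also have "\<dots> \<le> ln (real (Suc n)) + 1" using decseqD[OF decseq_harm_diff_ln, of 0 n] by (simp add: harm_def)
      also have "\<dots> \<le> (1 / ln 2 + 1) * ln (real n + 2)"
      proof -
        have "ln (real (Suc n)) \<le> ln (real n + 2)" by simp
        moreover have "1 \<le> ln (real n + 2) / ln 2" by (subst pos_le_divide_eq) auto
        moreover have "(1 / ln 2 + 1) * ln (real n + 2) = ln (real n + 2) / ln 2 + ln (real n + 2)"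
          by (simp add: algebra_simps)
        ultimately show ?thesis by linarith
      qed
      finally have 3: "(\<Sum>l\<le>n. rr l) \<le> (1 / ln 2 + 1) * ln (real n + 2)" .
      have 4: "qq n \<le> 4 * (real n + 2) powr - 2" using powr_shift[of 2 n] unfolding qq_two[OF 2] by simp
      have "qq n * (\<Sum>l\<le>n. rr l) \<le> (4 * (real n + 2) powr - 2) * ((1 / ln 2 + 1) * ln (real n + 2))"
        using rr_pos by (intro mult_mono 3 4 sum_nonneg) (auto intro: less_imp_le)
      then show ?thesis unfolding dd_two[OF 2] by (simp only: mult_ac)
    qed
    moreover have "4 * (1 / ln 2 + 1) > (0::real)" by (intro mult_pos_pos add_pos_pos) auto
    ultimately show ?thesis by (intro exI[of _ "4 * (1 / ln 2 + 1)"]) auto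
  next
    case 3
    have S: "(\<Sum>l\<le>n. rr l) \<le> (real n + 1) powr (2 - \<beta>) / (2 - \<beta>)" for n
    proof (induction n)
      case 0
      then show ?case using 3 beta by (simp add: rr_def field_simps)
    next
      case (Suc n)
      have "rr (Suc n) \<le> ((real n + 1 + 1) powr (2 - \<beta>) - (real n + 1) powr (2 - \<beta>)) / (2 - \<beta>)"
        using powr_sum_step[of "real n + 1" \<beta>] 3 beta by (simp add: rr_def field_simps)
      then show ?case using Suc by (simp add: diff_divide_distrib add_ac)
    qed
    have "qq n * (\<Sum>l\<le>n. rr l) \<le> (2 powr (2 * \<beta> - 2) / (2 - \<beta>)) * dd n" for n
    proof -
      have "qq n * (\<Sum>l\<le>n. rr l) \<le> qq n * ((real n + 1) powr (2 - \<beta>) / (2 - \<beta>))"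
        using S qq_pos by (intro mult_left_mono) (auto intro: less_imp_le)
      also have "\<dots> = (real n + 1) powr - (2 * \<beta> - 2) / (2 - \<beta>)"
        unfolding qq_def by (simp add: powr_add[symmetric] algebra_simps)
      also have "\<dots> \<le> (2 powr (2 * \<beta> - 2) * (real n + 2) powr - (2 * \<beta> - 2)) / (2 - \<beta>)"
        using 3 beta by (intro divide_right_mono powr_shift) auto
      finally show ?thesis using 3 by (simp add: dd_def decay_rate_def add.commute)
    qed
    then show ?thesis using 3 by (intro exI[of _ "2 powr (2 * \<beta> - 2) / (2 - \<beta>)"]) auto
  qed
qed

text \<open>Where the index of \<open>dd\<close> is at least n/2, that factor is pulled out and
  \<open>qq\<close> is summed. Otherwise \<open>qq\<close> is pulled out, and \<open>dd\<close> is
  summed after being bounded by \<open>rr\<close>, which is the situation of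
  \<open>key_sum\<close>.\<close>

lemma conv_qq_dd: "\<exists>C>0. \<forall>n. (\<Sum>i=0..n. qq i * dd (n - i)) \<le> C * dd n"
proof -
  obtain C1 where C1: "C1 > 0" "\<And>n l. l \<le> n \<Longrightarrow> n \<le> 2 * l \<Longrightarrow> dd l \<le> C1 * dd n" using dd_half by blast
  obtain C2 where C2: "C2 > 0" "\<And>n. dd n \<le> C2 * rr n" using dd_rr by blast
  obtain C3 where C3: "C3 > 0" "\<And>n. qq n * (\<Sum>l\<le>n. rr l) \<le> C3 * dd n" using key_sum by blast
  have Q: "suminf qq > 0" by (rule suminf_pos[OF qq_sum qq_pos])
  have "(\<Sum>i=0..n. qq i * dd (n - i)) \<le> (C1 * suminf qq + 2 powr \<beta> * C2 * C3) * dd n" for n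
  proof -
    have "qq i * dd (n - i) \<le> C1 * dd n * qq i + 2 powr \<beta> * C2 * qq n * rr (n - i)" if "i \<le> n" for i
    proof (cases "n \<le> 2 * (n - i)")
      case True
      have "qq i * dd (n - i) \<le> qq i * (C1 * dd n)" using C1(2)[OF _ True] qq_pos[of i] by (intro mult_left_mono) auto
      moreover have "0 \<le> 2 powr \<beta> * C2 * qq n * rr (n - i)" using C2 qq_pos[of n] rr_pos[of "n - i"] by simp
      ultimately show ?thesis by (simp add: mult_ac)
    next
      case False
      then have "n \<le> 2 * i" using that by auto
      then have "qq i * dd (n - i) \<le> (2 powr \<beta> * qq n) * (C2 * rr (n - i))"
        using qq_half C2(2) qq_pos dd_pos by (intro mult_mono) (auto intro: less_imp_le)
      moreover have "0 \<le> C1 * dd n * qq i" using C1 qq_pos[of i] dd_pos[of n] by simp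
      ultimately show ?thesis by (simp add: mult_ac)
    qed
    then have "(\<Sum>i=0..n. qq i * dd (n - i)) \<le> (\<Sum>i=0..n. C1 * dd n * qq i + 2 powr \<beta> * C2 * qq n * rr (n - i))"
      by (intro sum_mono) auto
    also have "\<dots> = C1 * dd n * (\<Sum>i=0..n. qq i) + 2 powr \<beta> * C2 * (qq n * (\<Sum>i=0..n. rr (n - i)))"
      by (simp add: sum.distrib sum_distrib_left mult_ac)
    also have "(\<Sum>i=0..n. rr (n - i)) = (\<Sum>l\<le>n. rr l)"
      using sum.nat_diff_reindex[of rr "Suc n"] by (simp add: atLeast0AtMost lessThan_Suc_atMost)
    also have "C1 * dd n * (\<Sum>i=0..n. qq i) + 2 powr \<beta> * C2 * (qq n * (\<Sum>l\<le>n. rr l))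
      \<le> C1 * dd n * suminf qq + 2 powr \<beta> * C2 * (C3 * dd n)"
      using C1(1) C2(1) C3(2)[of n] dd_pos[of n] qq_pos qq_sum
      by (intro add_mono mult_left_mono sum_le_suminf) (auto intro: less_imp_le)
    finally show ?thesis by (simp add: algebra_simps)
  qed
  moreover have "C1 * suminf qq + 2 powr \<beta> * C2 * C3 > 0" using C1 C2 C3 Q by (intro add_pos_pos mult_pos_pos) auto
  ultimately show ?thesis by blast
qed

text \<open>Here the tail sums, and not just the terms, are O(n^(-\<beta>)). This is one power
  better than what terms of that size would give, and it lets convolution with such a sequence
  preserve the expansion of T_n. Finite upper limits N avoid side conditions on summability.\<close>

definition TL :: "real \<Rightarrow> (nat \<Rightarrow> real) \<Rightarrow> bool" where
  "TL A s \<longleftrightarrow> (\<forall>k. 0 \<le> s k) \<and> (\<forall>n N. (\<Sum>k=n..N. s k) \<le> A * qq n)"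

lemma TL_nonneg: "TL A s \<Longrightarrow> 0 \<le> s k" and TL_tail: "TL A s \<Longrightarrow> (\<Sum>k=n..N. s k) \<le> A * qq n"
  by (auto simp: TL_def)

lemma TL_A: assumes "TL A s" shows "0 \<le> A"
proof -
  have "0 \<le> A * qq 0" using TL_tail[OF assms, of 0 0] TL_nonneg[OF assms, of 0] by simp
  then show ?thesis by (simp add: qq_def)
qed

lemma TL_total: assumes "TL A s" shows "(\<Sum>k=0..N. s k) \<le> A" "summable s" "suminf s \<le> A"
    "(\<Sum>k. s (k + n)) \<le> A * qq n"
proof -
  show 1: "(\<Sum>k=0..N. s k) \<le> A" for N using TL_tail[OF assms, of 0 N] by (simp add: qq_def)
  have 2: "(\<Sum>k<N. s k) \<le> A" for N
    using 1[of "N - 1"] TL_A[OF assms] by (cases N) (auto simp: lessThan_Suc_atMost atLeast0AtMost)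
  show s: "summable s" by (rule summableI_nonneg_bounded[of _ A]) (use TL_nonneg[OF assms] 2 in auto)
  show "suminf s \<le> A" by (rule suminf_le_const[OF s 2])
  show "(\<Sum>k. s (k + n)) \<le> A * qq n"
  proof (rule suminf_le_const)
    show "summable (\<lambda>k. s (k + n))" using s by (simp add: summable_iff_shift)
    fix N
    have "(\<Sum>k<N. s (k + n)) = (\<Sum>k=n..<N + n. s k)"
      using sum.shift_bounds_nat_ivl[of s 0 n N] by (simp add: atLeast0LessThan)
    also have "\<dots> \<le> (\<Sum>k=n..N + n. s k)" using TL_nonneg[OF assms] by (intro sum_mono2) auto
    also have "\<dots> \<le> A * qq n" by (rule TL_tail[OF assms])
    finally show "(\<Sum>k<N. s (k + n)) \<le> A * qq n" .
  qed
qed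

text \<open>If i + j \<ge> n then i or j is at least n/2, so the tail of the convolution is covered
  by two products of a tail with a total.\<close>

lemma TL_conv:
  assumes s: "TL A s" and t: "TL B t"
  shows "TL (2 * 2 powr \<beta> * A * B) (\<lambda>n. \<Sum>i=0..n. s i * t (n - i))"
proof -
  note s0 = TL_nonneg[OF s] and t0 = TL_nonneg[OF t]
  have A: "0 \<le> A" and B: "0 \<le> B" using s t TL_A by auto
  have "(\<Sum>k=n..N. \<Sum>i=0..k. s i * t (k - i)) \<le> 2 * 2 powr \<beta> * A * B * qq n" for n N
  proof -
    let ?h = "(n + 1) div 2"
    have h: "n \<le> 2 * ?h" by simp
    have "(\<Sum>k=n..N. \<Sum>i=0..k. s i * t (k - i)) = (\<Sum>(k, i)\<in>Sigma {n..N} (\<lambda>k. {0..k}). s i * t (k - i))"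
      by (simp add: sum.Sigma)
    also have "\<dots> = (\<Sum>(i, j)\<in>(\<lambda>(k, i). (i, k - i)) ` Sigma {n..N} (\<lambda>k. {0..k}). s i * t j)"
      by (subst sum.reindex) (auto simp: inj_on_def case_prod_unfold)
    also have "\<dots> \<le> (\<Sum>(i, j)\<in>{?h..N} \<times> {0..N} \<union> {0..N} \<times> {?h..N}. s i * t j)"
    proof (rule sum_mono2)
      show "(\<lambda>(k, i). (i, k - i)) ` Sigma {n..N} (\<lambda>k. {0..k}) \<subseteq> {?h..N} \<times> {0..N} \<union> {0..N} \<times> {?h..N}"
      proof
        fix p assume "p \<in> (\<lambda>(k, i). (i, k - i)) ` Sigma {n..N} (\<lambda>k. {0..k})"
        then obtain k i where p: "p = (i, k - i)" "n \<le> k" "k \<le> N" "i \<le> k" by auto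
        then have "?h \<le> i \<or> ?h \<le> k - i" by linarith
        then show "p \<in> {?h..N} \<times> {0..N} \<union> {0..N} \<times> {?h..N}" using p by auto
      qed
    qed (use s0 t0 in auto)
    also have "\<dots> \<le> (\<Sum>(i, j)\<in>{?h..N} \<times> {0..N}. s i * t j) + (\<Sum>(i, j)\<in>{0..N} \<times> {?h..N}. s i * t j)"
      using s0 t0 by (subst sum.union_inter[symmetric]) (auto intro!: sum_nonneg)
    also have "\<dots> = (\<Sum>i=?h..N. s i) * (\<Sum>j=0..N. t j) + (\<Sum>i=0..N. s i) * (\<Sum>j=?h..N. t j)"
      by (simp add: sum.cartesian_product[symmetric] sum_product)
    also have "\<dots> \<le> (A * qq ?h) * B + A * (B * qq ?h)"
      by (intro add_mono mult_mono TL_tail[OF s] TL_tail[OF t] TL_total(1)[OF s] TL_total(1)[OF t] sum_nonneg s0 t0)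
         (use A B qq_pos[of ?h] in auto)
    also have "\<dots> = 2 * A * B * qq ?h" by simp
    also have "\<dots> \<le> 2 * A * B * (2 powr \<beta> * qq n)" using A B qq_half[OF h] by (intro mult_left_mono) auto
    finally show ?thesis by (simp add: mult_ac)
  qed
  then show ?thesis using s0 t0 by (auto simp: TL_def intro!: sum_nonneg)
qed

text \<open>For i below n/2 the rate at n - i is comparable to the rate at n, and s is summed. For
  the remaining i the rate is merely bounded, and the tail of s is of order n^(-\<beta>), hence
  O(d_n).\<close>

lemma TL_dd: "\<exists>C>0. \<forall>A s n. TL A s \<longrightarrow> (\<Sum>i=0..n. s i * dd (n - i)) \<le> C * A * dd n"
proof -
  obtain C1 where C1: "C1 > 0" "\<And>n l. l \<le> n \<Longrightarrow> n \<le> 2 * l \<Longrightarrow> dd l \<le> C1 * dd n" using dd_half by blast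
  obtain C2 where C2: "C2 > 0" "\<And>n. dd n \<le> C2 * rr n" using dd_rr by blast
  obtain C3 where C3: "C3 > 0" "\<And>n. qq n \<le> C3 * dd n" using qq_dd by blast
  have rr1: "rr n \<le> 1" for n
    unfolding rr_def using powr_mono[of "1 - \<beta>" 0 "real n + 1"] beta by simp
  have dC: "dd n \<le> C2" for n
    using order_trans[OF C2(2)[of n] mult_left_mono[OF rr1[of n], of C2]] C2(1) by simp
  have "(\<Sum>i=0..n. s i * dd (n - i)) \<le> (C1 + C2 * 2 powr \<beta> * C3) * A * dd n" if s: "TL A s" for A s n
  proof -
    note s0 = TL_nonneg[OF s] and A = TL_A[OF s]
    let ?h = "(n + 1) div 2"
    have "(\<Sum>i=0..n. s i * dd (n - i)) \<le> (\<Sum>i=0..n. s i * (C1 * dd n)) + (\<Sum>i=?h..n. s i * C2)"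
    proof -
      have "s i * dd (n - i) \<le> s i * (C1 * dd n) + (if ?h \<le> i then s i * C2 else 0)" if "i \<le> n" for i
      proof (cases "?h \<le> i")
        case True
        have "s i * dd (n - i) \<le> s i * C2" using s0 dC by (intro mult_left_mono) auto
        moreover have "0 \<le> s i * (C1 * dd n)" using s0 C1 dd_pos[of n] by simp
        ultimately show ?thesis using True by simp
      next
        case False
        then have "n \<le> 2 * (n - i)" by linarith
        then show ?thesis using False s0 C1(2)[of "n - i" n] by (simp add: mult_left_mono)
      qed
      then have "(\<Sum>i=0..n. s i * dd (n - i)) \<le> (\<Sum>i=0..n. s i * (C1 * dd n) + (if ?h \<le> i then s i * C2 else 0))"
        by (intro sum_mono) auto
      also have "\<dots> = (\<Sum>i=0..n. s i * (C1 * dd n)) + (\<Sum>i\<in>{i \<in> {0..n}. ?h \<le> i}. s i * C2)"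
        unfolding sum.distrib by (subst sum.inter_filter) simp_all
      also have "{i \<in> {0..n}. ?h \<le> i} = {?h..n}" by auto
      finally show ?thesis .
    qed
    also have "\<dots> = (\<Sum>i=0..n. s i) * (C1 * dd n) + (\<Sum>i=?h..n. s i) * C2" by (simp add: sum_distrib_right)
    also have "\<dots> \<le> A * (C1 * dd n) + (A * qq ?h) * C2"
      using TL_total(1)[OF s] TL_tail[OF s] C1 C2 dd_pos[of n] by (intro add_mono mult_right_mono) auto
    also have "\<dots> \<le> A * (C1 * dd n) + (A * (2 powr \<beta> * (C3 * dd n))) * C2"
    proof -
      have "qq ?h \<le> 2 powr \<beta> * qq n" by (rule qq_half) simp
      also have "\<dots> \<le> 2 powr \<beta> * (C3 * dd n)" using C3 by (intro mult_left_mono) auto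
      finally show ?thesis using A C2 by (intro add_left_mono mult_right_mono mult_left_mono) auto
    qed
    finally show ?thesis by (simp add: algebra_simps)
  qed
  moreover have "C1 + C2 * 2 powr \<beta> * C3 > 0" using C1 C2 C3 by (intro add_pos_pos mult_pos_pos) auto
  ultimately show ?thesis by blast
qed

end

section \<open>Sums of the tails of the return time\<close>

locale tail_seq = poly_decay +
  fixes \<tau> :: "nat \<Rightarrow> real" and C\<^sub>\<tau> :: real
  assumes tau_nonneg: "\<And>n. 0 \<le> \<tau> n" and tau_le: "\<And>n. \<tau> n \<le> C\<^sub>\<tau> * qq n"
    and tau_anti: "\<And>i n. i \<le> n \<Longrightarrow> \<tau> n \<le> \<tau> i"
begin

definition t :: "nat \<Rightarrow> real" where "t n = (\<Sum>j. \<tau> (n + 1 + j))"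

lemma Ct: "0 \<le> C\<^sub>\<tau>"
  using tau_nonneg[of 0] tau_le[of 0] by (simp add: qq_def)

lemma tau_sum: "summable \<tau>"
  by (rule summable_comparison_test'[OF summable_mult[OF qq_sum, of C\<^sub>\<tau>], of 0]) (use tau_nonneg tau_le in simp)

lemma tau_sum': "summable (\<lambda>j. \<tau> (n + j))"
  using tau_sum summable_iff_shift[of \<tau> n] by (simp add: add.commute)

lemma t_nonneg: "0 \<le> t n"
  unfolding t_def using tau_sum'[of "n + 1"] tau_nonneg by (intro suminf_nonneg) auto

lemma t_step: "t n = \<tau> (n + 1) + t (Suc n)"
  unfolding t_def using suminf_split_head[OF tau_sum'[of "n + 1"]] by (simp add: add_ac)

lemma t_init: "suminf \<tau> = \<tau> 0 + t 0"
  unfolding t_def using suminf_split_head[OF tau_sum] by simp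

lemma t_diff: "k \<le> n \<Longrightarrow> t (n - k) - t n = (\<Sum>j\<in>{n - k<..n}. \<tau> j)"
proof (induction k)
  case (Suc k)
  have "{n - Suc k<..n} = insert (n - k) {n - k<..n}" using Suc.prems by auto
  moreover have "t (n - Suc k) = \<tau> (n - k) + t (n - k)"
    using t_step[of "n - Suc k"] Suc.prems by (simp add: Suc_diff_Suc)
  ultimately show ?case using Suc by simp
qed simp

lemma t_antimono: "i \<le> n \<Longrightarrow> t n \<le> t i"
  using t_diff[of "n - i" n] sum_nonneg[of "{n - (n - i)<..n}" \<tau>] tau_nonneg by simp

text \<open>The mean value theorem bounds each term by a difference of consecutive values of
  n^(1-\<beta>), and these telescope.\<close>

lemma t_rr: "t n \<le> C\<^sub>\<tau> / (\<beta> - 1) * rr n"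
proof -
  let ?c = "C\<^sub>\<tau> / (\<beta> - 1)"
  have c: "0 \<le> ?c" using Ct beta by simp
  have rr0: "rr \<longlonglongrightarrow> 0"
  proof -
    have "((\<lambda>n. (real n + 1) powr (1 - \<beta>)) \<longlongrightarrow> 0) sequentially" using beta by real_asymp
    then show ?thesis by (simp add: rr_def[abs_def])
  qed
  have sums: "(\<lambda>j. rr (n + j) - rr (Suc (n + j))) sums (rr n - 0)"
    using telescope_sums'[OF LIMSEQ_ignore_initial_segment[OF rr0, of n]] by (simp add: add.commute)
  have "\<tau> (n + 1 + j) \<le> ?c * (rr (n + j) - rr (Suc (n + j)))" for j
  proof -
    have "(\<beta> - 1) * qq (n + 1 + j) \<le> rr (n + j) - rr (Suc (n + j))"
      using powr_tail_step[of "real (n + j) + 1" \<beta>] beta by (simp add: qq_def rr_def add_ac)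
    then have "qq (n + 1 + j) \<le> (rr (n + j) - rr (Suc (n + j))) / (\<beta> - 1)"
      using beta by (simp add: pos_le_divide_eq mult.commute)
    from mult_left_mono[OF this Ct] tau_le[of "n + 1 + j"] show ?thesis by simp
  qed
  then have "t n \<le> (\<Sum>j. ?c * (rr (n + j) - rr (Suc (n + j))))"
    unfolding t_def using tau_sum'[of "n + 1"] sums by (intro suminf_le) (auto intro: sums_summable summable_mult)
  also have "\<dots> = ?c * rr n" using sums_mult[OF sums, of ?c] by (simp add: sums_iff)
  finally show ?thesis .
qed

lemma t_diff_le:
  assumes "2 * k \<le> n" shows "t (n - k) - t n \<le> real k * (2 powr \<beta> * C\<^sub>\<tau> * qq n)"
proof -
  have kn: "k \<le> n" using assms by simp
  have "(\<Sum>j\<in>{n - k<..n}. \<tau> j) \<le> (\<Sum>j\<in>{n - k<..n}. 2 powr \<beta> * C\<^sub>\<tau> * qq n)"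
  proof (rule sum_mono)
    fix j assume "j \<in> {n - k<..n}"
    then have "n \<le> 2 * j" using assms by auto
    from order_trans[OF tau_le mult_left_mono[OF qq_half[OF this] Ct]]
    show "\<tau> j \<le> 2 powr \<beta> * C\<^sub>\<tau> * qq n" by (simp only: mult_ac)
  qed
  then show ?thesis using t_diff[OF kn] kn by simp
qed

text \<open>The n-th coefficient of (1-z) t(z)^2, because (1-z) t(z) has constant term t_0 and
  coefficients - \<tau>_i for i \<ge> 1 (\<open>tFtD_nth\<close>).\<close>

definition S :: "nat \<Rightarrow> real" where
  "S n = t 0 * t n - (\<Sum>i=1..n. \<tau> i * t (n - i))"

text \<open>The cancellation: t_0 - t_n is the sum of the \<tau>_i with 1 \<le> i \<le> n, so the
  terms of order t_n drop out and differences t_(n-i) - t_n remain.\<close>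

lemma S_eq: "S n = t n * t n - (\<Sum>i=1..n. \<tau> i * (t (n - i) - t n))"
proof -
  have "t 0 - t n = (\<Sum>i=1..n. \<tau> i)" using t_diff[of n n] by (simp add: atLeastSucAtMost_greaterThanAtMost)
  then have "(\<Sum>i=1..n. \<tau> i * t n) = (t 0 - t n) * t n" by (simp add: sum_distrib_right)
  then show ?thesis by (simp add: S_def right_diff_distrib sum_subtractf algebra_simps)
qed

text \<open>For i \<le> n/2 the difference is at most of order i n^(-\<beta>), and i \<tau>_i is of
  order i^(1-\<beta>). For i > n/2 the factor \<tau>_i is of order n^(-\<beta>), and the difference
  is bounded by t_(n-i). Both halves lead to \<open>key_sum\<close>; the square of t_n is handled by
  \<open>rr_square_dd\<close>.\<close>

lemma S_bound: "\<exists>C>0. \<forall>n. \<bar>S n\<bar> \<le> C * dd n"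
proof -
  obtain C3 where C3: "C3 > 0" "\<And>n. qq n * (\<Sum>l\<le>n. rr l) \<le> C3 * dd n" using key_sum by blast
  obtain C4 where C4: "C4 > 0" "\<And>n. rr n * rr n \<le> C4 * dd n" using rr_square_dd by blast
  let ?c = "C\<^sub>\<tau> / (\<beta> - 1)" and ?e = "2 powr \<beta> * C\<^sub>\<tau>"
  have c: "0 \<le> ?c" and e: "0 \<le> ?e" using Ct beta by auto
  have "\<bar>S n\<bar> \<le> (?c * ?c * C4 + ?e * C\<^sub>\<tau> * C3 + ?e * ?c * C3 + 1) * dd n" for n
  proof -
    have tt: "t n * t n \<le> ?c * ?c * (C4 * dd n)"
    proof -
      have "t n * t n \<le> (?c * rr n) * (?c * rr n)"
        by (rule mult_mono[OF t_rr t_rr _ t_nonneg]) (rule mult_nonneg_nonneg[OF c less_imp_le[OF rr_pos]])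
      also have "\<dots> = ?c * ?c * (rr n * rr n)" by (simp only: mult_ac)
      also have "\<dots> \<le> ?c * ?c * (C4 * dd n)" using c C4 by (intro mult_left_mono) auto
      finally show ?thesis .
    qed
    have "\<tau> i * (t (n - i) - t n) \<le> ?e * C\<^sub>\<tau> * qq n * rr i + ?e * ?c * qq n * rr (n - i)" if i: "1 \<le> i" "i \<le> n" for i
    proof (cases "2 * i \<le> n")
      case True
      have "\<tau> i * (t (n - i) - t n) \<le> (C\<^sub>\<tau> * qq i) * (real i * (?e * qq n))"
        using t_diff_le[OF True] tau_le[of i] tau_nonneg[of i] t_antimono[of "n - i" n] Ct qq_pos[of i] by (intro mult_mono) auto
      also have "\<dots> = ?e * C\<^sub>\<tau> * qq n * (real i * qq i)" by (simp only: mult_ac)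
      also have "\<dots> \<le> ?e * C\<^sub>\<tau> * qq n * rr i"
        using e Ct qq_pos[of n] qq_pos[of i] qq_rr[of i] by (intro mult_left_mono) (auto simp: algebra_simps)
      finally have 1: "\<tau> i * (t (n - i) - t n) \<le> ?e * C\<^sub>\<tau> * qq n * rr i" .
      have "0 \<le> ?e * ?c * qq n * rr (n - i)"
        by (intro mult_nonneg_nonneg e c less_imp_le[OF qq_pos] less_imp_le[OF rr_pos])
      with 1 show ?thesis by linarith
    next
      case False
      have "n \<le> 2 * i" using False by simp
      from order_trans[OF tau_le mult_left_mono[OF qq_half[OF this] Ct]]
      have "\<tau> i \<le> ?e * qq n" by (simp only: mult_ac)
      moreover have "t (n - i) - t n \<le> ?c * rr (n - i)" using t_rr[of "n - i"] t_nonneg[of n] by linarith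
      ultimately have "\<tau> i * (t (n - i) - t n) \<le> (?e * qq n) * (?c * rr (n - i))"
        using tau_nonneg t_antimono[of "n - i" n] e qq_pos[of n] by (intro mult_mono) auto
      moreover have "(?e * qq n) * (?c * rr (n - i)) = ?e * ?c * qq n * rr (n - i)" by (simp only: mult_ac)
      moreover have "0 \<le> ?e * C\<^sub>\<tau> * qq n * rr i"
        by (intro mult_nonneg_nonneg e Ct less_imp_le[OF qq_pos] less_imp_le[OF rr_pos])
      ultimately show ?thesis by linarith
    qed
    then have "(\<Sum>i=1..n. \<tau> i * (t (n - i) - t n)) \<le> (\<Sum>i=1..n. ?e * C\<^sub>\<tau> * qq n * rr i + ?e * ?c * qq n * rr (n - i))"
      by (intro sum_mono) auto
    also have "\<dots> \<le> (\<Sum>i\<le>n. ?e * C\<^sub>\<tau> * qq n * rr i + ?e * ?c * qq n * rr (n - i))"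
    proof (rule sum_mono2)
      show "0 \<le> ?e * C\<^sub>\<tau> * qq n * rr b + ?e * ?c * qq n * rr (n - b)" for b
        by (intro add_nonneg_nonneg mult_nonneg_nonneg e Ct c less_imp_le[OF qq_pos] less_imp_le[OF rr_pos])
    qed auto
    also have "\<dots> = ?e * C\<^sub>\<tau> * (qq n * (\<Sum>i\<le>n. rr i)) + ?e * ?c * (qq n * (\<Sum>i\<le>n. rr (n - i)))"
      unfolding sum.distrib sum_distrib_left by (simp only: mult.assoc)
    also have "(\<Sum>i\<le>n. rr (n - i)) = (\<Sum>l\<le>n. rr l)"
      using sum.nat_diff_reindex[of rr "Suc n"] by (simp add: lessThan_Suc_atMost)
    also have "?e * C\<^sub>\<tau> * (qq n * (\<Sum>i\<le>n. rr i)) + ?e * ?c * (qq n * (\<Sum>i\<le>n. rr i))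
      \<le> ?e * C\<^sub>\<tau> * (C3 * dd n) + ?e * ?c * (C3 * dd n)"
      by (intro add_mono mult_left_mono C3(2) mult_nonneg_nonneg e Ct c)
    finally have ss: "(\<Sum>i=1..n. \<tau> i * (t (n - i) - t n)) \<le> ?e * C\<^sub>\<tau> * (C3 * dd n) + ?e * ?c * (C3 * dd n)" .
    have "0 \<le> (\<Sum>i=1..n. \<tau> i * (t (n - i) - t n))" using tau_nonneg t_antimono by (intro sum_nonneg mult_nonneg_nonneg) auto
    moreover have "0 \<le> t n * t n" by simp
    ultimately have "\<bar>S n\<bar> \<le> t n * t n + (\<Sum>i=1..n. \<tau> i * (t (n - i) - t n))" unfolding S_eq by linarith
    also have "\<dots> \<le> ?c * ?c * (C4 * dd n) + (?e * C\<^sub>\<tau> * (C3 * dd n) + ?e * ?c * (C3 * dd n))" using tt ss by (rule add_mono)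
    also have "\<dots> \<le> ?c * ?c * (C4 * dd n) + (?e * C\<^sub>\<tau> * (C3 * dd n) + ?e * ?c * (C3 * dd n)) + dd n" using dd_pos[of n] by simp
    also have "\<dots> = (?c * ?c * C4 + ?e * C\<^sub>\<tau> * C3 + ?e * ?c * C3 + 1) * dd n" by (simp only: distrib_right mult_1 mult.assoc add.assoc)
    finally show ?thesis .
  qed
  moreover have "?c * ?c * C4 + ?e * C\<^sub>\<tau> * C3 + ?e * ?c * C3 + 1 > 0"
    by (intro add_nonneg_pos add_nonneg_nonneg mult_nonneg_nonneg c e Ct less_imp_le[OF C3(1)] less_imp_le[OF C4(1)]) simp
  ultimately show ?thesis by blast
qed

text \<open>For small k the difference is at most of order k n^(-\<beta>), and the first moment of s
  is finite. For k from n/2 on the difference is at most t_0, and the tail of s is itself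
  O(n^(-\<beta>)).\<close>

lemma TL_t:
  assumes s: "TL A s"
  shows "(\<Sum>k=0..n. s k * (t (n - k) - t n)) \<le> (2 powr \<beta> * C\<^sub>\<tau> * suminf qq + t 0 * 2 powr \<beta>) * A * qq n"
proof -
  note s0 = TL_nonneg[OF s] and A = TL_A[OF s]
  let ?e = "2 powr \<beta> * C\<^sub>\<tau>" let ?h = "(n + 1) div 2"
  have e: "0 \<le> ?e" using Ct by simp
  \<comment> \<open>Summation by parts: k counts the j with 1 \<le> j \<le> k, so the first moment
    is a sum of tails of s.\<close>
  have ks: "(\<Sum>k=0..n. real k * s k) \<le> A * suminf qq"
  proof -
    have "(\<Sum>k=0..n. real k * s k) = (\<Sum>k=0..n. \<Sum>j=1..n. if j \<le> k then s k else 0)"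
    proof (rule sum.cong[OF refl])
      fix k assume "k \<in> {0..n}"
      then have "{j \<in> {1..n}. j \<le> k} = {1..k}" by auto
      then show "real k * s k = (\<Sum>j=1..n. if j \<le> k then s k else 0)"
        by (subst sum.inter_filter[symmetric]) simp_all
    qed
    also have "\<dots> = (\<Sum>j=1..n. \<Sum>k=0..n. if j \<le> k then s k else 0)" by (rule sum.swap)
    also have "\<dots> \<le> (\<Sum>j=1..n. A * qq j)"
    proof (rule sum_mono)
      fix j assume "j \<in> {1..n}"
      have "{k \<in> {0..n}. j \<le> k} = {j..n}" by auto
      then have "(\<Sum>k=0..n. if j \<le> k then s k else 0) = (\<Sum>k=j..n. s k)"
        by (subst sum.inter_filter[symmetric]) simp_all
      then show "(\<Sum>k=0..n. if j \<le> k then s k else 0) \<le> A * qq j" using TL_tail[OF s] by simp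
    qed
    also have "\<dots> = A * (\<Sum>j\<in>{1..n}. qq j)" by (simp add: sum_distrib_left)
    also have "\<dots> \<le> A * suminf qq" using A qq_sum qq_pos
      by (intro mult_left_mono sum_le_suminf) (auto intro: less_imp_le)
    finally show ?thesis .
  qed
  have "s k * (t (n - k) - t n) \<le> ?e * qq n * (real k * s k) + (if ?h \<le> k then s k * t 0 else 0)" if "k \<le> n" for k
  proof (cases "?h \<le> k")
    case True
    have "t (n - k) - t n \<le> t 0" using t_antimono[of 0 "n - k"] t_nonneg[of n] by simp
    then have "s k * (t (n - k) - t n) \<le> s k * t 0" using s0 by (intro mult_left_mono)
    moreover have "0 \<le> ?e * qq n * (real k * s k)" using e qq_pos[of n] s0[of k] by simp
    ultimately show ?thesis using True by simp
  next
    case False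
    then have "2 * k \<le> n" by linarith
    from mult_left_mono[OF t_diff_le[OF this] s0[of k]] show ?thesis using False by (simp add: mult_ac)
  qed
  then have "(\<Sum>k=0..n. s k * (t (n - k) - t n)) \<le> (\<Sum>k=0..n. ?e * qq n * (real k * s k) + (if ?h \<le> k then s k * t 0 else 0))"
    by (intro sum_mono) auto
  also have "\<dots> = ?e * qq n * (\<Sum>k=0..n. real k * s k) + (\<Sum>k\<in>{k \<in> {0..n}. ?h \<le> k}. s k * t 0)"
    unfolding sum.distrib sum_distrib_left by (subst sum.inter_filter) simp_all
  also have "{k \<in> {0..n}. ?h \<le> k} = {?h..n}" by auto
  also have "(\<Sum>k\<in>{?h..n}. s k * t 0) = (\<Sum>k=?h..n. s k) * t 0" by (simp add: sum_distrib_right)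
  also have "?e * qq n * (\<Sum>k=0..n. real k * s k) + (\<Sum>k=?h..n. s k) * t 0 \<le> ?e * qq n * (A * suminf qq) + (A * (2 powr \<beta> * qq n)) * t 0"
  proof (intro add_mono mult_left_mono mult_right_mono ks)
    have "(\<Sum>k=?h..n. s k) \<le> A * qq ?h" by (rule TL_tail[OF s])
    also have "\<dots> \<le> A * (2 powr \<beta> * qq n)" using A by (intro mult_left_mono qq_half) auto
    finally show "(\<Sum>k=?h..n. s k) \<le> A * (2 powr \<beta> * qq n)" .
  qed (use e qq_pos[of n] t_nonneg in auto)
  finally show ?thesis by (simp add: algebra_simps)
qed

end

section \<open>Operator renewal equations\<close>

text \<open>\<open>R\<close> is additive only where its integrals exist, but elements of
  \<open>endo\<close> must be linear on all functions. Precomposing with an algebraic projection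
  onto \<open>V\<close>, obtained by extending a basis, repairs this; \<open>bd\<close> looks at
  \<open>V\<close> alone, where the projection is the identity.\<close>

lemma exists_projection:
  fixes W :: "('a \<Rightarrow> complex) set"
  assumes "0 \<in> W" "\<And>u v. u \<in> W \<Longrightarrow> v \<in> W \<Longrightarrow> u + v \<in> W" "\<And>c u. u \<in> W \<Longrightarrow> (\<lambda>x. c * u x) \<in> W"
  shows "\<exists>Q :: 'a endo. (\<forall>u. ap Q u \<in> W) \<and> (\<forall>u\<in>W. ap Q u = u)"
proof -
  let ?s = "\<lambda>(c::complex) (u :: 'a \<Rightarrow> complex) x. c * u x"
  interpret vs: vector_space ?s
    by unfold_locales (auto simp: fun_eq_iff algebra_simps)
  interpret p: vector_space_pair ?s ?s ..
  have id: "Vector_Spaces.linear ?s ?s (\<lambda>u. u)" by (rule vs.linear_ident)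
  have sub: "vs.subspace W" using assms by (auto simp: vs.subspace_def)
  obtain g where g: "range g \<subseteq> W" "Vector_Spaces.linear ?s ?s g" "\<And>v. v \<in> W \<Longrightarrow> g v = v"
    using p.linear_exists_left_inverse_on[OF id sub] by auto
  interpret g: Vector_Spaces.linear ?s ?s g by (rule g(2))
  have "g (u + v) = g u + g v" "g (?s c u) = ?s c (g u)" for u v c by (rule g.add g.scale)+
  then have "ap (Abs_endo g) = g" by (intro Abs_endo_inverse) blast
  then show ?thesis using g by (intro exI[of _ "Abs_endo g"]) auto
qed

text \<open>The spectral hypothesis enters as a lower bound for 1 - R(z) at each z. The inverse
  itself is available as a formal power series, so a bound is what has to be imported.\<close>

locale renewal = full_branch +
  fixes \<phi> :: "'a \<Rightarrow> nat" and \<beta> C\<^sub>\<tau> :: real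
  assumes phi_meas: "\<phi> \<in> measurable \<mu> (count_space UNIV)"
    and phi_pos: "\<And>x. x \<in> \<Omega> \<Longrightarrow> 1 \<le> \<phi> x"
    and phi_const: "\<And>a x y. a \<in> \<alpha> \<Longrightarrow> x \<in> a \<Longrightarrow> y \<in> a \<Longrightarrow> x \<in> \<Omega> \<Longrightarrow> y \<in> \<Omega> \<Longrightarrow> \<phi> x = \<phi> y"
    and beta_gt: "\<beta> > 1"
    and tail: "\<And>n. measure \<mu> {x \<in> space \<mu>. \<phi> x > n} \<le> C\<^sub>\<tau> * (real n + 1) powr - \<beta>"
    and resolvent: "\<And>z. cmod z \<le> 1 \<Longrightarrow> z \<noteq> 1 \<Longrightarrow>
      \<exists>K. \<forall>v\<in>V. nrm v \<le> K * nrm (v - R (\<lambda>x. z ^ \<phi> x * v x))"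
begin

declare meas_m [measurable del] psi_pair [measurable del] G_pair [measurable del] cell_meas [measurable del]
  F_meas [measurable del]

definition \<tau> :: "nat \<Rightarrow> real" where "\<tau> n = measure \<mu> {x \<in> space \<mu>. \<phi> x > n}"

sublocale wiener \<mu> \<Omega> d \<beta>
  using beta_gt by unfold_locales

lemma phi_sets: "{x \<in> space \<mu>. \<phi> x \<in> N} \<in> sets \<mu>"
proof -
  have "{x \<in> space \<mu>. \<phi> x \<in> N} = \<phi> -` N \<inter> space \<mu>" by auto
  then show ?thesis using measurable_sets[OF phi_meas, of N] by simp
qed

lemma level_sets: "{x \<in> space \<mu>. \<phi> x > n} \<in> sets \<mu>"
  using phi_sets[of "{n<..}"] by (simp only: greaterThan_iff)

lemma tau_antimono: "i \<le> n \<Longrightarrow> \<tau> n \<le> \<tau> i"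
  unfolding \<tau>_def by (rule finite_measure_mono[OF _ level_sets]) auto

lemma tau_qq: "\<tau> n \<le> C\<^sub>\<tau> * poly_decay.qq \<beta> n"
  unfolding \<tau>_def poly_decay.qq_def[OF poly_decay.intro[OF beta_gt]] by (rule tail)

sublocale ts: tail_seq \<beta> \<tau> C\<^sub>\<tau>
proof
  show "1 < \<beta>" by (rule beta_gt)
  show "0 \<le> \<tau> n" for n by (simp add: \<tau>_def)
  show "\<tau> n \<le> C\<^sub>\<tau> * poly_decay.qq \<beta> n" for n
    by (rule tau_qq)
  show "\<tau> n \<le> \<tau> i" if "i \<le> n" for i n
    using that by (rule tau_antimono)
qed

lemma q_qq: "q = ts.qq"
  by (simp add: q_def[abs_def] ts.qq_def[abs_def])

definition PV :: "'a endo" where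
  "PV = (SOME A. (\<forall>u. ap A u \<in> V) \<and> (\<forall>u\<in>V. ap A u = u))"

lemma PV: "(\<forall>u. ap PV u \<in> V) \<and> (\<forall>u\<in>V. ap PV u = u)"
  unfolding PV_def by (rule someI_ex, rule exists_projection) (auto simp: V_zero V_add V_cmult)

lemma PV_V: "ap PV u \<in> V" and PV_id: "u \<in> V \<Longrightarrow> ap PV u = u"
  using PV by auto

definition of_lin :: "(('a \<Rightarrow> complex) \<Rightarrow> 'a \<Rightarrow> complex) \<Rightarrow> 'a endo" where
  "of_lin A = Abs_endo (\<lambda>u. A (ap PV u))"

lemma ap_of_lin:
  assumes "\<And>u v. u \<in> V \<Longrightarrow> v \<in> V \<Longrightarrow> A (u + v) = A u + A v"
    and "\<And>c u. u \<in> V \<Longrightarrow> A (\<lambda>x. c * u x) = (\<lambda>x. c * A u x)"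
  shows "ap (of_lin A) u = A (ap PV u)"
proof -
  have "ap (of_lin A) = (\<lambda>u. A (ap PV u))"
    unfolding of_lin_def by (rule Abs_endo_inverse) (use assms PV_V in \<open>auto simp: ap_add ap_cmult\<close>)
  then show ?thesis by simp
qed

definition cut :: "nat set \<Rightarrow> ('a \<Rightarrow> complex) \<Rightarrow> 'a \<Rightarrow> complex" where
  "cut N v = (\<lambda>x. if \<phi> x \<in> N then v x else 0)"

definition \<phi>c :: "'a set \<Rightarrow> nat" where "\<phi>c a = \<phi> (\<psi> a y0)"

lemma phic: "a \<in> \<alpha> \<Longrightarrow> x \<in> a \<Longrightarrow> x \<in> \<Omega> \<Longrightarrow> \<phi>c a = \<phi> x"
  unfolding \<phi>c_def by (rule phi_const[of a]) (use psi_mem[of a y0] y0 in auto)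

lemma cut_measurable: "v \<in> borel_measurable \<mu> \<Longrightarrow> cut N v \<in> borel_measurable \<mu>"
proof -
  assume v: "v \<in> borel_measurable \<mu>"
  have "(\<lambda>x. indicator {x \<in> space \<mu>. \<phi> x \<in> N} x * v x) \<in> borel_measurable \<mu>"
    by (intro borel_measurable_times borel_measurable_indicator phi_sets v)
  then show ?thesis by (subst measurable_cong[of \<mu> _ "\<lambda>x. indicator {x \<in> space \<mu>. \<phi> x \<in> N} x * v x"]) (auto simp: cut_def)
qed

lemma cut_bound: "v \<in> V \<Longrightarrow> x \<in> \<Omega> \<Longrightarrow> cmod (cut N v x) \<le> nrm v"
  using nrm_pt[of v x] nrm_nonneg[of v] by (auto simp: cut_def)

text \<open>Since \<phi> is constant on cells, restricting to a set of values of \<phi> leaves the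
  function Lipschitz within each cell, and \<open>R_lip\<close> turns the surviving cells into their
  total measure.\<close>

lemma R_cut:
  assumes v: "v \<in> V"
  shows "R (cut N v) \<in> V" "nrm (R (cut N v)) \<le> 2 * C\<^sub>1 * measure \<mu> {x \<in> space \<mu>. \<phi> x \<in> N} * nrm v"
proof -
  let ?h = "\<lambda>a. if \<phi>c a \<in> N then nrm v else 0"
  have hi: "integrable m ?h" by (rule m.integrable_const_bound[of _ "nrm v"]) (use nrm_nonneg[OF v] in auto)
  have qb: "cmod (cut N v x) \<le> ?h a" if "a \<in> \<alpha>" "x \<in> a" "x \<in> \<Omega>" for a x
    using phic[OF that] nrm_pt[OF v that(3)] by (simp add: cut_def)
  have ql: "cmod (cut N v x - cut N v x') \<le> ?h a * d x x'"
    if "a \<in> \<alpha>" "x \<in> a" "x \<in> \<Omega>" "x' \<in> a" "x' \<in> \<Omega>" for a x x'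
    using phic[OF that(1-3)] phic[OF that(1,4,5)] nrm_lip[OF v that(3,5)] by (simp add: cut_def)
  note * = R_lip(1)[OF cut_measurable[OF V_meas[OF v]] hi qb ql] R_lip(3)[OF cut_measurable[OF V_meas[OF v]] hi qb ql]
  have "(\<integral>a. ?h a \<partial>m) = (\<integral>x. nrm v * indicator {x \<in> space \<mu>. \<phi> x \<in> N} x \<partial>\<mu>)"
    unfolding integral_m
  proof (rule integral_cong_AE)
    show "AE x in \<mu>. ?h (cell x) = nrm v * indicator {x \<in> space \<mu>. \<phi> x \<in> N} x"
      using Om_AE by eventually_elim (use phic[OF cell_in cell_mem] Om_space in auto)
    show "(\<lambda>x. ?h (cell x)) \<in> borel_measurable \<mu>" by (rule measurable_compose[OF cell_meas]) simp
    show "(\<lambda>x. nrm v * indicator {x \<in> space \<mu>. \<phi> x \<in> N} x) \<in> borel_measurable \<mu>"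
      by (intro borel_measurable_times borel_measurable_indicator phi_sets borel_measurable_const)
  qed
  also have "\<dots> = measure \<mu> {x \<in> space \<mu>. \<phi> x \<in> N} * nrm v"
    using phi_sets[of N] by simp
  finally show "R (cut N v) \<in> V" "nrm (R (cut N v)) \<le> 2 * C\<^sub>1 * measure \<mu> {x \<in> space \<mu>. \<phi> x \<in> N} * nrm v"
    using * by (simp_all add: mult_ac)
qed

definition RN :: "nat set \<Rightarrow> 'a endo" where "RN N = of_lin (\<lambda>v. R (cut N v))"

lemma R_add_V:
  assumes b: "\<And>x. x \<in> \<Omega> \<Longrightarrow> cmod (u x) \<le> B" "\<And>x. x \<in> \<Omega> \<Longrightarrow> cmod (v x) \<le> B'"
  shows "R (\<lambda>x. u x + v x) = (\<lambda>y. R u y + R v y)" "R (\<lambda>x. u x - v x) = (\<lambda>y. R u y - R v y)"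
proof -
  have "R (\<lambda>x. u x + v x) y = R u y + R v y \<and> R (\<lambda>x. u x - v x) y = R u y - R v y" for y
  proof (cases "y \<in> \<Omega>")
    case True
    show ?thesis using R_add[OF True, of "\<lambda>_. B" u "\<lambda>_. B'" v] b psi_Om[OF _ True] by simp
  qed (simp add: R_out)
  then show "R (\<lambda>x. u x + v x) = (\<lambda>y. R u y + R v y)" "R (\<lambda>x. u x - v x) = (\<lambda>y. R u y - R v y)"
    by auto
qed

lemma ap_RN': "ap (RN N) u = R (cut N (ap PV u))"
  unfolding RN_def
proof (rule ap_of_lin)
  fix u v assume u: "u \<in> V" and v: "v \<in> V"
  have "cut N (u + v) = (\<lambda>x. cut N u x + cut N v x)" by (auto simp: cut_def)
  then show "R (cut N (u + v)) = R (cut N u) + R (cut N v)"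
    using R_add_V(1)[OF cut_bound[OF u] cut_bound[OF v]] by (simp add: plus_fun_def)
next
  fix c u
  have "cut N (\<lambda>x. c * u x) = (\<lambda>x. c * cut N u x)" by (auto simp: cut_def)
  then show "R (cut N (\<lambda>x. c * u x)) = (\<lambda>x. c * R (cut N u) x)"
    by (simp only:) (rule ext, rule R_cmult)
qed

lemma ap_RN: "v \<in> V \<Longrightarrow> ap (RN N) v = R (cut N v)"
  by (simp add: ap_RN' PV_id)

lemma bd_RN: "bd (RN N) (2 * C\<^sub>1 * measure \<mu> {x \<in> space \<mu>. \<phi> x \<in> N})"
  using R_cut C1 by (auto simp: bd_def ap_RN)

lemma RN_Un: "A \<inter> B = {} \<Longrightarrow> RN (A \<union> B) = RN A + RN B"
proof (rule endo_eqI)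
  fix u assume d: "A \<inter> B = {}"
  let ?v = "ap PV u"
  have "cut (A \<union> B) ?v = (\<lambda>x. cut A ?v x + cut B ?v x)" using d by (auto simp: cut_def fun_eq_iff)
  then show "ap (RN (A \<union> B)) u = ap (RN A + RN B) u"
    using R_add_V(1)[OF cut_bound[OF PV_V] cut_bound[OF PV_V]] by (simp add: ap_RN' plus_fun_def)
qed

lemma RN_zero: "(\<And>x. x \<in> \<Omega> \<Longrightarrow> \<phi> x \<notin> N) \<Longrightarrow> RN N = 0"
proof (rule endo_eqI)
  fix u assume n: "\<And>x. x \<in> \<Omega> \<Longrightarrow> \<phi> x \<notin> N"
  have e: "R (cut N (ap PV u)) y = R (\<lambda>x. 0) y" for y by (rule R_cong) (use n in \<open>auto simp: cut_def\<close>)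
  have z: "R (\<lambda>x. 0 :: complex) y = 0" for y by (simp add: R_def)
  have "R (cut N (ap PV u)) = (\<lambda>y. 0)" by (rule ext) (simp only: e z)
  then show "ap (RN N) u = ap 0 u" by (simp add: ap_RN' zero_fun_def)
qed

lemma RN_sum: "RN {..n} = (\<Sum>j\<le>n. RN {j})"
proof (induction n)
  case (Suc n)
  have "{..Suc n} = {..n} \<union> {Suc n}" by auto
  then show ?case using Suc RN_Un[of "{..n}" "{Suc n}"] by simp
qed (simp add: atMost_0)

lemma RN_split: "RN UNIV = (\<Sum>j\<le>n. RN {j}) + RN {n<..}"
proof -
  have "RN ({..n} \<union> {n<..}) = RN {..n} + RN {n<..}" by (rule RN_Un) auto
  moreover have "{..n} \<union> {n<..} = (UNIV :: nat set)" by auto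
  ultimately show ?thesis by (simp only: RN_sum)
qed

text \<open>The mean is multiplied by the indicator of \<open>\<Omega>\<close> because functions in
  the image of \<open>R\<close> vanish off \<open>\<Omega>\<close>; this makes \<open>R_P0\<close>
  an exact identity of functions.\<close>

definition P0 :: "'a endo" where "P0 = of_lin (\<lambda>v x. (\<integral>x. v x \<partial>\<mu>) * indicator \<Omega> x)"

lemma ap_P0': "ap P0 u = (\<lambda>x. (\<integral>x. ap PV u x \<partial>\<mu>) * indicator \<Omega> x)"
  unfolding P0_def
proof (rule ap_of_lin)
  fix u v assume u: "u \<in> V" and v: "v \<in> V"
  have "(\<integral>x. (u + v) x \<partial>\<mu>) = (\<integral>x. u x \<partial>\<mu>) + (\<integral>x. v x \<partial>\<mu>)"
    unfolding plus_fun_apply by (rule Bochner_Integration.integral_add[OF V_integrable[OF u] V_integrable[OF v]])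
  then show "(\<lambda>x. (\<integral>x. (u + v) x \<partial>\<mu>) * indicator \<Omega> x)
    = (\<lambda>x. (\<integral>x. u x \<partial>\<mu>) * indicator \<Omega> x) + (\<lambda>x. (\<integral>x. v x \<partial>\<mu>) * indicator \<Omega> x)"
    by (simp only: plus_fun_def distrib_right)
qed (simp add: mult.assoc)

lemma ap_P0: "v \<in> V \<Longrightarrow> ap P0 v = (\<lambda>x. (\<integral>x. v x \<partial>\<mu>) * indicator \<Omega> x)"
  by (simp add: ap_P0' PV_id)

lemma ind_V: "(\<lambda>x. c * indicator \<Omega> x) \<in> V" and ind_nrm: "nrm (\<lambda>x. c * indicator \<Omega> x) \<le> cmod c"
proof -
  have nb: "nb (cmod c) (\<lambda>x. c * indicator \<Omega> x)" using d_range by (auto simp: nb_def)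
  then show "nrm (\<lambda>x. c * indicator \<Omega> x) \<le> cmod c" by (rule nrm_le)
  have "(\<lambda>x. c * indicator \<Omega> x) \<in> borel_measurable \<mu>" by measurable
  then show "(\<lambda>x. c * indicator \<Omega> x) \<in> V" using nb V_iff by blast
qed

lemma ind_integral: "(\<integral>x. c * indicator \<Omega> x \<partial>\<mu>) = (c :: complex)"
proof -
  have "(\<integral>x. c * indicator \<Omega> x \<partial>\<mu>) = (\<integral>x. c \<partial>\<mu>)"
  proof (rule integral_cong_AE)
    show "(\<lambda>x. c * indicator \<Omega> x) \<in> borel_measurable \<mu>" by (rule V_meas[OF ind_V])
    show "AE x in \<mu>. c * indicator \<Omega> x = c" using Om_AE by eventually_elim simp
  qed simp
  then show ?thesis by (simp add: prob_space)
qed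

lemma bd_P0: "bd P0 1"
  using ind_V order_trans[OF ind_nrm V_integral_le] by (auto simp: bd_def ap_P0)

lemma P0_P0: "P0 * P0 = P0"
proof (rule endo_eqI)
  fix u
  show "ap (P0 * P0) u = ap P0 u"
    unfolding ap_simps ap_P0'[of u] ap_P0[OF ind_V] ind_integral by (rule refl)
qed

lemma P0_RN: "ap (P0 * RN N) u = (\<lambda>y. (\<integral>x. cut N (ap PV u) x \<partial>\<mu>) * indicator \<Omega> y)"
proof -
  have i: "integrable \<mu> (cut N (ap PV u))"
  proof (rule integrable_const_bound)
    show "AE x in \<mu>. norm (cut N (ap PV u) x) \<le> nrm (ap PV u)"
      using Om_AE by eventually_elim (rule cut_bound[OF PV_V])
  qed (rule cut_measurable[OF V_meas[OF PV_V]])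
  show ?thesis using R_integral(2)[OF i] by (simp add: ap_P0' PV_id[OF R_cut(1)[OF PV_V]] ap_RN')
qed

lemma P0_R: "P0 * RN UNIV = P0"
proof (rule endo_eqI)
  fix u
  have "cut UNIV (ap PV u) = ap PV u" by (simp add: cut_def)
  then show "ap (P0 * RN UNIV) u = ap P0 u" unfolding P0_RN ap_P0' by (simp only:)
qed

lemma R_P0: "RN UNIV * P0 = P0"
proof (rule endo_eqI)
  fix u
  let ?c = "\<integral>x. ap PV u x \<partial>\<mu>"
  have "R (\<lambda>x. ?c * indicator \<Omega> x) y = ?c * indicator \<Omega> y" for y
  proof (cases "y \<in> \<Omega>")
    case True
    have "R (\<lambda>x. ?c * indicator \<Omega> x) y = R (\<lambda>x. ?c * 1) y" by (rule R_cong) simp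
    also have "\<dots> = ?c" using R_cmult[of ?c "\<lambda>x. 1" y] R_one(1)[OF True] by simp
    finally show ?thesis using True by simp
  qed (simp add: R_out)
  then have "R (\<lambda>x. ?c * indicator \<Omega> x) = (\<lambda>y. ?c * indicator \<Omega> y)" by (rule ext)
  moreover have "cut UNIV (\<lambda>x. ?c * indicator \<Omega> x) = (\<lambda>x. ?c * indicator \<Omega> x)" by (simp add: cut_def)
  ultimately show "ap (RN UNIV * P0) u = ap P0 u"
    by (simp only: ap_simps ap_P0' ap_RN[OF ind_V])
qed

lemma integral_indicator_complex:
  assumes "A \<in> sets \<mu>" shows "(\<integral>x. indicator A x \<partial>\<mu>) = complex_of_real (measure \<mu> A)"
proof -
  have "(\<integral>x. indicator A x \<partial>\<mu>) = (\<integral>x. complex_of_real (indicator A x) \<partial>\<mu>)"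
    by (rule Bochner_Integration.integral_cong) (auto simp: indicator_def)
  also have "\<dots> = complex_of_real (\<integral>x. indicator A x \<partial>\<mu>)" by (rule integral_complex_of_real)
  also have "(\<integral>x. indicator A x \<partial>\<mu>) = measure \<mu> A"
    using sets.sets_into_space[OF assms] by (simp add: Int_absorb2)
  finally show ?thesis .
qed

text \<open>Compressed to constants, the tail operator is the number \<tau>_n. This is how the
  scalar tail of \<phi> enters the operator expansion.\<close>

lemma P0_tail_P0: "P0 * RN {n<..} * P0 = cm (of_real (\<tau> n)) * P0"
proof (rule endo_eqI)
  fix u
  let ?c = "\<integral>x. ap PV u x \<partial>\<mu>"
  have "(\<integral>x. cut {n<..} (\<lambda>x. ?c * indicator \<Omega> x) x \<partial>\<mu>) = (\<integral>x. ?c * indicator {x \<in> space \<mu>. \<phi> x > n} x \<partial>\<mu>)"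
  proof (rule integral_cong_AE)
    show "cut {n<..} (\<lambda>x. ?c * indicator \<Omega> x) \<in> borel_measurable \<mu>"
      by (rule cut_measurable[OF V_meas[OF ind_V]])
    show "(\<lambda>x. ?c * indicator {x \<in> space \<mu>. \<phi> x > n} x) \<in> borel_measurable \<mu>"
      by (intro borel_measurable_times borel_measurable_indicator level_sets borel_measurable_const)
    show "AE x in \<mu>. cut {n<..} (\<lambda>x. ?c * indicator \<Omega> x) x = ?c * indicator {x \<in> space \<mu>. \<phi> x > n} x"
      using Om_AE by eventually_elim (use Om_space in \<open>auto simp: cut_def indicator_def\<close>)
  qed
  also have "\<dots> = ?c * of_real (\<tau> n)"
    unfolding \<tau>_def integral_mult_right_zero by (subst integral_indicator_complex[OF level_sets]) (rule refl)
  finally have c: "(\<integral>x. cut {n<..} (\<lambda>x. ?c * indicator \<Omega> x) x \<partial>\<mu>) = ?c * of_real (\<tau> n)" .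
  have "ap (P0 * RN {n<..} * P0) u = (\<lambda>y. (\<integral>x. cut {n<..} (ap PV (ap P0 u)) x \<partial>\<mu>) * indicator \<Omega> y)"
    using P0_RN[of "{n<..}" "ap P0 u"] by (simp only: ap_simps)
  also have "\<dots> = (\<lambda>y. (?c * of_real (\<tau> n)) * indicator \<Omega> y)"
    by (simp only: ap_P0'[of u] PV_id[OF ind_V] c)
  also have "\<dots> = ap (cm (of_real (\<tau> n)) * P0) u"
    unfolding ap_simps ap_P0'[of u] by (rule ext) (simp only: mult_ac)
  finally show "ap (P0 * RN {n<..} * P0) u = ap (cm (of_real (\<tau> n)) * P0) u" .
qed

end

section \<open>The regularised operator series B and its inverse\<close>

context renewal
begin

abbreviation (input) P :: "'a endo fps" where "P \<equiv> fps_const P0"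

definition Rz :: "'a endo fps" where "Rz = Abs_fps (\<lambda>n. RN {n})"
text \<open>The series 1/(1-z), inverse to \<open>D\<close>.\<close>

definition J :: "'a endo fps" where "J = Abs_fps (\<lambda>n. 1)"
definition D :: "'a endo fps" where "D = 1 - fps_X"
text \<open>The formal inverse of 1 - R(z); it exists because \<phi> \<ge> 1 makes the constant
  coefficient of R(z) vanish.\<close>

definition T :: "'a endo fps" where "T = fps_right_inverse (1 - Rz) 1"
text \<open>On constants 1 - R(z) degenerates at z = 1. Dividing by 1 - z on the range of P alone
  removes this and leaves the complement untouched.\<close>

definition B :: "'a endo fps" where "B = (1 - Rz) * (P * J + 1 - P)"
definition b :: "'a endo fps" where "b = (P * D + 1 - P) * T"
text \<open>The series (R(1) - R(z)) / (1 - z).\<close>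

definition A1 :: "'a endo fps" where "A1 = Abs_fps (\<lambda>n. RN {n<..})"
definition phibar :: real where "phibar = suminf \<tau>"

lemma RN_0: "RN {0} = 0"
  by (rule RN_zero) (use phi_pos in fastforce)

lemma Rz_0: "fps_nth Rz 0 = 0"
  by (simp add: Rz_def RN_0)

lemma T_inv: "(1 - Rz) * T = 1" "T * (1 - Rz) = 1"
proof -
  have 0: "fps_nth (1 - Rz) 0 = 1" by (simp add: Rz_0)
  show "(1 - Rz) * T = 1" unfolding T_def by (rule fps_right_inverse) (simp add: Rz_0)
  show "T * (1 - Rz) = 1" unfolding T_def by (rule fps_left_inverse'[of 1]) (simp_all add: Rz_0)
qed

lemma X_comm: "fps_X * f = f * fps_X" for f :: "'a endo fps"
  by (simp add: fps_mult_fps_X_commute)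

lemma D_comm: "D * f = f * D" for f :: "'a endo fps"
  by (simp add: D_def algebra_simps X_comm)

lemma DJ: "D * J = 1"
  by (rule fps_ext) (simp add: D_def J_def left_diff_distrib)

lemma D_nth: "fps_nth (D * f) n = fps_nth f n - (if n = 0 then 0 else fps_nth f (n - 1))" for f :: "'a endo fps"
  by (simp add: D_def left_diff_distrib)

lemma JD: "J * D = 1" using D_comm[of J] DJ by simp

lemma PP: "P * P = P" by (simp add: P0_P0)

lemma DB_inv: "(P * D + 1 - P) * (P * J + 1 - P) = 1" "(P * J + 1 - P) * (P * D + 1 - P) = 1"
proof -
  have 1: "P * D * (P * J) = P" "P * J * (P * D) = P"
  proof -
    have "P * D * (P * J) = P * (D * P) * J" by (simp only: mult.assoc)
    also have "\<dots> = (P * P) * (D * J)" by (simp only: D_comm[of P] mult.assoc)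
    finally show "P * D * (P * J) = P" by (simp only: PP DJ mult_1_right)
    have "P * J * (P * D) = P * J * (D * P)" by (simp only: D_comm[of P])
    also have "\<dots> = P * (J * D) * P" by (simp only: mult.assoc)
    finally show "P * J * (P * D) = P" by (simp only: JD PP mult_1_right)
  qed
  have JP: "J * P = P * J"
  proof -
    have "J * P = J * (P * (D * J))" by (simp only: DJ mult_1_right)
    also have "\<dots> = J * (D * P) * J" by (simp only: D_comm[of P] mult.assoc)
    also have "\<dots> = (J * D) * P * J" by (simp only: mult.assoc)
    finally show ?thesis by (simp only: JD mult_1_left)
  qed
  have 2: "P * D * P = P * D" "P * J * P = P * J"
    by (simp_all only: mult.assoc D_comm[of P] JP) (simp_all only: mult.assoc[symmetric] PP)
  have 3: "P * (P * D) = P * D" "P * (P * J) = P * J" by (simp_all only: mult.assoc[symmetric] PP)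
  show "(P * D + 1 - P) * (P * J + 1 - P) = 1" "(P * J + 1 - P) * (P * D + 1 - P) = 1"
    by (simp_all only: distrib_left distrib_right left_diff_distrib right_diff_distrib 1 2 3 PP mult_1_left mult_1_right)
       (simp_all only: add_diff_cancel_left' algebra_simps)
qed

lemma B_b: "B * b = 1" and b_B: "b * B = 1"
proof -
  have "B * b = (1 - Rz) * ((P * J + 1 - P) * (P * D + 1 - P)) * T" by (simp only: B_def b_def mult.assoc)
  then show "B * b = 1" by (simp only: DB_inv mult_1_right T_inv)
  have "b * B = (P * D + 1 - P) * (T * (1 - Rz)) * (P * J + 1 - P)" by (simp only: B_def b_def mult.assoc)
  then show "b * B = 1" by (simp only: DB_inv mult_1_right T_inv)
qed

lemma J_nth: "fps_nth (f * J) n = (\<Sum>j\<le>n. fps_nth f j)" for f :: "'a endo fps"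
  by (simp add: fps_mult_nth J_def atMost_atLeast0)

text \<open>As R(1) P = P, the P-part of B is (R(1) - R(z)) P / (1 - z), the series of tails. Hence
  the coefficients of B decay like n^(-\<beta>) although those of 1/(1-z) do not decay.\<close>

lemma B_eq: "B = A1 * P + fps_const (1 - P0) - Rz * fps_const (1 - P0)"
proof -
  have "(1 - Rz) * P * J = A1 * P"
  proof (rule fps_ext)
    fix n
    have "fps_nth ((1 - Rz) * P * J) n = (\<Sum>j\<le>n. fps_nth (1 - Rz) j * P0)" by (simp add: J_nth)
    also have "\<dots> = (\<Sum>j\<le>n. fps_nth (1 - Rz) j) * P0" by (simp add: sum_distrib_right)
    also have "(\<Sum>j\<le>n. fps_nth (1 - Rz) j) = 1 - (\<Sum>j\<le>n. RN {j})" by (simp add: sum_subtractf Rz_def)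
    also have "\<dots> = 1 - (RN UNIV - RN {n<..})" by (subst RN_split[of n]) simp
    also have "\<dots> * P0 = RN {n<..} * P0" by (simp add: left_diff_distrib R_P0)
    finally show "fps_nth ((1 - Rz) * P * J) n = fps_nth (A1 * P) n" by (simp add: A1_def)
  qed
  moreover have "fps_const (1 - P0) = 1 - P" by (simp add: fps_const_sub[symmetric] del: fps_const_sub)
  ultimately show ?thesis
    by (simp only: B_def distrib_left right_diff_distrib left_diff_distrib mult_1_left mult_1_right mult.assoc[symmetric])
       (simp only: algebra_simps)
qed

lemma bd_1P: "bd (1 - P0) 2"
  using bd_diff[OF bd_1 bd_P0] by simp

lemma tau_nonneg: "0 \<le> \<tau> n" by (simp add: \<tau>_def)

lemma Ct: "0 \<le> C\<^sub>\<tau>" by (rule ts.Ct)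

lemma wt_A1: "wt A1 (2 * C\<^sub>1 * C\<^sub>\<tau>)"
proof -
  have "bd (RN {n<..}) (2 * C\<^sub>1 * C\<^sub>\<tau> * q n)" for n
  proof (rule bd_mono[OF bd_RN])
    have "2 * C\<^sub>1 * \<tau> n \<le> 2 * C\<^sub>1 * (C\<^sub>\<tau> * q n)" using ts.tau_le[of n] C1 by (intro mult_left_mono) (auto simp: q_qq)
    then show "2 * C\<^sub>1 * measure \<mu> {x \<in> space \<mu>. \<phi> x \<in> {n<..}} \<le> 2 * C\<^sub>1 * C\<^sub>\<tau> * q n" by (simp only: \<tau>_def greaterThan_iff mult.assoc)
  qed
  then show ?thesis using C1 Ct by (simp add: wt_def A1_def)
qed

lemma wt_Rz: "wt Rz (2 * C\<^sub>1 * (2 powr \<beta> * C\<^sub>\<tau>))"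
proof -
  have "bd (RN {n}) (2 * C\<^sub>1 * (2 powr \<beta> * C\<^sub>\<tau>) * q n)" for n
  proof (cases n)
    case 0
    show ?thesis unfolding 0 RN_0 by (rule bd_mono[OF bd_0]) (use C1 Ct q_pos[of 0] in simp)
  next
    case (Suc k)
    have "measure \<mu> {x \<in> space \<mu>. \<phi> x \<in> {n}} \<le> \<tau> k"
      unfolding \<tau>_def by (rule finite_measure_mono[OF _ level_sets]) (use Suc in auto)
    also have "\<dots> \<le> C\<^sub>\<tau> * q k" using ts.tau_le[of k] by (simp only: q_qq)
    also have "\<dots> \<le> C\<^sub>\<tau> * (2 powr \<beta> * q n)" using Ct ts.powr_shift[of \<beta> k] beta_gt Suc by (intro mult_left_mono) (auto simp: q_def add_ac)
    finally have "2 * C\<^sub>1 * measure \<mu> {x \<in> space \<mu>. \<phi> x \<in> {n}} \<le> 2 * C\<^sub>1 * (C\<^sub>\<tau> * (2 powr \<beta> * q n))"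
      using C1 by (intro mult_left_mono) auto
    from bd_mono[OF bd_RN this] show ?thesis by (simp only: mult_ac)
  qed
  then show ?thesis using C1 Ct by (simp add: wt_def Rz_def)
qed

lemma wt_B: "\<exists>x. wt B x"
  unfolding B_eq using wt_diff[OF wt_add[OF wt_mult[OF wt_A1 wt_const[OF bd_P0]] wt_const[OF bd_1P]] wt_mult[OF wt_Rz wt_const[OF bd_1P]]]
  by blast

text \<open>A qualitative statement, from the recursion T = 1 + R(z) T. It is the starting
  information on the coefficients of b that the Wiener lemma turns into decay.\<close>

lemma bd_T: "\<exists>K. bd (fps_nth T n) K"
proof (induction n rule: less_induct)
  case (less n)
  have "T = 1 + Rz * T" using T_inv(1) by (simp add: algebra_simps)
  then have "fps_nth T n = fps_nth (1 + Rz * T) n" by simp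
  also have "\<dots> = (if n = 0 then 1 else 0) + (\<Sum>i=0..n. RN {i} * fps_nth T (n - i))"
    by (simp add: fps_mult_nth Rz_def)
  also have "(\<Sum>i=0..n. RN {i} * fps_nth T (n - i)) = (\<Sum>i=1..n. RN {i} * fps_nth T (n - i))"
    by (simp add: sum.atLeast_Suc_atMost RN_0)
  finally have eq: "fps_nth T n = (if n = 0 then 1 else 0) + (\<Sum>i=1..n. RN {i} * fps_nth T (n - i))" .
  have "\<exists>K. bd (RN {i} * fps_nth T (n - i)) K" if "i \<in> {1..n}" for i
    using less[of "n - i"] that bd_mult[OF bd_RN] by fastforce
  then obtain k where "\<And>i. i \<in> {1..n} \<Longrightarrow> bd (RN {i} * fps_nth T (n - i)) (k i)" by metis
  then have "bd (\<Sum>i=1..n. RN {i} * fps_nth T (n - i)) (\<Sum>i=1..n. k i)" by (rule bd_sum)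
  moreover have "bd (if n = 0 then 1 else 0) 1" using bd_1 bd_mono[OF bd_0, of 1] by simp
  ultimately show ?case unfolding eq using bd_add by blast
qed

lemma bd_b: "\<exists>K. bd (fps_nth b n) K"
proof -
  obtain k where k: "\<And>n. bd (fps_nth T n) (k n)" using bd_T by metis
  have c: "fps_nth (P * D + 1 - P) i = (if i = 0 then 1 else 0) - (if i = 1 then P0 else 0)" for i
    by (simp add: D_def fps_X_def)
  have "bd (fps_nth (P * D + 1 - P) i) 2" for i
    unfolding c using bd_diff[OF bd_mono[OF bd_0, of 1] bd_P0] bd_mono[OF bd_1, of 2] bd_mono[OF bd_0, of 2] by auto
  then show ?thesis unfolding b_def using bd_fps_mult[of n "P * D + 1 - P" "\<lambda>_. 2" T k] k by blast
qed

lemma ev_Rz: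
  assumes v: "v \<in> V" and z: "cmod z \<le> 1" and y: "y \<in> \<Omega>"
  shows "ev Rz z v y = R (\<lambda>x. z ^ \<phi> x * v x) y"
proof -
  have zle: "cmod (z ^ k) \<le> 1" for k using z by (simp add: norm_power power_le_one)
  have "(\<Sum>n<N. z ^ n * ap (RN {n}) v y) = R (cut {..<N} (\<lambda>x. z ^ \<phi> x * v x)) y" for N
  proof (induction N)
    case 0
    have "R (cut {} (\<lambda>x. z ^ \<phi> x * v x)) y = 0" by (simp add: R_def cut_def)
    then show ?case by simp
  next
    case (Suc N)
    have b: "cmod (cut M (\<lambda>x. z ^ \<phi> x * v x) x) \<le> nrm v" if x: "x \<in> \<Omega>" for M x
    proof -
      have "cmod (z ^ \<phi> x * v x) \<le> 1 * nrm v" unfolding norm_mult by (intro mult_mono zle nrm_pt[OF v x]) auto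
      then show ?thesis using nrm_nonneg[OF v] by (simp add: cut_def)
    qed
    have "cut {..<Suc N} (\<lambda>x. z ^ \<phi> x * v x) = (\<lambda>x. cut {..<N} (\<lambda>x. z ^ \<phi> x * v x) x + cut {N} (\<lambda>x. z ^ \<phi> x * v x) x)"
      by (auto simp: cut_def fun_eq_iff)
    then have "R (cut {..<Suc N} (\<lambda>x. z ^ \<phi> x * v x)) y = R (cut {..<N} (\<lambda>x. z ^ \<phi> x * v x)) y + R (cut {N} (\<lambda>x. z ^ \<phi> x * v x)) y"
      using R_add_V(1)[OF b b] by simp
    moreover have "cut {N} (\<lambda>x. z ^ \<phi> x * v x) = (\<lambda>x. z ^ N * cut {N} v x)" by (auto simp: cut_def)
    then have "R (cut {N} (\<lambda>x. z ^ \<phi> x * v x)) y = z ^ N * ap (RN {N}) v y" by (simp only: R_cmult ap_RN[OF v])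
    ultimately show ?case using Suc by simp
  qed
  moreover have "(\<lambda>N. R (cut {..<N} (\<lambda>x. z ^ \<phi> x * v x)) y) \<longlonglongrightarrow> R (\<lambda>x. z ^ \<phi> x * v x) y"
    unfolding R_def
  proof (rule integral_dominated_convergence[where w = "\<lambda>_. C\<^sub>1 * nrm v"])
    show "AE a in m. (\<lambda>N. G a y *\<^sub>R cut {..<N} (\<lambda>x. z ^ \<phi> x * v x) (\<psi> a y)) \<longlonglongrightarrow> G a y *\<^sub>R (z ^ \<phi> (\<psi> a y) * v (\<psi> a y))"
    proof (intro AE_m_I tendsto_scaleR tendsto_const)
      fix a
      have "\<forall>\<^sub>F N in sequentially. cut {..<N} (\<lambda>x. z ^ \<phi> x * v x) (\<psi> a y) = z ^ \<phi> (\<psi> a y) * v (\<psi> a y)"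
        unfolding eventually_sequentially by (rule exI[of _ "Suc (\<phi> (\<psi> a y))"]) (simp add: cut_def)
      then show "(\<lambda>N. cut {..<N} (\<lambda>x. z ^ \<phi> x * v x) (\<psi> a y)) \<longlonglongrightarrow> z ^ \<phi> (\<psi> a y) * v (\<psi> a y)"
        by (rule tendsto_eventually)
    qed
    show "AE a in m. norm (G a y *\<^sub>R cut {..<N} (\<lambda>x. z ^ \<phi> x * v x) (\<psi> a y)) \<le> C\<^sub>1 * nrm v" for N
    proof (rule AE_m_I)
      fix a assume a: "a \<in> \<alpha>"
      have "cmod (z ^ \<phi> (\<psi> a y) * v (\<psi> a y)) \<le> 1 * nrm v"
        unfolding norm_mult by (intro mult_mono zle nrm_pt[OF v psi_Om[OF a y]]) auto
      then have "cmod (cut {..<N} (\<lambda>x. z ^ \<phi> x * v x) (\<psi> a y)) \<le> nrm v"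
        using nrm_nonneg[OF v] by (simp add: cut_def)
      then have "G a y * cmod (cut {..<N} (\<lambda>x. z ^ \<phi> x * v x) (\<psi> a y)) \<le> C\<^sub>1 * nrm v"
        using C1 by (intro mult_mono G_le[OF a y]) auto
      then show "norm (G a y *\<^sub>R cut {..<N} (\<lambda>x. z ^ \<phi> x * v x) (\<psi> a y)) \<le> C\<^sub>1 * nrm v" using G_nonneg[OF a] by simp
    qed
  qed simp_all
  ultimately have "(\<lambda>N. \<Sum>n<N. z ^ n * ap (RN {n}) v y) \<longlonglongrightarrow> R (\<lambda>x. z ^ \<phi> x * v x) y" by simp
  then show ?thesis by (simp add: ev_def Rz_def sums_def[symmetric] sums_iff)
qed

text \<open>Multiplying by 1 - z gives (1-z) B(z) = (1 - R(z)) Q(z) with Q(z) = P + (1-z)(1-P). The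
  hypothesis on the resolvent bounds x = Q(z) v, and v is recovered from x since x and v have the
  same mean and z \<noteq> 1.\<close>

lemma lower_away:
  assumes z: "cmod z \<le> 1" "z \<noteq> 1"
  shows "\<exists>K. \<forall>v\<in>V. nrm v \<le> K * nrm (ev B z v)"
proof -
  obtain K0 where K0: "\<And>v. v \<in> V \<Longrightarrow> nrm v \<le> K0 * nrm (v - R (\<lambda>x. z ^ \<phi> x * v x))" using resolvent[OF z] by blast
  define K where "K = max K0 0"
  obtain xB where xB: "wt B xB" using wt_B by blast
  have wR1: "wt (1 - Rz) (1 + 2 * C\<^sub>1 * (2 powr \<beta> * C\<^sub>\<tau>))" by (rule wt_diff[OF wt_1 wt_Rz])
  have wX: "wt fps_X (2 powr \<beta>)"
  proof -
    have "bd (fps_nth fps_X n) (2 powr \<beta> * q n)" for n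
    proof (cases "n = 1")
      case True
      have "1 \<le> 2 powr \<beta> * q 1" using q_half[of 1 1] q0 q_half[of 1 "1"] by (simp add: q_def powr_minus)
      then show ?thesis using bd_mono[OF bd_1] True by simp
    next
      case False
      have "0 \<le> 2 powr \<beta> * q n" using q_pos[of n] by simp
      from bd_mono[OF bd_0 this] show ?thesis using False by (simp add: fps_X_def)
    qed
    then show ?thesis by (simp add: wt_def)
  qed
  have wD: "wt D (1 + 2 powr \<beta>)" unfolding D_def by (rule wt_diff[OF wt_1 wX])
  have evD: "ev D z u p = (1 - z) * u p" if u: "u \<in> V" and p: "p \<in> \<Omega>" for u p
  proof -
    have "ev fps_X z u p = (\<Sum>n\<in>{1}. z ^ n * ap (fps_nth fps_X n) u p)"
      unfolding ev_def by (rule suminf_finite) (auto simp: fps_X_def)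
    then have "ev fps_X z u p = z * u p" by simp
    then show ?thesis unfolding D_def using ev_diff[OF wt_ell[OF wt_1] wt_ell[OF wX] u z(1) p]
      by (simp add: ev_1 left_diff_distrib)
  qed
  define Q where "Q = P + D * fps_const (1 - P0)"
  have wQ: "\<exists>w. wt Q w" unfolding Q_def using wt_add[OF wt_const[OF bd_P0] wt_mult[OF wD wt_const[OF bd_1P]]] by blast
  have id: "D * B = (1 - Rz) * Q"
  proof -
    have c: "fps_const (1 - P0) = 1 - P" by (simp add: fps_const_sub[symmetric] del: fps_const_sub)
    have "D * B = (1 - Rz) * (D * (P * J + 1 - P))" unfolding B_def by (simp only: mult.assoc[symmetric] D_comm[of "1 - Rz"])
    also have "D * (P * J + 1 - P) = Q"
    proof -
      have "D * (P * J) = P * (D * J)" by (simp only: mult.assoc[symmetric] D_comm[of P])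
      then show ?thesis unfolding Q_def c by (simp only: distrib_left right_diff_distrib DJ mult_1_right add_diff_eq)
    qed
    finally show ?thesis .
  qed
  have "nrm v \<le> (K * cmod (1 - z) + (2 / cmod (1 - z)) * (K * cmod (1 - z))) * nrm (ev B z v)" if v: "v \<in> V" for v
  proof -
    obtain w where w: "wt Q w" using wQ by blast
    let ?x = "ev Q z v" and ?u = "ev B z v"
    have xV: "?x \<in> V" by (rule ev_V[OF wt_ell[OF w] v z(1)])
    have uV: "?u \<in> V" by (rule ev_V[OF wt_ell[OF xB] v z(1)])
    have "nrm (?x - R (\<lambda>y. z ^ \<phi> y * ?x y)) = nrm (\<lambda>p. (1 - z) * ?u p)"
    proof (rule nrm_cong)
      fix p assume p: "p \<in> \<Omega>"
      have "(1 - z) * ?u p = ev (D * B) z v p"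
        using ev_mult[OF wt_ell[OF wD] wt_ell[OF xB] v z(1) p] evD[OF uV p] by simp
      also have "\<dots> = ev (1 - Rz) z ?x p" unfolding id by (rule ev_mult[OF wt_ell[OF wR1] wt_ell[OF w] v z(1) p])
      also have "\<dots> = ?x p - ev Rz z ?x p" using ev_diff[OF wt_ell[OF wt_1] wt_ell[OF wt_Rz] xV z(1) p] by (simp add: ev_1)
      also have "\<dots> = ?x p - R (\<lambda>y. z ^ \<phi> y * ?x y) p" by (simp only: ev_Rz[OF xV z(1) p])
      finally show "(?x - R (\<lambda>y. z ^ \<phi> y * ?x y)) p = (1 - z) * ?u p" by simp
    qed
    also have "\<dots> \<le> cmod (1 - z) * nrm ?u" by (rule nrm_cmult[OF uV])
    finally have r: "nrm (?x - R (\<lambda>y. z ^ \<phi> y * ?x y)) \<le> cmod (1 - z) * nrm ?u" .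
    have x1: "nrm ?x \<le> K * cmod (1 - z) * nrm ?u"
    proof -
      have Rn: "0 \<le> nrm (?x - R (\<lambda>y. z ^ \<phi> y * ?x y))"
      proof -
        have "nrm (?x - R (\<lambda>y. z ^ \<phi> y * ?x y)) = nrm (\<lambda>p. (1 - z) * ?u p)" by fact
        then show ?thesis using nrm_nonneg[OF V_cmult[OF uV]] by simp
      qed
      have "nrm ?x \<le> K0 * nrm (?x - R (\<lambda>y. z ^ \<phi> y * ?x y))" by (rule K0[OF xV])
      also have "\<dots> \<le> K * nrm (?x - R (\<lambda>y. z ^ \<phi> y * ?x y))" using Rn by (intro mult_right_mono) (auto simp: K_def)
      also have "\<dots> \<le> K * (cmod (1 - z) * nrm ?u)" using r by (intro mult_left_mono) (auto simp: K_def)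
      finally show ?thesis by simp
    qed
    let ?Pv = "ap P0 v"
    have PvV: "?Pv \<in> V" by (rule bd_V[OF bd_P0 v])
    have xp: "?x p = ?Pv p + (1 - z) * (v p - ?Pv p)" if p: "p \<in> \<Omega>" for p
    proof -
      have oV: "ap (1 - P0) v \<in> V" by (rule bd_V[OF bd_1P v])
      have "ev (D * fps_const (1 - P0)) z v p = (1 - z) * ap (1 - P0) v p"
        using ev_mult[OF wt_ell[OF wD] wt_ell[OF wt_const[OF bd_1P]] v z(1) p] evD[OF oV p] by (simp add: ev_const)
      then show ?thesis unfolding Q_def
        using ev_add[OF wt_ell[OF wt_const[OF bd_P0]] wt_ell[OF wt_mult[OF wD wt_const[OF bd_1P]]] v z(1) p]
        by (simp add: ev_const)
    qed
    have Px: "nrm ?Pv \<le> nrm ?x"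
    proof -
      have i: "(\<integral>p. ?x p \<partial>\<mu>) = (\<integral>p. v p \<partial>\<mu>)"
      proof -
        have "(\<integral>p. ?x p \<partial>\<mu>) = (\<integral>p. ?Pv p + (1 - z) * (v p - ?Pv p) \<partial>\<mu>)"
          by (rule integral_cong_AE)
            (use Om_AE xp V_meas[OF xV] V_meas[OF PvV] V_meas[OF v] in \<open>auto intro!: borel_measurable_add borel_measurable_times borel_measurable_diff\<close>)
        also have "\<dots> = (\<integral>p. ?Pv p \<partial>\<mu>) + (1 - z) * ((\<integral>p. v p \<partial>\<mu>) - (\<integral>p. ?Pv p \<partial>\<mu>))"
          using V_integrable[OF PvV] V_integrable[OF v] by simp
        also have "(\<integral>p. ?Pv p \<partial>\<mu>) = (\<integral>p. v p \<partial>\<mu>)" by (simp only: ap_P0[OF v] ind_integral)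
        finally show ?thesis by simp
      qed
      have "nrm ?Pv = nrm (ap P0 ?x)" unfolding ap_P0[OF v] ap_P0[OF xV] i by (rule refl)
      also have "\<dots> \<le> 1 * nrm ?x" by (rule bd_nrm[OF bd_P0 xV])
      finally show ?thesis by simp
    qed
    have z1: "cmod (1 - z) > 0" using z by simp
    have "nrm v = nrm (?Pv + (\<lambda>p. (1 / (1 - z)) * (?x - ?Pv) p))"
      by (rule nrm_cong) (use z in \<open>simp add: xp field_simps\<close>)
    also have "\<dots> \<le> nrm ?Pv + cmod (1 / (1 - z)) * nrm (?x - ?Pv)"
      using nrm_add[OF PvV V_cmult[OF V_diff[OF xV PvV], of "1 / (1 - z)"]] nrm_cmult[OF V_diff[OF xV PvV], of "1 / (1 - z)"]
      by linarith
    also have "\<dots> \<le> nrm ?x + (1 / cmod (1 - z)) * (nrm ?x + nrm ?x)"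
      using Px nrm_diff[OF xV PvV] z1 by (intro add_mono mult_mono) (auto simp: norm_divide nrm_nonneg[OF V_diff[OF xV PvV]])
    also have "\<dots> = nrm ?x + (2 / cmod (1 - z)) * nrm ?x" by simp
    also have "\<dots> \<le> K * cmod (1 - z) * nrm ?u + (2 / cmod (1 - z)) * (K * cmod (1 - z) * nrm ?u)"
      using x1 z1 by (intro add_mono mult_left_mono) auto
    finally show ?thesis by (simp only: distrib_right mult.assoc)
  qed
  then show ?thesis by blast
qed

end

lemma (in lip_space) ev_diff_z:
  assumes a: "ell a x" and v: "v \<in> V" and z: "cmod z \<le> 1" and w: "cmod w \<le> 1"
  shows "summable (\<lambda>n. cmod (z ^ n - w ^ n) * x n)"
    "nrm (ev a z v - ev a w v) \<le> (\<Sum>n. cmod (z ^ n - w ^ n) * x n) * nrm v"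
proof -
  have le2: "cmod (z ^ n - w ^ n) \<le> 2" for n
    using norm_triangle_ineq4[of "z ^ n" "w ^ n"] power_le_one[OF norm_ge_zero z, of n] power_le_one[OF norm_ge_zero w, of n]
    by (simp add: norm_power)
  have x0: "0 \<le> x n" for n by (rule ell_nonneg[OF a])
  show s: "summable (\<lambda>n. cmod (z ^ n - w ^ n) * x n)"
  proof (rule summable_comparison_test'[of "\<lambda>n. 2 * x n" 0])
    show "summable (\<lambda>n. 2 * x n)" using a by (intro summable_mult) (simp add: ell_def)
    show "norm (cmod (z ^ n - w ^ n) * x n) \<le> 2 * x n" for n
      using mult_right_mono[OF le2 x0, of n n] x0[of n] by (simp add: abs_mult)
  qed
  have "nb (\<Sum>n. cmod (z ^ n - w ^ n) * x n * nrm v) (\<lambda>p. \<Sum>n. (z ^ n - w ^ n) * ap (fps_nth a n) v p)"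
  proof (rule nb_suminf)
    show "summable (\<lambda>n. cmod (z ^ n - w ^ n) * x n * nrm v)" using s by (rule summable_mult2)
    fix n
    have 1: "nb (cmod (z ^ n - w ^ n) * nrm (ap (fps_nth a n) v)) (\<lambda>p. (z ^ n - w ^ n) * ap (fps_nth a n) v p)"
      by (intro nb_cmult nb_nrm bd_V[OF ell_bd[OF a] v])
    have 2: "cmod (z ^ n - w ^ n) * nrm (ap (fps_nth a n) v) \<le> cmod (z ^ n - w ^ n) * (x n * nrm v)"
      by (intro mult_left_mono bd_nrm[OF ell_bd[OF a] v]) simp
    from nb_mono[OF 1 2] show "nb (cmod (z ^ n - w ^ n) * x n * nrm v) (\<lambda>p. (z ^ n - w ^ n) * ap (fps_nth a n) v p)"
      by (simp only: mult.assoc)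
  qed
  from nrm_le[OF this] have 3: "nrm (\<lambda>p. \<Sum>n. (z ^ n - w ^ n) * ap (fps_nth a n) v p) \<le> (\<Sum>n. cmod (z ^ n - w ^ n) * x n) * nrm v"
    using suminf_mult2[OF s, of "nrm v"] by simp
  have "nrm (ev a z v - ev a w v) = nrm (\<lambda>p. \<Sum>n. (z ^ n - w ^ n) * ap (fps_nth a n) v p)"
  proof (rule nrm_cong)
    fix p assume p: "p \<in> \<Omega>"
    have "ev a z v p - ev a w v p = (\<Sum>n. z ^ n * ap (fps_nth a n) v p - w ^ n * ap (fps_nth a n) v p)"
      unfolding ev_def by (rule suminf_diff[OF summable_norm_cancel[OF ell_summable[OF a v p z]] summable_norm_cancel[OF ell_summable[OF a v p w]]])
    then show "(ev a z v - ev a w v) p = (\<Sum>n. (z ^ n - w ^ n) * ap (fps_nth a n) v p)"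
      by (simp only: minus_apply left_diff_distrib)
  qed
  then show "nrm (ev a z v - ev a w v) \<le> (\<Sum>n. cmod (z ^ n - w ^ n) * x n) * nrm v" using 3 by simp
qed

text \<open>The operators a(z) depend continuously on z because the coefficient bounds are summable,
  so a lower bound at w persists near w. Compactness of the closed disc does the rest, by
  contradiction along a convergent sequence of bad points.\<close>

lemma (in lip_space) ev_lower_uniform:
  assumes a: "ell a x" and lower: "\<And>z. cmod z \<le> 1 \<Longrightarrow> \<exists>K. \<forall>v\<in>V. nrm v \<le> K * nrm (ev a z v)"
  shows "\<exists>K. \<forall>z v. cmod z \<le> 1 \<longrightarrow> v \<in> V \<longrightarrow> nrm v \<le> K * nrm (ev a z v)"
proof (rule ccontr)
  assume neg: "\<not> ?thesis"
  have "\<exists>z v. cmod z \<le> 1 \<and> v \<in> V \<and> nrm v > real k * nrm (ev a z v)" for k :: nat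
    using neg by (meson not_le)
  then obtain z v where zv: "\<And>k :: nat. cmod (z k) \<le> 1" "\<And>k. v k \<in> V" "\<And>k. nrm (v k) > real k * nrm (ev a (z k) (v k))"
    by metis
  have "\<forall>k. z k \<in> cball 0 1" using zv(1) by simp
  then obtain w \<kappa> where w: "w \<in> cball 0 1" "strict_mono (\<kappa> :: nat \<Rightarrow> nat)" "(z \<circ> \<kappa>) \<longlonglongrightarrow> w"
    using compact_cball[of "0::complex" 1] unfolding compact_def by metis
  then have w1: "cmod w \<le> 1" by simp
  obtain K0 where K0: "\<And>v. v \<in> V \<Longrightarrow> nrm v \<le> K0 * nrm (ev a w v)" using lower[OF w1] by blast
  define K where "K = max K0 1"
  have x0: "0 \<le> x n" for n by (rule ell_nonneg[OF a])
  have xs: "summable x" using a by (simp add: ell_def)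
  define h where "h k = (\<Sum>n. cmod (z (\<kappa> k) ^ n - w ^ n) * x n)" for k
  have "h \<longlonglongrightarrow> 0"
  proof (rule LIMSEQ_I)
    fix e :: real assume e: "e > 0"
    have "(\<lambda>N. \<Sum>n. x (n + N)) \<longlonglongrightarrow> 0" by (rule suminf_exist_split2[OF xs])
    then have "\<forall>\<^sub>F N in sequentially. (\<Sum>n. x (n + N)) < e / 4" using e by (intro order_tendstoD(2)) auto
    then obtain N where N: "(\<Sum>n. x (n + N)) < e / 4" by (auto simp: eventually_sequentially)
    have "(\<lambda>k. \<Sum>n<N. cmod (z (\<kappa> k) ^ n - w ^ n) * x n) \<longlonglongrightarrow> (\<Sum>n<N. cmod (w ^ n - w ^ n) * x n)"
      using w(3) unfolding o_def by (intro tendsto_intros)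
    then have "(\<lambda>k. \<Sum>n<N. cmod (z (\<kappa> k) ^ n - w ^ n) * x n) \<longlonglongrightarrow> 0" by simp
    then have "\<forall>\<^sub>F k in sequentially. (\<Sum>n<N. cmod (z (\<kappa> k) ^ n - w ^ n) * x n) < e / 2" using e by (intro order_tendstoD(2)) auto
    then obtain k0 where k0: "\<And>k. k \<ge> k0 \<Longrightarrow> (\<Sum>n<N. cmod (z (\<kappa> k) ^ n - w ^ n) * x n) < e / 2" by (auto simp: eventually_sequentially)
    have "norm (h k - 0) < e" if k: "k \<ge> k0" for k
    proof -
      let ?t = "\<lambda>n. cmod (z (\<kappa> k) ^ n - w ^ n) * x n"
      have st: "summable ?t" by (rule ev_diff_z(1)[OF a zv(2) zv(1) w1])
      have le2: "?t n \<le> 2 * x n" for n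
      proof (rule mult_right_mono[OF _ x0])
        show "cmod (z (\<kappa> k) ^ n - w ^ n) \<le> 2"
          using norm_triangle_ineq4[of "z (\<kappa> k) ^ n" "w ^ n"] power_le_one[OF norm_ge_zero zv(1), of "\<kappa> k" n] power_le_one[OF norm_ge_zero w1, of n]
          by (simp add: norm_power)
      qed
      have t1: "summable (\<lambda>n. ?t (n + N))" by (rule summable_ignore_initial_segment[OF st])
      have t2: "summable (\<lambda>n. x (n + N))" by (rule summable_ignore_initial_segment[OF xs])
      have "h k = (\<Sum>n. ?t (n + N)) + (\<Sum>n<N. ?t n)" unfolding h_def by (rule suminf_split_initial_segment[OF st])
      also have "(\<Sum>n. ?t (n + N)) \<le> (\<Sum>n. 2 * x (n + N))" by (rule suminf_le[OF le2 t1 summable_mult[OF t2]])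
      also have "\<dots> = 2 * (\<Sum>n. x (n + N))" by (rule suminf_mult[OF t2])
      finally have "h k < e" using N k0[OF k] by linarith
      moreover have "0 \<le> h k" unfolding h_def by (rule suminf_nonneg[OF st]) (intro mult_nonneg_nonneg x0 norm_ge_zero)
      ultimately show ?thesis by simp
    qed
    then show "\<exists>k0. \<forall>k\<ge>k0. norm (h k - 0) < e" by blast
  qed
  \<comment> \<open>With this margin the perturbation costs at most half of \<open>nrm u\<close>,
    which is absorbed on the left.\<close>
  then have "\<forall>\<^sub>F k in sequentially. h k < 1 / (2 * K)" by (intro order_tendstoD(2)) (auto simp: K_def)
  then obtain k1 where k1: "\<And>k. k \<ge> k1 \<Longrightarrow> h k < 1 / (2 * K)" by (auto simp: eventually_sequentially)
  obtain k2 :: nat where k2: "real k2 \<ge> 2 * K" using real_arch_simple by blast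
  define k where "k = max k1 k2"
  define u where "u = v (\<kappa> k)"
  have uV: "u \<in> V" by (simp add: u_def zv)
  let ?E = "ev a (z (\<kappa> k)) u"
  have EV: "?E \<in> V" by (rule ev_V[OF a uV zv(1)])
  have EwV: "ev a w u \<in> V" by (rule ev_V[OF a uV w1])
  have K1: "K \<ge> 1" by (simp add: K_def)
  have n0: "0 \<le> nrm u" "0 \<le> nrm ?E" using nrm_nonneg uV EV by auto
  have "nrm u \<le> K0 * nrm (ev a w u)" by (rule K0[OF uV])
  also have "\<dots> \<le> K * nrm (ev a w u)" by (intro mult_right_mono nrm_nonneg[OF EwV]) (simp add: K_def)
  also have "\<dots> \<le> K * (nrm ?E + nrm (ev a w u - ?E))" using K1 nrm_diff_ge[OF EwV EV] by (intro mult_left_mono) auto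
  also have "\<dots> \<le> K * (nrm ?E + h k * nrm u)"
  proof -
    have "nrm (ev a w u - ?E) = nrm (- (?E - ev a w u))" by (simp add: fun_eq_iff)
    also have "\<dots> \<le> nrm (?E - ev a w u)" by (rule nrm_uminus[OF V_diff[OF EV EwV]])
    also have "\<dots> \<le> h k * nrm u" unfolding h_def by (rule ev_diff_z(2)[OF a uV zv(1) w1])
    finally show ?thesis using K1 by (intro mult_left_mono add_left_mono) auto
  qed
  also have "\<dots> \<le> K * (nrm ?E + 1 / (2 * K) * nrm u)"
    using k1[of k] K1 n0 by (intro mult_left_mono add_left_mono mult_right_mono) (auto simp: k_def intro: less_imp_le)
  also have "\<dots> = K * nrm ?E + nrm u / 2" using K1 by (simp add: distrib_left)
  finally have "nrm u \<le> 2 * K * nrm ?E" by simp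
  also have "\<dots> \<le> real (\<kappa> k) * nrm ?E"
  proof (rule mult_right_mono[OF _ n0(2)])
    have "k2 \<le> \<kappa> k" using seq_suble[OF w(2), of k] by (simp add: k_def)
    then have "real k2 \<le> real (\<kappa> k)" by simp
    then show "2 * K \<le> real (\<kappa> k)" using k2 by linarith
  qed
  finally show False using zv(3)[of "\<kappa> k"] by (simp add: u_def)
qed

section \<open>The lower bound at z = 1 and the expansion of T\<close>

context renewal
begin

lemma phibar_pos: "phibar > 0"
proof -
  have "\<tau> 0 = 1"
  proof -
    have "measure \<mu> {x \<in> space \<mu>. \<phi> x > 0} = measure \<mu> (space \<mu>)"
    proof (rule finite_measure_eq_AE[OF _ level_sets])
      show "AE x in \<mu>. (x \<in> {x \<in> space \<mu>. 0 < \<phi> x}) = (x \<in> space \<mu>)"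
        using Om_AE by eventually_elim (use phi_pos in fastforce)
    qed simp
    then show ?thesis by (simp add: \<tau>_def prob_space)
  qed
  then show ?thesis unfolding phibar_def using suminf_pos2[OF ts.tau_sum tau_nonneg, of 0] by simp
qed

text \<open>At z = 1, B v is A1(1) P v + (1 - R)(1 - P) v. Integration kills the second summand and
  multiplies the mean of v by \<open>phibar\<close>, so B v controls the mean since
  \<open>phibar\<close> is positive. What remains is v - R v, and there the spectral gap
  applies.\<close>

lemma lower_one: "\<exists>K. \<forall>v\<in>V. nrm v \<le> K * nrm (ev B 1 v)"
proof -
  obtain K where K: "K > 0" "\<And>v. v \<in> V \<Longrightarrow> nrm v \<le> K * (nrm (v - R v) + cmod (\<integral>x. v x \<partial>\<mu>))"
    using bounded_below by blast
  obtain xB where xB: "wt B xB" using wt_B by blast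
  let ?L = "(\<Sum>n. 2 * C\<^sub>1 * C\<^sub>\<tau> * q n)"
  have L0: "0 \<le> ?L" using C1 Ct q_pos q_sum by (intro suminf_nonneg summable_mult mult_nonneg_nonneg) (auto intro: less_imp_le)
  have "nrm v \<le> (K * (1 + ?L / phibar + 1 / phibar)) * nrm (ev B 1 v)" if v: "v \<in> V" for v
  proof -
    let ?c = "\<integral>x. v x \<partial>\<mu>" and ?u = "ev B 1 v" and ?Pv = "ap P0 v" and ?o = "ap (1 - P0) v"
    have one: "cmod 1 \<le> 1" by simp
    have PvV: "?Pv \<in> V" by (rule bd_V[OF bd_P0 v])
    have oV: "?o \<in> V" by (rule bd_V[OF bd_1P v])
    have uV: "?u \<in> V" by (rule ev_V[OF wt_ell[OF xB] v one])
    let ?g = "ev A1 1 ?Pv"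
    have gV: "?g \<in> V" by (rule ev_V[OF wt_ell[OF wt_A1] PvV one])
    have up: "?u p = ?g p + (?o p - R ?o p)" if p: "p \<in> \<Omega>" for p
    proof -
      have w1: "wt (A1 * P) (CW * (2 * C\<^sub>1 * C\<^sub>\<tau>) * 1)" by (rule wt_mult[OF wt_A1 wt_const[OF bd_P0]])
      have w2: "wt (Rz * fps_const (1 - P0)) (CW * (2 * C\<^sub>1 * (2 powr \<beta> * C\<^sub>\<tau>)) * 2)" by (rule wt_mult[OF wt_Rz wt_const[OF bd_1P]])
      have "?u p = ev (A1 * P) 1 v p + ev (fps_const (1 - P0)) 1 v p - ev (Rz * fps_const (1 - P0)) 1 v p"
        unfolding B_eq ev_diff[OF wt_ell[OF wt_add[OF w1 wt_const[OF bd_1P]]] wt_ell[OF w2] v one p]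
          ev_add[OF wt_ell[OF w1] wt_ell[OF wt_const[OF bd_1P]] v one p] by (rule refl)
      also have "ev (A1 * P) 1 v p = ?g p"
        using ev_mult[OF wt_ell[OF wt_A1] wt_ell[OF wt_const[OF bd_P0]] v one p] by (simp only: ev_const)
      also have "ev (Rz * fps_const (1 - P0)) 1 v p = R ?o p"
        using ev_mult[OF wt_ell[OF wt_Rz] wt_ell[OF wt_const[OF bd_1P]] v one p] ev_Rz[OF oV one p]
        by (simp only: ev_const power_one mult_1_left)
      finally show ?thesis by (simp add: ev_const)
    qed
    have gint: "(\<integral>x. ?g x \<partial>\<mu>) = of_real phibar * ?c"
    proof -
      have y: "y0 \<in> \<Omega>" by (rule y0)
      have "(\<lambda>m. 1 ^ m * ap (P0 * fps_nth A1 m) ?Pv y0) sums ap P0 ?g y0"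
        by (rule ap_ev[OF bd_P0 wt_ell[OF wt_A1] PvV one y])
      moreover have "1 ^ m * ap (P0 * fps_nth A1 m) ?Pv y0 = of_real (\<tau> m) * ?c" for m
      proof -
        have "ap (P0 * fps_nth A1 m) ?Pv = ap (P0 * RN {m<..} * P0) v" by (simp only: A1_def fps_nth_Abs_fps ap_simps)
        then show ?thesis using y unfolding P0_tail_P0 by (simp add: ap_P0[OF v])
      qed
      ultimately have "(\<lambda>m. of_real (\<tau> m) * ?c) sums ap P0 ?g y0" by simp
      moreover have "(\<lambda>m. complex_of_real (\<tau> m) * ?c) sums (of_real phibar * ?c)"
        using sums_mult2[OF sums_of_real[OF summable_sums[OF ts.tau_sum]], of ?c] by (simp add: phibar_def)
      ultimately have "ap P0 ?g y0 = of_real phibar * ?c" by (rule sums_unique2)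
      then show ?thesis using y by (simp add: ap_P0[OF gV])
    qed
    have uint: "(\<integral>x. ?u x \<partial>\<mu>) = of_real phibar * ?c"
    proof -
      have "(\<integral>x. ?u x \<partial>\<mu>) = (\<integral>x. ?g x + (?o x - R ?o x) \<partial>\<mu>)"
      proof (rule integral_cong_AE)
        show "?u \<in> borel_measurable \<mu>" by (rule V_meas[OF uV])
        show "(\<lambda>x. ?g x + (?o x - R ?o x)) \<in> borel_measurable \<mu>"
          by (intro borel_measurable_add borel_measurable_diff V_meas[OF gV] V_meas[OF oV] V_meas[OF R_V(1)[OF oV]])
        show "AE x in \<mu>. ?u x = ?g x + (?o x - R ?o x)" using Om_AE by eventually_elim (rule up)
      qed
      also have "\<dots> = (\<integral>x. ?g x \<partial>\<mu>) + ((\<integral>x. ?o x \<partial>\<mu>) - (\<integral>x. R ?o x \<partial>\<mu>))"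
        by (subst Bochner_Integration.integral_add[OF V_integrable[OF gV] Bochner_Integration.integrable_diff[OF V_integrable[OF oV] V_integrable[OF R_V(1)[OF oV]]]],
            subst Bochner_Integration.integral_diff[OF V_integrable[OF oV] V_integrable[OF R_V(1)[OF oV]]]) (rule refl)
      also have "\<dots> = of_real phibar * ?c" unfolding gint R_integral(2)[OF V_integrable[OF oV]] by (simp only: diff_self add_0_right)
      finally show ?thesis .
    qed
    have cb: "cmod ?c \<le> nrm ?u / phibar"
      using V_integral_le[OF uV] phibar_pos unfolding uint by (simp add: norm_mult field_simps)
    have gb: "nrm ?g \<le> ?L * cmod ?c"
    proof -
      have "nrm ?g \<le> ?L * nrm ?Pv" by (rule ev_nrm[OF wt_ell[OF wt_A1] PvV one])
      also have "\<dots> \<le> ?L * cmod ?c" unfolding ap_P0[OF v] by (intro mult_left_mono ind_nrm L0)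
      finally show ?thesis .
    qed
    have "nrm (v - R v) = nrm (?u - ?g)"
    proof (rule nrm_cong)
      fix p assume p: "p \<in> \<Omega>"
      have "R ?o p = R v p - R ?Pv p" using R_diff_V[OF v PvV p] by simp
      moreover have "R ?Pv p = ?Pv p"
      proof -
        have "ap (RN UNIV * P0) v = R ?Pv" by (simp add: ap_RN[OF PvV] cut_def)
        then show ?thesis by (simp only: R_P0)
      qed
      ultimately show "(v - R v) p = (?u - ?g) p" using up[OF p] by simp
    qed
    also have "\<dots> \<le> nrm ?u + nrm ?g" by (rule nrm_diff[OF uV gV])
    also have "\<dots> \<le> nrm ?u + ?L * (nrm ?u / phibar)" using gb mult_left_mono[OF cb L0] by linarith
    finally have "nrm (v - R v) + cmod ?c \<le> nrm ?u + ?L * (nrm ?u / phibar) + nrm ?u / phibar" using cb by linarith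
    then have "K * (nrm (v - R v) + cmod ?c) \<le> K * (nrm ?u + ?L * (nrm ?u / phibar) + nrm ?u / phibar)"
      using K by (intro mult_left_mono) auto
    also have "\<dots> = (K * (1 + ?L / phibar + 1 / phibar)) * nrm ?u" by (simp add: algebra_simps)
    finally show ?thesis using K(2)[OF v] by linarith
  qed
  then show ?thesis by blast
qed

lemma wt_b: "\<exists>y. wt b y"
proof -
  obtain x where x: "wt B x" using wt_B by blast
  have "\<exists>K. \<forall>z v. cmod z \<le> 1 \<longrightarrow> v \<in> V \<longrightarrow> nrm v \<le> K * nrm (ev B z v)"
  proof (rule ev_lower_uniform[OF wt_ell[OF x]])
    fix z :: complex assume "cmod z \<le> 1"
    then show "\<exists>K. \<forall>v\<in>V. nrm v \<le> K * nrm (ev B z v)" using lower_away lower_one by (cases "z = 1") auto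
  qed
  then obtain K where "\<And>z v. cmod z \<le> 1 \<Longrightarrow> v \<in> V \<Longrightarrow> nrm v \<le> K * nrm (ev B z v)" by blast
  then show ?thesis by (rule wiener_inverse[OF x bd_b B_b b_B])
qed

definition cF :: "complex fps \<Rightarrow> 'a endo fps" where "cF f = Abs_fps (\<lambda>n. cm (fps_nth f n))"

lemma cF_mult: "cF (f * g) = cF f * cF g"
  by (rule fps_ext) (simp add: cF_def fps_mult_nth cm_sum cm_mult)

lemma cF_X: "cF (1 - fps_X) = D"
  by (rule fps_ext) (simp add: cF_def cm_diff cm_0 cm_1 D_def fps_X_def fps_const_def)

definition tF :: "complex fps" where "tF = Abs_fps (\<lambda>n. of_real (ts.t n))"
text \<open>The part of the tail series that feeds the complement of the constants into the
  constants, P A1(z) (1 - P).\<close>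

definition GF :: "'a endo fps" where "GF = Abs_fps (\<lambda>n. P0 * RN {n<..} * (1 - P0))"

lemma tFD_nth: "fps_nth ((1 - fps_X) * tF) n = (if n = 0 then of_real (ts.t 0) else of_real (- \<tau> n))"
proof (cases n)
  case (Suc k)
  then show ?thesis using ts.t_step[of k] by (simp add: tF_def left_diff_distrib)
qed (simp add: tF_def left_diff_distrib)

lemma tFtD_nth: "fps_nth (tF * ((1 - fps_X) * tF)) n = of_real (ts.S n)"
proof -
  have "fps_nth (((1 - fps_X) * tF) * tF) n = (\<Sum>i=0..n. (if i = 0 then of_real (ts.t 0) else of_real (- \<tau> i)) * of_real (ts.t (n - i)))"
    unfolding fps_mult_nth[of "(1 - fps_X) * tF"] tFD_nth by (simp add: tF_def)
  also have "\<dots> = of_real (ts.t 0) * of_real (ts.t n) + (\<Sum>i=Suc 0..n. of_real (- \<tau> i) * of_real (ts.t (n - i)))"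
    by (subst sum.atLeast_Suc_atMost) (auto intro!: sum.cong)
  also have "\<dots> = of_real (ts.S n)" by (simp add: ts.S_def sum_negf)
  finally show ?thesis by (simp only: mult.commute)
qed

text \<open>On constants P B is the generating function of \<tau>, which equals phibar - (1-z) t(z).
  On the complement it is - P R(z) (1 - P) = (1-z) G(z), because P R(1) (1 - P) = 0.\<close>

lemma PB_eq: "P * B = fps_const (cm (of_real phibar)) * P - cF tF * D * P + D * GF"
proof (rule fps_ext)
  fix n
  have PT: "P0 * (1 - P0) = 0" by (simp add: right_diff_distrib P0_P0)
  have l: "fps_nth (P * B) n = cm (of_real (\<tau> n)) * P0 - P0 * RN {n} * (1 - P0)"
  proof -
    have "fps_nth B n = RN {n<..} * P0 + (if n = 0 then 1 - P0 else 0) - RN {n} * (1 - P0)"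
      by (simp add: B_eq A1_def Rz_def)
    then have "fps_nth (P * B) n = P0 * RN {n<..} * P0 + (if n = 0 then P0 * (1 - P0) else 0) - P0 * RN {n} * (1 - P0)"
      by (simp add: distrib_left right_diff_distrib mult.assoc)
    then show ?thesis by (simp add: PT P0_tail_P0)
  qed
  have r1: "fps_nth (cF tF * D * P) n = cm (if n = 0 then of_real (ts.t 0) else of_real (- \<tau> n)) * P0"
  proof -
    have "cF tF * D = cF ((1 - fps_X) * tF)" by (simp only: cF_mult cF_X D_comm)
    then have "fps_nth (cF tF * D * P) n = fps_nth (cF ((1 - fps_X) * tF)) n * P0" by simp
    then show ?thesis by (simp only: cF_def fps_nth_Abs_fps tFD_nth)
  qed
  have r2: "fps_nth (D * GF) n = - (P0 * RN {n} * (1 - P0))"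
  proof (cases n)
    case 0
    have "RN UNIV = RN {0<..}" using RN_split[of 0] RN_0 by simp
    then have "P0 * RN {0<..} = P0" using P0_R by simp
    then show ?thesis using 0 by (simp add: D_nth GF_def RN_0 PT)
  next
    case (Suc k)
    have "{k<..} = {n} \<union> {n<..}" using Suc by auto
    then have "RN {k<..} = RN {n} + RN {n<..}" by (simp only:) (rule RN_Un, auto)
    then show ?thesis using Suc by (simp add: D_nth GF_def distrib_left distrib_right)
  qed
  have r0: "fps_nth (fps_const (cm (of_real phibar)) * P) n = cm (if n = 0 then of_real phibar else 0) * P0"
    by (simp only: fps_mult_left_const_nth fps_nth_fps_const) (simp add: cm_0)
  have pb: "phibar = \<tau> 0 + ts.t 0" unfolding phibar_def by (rule ts.t_init)
  show "fps_nth (P * B) n = fps_nth (fps_const (cm (of_real phibar)) * P - cF tF * D * P + D * GF) n"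
    unfolding fps_add_nth fps_sub_nth l r0 r1 r2 using pb
    by (simp add: left_diff_distrib[symmetric] cm_diff[symmetric])
qed

text \<open>The first summand is the second order term in (1-z) t(z) and carries the rate d_n; in
  the others all factors have coefficients O(n^(-\<beta>)).\<close>

definition E :: "'a endo fps" where
  "E = fps_const (cm (of_real (1 / phibar\<^sup>2))) * (cF tF * (cF tF * D)) * (P * b)
     - fps_const (cm (of_real (1 / phibar\<^sup>2))) * (cF tF * D) * (GF * b)
     - fps_const (cm (of_real (1 / phibar))) * (GF * b) + (1 - P) * b"

text \<open>T is recovered as (P J + 1 - P) b. The relation P = (P B) b is solved for P b, which
  still occurs on the right with the small factor (1-z) t(z). Multiplying by J cancels 1 - z in the
  correction terms, and a second substitution then isolates the two leading terms.\<close>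

lemma T_eq: "T = fps_const (cm (of_real (1 / phibar))) * (P * J)
    + fps_const (cm (of_real (1 / phibar\<^sup>2))) * (cF tF * P) + E"
proof -
  let ?i = "fps_const (cm (of_real (1 / phibar))) :: 'a endo fps" and ?f = "fps_const (cm (of_real phibar)) :: 'a endo fps"
  let ?t = "cF tF"
  have if1: "?i * ?f = 1" using phibar_pos by (simp add: cm_mult[symmetric] cm_1)
  have ii: "?i * ?i = fps_const (cm (of_real (1 / phibar\<^sup>2)))" by (simp add: cm_mult[symmetric] power2_eq_square)
  have ci: "?i * f = f * ?i" for f :: "'a endo fps" by (rule fps_ext) (simp add: cm_commute)
  have Jc: "J * f = f * J" for f :: "'a endo fps"
  proof -
    have "J * f = J * (f * D) * J" by (simp add: mult.assoc DJ)
    also have "\<dots> = J * (D * f) * J" by (simp only: D_comm)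
    also have "\<dots> = (J * D) * f * J" by (simp only: mult.assoc)
    finally show ?thesis by (simp add: JD)
  qed
  have Pb: "P * b = ?i * (P + ?t * D * (P * b) - D * (GF * b))"
  proof -
    have "P = (P * B) * b" by (simp add: mult.assoc B_b)
    also have "\<dots> = ?f * (P * b) - ?t * D * (P * b) + D * (GF * b)"
      unfolding PB_eq by (simp only: distrib_right left_diff_distrib mult.assoc)
    finally have "P + ?t * D * (P * b) - D * (GF * b) = ?f * (P * b)" by (simp add: algebra_simps)
    then have "?i * (P + ?t * D * (P * b) - D * (GF * b)) = (?i * ?f) * (P * b)" by (simp only: mult.assoc)
    then show ?thesis by (simp only: if1 mult_1_left)
  qed
  have "T = (P * J + 1 - P) * b"
  proof -
    have "(P * J + 1 - P) * b = ((P * J + 1 - P) * (P * D + 1 - P)) * T" by (simp only: b_def mult.assoc)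
    then show ?thesis by (simp only: DB_inv mult_1_left)
  qed
  also have "\<dots> = (P * b) * J + (1 - P) * b"
  proof -
    have "P * J * b = P * b * J" by (simp only: mult.assoc Jc[of b])
    then show ?thesis by (simp only: distrib_right left_diff_distrib mult_1_left add_diff_eq)
  qed
  also have "(P * b) * J = ?i * (P * J + ?t * (P * b) - GF * b)"
  proof -
    have 1: "?t * D * (P * b) * J = ?t * (P * b)"
    proof -
      have "?t * D * (P * b) * J = ?t * (D * (P * b)) * J" by (simp only: mult.assoc)
      also have "\<dots> = ?t * (P * b) * (D * J)" by (simp only: D_comm[of "P * b"] mult.assoc)
      finally show ?thesis by (simp only: DJ mult_1_right)
    qed
    have 2: "D * (GF * b) * J = GF * b"
    proof -
      have "D * (GF * b) * J = GF * b * (D * J)" by (simp only: D_comm[of "GF * b"] mult.assoc)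
      then show ?thesis by (simp only: DJ mult_1_right)
    qed
    have "(P * b) * J = ?i * (P + ?t * D * (P * b) - D * (GF * b)) * J" by (subst Pb) (rule refl)
    also have "\<dots> = ?i * (P * J + ?t * D * (P * b) * J - D * (GF * b) * J)"
      by (simp only: mult.assoc distrib_right left_diff_distrib)
    finally show ?thesis by (simp only: 1 2)
  qed
  \<comment> \<open>The second substitution: it produces the term t(z) P and leaves (1-z) t(z)^2 P b
    for the remainder.\<close>
  also have "?t * (P * b) = ?i * (?t * P + ?t * (?t * D) * (P * b) - ?t * D * (GF * b))"
  proof -
    have "?t * (P * b) = ?t * (?i * (P + ?t * D * (P * b) - D * (GF * b)))" by (subst Pb) (rule refl)
    also have "\<dots> = ?i * (?t * (P + ?t * D * (P * b) - D * (GF * b)))" by (simp only: mult.assoc[symmetric] ci[of ?t])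
    finally show ?thesis by (simp only: distrib_left right_diff_distrib mult.assoc)
  qed
  finally have "T = ?i * (P * J + ?i * (?t * P + ?t * (?t * D) * (P * b) - ?t * D * (GF * b)) - GF * b) + (1 - P) * b" .
  also have "\<dots> = ?i * (P * J) + (?i * ?i) * (?t * P) + ((?i * ?i) * (?t * (?t * D)) * (P * b)
      - (?i * ?i) * (?t * D) * (GF * b) - ?i * (GF * b) + (1 - P) * b)"
    by (simp only: distrib_left right_diff_distrib mult.assoc) (simp only: algebra_simps)
  finally show ?thesis unfolding ii E_def .
qed

text \<open>Everything but the first summand is a product in the weighted algebra and decays like
  n^(-\<beta>). The first is the convolution of the sequence \<open>ts.S\<close> with the
  coefficients of P b, estimated by \<open>conv_qq_dd\<close>.\<close>

lemma E_bound: "\<exists>C. \<forall>n. bd (fps_nth E n) (C * ts.dd n)"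
proof -
  obtain y where y: "wt b y" using wt_b by blast
  obtain Cq where Cq: "Cq > 0" "\<And>n. ts.qq n \<le> Cq * ts.dd n" using ts.qq_dd by blast
  obtain CS where CS: "CS > 0" "\<And>n. \<bar>ts.S n\<bar> \<le> CS * ts.dd n" using ts.S_bound by blast
  obtain Cc where Cc: "Cc > 0" "\<And>n. (\<Sum>i=0..n. ts.qq i * ts.dd (n - i)) \<le> Cc * ts.dd n" using ts.conv_qq_dd by blast
  have wG: "wt GF (2 * C\<^sub>1 * C\<^sub>\<tau> * 2)"
  proof -
    have "bd (P0 * RN {n<..} * (1 - P0)) (1 * (2 * C\<^sub>1 * C\<^sub>\<tau> * q n) * 2)" for n
      using wt_bd[OF wt_A1, of n] by (intro bd_mult bd_P0 bd_1P) (simp add: A1_def)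
    then show ?thesis using C1 Ct by (simp add: wt_def GF_def mult_ac)
  qed
  have wGb: "\<exists>x. wt (GF * b) x" and wPb: "\<exists>x. wt (P * b) x" and wQb: "\<exists>x. wt ((1 - P) * b) x"
    using wt_mult[OF wG y] wt_mult[OF wt_const[OF bd_P0] y] wt_mult[OF wt_diff[OF wt_1 wt_const[OF bd_P0]] y] by blast+
  have wtD: "wt (cF tF * D) (max (ts.t 0) C\<^sub>\<tau>)"
  proof -
    have e: "cF tF * D = cF ((1 - fps_X) * tF)" by (simp only: cF_mult cF_X D_comm)
    have "bd (fps_nth (cF tF * D) n) (max (ts.t 0) C\<^sub>\<tau> * q n)" for n
    proof (cases "n = 0")
      case True
      have "bd (cm (of_real (ts.t 0))) (cmod (of_real (ts.t 0)))" by (rule bd_cm)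
      then have "bd (cm (of_real (ts.t 0))) (ts.t 0)" using ts.t_nonneg[of 0] by simp
      from bd_mono[OF this, of "max (ts.t 0) C\<^sub>\<tau> * q n"] show ?thesis
        unfolding e unfolding cF_def fps_nth_Abs_fps tFD_nth using True by (simp add: q0)
    next
      case False
      have "bd (cm (of_real (- \<tau> n))) (cmod (of_real (- \<tau> n)))" by (rule bd_cm)
      moreover have "cmod (of_real (- \<tau> n)) \<le> max (ts.t 0) C\<^sub>\<tau> * q n"
      proof -
        have "\<tau> n \<le> C\<^sub>\<tau> * q n" using ts.tau_le[of n] by (simp only: q_qq)
        also have "\<dots> \<le> max (ts.t 0) C\<^sub>\<tau> * q n" using q_pos[of n] by (intro mult_right_mono) auto
        finally show ?thesis using tau_nonneg[of n] by simp
      qed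
      ultimately have "bd (cm (of_real (- \<tau> n))) (max (ts.t 0) C\<^sub>\<tau> * q n)" by (rule bd_mono)
      then show ?thesis unfolding e unfolding cF_def fps_nth_Abs_fps tFD_nth using False by (simp only: if_False)
    qed
    then show ?thesis using Ct by (simp add: wt_def)
  qed
  obtain x1 where x1: "wt (P * b) x1" using wPb by blast
  obtain x2 where x2: "wt (GF * b) x2" using wGb by blast
  obtain x3 where x3: "wt ((1 - P) * b) x3" using wQb by blast
  let ?k1 = "fps_const (cm (of_real (1 / phibar))) :: 'a endo fps" and ?k2 = "fps_const (cm (of_real (1 / phibar\<^sup>2))) :: 'a endo fps"
  obtain x4 where x4: "wt (?k2 * (cF tF * D) * (GF * b)) x4" using wt_mult[OF wt_mult[OF wt_const[OF bd_cm] wtD] x2] by blast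
  obtain x5 where x5: "wt (?k1 * (GF * b)) x5" using wt_mult[OF wt_const[OF bd_cm] x2] by blast
  have S: "bd (fps_nth (cF tF * (cF tF * D)) n) (CS * ts.dd n)" for n
  proof -
    have "cF tF * (cF tF * D) = cF (tF * ((1 - fps_X) * tF))" by (simp only: cF_mult cF_X D_comm)
    then have "fps_nth (cF tF * (cF tF * D)) n = cm (of_real (ts.S n))" by (simp only: cF_def fps_nth_Abs_fps tFtD_nth)
    moreover have "bd (cm (of_real (ts.S n))) \<bar>ts.S n\<bar>" using bd_cm[of "of_real (ts.S n)"] by simp
    ultimately show ?thesis using bd_mono[OF _ CS(2)] by simp
  qed
  have S1: "bd (fps_nth ((cF tF * (cF tF * D)) * (P * b)) n) (CS * x1 * Cc * ts.dd n)" for n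
  proof (rule bd_mono[OF bd_fps_mult[OF S wt_bd[OF x1]]])
    have "(\<Sum>i=0..n. CS * ts.dd i * (x1 * q (n - i))) = CS * x1 * (\<Sum>i=0..n. ts.dd i * ts.qq (n - i))"
      by (simp add: sum_distrib_left q_qq mult_ac)
    also have "(\<Sum>i=0..n. ts.dd i * ts.qq (n - i)) = (\<Sum>i=0..n. ts.qq i * ts.dd (n - i))"
      by (rule sum.reindex_bij_witness[of _ "\<lambda>i. n - i" "\<lambda>i. n - i"]) (auto simp: mult.commute)
    also have "CS * x1 * \<dots> \<le> CS * x1 * (Cc * ts.dd n)" using CS wt_nonneg[OF x1] Cc(2)[of n] by (intro mult_left_mono) auto
    finally show "(\<Sum>i=0..n. CS * ts.dd i * (x1 * q (n - i))) \<le> CS * x1 * Cc * ts.dd n" by (simp only: mult.assoc)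
  qed
  let ?c2 = "cmod (of_real (1 / phibar\<^sup>2))"
  have S2: "bd (fps_nth (?k2 * (cF tF * (cF tF * D)) * (P * b)) n) (?c2 * (CS * x1 * Cc * ts.dd n))" for n
    unfolding mult.assoc[of ?k2] fps_mult_left_const_nth by (rule bd_mult[OF bd_cm S1])
  have qd: "x * q n \<le> x * (Cq * ts.dd n)" if "0 \<le> x" for x n using that Cq by (intro mult_left_mono) (auto simp: q_qq)
  have "bd (fps_nth E n) ((?c2 * (CS * x1 * Cc) + (x4 + x5 + x3) * Cq) * ts.dd n)" for n
  proof -
    have "bd (fps_nth E n) (?c2 * (CS * x1 * Cc * ts.dd n) + x4 * q n + x5 * q n + x3 * q n)"
      unfolding E_def fps_add_nth fps_sub_nth by (intro bd_add bd_diff S2 wt_bd[OF x4] wt_bd[OF x5] wt_bd[OF x3])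
    moreover have "?c2 * (CS * x1 * Cc * ts.dd n) + x4 * q n + x5 * q n + x3 * q n \<le> (?c2 * (CS * x1 * Cc) + (x4 + x5 + x3) * Cq) * ts.dd n"
      using qd[OF wt_nonneg[OF x4], of n] qd[OF wt_nonneg[OF x5], of n] qd[OF wt_nonneg[OF x3], of n]
      unfolding distrib_right mult.assoc by linarith
    ultimately show ?thesis by (rule bd_mono)
  qed
  then show ?thesis by blast
qed

theorem T_expansion:
  "\<exists>C. \<forall>n. \<exists>A. fps_nth T n = cm (of_real (1 / phibar)) * P0 + cm (of_real (ts.t n / phibar\<^sup>2)) * P0 + A \<and> bd A (C * ts.dd n)"
proof -
  obtain C where C: "\<And>n. bd (fps_nth E n) (C * ts.dd n)" using E_bound by blast
  have "fps_nth T n = cm (of_real (1 / phibar)) * P0 + cm (of_real (ts.t n / phibar\<^sup>2)) * P0 + fps_nth E n" for n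
  proof -
    have "fps_nth (P * J) n = P0" by (simp add: J_def)
    moreover have "fps_nth (cF tF * P) n = cm (of_real (ts.t n)) * P0" by (simp add: cF_def tF_def)
    moreover have "cm (of_real (1 / phibar\<^sup>2)) * (cm (of_real (ts.t n)) * P0) = cm (of_real (ts.t n / phibar\<^sup>2)) * P0"
      by (simp add: mult.assoc[symmetric] cm_mult[symmetric])
    ultimately show ?thesis by (subst T_eq) (simp only: fps_add_nth fps_mult_left_const_nth)
  qed
  then show ?thesis using C by blast
qed

end

section \<open>Correlations on the tower\<close>

text \<open>\<open>\<kappa> i x\<close> will be the weight of the norms at the point f^i(x). It
  bounds both the size and the Lipschitz constant of observables at height i, and condition (ii) is
  encoded in \<open>kappa_tail\<close>.\<close>

locale tower = renewal +
  fixes f :: "'a \<Rightarrow> 'a" and \<kappa> :: "nat \<Rightarrow> 'a \<Rightarrow> real" and C\<^sub>\<kappa> :: real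
  assumes F_eq: "\<And>x. x \<in> \<Omega> \<Longrightarrow> F x = (f ^^ \<phi> x) x"
    and kappa_meas: "\<And>i. \<kappa> i \<in> borel_measurable \<mu>"
    and kappa_nonneg: "\<And>i x. 0 \<le> \<kappa> i x" and kappa_le_1: "\<And>i x. \<kappa> i x \<le> 1"
    and kappa_const: "\<And>a x y i. a \<in> \<alpha> \<Longrightarrow> x \<in> a \<Longrightarrow> y \<in> a \<Longrightarrow> x \<in> \<Omega> \<Longrightarrow> y \<in> \<Omega> \<Longrightarrow> i < \<phi> x \<Longrightarrow> \<kappa> i x = \<kappa> i y"
    and kappa_int: "integrable \<mu> (\<lambda>x. \<Sum>i<\<phi> x. \<kappa> i x)"
    and kappa_tail: "\<And>n. (\<integral>x. (if n < \<phi> x then \<Sum>i<\<phi> x. \<kappa> i x else 0) \<partial>\<mu>) \<le> C\<^sub>\<kappa> * (real n + 1) powr - \<beta>"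
begin

lemma phi_comp:
  fixes g :: "nat \<Rightarrow> 'a \<Rightarrow> 'b::{topological_space}"
  assumes "\<And>i. g i \<in> borel_measurable \<mu>" shows "(\<lambda>x. g (\<phi> x) x) \<in> borel_measurable \<mu>"
  by (rule measurable_compose_countable[OF assms phi_meas])

definition H :: "'a \<Rightarrow> real" where "H x = (\<Sum>i<\<phi> x. \<kappa> i x)"

lemma H_int: "integrable \<mu> H" using kappa_int by (simp add: H_def[abs_def])

lemma H_nonneg: "0 \<le> H x" unfolding H_def by (intro sum_nonneg kappa_nonneg)

lemma cutH_int: "integrable \<mu> (\<lambda>x. if n < \<phi> x then H x else 0)"
proof (rule Bochner_Integration.integrable_bound[OF H_int])
  have "H \<in> borel_measurable \<mu>" using H_int by simp
  then show "(\<lambda>x. if n < \<phi> x then H x else 0) \<in> borel_measurable \<mu>"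
    by (intro phi_comp[of "\<lambda>i x. if n < i then H x else 0"]) auto
qed (simp add: H_nonneg)

lemma cutH_le: "(\<integral>x. (if n < \<phi> x then H x else 0) \<partial>\<mu>) \<le> C\<^sub>\<kappa> * ts.qq n"
  unfolding H_def ts.qq_def by (rule kappa_tail)

lemma Ck: "0 \<le> C\<^sub>\<kappa>"
proof -
  have "0 \<le> (\<integral>x. (if 0 < \<phi> x then H x else 0) \<partial>\<mu>)" using H_nonneg by (intro integral_nonneg_AE) auto
  also have "\<dots> \<le> C\<^sub>\<kappa> * ts.qq 0" by (rule cutH_le)
  finally show ?thesis by (simp add: ts.qq_def)
qed

text \<open>The same weights, indexed downwards as k steps before the return in \<open>kd\<close>
  and upwards as height k in \<open>ku\<close>. The first observable is read in the former way, the
  second in the latter.\<close>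

definition kd :: "nat \<Rightarrow> 'a \<Rightarrow> real" where
  "kd k x = (if 1 \<le> k \<and> k \<le> \<phi> x then \<kappa> (\<phi> x - k) x else 0)"
definition ku :: "nat \<Rightarrow> 'a \<Rightarrow> real" where "ku k x = (if k < \<phi> x then \<kappa> k x else 0)"

lemma kd_meas: "kd k \<in> borel_measurable \<mu>" and ku_meas: "ku k \<in> borel_measurable \<mu>"
  unfolding kd_def[abs_def] ku_def[abs_def]
   apply (rule phi_comp[of "\<lambda>i x. if 1 \<le> k \<and> k \<le> i then \<kappa> (i - k) x else 0"])
   apply (cases "1 \<le> k"; simp add: kappa_meas)
  subgoal for i by (cases "k \<le> i") (auto simp: kappa_meas)
  apply (rule phi_comp[of "\<lambda>i x. if k < i then \<kappa> k x else 0"])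
  subgoal for i by (cases "k < i") (auto simp: kappa_meas)
  done

lemma kd_range: "0 \<le> kd k x" "kd k x \<le> 1" and ku_range: "0 \<le> ku k x" "ku k x \<le> 1"
  using kappa_nonneg kappa_le_1 by (auto simp: kd_def ku_def)

lemma kd_int: "integrable \<mu> (kd k)" and ku_int: "integrable \<mu> (ku k)"
  by (rule integrable_const_bound[of _ 1]; simp add: kd_range ku_range kd_meas ku_meas)+

lemma sum_ku: "(\<Sum>k=n..N. ku k x) \<le> (if n < \<phi> x then H x else 0)"
proof (cases "n < \<phi> x")
  case True
  have "(\<Sum>k=n..N. ku k x) = (\<Sum>k\<in>{n..N} \<inter> {..<\<phi> x}. \<kappa> k x)"
    by (simp add: ku_def sum.If_cases Int_def lessThan_def)
  also have "\<dots> \<le> H x" unfolding H_def by (intro sum_mono2) (auto simp: kappa_nonneg)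
  finally show ?thesis using True by simp
qed (simp add: ku_def)

text \<open>Here k may equal \<phi> x, so k \<ge> n only forces \<phi> x > n - 1;
  \<open>TL_kap\<close> pays for this shift with the factor 2^\<beta>.\<close>

lemma sum_kd: "(\<Sum>k=n..N. kd k x) \<le> (if n - 1 < \<phi> x then H x else 0)"
proof (cases "n - 1 < \<phi> x")
  case True
  have "(\<Sum>k=n..N. kd k x) = (\<Sum>k\<in>{n..N} \<inter> {1..\<phi> x}. \<kappa> (\<phi> x - k) x)"
    by (simp add: kd_def sum.If_cases Int_def atLeastAtMost_def atLeast_def atMost_def conj_ac)
  also have "\<dots> \<le> (\<Sum>k\<in>{1..\<phi> x}. \<kappa> (\<phi> x - k) x)" by (intro sum_mono2) (auto simp: kappa_nonneg)
  also have "\<dots> = H x" unfolding H_def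
    by (rule sum.reindex_bij_witness[of _ "\<lambda>i. \<phi> x - i" "\<lambda>k. \<phi> x - k"]) auto
  finally show ?thesis using True by simp
next
  case False
  then have "kd k x = 0" if "k \<in> {n..N}" for k using that by (auto simp: kd_def)
  then show ?thesis using False by simp
qed

definition kap :: "nat \<Rightarrow> real" where "kap k = (\<integral>x. kd k x \<partial>\<mu>)"
definition ome :: "nat \<Rightarrow> real" where "ome k = (\<integral>x. ku k x \<partial>\<mu>)"

lemma kap_nonneg: "0 \<le> kap k" and ome_nonneg: "0 \<le> ome k"
  unfolding kap_def ome_def by (intro integral_nonneg_AE AE_I2 kd_range ku_range)+

lemma TL_ome: "ts.TL C\<^sub>\<kappa> ome"
proof -
  have "(\<Sum>k=n..N. ome k) \<le> C\<^sub>\<kappa> * ts.qq n" for n N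
  proof -
    have "(\<Sum>k=n..N. ome k) = (\<integral>x. (\<Sum>k=n..N. ku k x) \<partial>\<mu>)" unfolding ome_def using ku_int by simp
    also have "\<dots> \<le> (\<integral>x. (if n < \<phi> x then H x else 0) \<partial>\<mu>)"
      by (intro integral_mono cutH_int sum_ku Bochner_Integration.integrable_sum ku_int)
    also have "\<dots> \<le> C\<^sub>\<kappa> * ts.qq n" by (rule cutH_le)
    finally show ?thesis .
  qed
  then show ?thesis using ome_nonneg by (simp add: ts.TL_def)
qed

lemma TL_kap: "ts.TL (C\<^sub>\<kappa> * 2 powr \<beta>) kap"
proof -
  have "(\<Sum>k=n..N. kap k) \<le> (C\<^sub>\<kappa> * 2 powr \<beta>) * ts.qq n" for n N
  proof -
    have "(\<Sum>k=n..N. kap k) = (\<integral>x. (\<Sum>k=n..N. kd k x) \<partial>\<mu>)" unfolding kap_def using kd_int by simp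
    also have "\<dots> \<le> (\<integral>x. (if n - 1 < \<phi> x then H x else 0) \<partial>\<mu>)"
      by (intro integral_mono cutH_int sum_kd Bochner_Integration.integrable_sum kd_int)
    also have "\<dots> \<le> C\<^sub>\<kappa> * ts.qq (n - 1)" by (rule cutH_le)
    also have "\<dots> \<le> C\<^sub>\<kappa> * (2 powr \<beta> * ts.qq n)"
    proof (intro mult_left_mono Ck)
      show "ts.qq (n - 1) \<le> 2 powr \<beta> * ts.qq n"
      proof (cases n)
        case 0
        then show ?thesis using ts.qq_half[of 0 0] by simp
      next
        case (Suc k)
        then show ?thesis using ts.powr_shift[of \<beta> k] beta_gt by (simp add: ts.qq_def add_ac)
      qed
    qed
    finally show ?thesis by (simp only: mult.assoc)
  qed
  then show ?thesis using kap_nonneg by (simp add: ts.TL_def)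
qed

lemma T_rec: "L \<ge> 1 \<Longrightarrow> fps_nth T L = (\<Sum>j=1..L. fps_nth T (L - j) * RN {j})"
proof -
  assume L: "L \<ge> 1"
  have "T = 1 + T * Rz" using T_inv(2) by (simp add: algebra_simps)
  then have "fps_nth T L = fps_nth (1 + T * Rz) L" by simp
  also have "\<dots> = (\<Sum>i=0..L. fps_nth T i * RN {L - i})" using L by (simp add: fps_mult_nth Rz_def)
  also have "\<dots> = (\<Sum>j=0..L. fps_nth T (L - j) * RN {j})"
    by (rule sum.reindex_bij_witness[of _ "\<lambda>i. L - i" "\<lambda>i. L - i"]) auto
  also have "\<dots> = (\<Sum>j=1..L. fps_nth T (L - j) * RN {j})" by (simp add: sum.atLeast_Suc_atMost RN_0)
  finally show ?thesis .
qed

lemma T_0: "fps_nth T 0 = 1"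
proof -
  have "T = 1 + T * Rz" using T_inv(2) by (simp add: algebra_simps)
  then have "fps_nth T 0 = fps_nth (1 + T * Rz) 0" by simp
  then show ?thesis by (simp add: fps_mult_nth Rz_0)
qed

lemma T_V: "u \<in> V \<Longrightarrow> ap (fps_nth T l) u \<in> V"
  using bd_T bd_V by blast

text \<open>The test function at height r of the last, unfinished excursion.\<close>

definition up :: "('a \<Rightarrow> complex) \<Rightarrow> nat \<Rightarrow> 'a \<Rightarrow> complex" where
  "up w r x = (if r < \<phi> x then w ((f ^^ r) x) else 0)"

context
  fixes w :: "'a \<Rightarrow> complex" and W :: real
  assumes wm: "\<And>i. (\<lambda>x. w ((f ^^ i) x)) \<in> borel_measurable \<mu>" and W: "0 \<le> W"
    and wb: "\<And>i x. x \<in> \<Omega> \<Longrightarrow> i < \<phi> x \<Longrightarrow> cmod (w ((f ^^ i) x)) \<le> W * \<kappa> i x"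
begin

lemma up_meas: "up w r \<in> borel_measurable \<mu>"
  unfolding up_def[abs_def]
  apply (rule phi_comp[of "\<lambda>i x. if r < i then w ((f ^^ r) x) else 0"])
  subgoal for i by (cases "r < i") (auto simp: wm)
  done

lemma up_le: "x \<in> \<Omega> \<Longrightarrow> cmod (up w r x) \<le> W * ku r x"
  using wb by (simp add: up_def ku_def)

lemma up_le_W: "x \<in> \<Omega> \<Longrightarrow> cmod (up w r x) \<le> W"
  using order_trans[OF up_le mult_left_mono[OF ku_range(2) W]] by simp

lemma prod_int:
  assumes u: "u \<in> borel_measurable \<mu>" "\<And>x. x \<in> \<Omega> \<Longrightarrow> cmod (u x) \<le> g x" and g: "integrable \<mu> g"
    and h: "h \<in> borel_measurable \<mu>" "\<And>x. x \<in> \<Omega> \<Longrightarrow> cmod (h x) \<le> W"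
  shows "integrable \<mu> (\<lambda>x. u x * h x)"
proof (rule Bochner_Integration.integrable_bound)
  show "integrable \<mu> (\<lambda>x. W * g x)" using g by simp
  show "(\<lambda>x. u x * h x) \<in> borel_measurable \<mu>" by (intro borel_measurable_times u h)
  show "AE x in \<mu>. norm (u x * h x) \<le> norm (W * g x)"
    using Om_AE
  proof eventually_elim
    case (elim x)
    have "norm (u x * h x) \<le> g x * W" unfolding norm_mult
      using u(2)[OF elim] h(2)[OF elim] order_trans[OF norm_ge_zero u(2)[OF elim]] by (intro mult_mono) auto
    then show ?case by (simp add: mult.commute)
  qed
qed

lemma V_prod_int:
  assumes u: "u \<in> V" and h: "h \<in> borel_measurable \<mu>" "\<And>x. x \<in> \<Omega> \<Longrightarrow> cmod (h x) \<le> W"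
  shows "integrable \<mu> (\<lambda>x. u x * h x)"
  by (rule prod_int[OF V_meas[OF u] nrm_pt[OF u] _ h]) simp_all

lemma funpow_F: "x \<in> \<Omega> \<Longrightarrow> \<phi> x \<le> n \<Longrightarrow> (f ^^ n) x = (f ^^ (n - \<phi> x)) (F x)"
  using funpow_add[of "n - \<phi> x" "\<phi> x" f] by (simp add: F_eq)

text \<open>The hypothesis bounds w below height \<phi> only. Later times are reduced to it by
  discarding complete excursions.\<close>

lemma wn_bound: "x \<in> \<Omega> \<Longrightarrow> cmod (w ((f ^^ n) x)) \<le> W"
proof (induction n arbitrary: x rule: less_induct)
  case (less n)
  show ?case
  proof (cases "n < \<phi> x")
    case True
    have "cmod (w ((f ^^ n) x)) \<le> W * \<kappa> n x" by (rule wb[OF less.prems True])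
    also have "\<dots> \<le> W * 1" by (intro mult_left_mono kappa_le_1 W)
    finally show ?thesis by simp
  next
    case False
    then show ?thesis using less.IH[of "n - \<phi> x" "F x"] phi_pos[OF less.prems] F_Om[OF less.prems]
        funpow_F[OF less.prems, of n] by simp
  qed
qed

text \<open>Either the first excursion outlasts n, or it ends at some time j \<le> n; in the latter
  case duality replaces composition with \<open>F\<close> by the operator R_j, and induction treats
  the remaining n - j steps. The recursion for the coefficients of T collects all sequences of
  excursions.\<close>

lemma renewal_decomp:
  "u \<in> V \<Longrightarrow> (\<integral>x. u x * w ((f ^^ n) x) \<partial>\<mu>) = (\<Sum>l=0..n. \<integral>x. ap (fps_nth T l) u x * up w (n - l) x \<partial>\<mu>)"
proof (induction n arbitrary: u rule: less_induct)
  case (less n)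
  note u = less.prems
  have pt: "u x * w ((f ^^ n) x) = u x * up w n x + (\<Sum>j=1..n. cut {j} u x * w ((f ^^ (n - j)) (F x)))"
    if x: "x \<in> \<Omega>" for x
  proof (cases "n < \<phi> x")
    case True
    then show ?thesis by (simp add: up_def cut_def)
  next
    case False
    then have in_n: "\<phi> x \<in> {1..n}" using phi_pos[OF x] by simp
    have "(\<Sum>j=1..n. cut {j} u x * w ((f ^^ (n - j)) (F x))) = (\<Sum>j\<in>{1..n}. if j = \<phi> x then u x * w ((f ^^ (n - j)) (F x)) else 0)"
      by (rule sum.cong) (auto simp: cut_def)
    also have "\<dots> = u x * w ((f ^^ (n - \<phi> x)) (F x))" using in_n by (subst sum.delta) auto
    finally show ?thesis using False funpow_F[OF x, of n] by (simp add: up_def)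
  qed
  have i1: "integrable \<mu> (\<lambda>x. u x * up w n x)" by (rule V_prod_int[OF u up_meas up_le_W])
  have wFm: "(\<lambda>x. w ((f ^^ i) (F x))) \<in> borel_measurable \<mu>" for i by (rule measurable_compose[OF F_meas wm])
  have i2: "integrable \<mu> (\<lambda>x. cut {j} u x * w ((f ^^ i) (F x)))" for i j
    by (rule prod_int[OF cut_measurable[OF V_meas[OF u]] cut_bound[OF u] _ wFm wn_bound[OF F_Om]]) simp_all
  have "(\<integral>x. u x * w ((f ^^ n) x) \<partial>\<mu>) = (\<integral>x. u x * up w n x + (\<Sum>j=1..n. cut {j} u x * w ((f ^^ (n - j)) (F x))) \<partial>\<mu>)"
  proof (rule integral_cong_AE)
    show "(\<lambda>x. u x * w ((f ^^ n) x)) \<in> borel_measurable \<mu>" by (intro borel_measurable_times V_meas[OF u] wm)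
    show "(\<lambda>x. u x * up w n x + (\<Sum>j=1..n. cut {j} u x * w ((f ^^ (n - j)) (F x)))) \<in> borel_measurable \<mu>"
      by (intro borel_measurable_add borel_measurable_sum borel_measurable_times V_meas[OF u] up_meas wFm cut_measurable)
    show "AE x in \<mu>. u x * w ((f ^^ n) x) = u x * up w n x + (\<Sum>j=1..n. cut {j} u x * w ((f ^^ (n - j)) (F x)))"
      using Om_AE by eventually_elim (rule pt)
  qed
  also have "\<dots> = (\<integral>x. u x * up w n x \<partial>\<mu>) + (\<Sum>j=1..n. \<integral>x. cut {j} u x * w ((f ^^ (n - j)) (F x)) \<partial>\<mu>)"
    using i1 i2 by (subst Bochner_Integration.integral_add) (auto intro!: Bochner_Integration.integrable_sum Bochner_Integration.integral_sum)
  also have "(\<Sum>j=1..n. \<integral>x. cut {j} u x * w ((f ^^ (n - j)) (F x)) \<partial>\<mu>)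
      = (\<Sum>j=1..n. \<Sum>l=0..n - j. \<integral>x. ap (fps_nth T l) (ap (RN {j}) u) x * up w (n - j - l) x \<partial>\<mu>)"
  proof (rule sum.cong[OF refl])
    fix j assume j: "j \<in> {1..n}"
    have "(\<integral>x. cut {j} u x * w ((f ^^ (n - j)) (F x)) \<partial>\<mu>) = (\<integral>x. R (cut {j} u) x * w ((f ^^ (n - j)) x) \<partial>\<mu>)"
      using R_dual(2)[of "cut {j} u" "\<lambda>x. w ((f ^^ (n - j)) x)", OF i2] by simp
    also have "\<dots> = (\<integral>x. ap (RN {j}) u x * w ((f ^^ (n - j)) x) \<partial>\<mu>)" by (simp only: ap_RN[OF u])
    also have "\<dots> = (\<Sum>l=0..n - j. \<integral>x. ap (fps_nth T l) (ap (RN {j}) u) x * up w (n - j - l) x \<partial>\<mu>)"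
      by (rule less.IH) (use j bd_V[OF bd_RN u] in auto)
    finally show "(\<integral>x. cut {j} u x * w ((f ^^ (n - j)) (F x)) \<partial>\<mu>)
      = (\<Sum>l=0..n - j. \<integral>x. ap (fps_nth T l) (ap (RN {j}) u) x * up w (n - j - l) x \<partial>\<mu>)" .
  qed
  \<comment> \<open>The pairs (j, l) are regrouped by L = j + l, the total time of the completed
    excursions.\<close>
  also have "\<dots> = (\<Sum>L=1..n. \<Sum>j=1..L. \<integral>x. ap (fps_nth T (L - j)) (ap (RN {j}) u) x * up w (n - L) x \<partial>\<mu>)"
    unfolding sum.Sigma[OF finite_atLeastAtMost ballI[OF finite_atLeastAtMost]]
    by (rule sum.reindex_bij_witness[of _ "\<lambda>(L, j). (j, L - j)" "\<lambda>(j, l). (l + j, j)"]) (auto simp: diff_diff_add add.commute)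
  also have "\<dots> = (\<Sum>L=1..n. \<integral>x. ap (fps_nth T L) u x * up w (n - L) x \<partial>\<mu>)"
  proof (rule sum.cong[OF refl])
    fix L assume L: "L \<in> {1..n}"
    have e: "ap (fps_nth T L) u x * up w (n - L) x = (\<Sum>j=1..L. ap (fps_nth T (L - j)) (ap (RN {j}) u) x * up w (n - L) x)" for x
      using T_rec[of L] L by (simp add: ap_sum sum_distrib_right)
    have "(\<integral>x. ap (fps_nth T L) u x * up w (n - L) x \<partial>\<mu>) = (\<integral>x. (\<Sum>j=1..L. ap (fps_nth T (L - j)) (ap (RN {j}) u) x * up w (n - L) x) \<partial>\<mu>)"
      by (simp only: e)
    also have "\<dots> = (\<Sum>j=1..L. \<integral>x. ap (fps_nth T (L - j)) (ap (RN {j}) u) x * up w (n - L) x \<partial>\<mu>)"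
      by (rule Bochner_Integration.integral_sum) (rule V_prod_int[OF T_V[OF bd_V[OF bd_RN u]] up_meas up_le_W])
    finally show "(\<Sum>j=1..L. \<integral>x. ap (fps_nth T (L - j)) (ap (RN {j}) u) x * up w (n - L) x \<partial>\<mu>) = (\<integral>x. ap (fps_nth T L) u x * up w (n - L) x \<partial>\<mu>)" by simp
  qed
  also have "(\<integral>x. u x * up w n x \<partial>\<mu>) + (\<Sum>L=1..n. \<integral>x. ap (fps_nth T L) u x * up w (n - L) x \<partial>\<mu>)
      = (\<Sum>l=0..n. \<integral>x. ap (fps_nth T l) u x * up w (n - l) x \<partial>\<mu>)"
    by (simp add: sum.atLeast_Suc_atMost[of 0 n] T_0)
  finally show ?case .
qed

end
end

section \<open>The correlation integral on the tower\<close>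

context tower
begin

definition dn :: "('a \<Rightarrow> complex) \<Rightarrow> nat \<Rightarrow> 'a \<Rightarrow> complex" where
  "dn v k x = (if 1 \<le> k \<and> k \<le> \<phi> x then v ((f ^^ (\<phi> x - k)) x) else 0)"

text \<open>The scalar factor of P in the expansion of T_l.\<close>

definition crate :: "nat \<Rightarrow> real" where "crate l = 1 / phibar + ts.t l / phibar\<^sup>2"

definition sig :: "nat \<Rightarrow> real" where "sig n = (\<Sum>i=0..n. kap i * ome (n - i))"

lemma TL_sig: "ts.TL (2 * 2 powr \<beta> * (C\<^sub>\<kappa> * 2 powr \<beta>) * C\<^sub>\<kappa>) sig"
  unfolding sig_def by (rule ts.TL_conv[OF TL_kap TL_ome])

lemma kd_cell: "a \<in> \<alpha> \<Longrightarrow> x \<in> a \<Longrightarrow> x \<in> \<Omega> \<Longrightarrow> kd k x = kd k (\<psi> a y0)"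
proof -
  assume a: "a \<in> \<alpha>" "x \<in> a" "x \<in> \<Omega>"
  have p: "\<psi> a y0 \<in> a" "\<psi> a y0 \<in> \<Omega>" using psi_mem[OF a(1) y0] by auto
  have ph: "\<phi> x = \<phi> (\<psi> a y0)" by (rule phi_const[OF a(1,2) p(1) a(3) p(2)])
  have "\<kappa> (\<phi> x - k) x = \<kappa> (\<phi> x - k) (\<psi> a y0)" if "1 \<le> k" "k \<le> \<phi> x"
    by (rule kappa_const[OF a(1,2) p(1) a(3) p(2)]) (use that in auto)
  then show ?thesis using ph by (simp add: kd_def)
qed

lemma crate_le: "\<bar>crate l\<bar> \<le> crate 0" and crate_diff: "crate l - crate n = (ts.t l - ts.t n) / phibar\<^sup>2"
proof -
  have "0 \<le> crate l" using ts.t_nonneg[of l] phibar_pos by (simp add: crate_def)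
  moreover have "crate l \<le> crate 0"
    unfolding crate_def using ts.t_antimono[of 0 l] by (intro add_left_mono divide_right_mono) auto
  ultimately show "\<bar>crate l\<bar> \<le> crate 0" by simp
  show "crate l - crate n = (ts.t l - ts.t n) / phibar\<^sup>2" by (simp add: crate_def diff_divide_distrib)
qed

context
  fixes v w :: "'a \<Rightarrow> complex" and V0 W :: real
  assumes vm: "\<And>i. (\<lambda>x. v ((f ^^ i) x)) \<in> borel_measurable \<mu>" and V0: "0 \<le> V0"
    and vb: "\<And>i x. x \<in> \<Omega> \<Longrightarrow> i < \<phi> x \<Longrightarrow> cmod (v ((f ^^ i) x)) \<le> V0 * \<kappa> i x"
    and vl: "\<And>a x x' i. a \<in> \<alpha> \<Longrightarrow> x \<in> a \<Longrightarrow> x \<in> \<Omega> \<Longrightarrow> x' \<in> a \<Longrightarrow> x' \<in> \<Omega> \<Longrightarrow> i < \<phi> x \<Longrightarrow>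
      cmod (v ((f ^^ i) x) - v ((f ^^ i) x')) \<le> V0 * \<kappa> i x * d x x'"
    and wm: "\<And>i. (\<lambda>x. w ((f ^^ i) x)) \<in> borel_measurable \<mu>" and W: "0 \<le> W"
    and wb: "\<And>i x. x \<in> \<Omega> \<Longrightarrow> i < \<phi> x \<Longrightarrow> cmod (w ((f ^^ i) x)) \<le> W * \<kappa> i x"
begin

lemma dn_meas: "dn v k \<in> borel_measurable \<mu>"
  unfolding dn_def[abs_def]
  apply (rule phi_comp[of "\<lambda>i x. if 1 \<le> k \<and> k \<le> i then v ((f ^^ (i - k)) x) else 0"])
  subgoal for i by (cases "1 \<le> k \<and> k \<le> i") (auto simp: vm)
  done

lemma dn_le: "x \<in> \<Omega> \<Longrightarrow> cmod (dn v k x) \<le> V0 * kd k x"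
  using vb[of x "\<phi> x - k"] by (simp add: dn_def kd_def)

lemma dn_int: "integrable \<mu> (dn v k)"
proof (rule Bochner_Integration.integrable_bound)
  show "integrable \<mu> (\<lambda>x. V0 * kd k x)" using kd_int by simp
  show "AE x in \<mu>. norm (dn v k x) \<le> norm (V0 * kd k x)"
    using Om_AE
  proof eventually_elim
    case (elim x)
    from dn_le[OF elim, of k] show ?case by simp
  qed
qed (rule dn_meas)

lemma dn_norm_int: "(\<integral>x. norm (dn v k x) \<partial>\<mu>) \<le> V0 * kap k"
proof -
  have "(\<integral>x. norm (dn v k x) \<partial>\<mu>) \<le> (\<integral>x. V0 * kd k x \<partial>\<mu>)"
    using dn_int kd_int Om_AE dn_le by (intro integral_mono_AE) auto
  then show ?thesis by (simp add: kap_def)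
qed

lemma up_int: "integrable \<mu> (up w k)"
proof (rule integrable_const_bound[of _ W])
  show "up w k \<in> borel_measurable \<mu>" by (rule up_meas[OF wm W wb])
  show "AE x in \<mu>. norm (up w k x) \<le> W" using Om_AE by eventually_elim (rule up_le_W[OF wm W wb])
qed

lemma up_norm_int: "(\<integral>x. norm (up w k x) \<partial>\<mu>) \<le> W * ome k"
proof -
  have "(\<integral>x. norm (up w k x) \<partial>\<mu>) \<le> (\<integral>x. W * ku k x \<partial>\<mu>)"
    using up_int ku_int Om_AE up_le[OF wm W wb] by (intro integral_mono_AE) auto
  then show ?thesis by (simp add: ome_def)
qed

text \<open>One application of \<open>R\<close> is made before entering \<open>V\<close>: it
  replaces the cellwise bound by its integral \<open>kap k\<close>, whose tails decay, where the
  supremum norm would give a bound that is not summable in k.\<close>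

lemma Rdn: "R (dn v k) \<in> V" "nrm (R (dn v k)) \<le> 2 * C\<^sub>1 * (V0 * kap k)"
proof -
  let ?h = "\<lambda>a. V0 * kd k (\<psi> a y0)"
  have hi: "integrable m ?h"
  proof (rule m.integrable_const_bound[of _ V0])
    have "norm (V0 * kd k (\<psi> a y0)) \<le> V0" for a using mult_left_le[OF kd_range(2) V0] V0 kd_range(1)[of k] by (simp add: abs_mult)
    then show "AE a in m. norm (V0 * kd k (\<psi> a y0)) \<le> V0" by simp
  qed simp
  have qb: "cmod (dn v k x) \<le> ?h a" if "a \<in> \<alpha>" "x \<in> a" "x \<in> \<Omega>" for a x
    using dn_le[OF that(3), of k] kd_cell[OF that, of k] by simp
  have ql: "cmod (dn v k x - dn v k x') \<le> ?h a * d x x'"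
    if "a \<in> \<alpha>" "x \<in> a" "x \<in> \<Omega>" "x' \<in> a" "x' \<in> \<Omega>" for a x x'
  proof -
    have ph: "\<phi> x = \<phi> x'" by (rule phi_const[OF that(1,2,4,3,5)])
    have "cmod (dn v k x - dn v k x') \<le> V0 * kd k x * d x x'"
      using vl[OF that, of "\<phi> x - k"] ph by (simp add: dn_def kd_def)
    then show ?thesis using kd_cell[OF that(1-3), of k] by simp
  qed
  have "(\<integral>a. ?h a \<partial>m) = (\<integral>x. V0 * kd k x \<partial>\<mu>)"
    unfolding integral_m
  proof (rule integral_cong_AE)
    show "(\<lambda>x. ?h (cell x)) \<in> borel_measurable \<mu>" by (rule measurable_compose[OF cell_meas]) simp
    show "(\<lambda>x. V0 * kd k x) \<in> borel_measurable \<mu>" by (intro borel_measurable_times borel_measurable_const kd_meas)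
    show "AE x in \<mu>. ?h (cell x) = V0 * kd k x"
      using Om_AE by eventually_elim (simp add: kd_cell[OF cell_in cell_mem])
  qed
  then have e: "(\<integral>a. ?h a \<partial>m) = V0 * kap k" by (simp add: kap_def)
  show "R (dn v k) \<in> V" by (rule R_lip(1)[OF dn_meas hi qb ql])
  show "nrm (R (dn v k)) \<le> 2 * C\<^sub>1 * (V0 * kap k)" unfolding e[symmetric] by (rule R_lip(3)[OF dn_meas hi qb ql])
qed

definition xk :: "nat \<Rightarrow> complex" where "xk k = (\<integral>x. dn v k x \<partial>\<mu>)"
definition yk :: "nat \<Rightarrow> complex" where "yk k = (\<integral>x. up w k x \<partial>\<mu>)"
text \<open>The convolution with which the leading part of T_l is paired. It sums to the product of
  the two tower integrals, and its tail sums are O(n^(-\<beta>)).\<close>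

definition sk :: "nat \<Rightarrow> complex" where "sk n = (\<Sum>i=0..n. xk i * yk (n - i))"

lemma xk_le: "cmod (xk k) \<le> V0 * kap k"
  unfolding xk_def by (rule order_trans[OF integral_norm_bound dn_norm_int])

lemma yk_le: "cmod (yk k) \<le> W * ome k"
  unfolding yk_def by (rule order_trans[OF integral_norm_bound up_norm_int])

lemma sk_le: "cmod (sk n) \<le> V0 * W * sig n"
proof -
  have "cmod (sk n) \<le> (\<Sum>i=0..n. cmod (xk i * yk (n - i)))" unfolding sk_def by (rule norm_sum)
  also have "\<dots> \<le> (\<Sum>i=0..n. (V0 * kap i) * (W * ome (n - i)))"
    unfolding norm_mult by (intro sum_mono mult_mono xk_le yk_le mult_nonneg_nonneg V0 kap_nonneg) auto
  also have "\<dots> = V0 * W * sig n" unfolding sig_def sum_distrib_left by (simp only: mult_ac)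
  finally show ?thesis .
qed

lemma xk_total: "xk sums (\<integral>x. (\<Sum>j<\<phi> x. v ((f ^^ j) x)) \<partial>\<mu>)"
proof -
  have "(\<lambda>k. \<integral>x. dn v k x \<partial>\<mu>) sums (\<integral>x. (\<Sum>k. dn v k x) \<partial>\<mu>)"
  proof (rule sums_integral)
    have fin: "dn v k x = 0" if "k \<notin> {1..\<phi> x}" for k x using that by (auto simp: dn_def)
    show "AE x in \<mu>. summable (\<lambda>k. norm (dn v k x))"
    proof (rule AE_I2)
      fix x show "summable (\<lambda>k. norm (dn v k x))" by (rule summable_finite[of "{1..\<phi> x}"]) (use fin in auto)
    qed
    show "summable (\<lambda>k. \<integral>x. norm (dn v k x) \<partial>\<mu>)"
    proof (rule summable_comparison_test'[of "\<lambda>k. V0 * kap k" 0])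
      show "summable (\<lambda>k. V0 * kap k)" by (rule summable_mult[OF ts.TL_total(2)[OF TL_kap]])
      fix k
      have "0 \<le> (\<integral>x. norm (dn v k x) \<partial>\<mu>)" by (intro integral_nonneg_AE) simp
      then show "norm (\<integral>x. norm (dn v k x) \<partial>\<mu>) \<le> V0 * kap k" using dn_norm_int[of k] by simp
    qed
  qed (rule dn_int)
  moreover have "(\<Sum>k. dn v k x) = (\<Sum>j<\<phi> x. v ((f ^^ j) x))" for x
  proof -
    have "(\<Sum>k. dn v k x) = (\<Sum>k\<in>{1..\<phi> x}. dn v k x)" by (rule suminf_finite) (auto simp: dn_def)
    also have "\<dots> = (\<Sum>j<\<phi> x. v ((f ^^ j) x))"
      by (rule sum.reindex_bij_witness[of _ "\<lambda>i. \<phi> x - i" "\<lambda>k. \<phi> x - k"]) (auto simp: dn_def)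
    finally show ?thesis .
  qed
  ultimately show ?thesis unfolding xk_def[abs_def] by simp
qed

lemma yk_total: "yk sums (\<integral>x. (\<Sum>j<\<phi> x. w ((f ^^ j) x)) \<partial>\<mu>)"
proof -
  have "(\<lambda>k. \<integral>x. up w k x \<partial>\<mu>) sums (\<integral>x. (\<Sum>k. up w k x) \<partial>\<mu>)"
  proof (rule sums_integral)
    show "AE x in \<mu>. summable (\<lambda>k. norm (up w k x))"
    proof (rule AE_I2)
      fix x show "summable (\<lambda>k. norm (up w k x))" by (rule summable_finite[of "{..<\<phi> x}"]) (auto simp: up_def)
    qed
    show "summable (\<lambda>k. \<integral>x. norm (up w k x) \<partial>\<mu>)"
    proof (rule summable_comparison_test'[of "\<lambda>k. W * ome k" 0])
      show "summable (\<lambda>k. W * ome k)" by (rule summable_mult[OF ts.TL_total(2)[OF TL_ome]])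
      fix k
      have "0 \<le> (\<integral>x. norm (up w k x) \<partial>\<mu>)" by (intro integral_nonneg_AE) simp
      then show "norm (\<integral>x. norm (up w k x) \<partial>\<mu>) \<le> W * ome k" using up_norm_int[of k] by simp
    qed
  qed (rule up_int)
  moreover have "(\<Sum>k. up w k x) = (\<Sum>j<\<phi> x. w ((f ^^ j) x))" for x
  proof -
    have "(\<Sum>k. up w k x) = (\<Sum>k\<in>{..<\<phi> x}. up w k x)" by (rule suminf_finite) (auto simp: up_def)
    also have "\<dots> = (\<Sum>j<\<phi> x. w ((f ^^ j) x))" by (rule sum.cong) (auto simp: up_def)
    finally show ?thesis .
  qed
  ultimately show ?thesis unfolding yk_def[abs_def] by simp
qed

lemma sk_total: "sk sums ((\<integral>x. (\<Sum>j<\<phi> x. v ((f ^^ j) x)) \<partial>\<mu>) * (\<integral>x. (\<Sum>j<\<phi> x. w ((f ^^ j) x)) \<partial>\<mu>))"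
proof -
  have "summable (\<lambda>k. norm (xk k))"
    by (rule summable_comparison_test'[OF summable_mult[OF ts.TL_total(2)[OF TL_kap], of V0], of 0]) (simp add: xk_le)
  moreover have "summable (\<lambda>k. norm (yk k))"
    by (rule summable_comparison_test'[OF summable_mult[OF ts.TL_total(2)[OF TL_ome], of W], of 0]) (simp add: yk_le)
  ultimately have "(\<lambda>k. \<Sum>i\<le>k. xk i * yk (k - i)) sums ((\<Sum>k. xk k) * (\<Sum>k. yk k))" by (rule Cauchy_product_sums)
  then show ?thesis using xk_total yk_total by (simp add: sk_def[abs_def] atMost_atLeast0 sums_iff)
qed

definition corr :: "nat \<Rightarrow> complex" where
  "corr n = (\<integral>x. (\<Sum>j<\<phi> x. v ((f ^^ j) x) * w ((f ^^ (j + n)) x)) \<partial>\<mu>)"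

text \<open>The starting heights from which n further steps stay within the same column. Truncated
  subtraction makes the sum empty for \<phi> x \<le> n, so its integral inherits the tail bound of
  the column sums.\<close>

definition short :: "nat \<Rightarrow> 'a \<Rightarrow> complex" where
  "short n x = (\<Sum>j<\<phi> x - n. v ((f ^^ j) x) * w ((f ^^ (j + n)) x))"

lemma wFm: "(\<lambda>x. w ((f ^^ i) (F x))) \<in> borel_measurable \<mu>"
  by (rule measurable_compose[OF F_meas wm])

lemma dnw_int: "integrable \<mu> (\<lambda>x. dn v k x * w ((f ^^ i) (F x)))"
proof (rule prod_int[OF wm W wb dn_meas dn_le _ wFm wn_bound[OF wm W wb F_Om]])
  show "integrable \<mu> (\<lambda>x. V0 * kd k x)" using kd_int by simp
qed

lemma short_meas: "short n \<in> borel_measurable \<mu>"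
  unfolding short_def[abs_def]
  by (rule phi_comp[of "\<lambda>i x. \<Sum>j<i - n. v ((f ^^ j) x) * w ((f ^^ (j + n)) x)"])
     (intro borel_measurable_sum borel_measurable_times vm wm)

lemma short_le: "x \<in> \<Omega> \<Longrightarrow> cmod (short n x) \<le> V0 * W * (if n < \<phi> x then H x else 0)"
proof -
  assume x: "x \<in> \<Omega>"
  have "cmod (short n x) \<le> (\<Sum>j<\<phi> x - n. cmod (v ((f ^^ j) x) * w ((f ^^ (j + n)) x)))"
    unfolding short_def by (rule norm_sum)
  also have "\<dots> \<le> (\<Sum>j<\<phi> x - n. (V0 * \<kappa> j x) * W)"
    unfolding norm_mult
    by (intro sum_mono mult_mono vb[OF x] wn_bound[OF wm W wb x] mult_nonneg_nonneg V0 kappa_nonneg) auto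
  also have "\<dots> = V0 * W * (\<Sum>j<\<phi> x - n. \<kappa> j x)" unfolding sum_distrib_left by (simp only: mult_ac)
  also have "\<dots> \<le> V0 * W * (if n < \<phi> x then H x else 0)"
  proof (intro mult_left_mono mult_nonneg_nonneg V0 W)
    have "(\<Sum>j<\<phi> x - n. \<kappa> j x) \<le> H x" unfolding H_def by (intro sum_mono2) (auto simp: kappa_nonneg)
    then show "(\<Sum>j<\<phi> x - n. \<kappa> j x) \<le> (if n < \<phi> x then H x else 0)" by simp
  qed
  finally show ?thesis .
qed

lemma short_int: "integrable \<mu> (short n)" and short_integral: "cmod (\<integral>x. short n x \<partial>\<mu>) \<le> V0 * W * (C\<^sub>\<kappa> * ts.qq n)"
proof -
  have g: "integrable \<mu> (\<lambda>x. V0 * W * (if n < \<phi> x then H x else 0))" using cutH_int by simp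
  show i: "integrable \<mu> (short n)"
  proof (rule Bochner_Integration.integrable_bound[OF g short_meas])
    show "AE x in \<mu>. norm (short n x) \<le> norm (V0 * W * (if n < \<phi> x then H x else 0))"
      using Om_AE
    proof eventually_elim
      case (elim x)
      from short_le[OF elim, of n] show ?case by (rule order_trans) (simp only: real_norm_def abs_ge_self)
    qed
  qed
  have "cmod (\<integral>x. short n x \<partial>\<mu>) \<le> (\<integral>x. norm (short n x) \<partial>\<mu>)" by (rule integral_norm_bound)
  also have "\<dots> \<le> (\<integral>x. V0 * W * (if n < \<phi> x then H x else 0) \<partial>\<mu>)"
  proof (rule integral_mono_AE)
    show "AE x in \<mu>. norm (short n x) \<le> V0 * W * (if n < \<phi> x then H x else 0)"
      using Om_AE by eventually_elim (rule short_le)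
  qed (use i g in auto)
  also have "\<dots> = V0 * W * (\<integral>x. (if n < \<phi> x then H x else 0) \<partial>\<mu>)" by (rule integral_mult_right_zero)
  also have "\<dots> \<le> V0 * W * (C\<^sub>\<kappa> * ts.qq n)" by (intro mult_left_mono cutH_le mult_nonneg_nonneg V0 W)
  finally show "cmod (\<integral>x. short n x \<partial>\<mu>) \<le> V0 * W * (C\<^sub>\<kappa> * ts.qq n)" .
qed

text \<open>From the remaining heights j the column is left after k = \<phi> x - j steps, with 1
  \<le> k \<le> n. This moves time to a return to Y, where duality makes \<open>R\<close> act on the
  values k steps below the top.\<close>

lemma corr_split: "corr n = (\<integral>x. short n x \<partial>\<mu>) + (\<Sum>k=1..n. \<integral>x. R (dn v k) x * w ((f ^^ (n - k)) x) \<partial>\<mu>)"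
proof -
  have pt: "(\<Sum>j<\<phi> x. v ((f ^^ j) x) * w ((f ^^ (j + n)) x)) = short n x + (\<Sum>k=1..n. dn v k x * w ((f ^^ (n - k)) (F x)))"
    if x: "x \<in> \<Omega>" for x
  proof -
    let ?g = "\<lambda>j. v ((f ^^ j) x) * w ((f ^^ (j + n)) x)"
    have "(\<Sum>j<\<phi> x. ?g j) = (\<Sum>j<\<phi> x - n. ?g j) + (\<Sum>j\<in>{\<phi> x - n..<\<phi> x}. ?g j)"
      by (subst sum.union_disjoint[symmetric]) (auto intro!: sum.cong)
    also have "(\<Sum>j\<in>{\<phi> x - n..<\<phi> x}. ?g j) = (\<Sum>k\<in>{1..n} \<inter> {..\<phi> x}. v ((f ^^ (\<phi> x - k)) x) * w ((f ^^ (n - k)) (F x)))"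
    proof (rule sum.reindex_bij_witness[of _ "\<lambda>k. \<phi> x - k" "\<lambda>j. \<phi> x - j"])
      fix j assume j: "j \<in> {\<phi> x - n..<\<phi> x}"
      have le: "\<phi> x \<le> j + n" using j by auto
      have e: "j + n - \<phi> x = n - (\<phi> x - j)" using j by auto
      have "(f ^^ (j + n)) x = (f ^^ (n - (\<phi> x - j))) (F x)"
        using funpow_F[OF wm W wb x le] unfolding e .
      then show "v ((f ^^ (\<phi> x - (\<phi> x - j))) x) * w ((f ^^ (n - (\<phi> x - j))) (F x)) = ?g j" using j by simp
    qed auto
    also have "\<dots> = (\<Sum>k=1..n. dn v k x * w ((f ^^ (n - k)) (F x)))"
      unfolding sum.inter_restrict[OF finite_atLeastAtMost] by (rule sum.cong) (auto simp: dn_def)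
    finally show ?thesis by (simp add: short_def)
  qed
  have "corr n = (\<integral>x. short n x + (\<Sum>k=1..n. dn v k x * w ((f ^^ (n - k)) (F x))) \<partial>\<mu>)"
    unfolding corr_def
  proof (rule integral_cong_AE)
    show "(\<lambda>x. \<Sum>j<\<phi> x. v ((f ^^ j) x) * w ((f ^^ (j + n)) x)) \<in> borel_measurable \<mu>"
      by (rule phi_comp[of "\<lambda>i x. \<Sum>j<i. v ((f ^^ j) x) * w ((f ^^ (j + n)) x)"])
         (intro borel_measurable_sum borel_measurable_times vm wm)
    show "(\<lambda>x. short n x + (\<Sum>k=1..n. dn v k x * w ((f ^^ (n - k)) (F x)))) \<in> borel_measurable \<mu>"
      by (intro borel_measurable_add borel_measurable_sum borel_measurable_times short_meas dn_meas wFm)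
    show "AE x in \<mu>. (\<Sum>j<\<phi> x. v ((f ^^ j) x) * w ((f ^^ (j + n)) x)) = short n x + (\<Sum>k=1..n. dn v k x * w ((f ^^ (n - k)) (F x)))"
      using Om_AE by eventually_elim (rule pt)
  qed
  also have "\<dots> = (\<integral>x. short n x \<partial>\<mu>) + (\<Sum>k=1..n. \<integral>x. dn v k x * w ((f ^^ (n - k)) (F x)) \<partial>\<mu>)"
    using short_int dnw_int
    by (subst Bochner_Integration.integral_add) (auto intro!: Bochner_Integration.integrable_sum Bochner_Integration.integral_sum)
  also have "(\<Sum>k=1..n. \<integral>x. dn v k x * w ((f ^^ (n - k)) (F x)) \<partial>\<mu>) = (\<Sum>k=1..n. \<integral>x. R (dn v k) x * w ((f ^^ (n - k)) x) \<partial>\<mu>)"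
    by (rule sum.cong[OF refl]) (rule R_dual(2)[of _ "\<lambda>x. w ((f ^^ _) x)", symmetric], rule dnw_int)
  finally show ?thesis .
qed

text \<open>The P-part of T_l sees only the mean of \<open>R (dn v k)\<close>, which is
  \<open>xk k\<close>; the rest is an operator of size c, paired with the integral of the test
  function.\<close>

lemma term_split:
  assumes T: "fps_nth T l = cm (of_real (1 / phibar)) * P0 + cm (of_real (ts.t l / phibar\<^sup>2)) * P0 + A" and A: "bd A c"
  shows "cmod ((\<integral>x. ap (fps_nth T l) (R (dn v k)) x * up w r x \<partial>\<mu>) - of_real (crate l) * xk k * yk r)
    \<le> 2 * C\<^sub>1 * (V0 * W) * (c * kap k * ome r)"
proof -
  let ?u = "R (dn v k)"
  have uV: "?u \<in> V" by (rule Rdn)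
  have AV: "ap A ?u \<in> V" by (rule bd_V[OF A uV])
  have ui: "(\<integral>x. ?u x \<partial>\<mu>) = xk k" unfolding xk_def by (rule R_integral(2)[OF dn_int])
  have iA: "integrable \<mu> (\<lambda>x. ap A ?u x * up w r x)"
    by (rule V_prod_int[OF wm W wb AV up_meas[OF wm W wb] up_le_W[OF wm W wb]])
  have i2: "integrable \<mu> (\<lambda>x. of_real (crate l) * xk k * up w r x)" using up_int by simp
  have "(\<integral>x. ap (fps_nth T l) ?u x * up w r x \<partial>\<mu>) = (\<integral>x. of_real (crate l) * xk k * up w r x + ap A ?u x * up w r x \<partial>\<mu>)"
  proof (rule integral_cong_AE)
    show "(\<lambda>x. ap (fps_nth T l) ?u x * up w r x) \<in> borel_measurable \<mu>"
      by (intro borel_measurable_times V_meas[OF T_V[OF uV]] up_meas[OF wm W wb])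
    show "(\<lambda>x. of_real (crate l) * xk k * up w r x + ap A ?u x * up w r x) \<in> borel_measurable \<mu>"
      using iA i2 by (intro borel_measurable_add) auto
    show "AE x in \<mu>. ap (fps_nth T l) ?u x * up w r x = of_real (crate l) * xk k * up w r x + ap A ?u x * up w r x"
      using Om_AE
    proof eventually_elim
      case (elim x)
      have "ap (fps_nth T l) ?u x = of_real (crate l) * xk k + ap A ?u x"
        unfolding T using elim by (simp add: ap_P0[OF uV] ui crate_def algebra_simps)
      then show ?case by (simp only: distrib_right)
    qed
  qed
  also have "\<dots> = (\<integral>x. of_real (crate l) * xk k * up w r x \<partial>\<mu>) + (\<integral>x. ap A ?u x * up w r x \<partial>\<mu>)"
    by (rule Bochner_Integration.integral_add[OF i2 iA])
  also have "(\<integral>x. of_real (crate l) * xk k * up w r x \<partial>\<mu>) = of_real (crate l) * xk k * yk r"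
    unfolding yk_def by (rule integral_mult_right_zero)
  finally have e: "(\<integral>x. ap (fps_nth T l) ?u x * up w r x \<partial>\<mu>) - of_real (crate l) * xk k * yk r = (\<integral>x. ap A ?u x * up w r x \<partial>\<mu>)" by simp
  have "cmod (\<integral>x. ap A ?u x * up w r x \<partial>\<mu>) \<le> (\<integral>x. norm (ap A ?u x * up w r x) \<partial>\<mu>)" by (rule integral_norm_bound)
  also have "\<dots> \<le> (\<integral>x. nrm (ap A ?u) * norm (up w r x) \<partial>\<mu>)"
  proof (rule integral_mono_AE)
    show "AE x in \<mu>. norm (ap A ?u x * up w r x) \<le> nrm (ap A ?u) * norm (up w r x)"
      using Om_AE
    proof eventually_elim
      case (elim x)
      show ?case unfolding norm_mult by (rule mult_right_mono[OF nrm_pt[OF AV elim] norm_ge_zero])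
    qed
    show "integrable \<mu> (\<lambda>x. norm (ap A ?u x * up w r x))" by (rule integrable_norm[OF iA])
    show "integrable \<mu> (\<lambda>x. nrm (ap A ?u) * norm (up w r x))" by (rule integrable_mult_right[OF integrable_norm[OF up_int]])
  qed
  also have "\<dots> = nrm (ap A ?u) * (\<integral>x. norm (up w r x) \<partial>\<mu>)" by (rule integral_mult_right_zero)
  also have "\<dots> \<le> (c * (2 * C\<^sub>1 * (V0 * kap k))) * (W * ome r)"
  proof (intro mult_mono up_norm_int)
    have "nrm (ap A ?u) \<le> c * nrm ?u" by (rule bd_nrm[OF A uV])
    also have "\<dots> \<le> c * (2 * C\<^sub>1 * (V0 * kap k))" by (intro mult_left_mono Rdn(2) bd_nonneg[OF A])
    finally show "nrm (ap A ?u) \<le> c * (2 * C\<^sub>1 * (V0 * kap k))" .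
    show "0 \<le> c * (2 * C\<^sub>1 * (V0 * kap k))" using bd_nonneg[OF A] C1 V0 kap_nonneg[of k] by simp
    show "0 \<le> (\<integral>x. norm (up w r x) \<partial>\<mu>)" by (intro integral_nonneg_AE) simp
  qed
  also have "\<dots> = 2 * C\<^sub>1 * (V0 * W) * (c * kap k * ome r)" by (simp only: mult_ac)
  finally show ?thesis unfolding e .
qed

text \<open>All constants are fixed by the hypotheses before v and w enter the bound, which is what
  makes the final constant uniform in the observables.\<close>

lemma main_estimate:
  assumes TA: "\<And>l. fps_nth T l = cm (of_real (1 / phibar)) * P0 + cm (of_real (ts.t l / phibar\<^sup>2)) * P0 + A l \<and> bd (A l) (C * ts.dd l)"
    and Cd: "\<And>a s n. ts.TL a s \<Longrightarrow> (\<Sum>i=0..n. s i * ts.dd (n - i)) \<le> Cd * a * ts.dd n"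
    and Cq: "\<And>n. ts.qq n \<le> Cq * ts.dd n" and C0: "0 \<le> C"
    and a_def: "a = 2 * 2 powr \<beta> * (C\<^sub>\<kappa> * 2 powr \<beta>) * C\<^sub>\<kappa>"
    and k_def: "k = (2 powr \<beta> * C\<^sub>\<tau> * suminf ts.qq + ts.t 0 * 2 powr \<beta>) * a"
  shows "cmod (corr n - of_real (crate n) * (\<integral>x. (\<Sum>j<\<phi> x. v ((f ^^ j) x)) \<partial>\<mu>) * (\<integral>x. (\<Sum>j<\<phi> x. w ((f ^^ j) x)) \<partial>\<mu>))
    \<le> (C\<^sub>\<kappa> * Cq + 2 * C\<^sub>1 * C * Cd * a + k / phibar\<^sup>2 * Cq + crate 0 * a * Cq) * V0 * W * ts.dd n"
proof -
  let ?I = "(\<integral>x. (\<Sum>j<\<phi> x. v ((f ^^ j) x)) \<partial>\<mu>) * (\<integral>x. (\<Sum>j<\<phi> x. w ((f ^^ j) x)) \<partial>\<mu>)"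
  have VW: "0 \<le> V0 * W" using V0 W by simp
  have TLs: "ts.TL a sig" unfolding a_def by (rule TL_sig)
  have sig0: "0 \<le> sig i" for i by (rule ts.TL_nonneg[OF TLs])
  \<comment> \<open>The leading terms, regrouped by l; the sum over k is then the convolution
    \<open>sk\<close>.\<close>
  define M where "M = (\<Sum>l=0..n. of_real (crate l) * sk (n - l))"
  define Err where "Err = (\<Sum>k=0..n. \<Sum>l=0..n - k. (\<integral>x. ap (fps_nth T l) (R (dn v k)) x * up w (n - k - l) x \<partial>\<mu>) - of_real (crate l) * xk k * yk (n - k - l))"
  have swap: "(\<Sum>k=0..n. \<Sum>l=0..n - k. g k l) = (\<Sum>l=0..n. \<Sum>k=0..n - l. g k l)" for g :: "nat \<Rightarrow> nat \<Rightarrow> 'z::comm_monoid_add"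
    unfolding sum.Sigma[OF finite_atLeastAtMost ballI[OF finite_atLeastAtMost]]
    by (rule sum.reindex_bij_witness[of _ "\<lambda>(l, k). (k, l)" "\<lambda>(k, l). (l, k)"]) auto
  have z0: "R (dn v 0) = (\<lambda>x. 0)" by (rule ext) (simp add: R_def dn_def)
  have c1: "corr n = (\<integral>x. short n x \<partial>\<mu>) + (\<Sum>k=0..n. \<Sum>l=0..n - k. \<integral>x. ap (fps_nth T l) (R (dn v k)) x * up w (n - k - l) x \<partial>\<mu>)"
  proof -
    have "(\<Sum>k=1..n. \<integral>x. R (dn v k) x * w ((f ^^ (n - k)) x) \<partial>\<mu>) = (\<Sum>k=0..n. \<integral>x. R (dn v k) x * w ((f ^^ (n - k)) x) \<partial>\<mu>)"
      by (simp add: sum.atLeast_Suc_atMost[of 0 n] z0)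
    also have "\<dots> = (\<Sum>k=0..n. \<Sum>l=0..n - k. \<integral>x. ap (fps_nth T l) (R (dn v k)) x * up w (n - k - l) x \<partial>\<mu>)"
      by (rule sum.cong[OF refl]) (rule renewal_decomp[OF wm W wb Rdn(1)])
    finally show ?thesis unfolding corr_split by simp
  qed
  have "(\<Sum>k=0..n. \<Sum>l=0..n - k. of_real (crate l) * xk k * yk (n - k - l)) = M"
    unfolding M_def sk_def sum_distrib_left
    by (rule trans[OF swap]) (intro sum.cong refl, simp add: mult.assoc add.commute)
  then have c2: "corr n = (\<integral>x. short n x \<partial>\<mu>) + M + Err"
    unfolding c1 Err_def by (simp add: sum_subtractf)
  have e1: "cmod Err \<le> 2 * C\<^sub>1 * C * Cd * a * (V0 * W) * ts.dd n"
  proof -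
    have "cmod Err \<le> (\<Sum>k=0..n. \<Sum>l=0..n - k. 2 * C\<^sub>1 * (V0 * W) * (C * ts.dd l * kap k * ome (n - k - l)))"
      unfolding Err_def
      by (intro order_trans[OF norm_sum] sum_mono term_split[OF conjunct1[OF TA] conjunct2[OF TA]])
    also have "\<dots> = (\<Sum>l=0..n. \<Sum>k=0..n - l. 2 * C\<^sub>1 * (V0 * W) * (C * ts.dd l * kap k * ome (n - k - l)))" by (rule swap)
    also have "\<dots> = 2 * C\<^sub>1 * (V0 * W) * C * (\<Sum>l=0..n. sig (n - l) * ts.dd l)"
      unfolding sig_def sum_distrib_left sum_distrib_right by (intro sum.cong refl) (simp add: add.commute mult_ac)
    also have "(\<Sum>l=0..n. sig (n - l) * ts.dd l) = (\<Sum>i=0..n. sig i * ts.dd (n - i))"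
      by (rule sum.reindex_bij_witness[of _ "\<lambda>i. n - i" "\<lambda>i. n - i"]) auto
    also have "2 * C\<^sub>1 * (V0 * W) * C * \<dots> \<le> 2 * C\<^sub>1 * (V0 * W) * C * (Cd * a * ts.dd n)"
      using C1 VW C0 by (intro mult_left_mono Cd[OF TLs]) auto
    finally show ?thesis by (simp only: mult_ac)
  qed
  have e2: "cmod (M - of_real (crate n) * ?I) \<le> (k / phibar\<^sup>2 * Cq + crate 0 * a * Cq) * (V0 * W) * ts.dd n"
  proof -
    have ssum: "summable (\<lambda>i. V0 * W * sig i)" by (rule summable_mult[OF ts.TL_total(2)[OF TLs]])
    have skn: "summable (\<lambda>i. norm (sk i))" by (rule summable_comparison_test'[OF ssum, of 0]) (simp add: sk_le)
    have "?I = (\<Sum>i. sk (i + Suc n)) + (\<Sum>i<Suc n. sk i)"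
      using suminf_split_initial_segment[OF summable_norm_cancel[OF skn], of "Suc n"] sk_total by (simp add: sums_iff)
    also have "(\<Sum>i<Suc n. sk i) = (\<Sum>i=0..n. sk i)" by (simp only: lessThan_Suc_atMost atLeast0AtMost)
    finally have I: "?I = (\<Sum>i. sk (i + Suc n)) + (\<Sum>i=0..n. sk i)" .
    have Mi: "M = (\<Sum>i=0..n. of_real (crate (n - i)) * sk i)"
      unfolding M_def by (rule sum.reindex_bij_witness[of _ "\<lambda>i. n - i" "\<lambda>i. n - i"]) auto
    \<comment> \<open>The factor at n - i is compared with the factor at n. Their difference is
      (t_(n-i) - t_n) / phibar^2, which \<open>TL_t\<close> handles, and the part of the total of
      \<open>sk\<close> beyond n is a tail of order n^(-\<beta>).\<close>
    have eM: "M - of_real (crate n) * ?I = (\<Sum>i=0..n. of_real (crate (n - i) - crate n) * sk i) - of_real (crate n) * (\<Sum>i. sk (i + Suc n))"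
      unfolding I Mi by (simp add: distrib_left left_diff_distrib sum_subtractf sum_distrib_left)
    have "cmod ((\<Sum>i=0..n. of_real (crate (n - i) - crate n) * sk i) - of_real (crate n) * (\<Sum>i. sk (i + Suc n)))
        \<le> cmod (\<Sum>i=0..n. of_real (crate (n - i) - crate n) * sk i) + cmod (of_real (crate n) * (\<Sum>i. sk (i + Suc n)))"
      by (rule norm_triangle_ineq4)
    also have "\<dots> \<le> V0 * W * (k * ts.qq n) / phibar\<^sup>2 + crate 0 * (V0 * W * (a * ts.qq n))"
    proof (rule add_mono)
      have "cmod (\<Sum>i=0..n. of_real (crate (n - i) - crate n) * sk i) \<le> (\<Sum>i=0..n. (ts.t (n - i) - ts.t n) / phibar\<^sup>2 * (V0 * W * sig i))"
      proof (rule order_trans[OF norm_sum], rule sum_mono)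
        fix i
        have t0: "0 \<le> (ts.t (n - i) - ts.t n) / phibar\<^sup>2" using ts.t_antimono[of "n - i" n] by simp
        show "cmod (of_real (crate (n - i) - crate n) * sk i) \<le> (ts.t (n - i) - ts.t n) / phibar\<^sup>2 * (V0 * W * sig i)"
          unfolding crate_diff norm_mult norm_of_real abs_of_nonneg[OF t0] by (rule mult_left_mono[OF sk_le t0])
      qed
      also have "\<dots> = V0 * W * (\<Sum>i=0..n. sig i * (ts.t (n - i) - ts.t n)) / phibar\<^sup>2"
        unfolding sum_distrib_left sum_divide_distrib by (intro sum.cong refl) (simp add: mult_ac)
      also have "\<dots> \<le> V0 * W * (k * ts.qq n) / phibar\<^sup>2"
        unfolding k_def by (intro divide_right_mono mult_left_mono ts.TL_t[OF TLs] VW) simp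
      finally show "cmod (\<Sum>i=0..n. of_real (crate (n - i) - crate n) * sk i) \<le> V0 * W * (k * ts.qq n) / phibar\<^sup>2" .
      have "cmod (\<Sum>i. sk (i + Suc n)) \<le> (\<Sum>i. norm (sk (i + Suc n)))"
        by (rule summable_norm[OF summable_ignore_initial_segment[OF skn]])
      also have "\<dots> \<le> (\<Sum>i. V0 * W * sig (i + Suc n))"
        by (rule suminf_le[OF sk_le summable_ignore_initial_segment[OF skn] summable_ignore_initial_segment[OF ssum]])
      also have "\<dots> = V0 * W * (\<Sum>i. sig (i + Suc n))"
        by (rule suminf_mult[OF summable_ignore_initial_segment[OF ts.TL_total(2)[OF TLs]]])
      also have "\<dots> \<le> V0 * W * (a * ts.qq (Suc n))" by (intro mult_left_mono ts.TL_total(4)[OF TLs] VW)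
      also have "\<dots> \<le> V0 * W * (a * ts.qq n)"
        by (intro mult_left_mono ts.qq_antimono VW ts.TL_A[OF TLs]) simp
      finally have "cmod (\<Sum>i. sk (i + Suc n)) \<le> V0 * W * (a * ts.qq n)" .
      then show "cmod (of_real (crate n) * (\<Sum>i. sk (i + Suc n))) \<le> crate 0 * (V0 * W * (a * ts.qq n))"
        unfolding norm_mult norm_of_real using crate_le[of 0]
        by (intro mult_mono crate_le) auto
    qed
    also have "\<dots> = (k / phibar\<^sup>2 + crate 0 * a) * (V0 * W) * ts.qq n" by (simp add: algebra_simps)
    also have "\<dots> \<le> (k / phibar\<^sup>2 + crate 0 * a) * (V0 * W) * (Cq * ts.dd n)"
    proof (intro mult_left_mono Cq mult_nonneg_nonneg add_nonneg_nonneg divide_nonneg_nonneg V0 W)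
      show "0 \<le> k" unfolding k_def using ts.t_nonneg[of 0] Ct ts.TL_A[OF TLs] suminf_nonneg[OF ts.qq_sum less_imp_le[OF ts.qq_pos]]
        by (intro mult_nonneg_nonneg add_nonneg_nonneg) auto
      show "0 \<le> crate 0" "0 \<le> a" "0 \<le> phibar\<^sup>2" using crate_le[of 0] ts.TL_A[OF TLs] by auto
    qed
    also have "\<dots> = (k / phibar\<^sup>2 * Cq + crate 0 * a * Cq) * (V0 * W) * ts.dd n" by (simp add: algebra_simps)
    finally show ?thesis unfolding eM .
  qed
  have e3: "cmod (\<integral>x. short n x \<partial>\<mu>) \<le> C\<^sub>\<kappa> * Cq * (V0 * W) * ts.dd n"
  proof -
    have "cmod (\<integral>x. short n x \<partial>\<mu>) \<le> V0 * W * (C\<^sub>\<kappa> * ts.qq n)" by (rule short_integral)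
    also have "\<dots> \<le> V0 * W * (C\<^sub>\<kappa> * (Cq * ts.dd n))" by (intro mult_left_mono Cq Ck VW)
    finally show ?thesis by (simp only: mult_ac)
  qed
  have e: "corr n - of_real (crate n) * ?I = (\<integral>x. short n x \<partial>\<mu>) + Err + (M - of_real (crate n) * ?I)" unfolding c2 by simp
  have "cmod ((\<integral>x. short n x \<partial>\<mu>) + Err + (M - of_real (crate n) * ?I)) \<le> C\<^sub>\<kappa> * Cq * (V0 * W) * ts.dd n + 2 * C\<^sub>1 * C * Cd * a * (V0 * W) * ts.dd n + (k / phibar\<^sup>2 * Cq + crate 0 * a * Cq) * (V0 * W) * ts.dd n"
    by (intro norm_triangle_mono e1 e2 e3)
  also have "\<dots> = (C\<^sub>\<kappa> * Cq + 2 * C\<^sub>1 * C * Cd * a + k / phibar\<^sup>2 * Cq + crate 0 * a * Cq) * V0 * W * ts.dd n"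
    by (simp only: distrib_right mult.assoc add.assoc)
  finally show ?thesis using e by (simp only: mult.assoc)
qed

lemmas main_estimate_unfolded = main_estimate[unfolded corr_def crate_def]

end

theorem correlation_bound:
  "\<exists>K. \<forall>v w V0 W n. (\<forall>i. (\<lambda>x. v ((f ^^ i) x)) \<in> borel_measurable \<mu>) \<longrightarrow> 0 \<le> V0 \<longrightarrow>
    (\<forall>i x. x \<in> \<Omega> \<longrightarrow> i < \<phi> x \<longrightarrow> cmod (v ((f ^^ i) x)) \<le> V0 * \<kappa> i x) \<longrightarrow>
    (\<forall>a x x' i. a \<in> \<alpha> \<longrightarrow> x \<in> a \<longrightarrow> x \<in> \<Omega> \<longrightarrow> x' \<in> a \<longrightarrow> x' \<in> \<Omega> \<longrightarrow> i < \<phi> x \<longrightarrow>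
      cmod (v ((f ^^ i) x) - v ((f ^^ i) x')) \<le> V0 * \<kappa> i x * d x x') \<longrightarrow>
    (\<forall>i. (\<lambda>x. w ((f ^^ i) x)) \<in> borel_measurable \<mu>) \<longrightarrow> 0 \<le> W \<longrightarrow>
    (\<forall>i x. x \<in> \<Omega> \<longrightarrow> i < \<phi> x \<longrightarrow> cmod (w ((f ^^ i) x)) \<le> W * \<kappa> i x) \<longrightarrow>
    cmod ((\<integral>x. (\<Sum>j<\<phi> x. v ((f ^^ j) x) * w ((f ^^ (j + n)) x)) \<partial>\<mu>)
      - of_real (1 / phibar + ts.t n / phibar\<^sup>2) * (\<integral>x. (\<Sum>j<\<phi> x. v ((f ^^ j) x)) \<partial>\<mu>) * (\<integral>x. (\<Sum>j<\<phi> x. w ((f ^^ j) x)) \<partial>\<mu>))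
    \<le> K * V0 * W * ts.dd n"
proof -
  obtain C A where CA: "\<And>n. fps_nth T n = cm (of_real (1 / phibar)) * P0 + cm (of_real (ts.t n / phibar\<^sup>2)) * P0 + A n \<and> bd (A n) (C * ts.dd n)"
    using T_expansion by metis
  obtain Cd where Cd: "\<And>a s n. ts.TL a s \<Longrightarrow> (\<Sum>i=0..n. s i * ts.dd (n - i)) \<le> Cd * a * ts.dd n" using ts.TL_dd by blast
  obtain Cq where Cq: "\<And>n. ts.qq n \<le> Cq * ts.dd n" using ts.qq_dd by blast
  have C0: "0 \<le> C" using bd_nonneg[OF conjunct2[OF CA[of 0]]] ts.dd_pos[of 0] by (simp add: zero_le_mult_iff)
  define a where "a = 2 * 2 powr \<beta> * (C\<^sub>\<kappa> * 2 powr \<beta>) * C\<^sub>\<kappa>"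
  define k where "k = (2 powr \<beta> * C\<^sub>\<tau> * suminf ts.qq + ts.t 0 * 2 powr \<beta>) * a"
  show ?thesis
  proof (rule exI[of _ "C\<^sub>\<kappa> * Cq + 2 * C\<^sub>1 * C * Cd * a + k / phibar\<^sup>2 * Cq + (1 / phibar + ts.t 0 / phibar\<^sup>2) * a * Cq"], intro allI impI)
    fix v w :: "'a \<Rightarrow> complex" and V0 W :: real and n :: nat
    assume h: "\<forall>i. (\<lambda>x. v ((f ^^ i) x)) \<in> borel_measurable \<mu>" "0 \<le> V0"
      "\<forall>i x. x \<in> \<Omega> \<longrightarrow> i < \<phi> x \<longrightarrow> cmod (v ((f ^^ i) x)) \<le> V0 * \<kappa> i x"
      "\<forall>a x x' i. a \<in> \<alpha> \<longrightarrow> x \<in> a \<longrightarrow> x \<in> \<Omega> \<longrightarrow> x' \<in> a \<longrightarrow> x' \<in> \<Omega> \<longrightarrow> i < \<phi> x \<longrightarrow>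
        cmod (v ((f ^^ i) x) - v ((f ^^ i) x')) \<le> V0 * \<kappa> i x * d x x'"
      "\<forall>i. (\<lambda>x. w ((f ^^ i) x)) \<in> borel_measurable \<mu>" "0 \<le> W"
      "\<forall>i x. x \<in> \<Omega> \<longrightarrow> i < \<phi> x \<longrightarrow> cmod (w ((f ^^ i) x)) \<le> W * \<kappa> i x"
    have vl: "cmod (v ((f ^^ i) x) - v ((f ^^ i) x')) \<le> V0 * \<kappa> i x * d x x'"
      if "b \<in> \<alpha>" "x \<in> b" "x \<in> \<Omega>" "x' \<in> b" "x' \<in> \<Omega>" "i < \<phi> x" for b x x' i using h(4) that by blast
    show "cmod ((\<integral>x. (\<Sum>j<\<phi> x. v ((f ^^ j) x) * w ((f ^^ (j + n)) x)) \<partial>\<mu>)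
      - of_real (1 / phibar + ts.t n / phibar\<^sup>2) * (\<integral>x. (\<Sum>j<\<phi> x. v ((f ^^ j) x)) \<partial>\<mu>) * (\<integral>x. (\<Sum>j<\<phi> x. w ((f ^^ j) x)) \<partial>\<mu>))
      \<le> (C\<^sub>\<kappa> * Cq + 2 * C\<^sub>1 * C * Cd * a + k / phibar\<^sup>2 * Cq + (1 / phibar + ts.t 0 / phibar\<^sup>2) * a * Cq) * V0 * W * ts.dd n"
      by (rule main_estimate_unfolded[OF h(1)[rule_format] h(2) h(3)[rule_format] vl h(5)[rule_format] h(6) h(7)[rule_format] CA Cd Cq C0 a_def k_def, where n = n]; assumption)
  qed
qed

end

section \<open>Gibbs Markov maps with full branches\<close>

lemma separation_time_diff:
  assumes "a \<in> \<alpha>" "b \<in> \<alpha>" "a \<noteq> b" "x \<in> a" "y \<in> b"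
  shows "separation_time \<alpha> F x y = 0"
proof -
  have "(0 :: nat) \<in> {n. \<exists>a\<in>\<alpha>. \<exists>b\<in>\<alpha>. a \<noteq> b \<and> (F ^^ n) x \<in> a \<and> (F ^^ n) y \<in> b}" using assms by auto
  then have "separation_time \<alpha> F x y \<le> enat 0" unfolding separation_time_def by (rule INF_lower)
  then show ?thesis by (simp flip: zero_enat_def)
qed

lemma INF_Suc_enat: "(INF n\<in>Suc ` S. enat n) = eSuc (INF n\<in>S. enat n)"
proof (cases "S = {}")
  case False
  define l where "l = (LEAST n. n \<in> S)"
  have l: "l \<in> S" "\<And>n. n \<in> S \<Longrightarrow> l \<le> n" using False by (auto simp: l_def intro: LeastI Least_le)
  have "(INF n\<in>S. enat n) = enat l" by (intro antisym INF_lower INF_greatest) (use l in auto)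
  moreover have "(INF n\<in>Suc ` S. enat n) = enat (Suc l)" by (intro antisym INF_lower INF_greatest) (use l in auto)
  ultimately show ?thesis by (simp add: eSuc_enat)
qed (simp add: top_enat_def)

text \<open>Two points of one cell are not separated at time 0, so their separating times are
  exactly those of the images shifted by one; an empty set of times gives infinity on both
  sides.\<close>

lemma separation_time_Suc:
  assumes "disjoint \<alpha>" "a \<in> \<alpha>" "x \<in> a" "y \<in> a"
  shows "separation_time \<alpha> F x y = eSuc (separation_time \<alpha> F (F x) (F y))"
proof -
  let ?S = "\<lambda>x y. {n. \<exists>a\<in>\<alpha>. \<exists>b\<in>\<alpha>. a \<noteq> b \<and> (F ^^ n) x \<in> a \<and> (F ^^ n) y \<in> b}"
  have "c = a" if "c \<in> \<alpha>" "x \<in> c \<or> y \<in> c" for c using assms that by (auto simp: disjoint_def)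
  then have "0 \<notin> ?S x y" by auto
  moreover have "Suc n \<in> ?S x y \<longleftrightarrow> n \<in> ?S (F x) (F y)" for n by (simp add: funpow_swap1)
  ultimately have S: "?S x y = Suc ` ?S (F x) (F y)"
    by (intro set_eqI, case_tac xa) (auto simp: image_iff simp del: mem_Collect_eq)
  show ?thesis unfolding separation_time_def S by (rule INF_Suc_enat)
qed

lemma d_theta_range: assumes "0 < \<theta>" "\<theta> < 1" shows "0 \<le> d_theta \<alpha> F \<theta> x y" "d_theta \<alpha> F \<theta> x y \<le> 1"
  using assms by (auto simp: d_theta_def power_le_one split: enat.split)

lemma d_theta_diff:
  assumes "a \<in> \<alpha>" "b \<in> \<alpha>" "a \<noteq> b" "x \<in> a" "y \<in> b" shows "d_theta \<alpha> F \<theta> x y = 1"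
  using separation_time_diff[OF assms] by (simp add: d_theta_def zero_enat_def)

lemma d_theta_Suc:
  assumes "disjoint \<alpha>" "a \<in> \<alpha>" "x \<in> a" "y \<in> a"
  shows "d_theta \<alpha> F \<theta> x y = \<theta> * d_theta \<alpha> F \<theta> (F x) (F y)"
  unfolding d_theta_def separation_time_Suc[OF assms]
  by (cases "separation_time \<alpha> F (F x) (F y)") (auto simp: eSuc_enat)

text \<open>\<open>core\<close> and \<open>rng\<close> select, for each cell, the subsets of full
  measure between which \<open>F\<close> is a genuine bijection.\<close>

locale gibbs_markov_data = prob_space \<mu> for \<mu> :: "'a measure" +
  fixes F :: "'a \<Rightarrow> 'a" and \<alpha> :: "'a set set" and \<theta> :: real and p :: "'a \<Rightarrow> real" and C :: real
    and core :: "'a set \<Rightarrow> 'a set" and rng :: "'a set \<Rightarrow> 'a set"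
  assumes pres: "measure_preserving_map \<mu> F"
    and part: "countable_partition_mod \<mu> \<alpha>"
    and theta01: "0 < \<theta>" "\<theta> < 1"
    and p_meas [measurable]: "p \<in> borel_measurable \<mu>" and C_pos: "C > 0"
    and bij: "\<And>a. a \<in> \<alpha> \<Longrightarrow> bijection_mod \<mu> F a (core a) (rng a)"
    and dens: "\<And>a. a \<in> \<alpha> \<Longrightarrow>
      density (image_measure \<mu> F (core a)) (\<lambda>y. ennreal (exp (p y))) = restrict_space \<mu> (core a)"
    and gibbs: "\<And>a y y'. a \<in> \<alpha> \<Longrightarrow> y \<in> a \<inter> itinerary_set \<alpha> F \<Longrightarrow> y' \<in> a \<inter> itinerary_set \<alpha> F \<Longrightarrow>
      exp (p y) \<le> C * measure \<mu> a \<and> \<bar>exp (p y) - exp (p y')\<bar> \<le> C * measure \<mu> a * d_theta \<alpha> F \<theta> y y'"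
begin

lemma F_measurable: "F \<in> measurable \<mu> \<mu>" and F_distr: "distr \<mu> \<mu> F = \<mu>"
  using pres by (auto simp: measure_preserving_map_def)

lemma cells: "countable \<alpha>" "a \<in> \<alpha> \<Longrightarrow> a \<in> sets \<mu>" "disjoint \<alpha>" "emeasure \<mu> (space \<mu> - \<Union>\<alpha>) = 0"
  using part by (auto simp: countable_partition_mod_def)

context
  fixes a assumes a: "a \<in> \<alpha>"
begin

lemma core: "core a \<in> sets \<mu>" "core a \<subseteq> a" "emeasure \<mu> (a - core a) = 0" "core a \<inter> space \<mu> = core a"
  and rng: "rng a \<in> sets \<mu>" "emeasure \<mu> (space \<mu> - rng a) = 0" "rng a \<inter> space \<mu> = rng a"
  and core_bij: "bij_betw F (core a) (rng a)"
  and image_sets: "A \<in> sets \<mu> \<Longrightarrow> A \<subseteq> core a \<Longrightarrow> F ` A \<in> sets \<mu>"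
  using bij[OF a] sets.sets_into_space[of "core a" \<mu>] sets.sets_into_space[of "rng a" \<mu>]
  by (auto simp: bijection_mod_def)

definition "branch = inv_into (core a) F"

lemma branch: "y \<in> rng a \<Longrightarrow> branch y \<in> core a" "y \<in> rng a \<Longrightarrow> F (branch y) = y"
    "x \<in> core a \<Longrightarrow> branch (F x) = x" "x \<in> core a \<Longrightarrow> F x \<in> rng a"
  using core_bij bij_betw_inv_into_right[OF core_bij] bij_betw_inv_into_left[OF core_bij]
  by (auto simp: branch_def bij_betw_def intro: inv_into_into)

lemma branch_vimage: "A \<subseteq> core a \<Longrightarrow> branch -` A \<inter> rng a = F ` A"
proof (intro equalityI subsetI)
  fix y assume "A \<subseteq> core a" "y \<in> branch -` A \<inter> rng a"
  then show "y \<in> F ` A" using branch(2)[of y] by (intro image_eqI[of _ _ "branch y"]) auto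
next
  fix y assume "A \<subseteq> core a" "y \<in> F ` A"
  then show "y \<in> branch -` A \<inter> rng a" using branch(3,4) by auto
qed

lemma branch_measurable: "branch \<in> measurable (restrict_space \<mu> (rng a)) (restrict_space \<mu> (core a))"
proof (rule measurableI)
  fix y assume "y \<in> space (restrict_space \<mu> (rng a))"
  then show "branch y \<in> space (restrict_space \<mu> (core a))"
    using branch(1)[of y] rng(3) core(4) by (auto simp: space_restrict_space)
next
  fix A assume "A \<in> sets (restrict_space \<mu> (core a))"
  then have A: "A \<in> sets \<mu>" "A \<subseteq> core a" using sets_restrict_space_iff[of "core a" \<mu> A] core(1,4) by auto
  have "branch -` A \<inter> space (restrict_space \<mu> (rng a)) = F ` A"
    using branch_vimage[OF A(2)] rng(3) by (simp add: space_restrict_space Int_commute)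
  moreover have "F ` A \<subseteq> rng a" using branch_vimage[OF A(2)] by auto
  ultimately show "branch -` A \<inter> space (restrict_space \<mu> (rng a)) \<in> sets (restrict_space \<mu> (rng a))"
    using image_sets[OF A] rng(1,3) by (simp add: sets_restrict_space_iff)
qed

text \<open>A set function passed to \<open>measure_of\<close> is only known to be the resulting
  measure once it is countably additive. Recognising it as a push-forward under the inverse branch
  settles this and makes integrals computable.\<close>

lemma image_measure_eq:
  "image_measure \<mu> F (core a) = distr (restrict_space \<mu> (rng a)) (restrict_space \<mu> (core a)) branch" (is "_ = ?D")
proof -
  have sp: "space (restrict_space \<mu> (core a)) = core a" using core(4) by (simp add: space_restrict_space)
  have ss: "sigma_sets (core a) (sets (restrict_space \<mu> (core a))) = sets (restrict_space \<mu> (core a))"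
    using sets.sigma_sets_eq[of "restrict_space \<mu> (core a)"] sp by simp
  have "?D = measure_of (space ?D) (sets ?D) (emeasure ?D)" by (rule measure_of_of_measure[symmetric])
  also have "\<dots> = measure_of (core a) (sets (restrict_space \<mu> (core a))) (emeasure ?D)" by (simp add: sp)
  also have "\<dots> = measure_of (core a) (sets (restrict_space \<mu> (core a))) (\<lambda>A. emeasure \<mu> (F ` A))"
  proof (rule measure_of_eq)
    show "sets (restrict_space \<mu> (core a)) \<subseteq> Pow (core a)"
      using sets.space_closed[of "restrict_space \<mu> (core a)"] sp by simp
    fix A assume "A \<in> sigma_sets (core a) (sets (restrict_space \<mu> (core a)))"
    then have A': "A \<in> sets (restrict_space \<mu> (core a))" using ss by simp
    then have A: "A \<in> sets \<mu>" "A \<subseteq> core a" using sets_restrict_space_iff[of "core a" \<mu> A] core(1,4) by auto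
    have e: "branch -` A \<inter> space (restrict_space \<mu> (rng a)) = F ` A"
      using branch_vimage[OF A(2)] rng(3) by (simp add: space_restrict_space Int_commute)
    have "F ` A \<subseteq> rng a" using branch_vimage[OF A(2)] by auto
    then show "emeasure ?D A = emeasure \<mu> (F ` A)"
      using rng(1,3) unfolding emeasure_distr[OF branch_measurable A'] e by (simp add: emeasure_restrict_space)
  qed
  finally show ?thesis by (simp add: image_measure_def)
qed

lemma branch_change:
  assumes A: "A \<in> sets \<mu>"
  shows "emeasure \<mu> (A \<inter> a) = (\<integral>\<^sup>+ y. ennreal (exp (p (branch y))) * indicator A (branch y) * indicator (rng a) y \<partial>\<mu>)"
proof -
  have p': "p \<in> borel_measurable (restrict_space \<mu> (core a))" by (rule measurable_restrict_space1[OF p_meas])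
  have Ac: "A \<inter> core a \<in> sets (restrict_space \<mu> (core a))"
    using A core(1,4) by (simp add: sets_restrict_space_iff)
  have i': "(indicator (A \<inter> core a) :: 'a \<Rightarrow> ennreal) \<in> borel_measurable (restrict_space \<mu> (core a))"
    using Ac by (rule borel_measurable_indicator)
  have m': "(\<lambda>x. ennreal (exp (p x)) * indicator (A \<inter> core a) x) \<in> borel_measurable (restrict_space \<mu> (core a))"
    by (intro borel_measurable_times_ennreal i' measurable_compose[OF p']) measurable
  have e': "(\<lambda>x. ennreal (exp (p x))) \<in> borel_measurable (restrict_space \<mu> (core a))"
    by (intro measurable_compose[OF p']) measurable
  have "emeasure \<mu> (A \<inter> a) = emeasure \<mu> (A \<inter> core a)"
  proof (rule emeasure_eq_AE)
    have "a - core a \<in> null_sets \<mu>" using core(1,3) cells(2)[OF a] by (simp add: null_sets_def)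
    from AE_not_in[OF this] show "AE x in \<mu>. (x \<in> A \<inter> a) = (x \<in> A \<inter> core a)"
      by eventually_elim (use core(2) in auto)
  qed (use A core cells(2)[OF a] in auto)
  also have "\<dots> = emeasure (restrict_space \<mu> (core a)) (A \<inter> core a)"
    using core(1,4) by (simp add: emeasure_restrict_space)
  also have "\<dots> = emeasure (density (image_measure \<mu> F (core a)) (\<lambda>y. ennreal (exp (p y)))) (A \<inter> core a)"
    by (simp only: dens[OF a])
  also have "\<dots> = (\<integral>\<^sup>+ x. ennreal (exp (p x)) * indicator (A \<inter> core a) x \<partial>image_measure \<mu> F (core a))"
    by (rule emeasure_density) (use e' Ac in \<open>simp_all add: image_measure_eq\<close>)
  also have "\<dots> = (\<integral>\<^sup>+ y. ennreal (exp (p (branch y))) * indicator (A \<inter> core a) (branch y) \<partial>restrict_space \<mu> (rng a))"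
    unfolding image_measure_eq
    by (rule nn_integral_distr[OF branch_measurable]) (use m' in simp)
  also have "\<dots> = (\<integral>\<^sup>+ y. ennreal (exp (p (branch y))) * indicator (A \<inter> core a) (branch y) * indicator (rng a) y \<partial>\<mu>)"
    by (rule nn_integral_restrict_space) (use rng(1,3) in simp)
  also have "\<dots> = (\<integral>\<^sup>+ y. ennreal (exp (p (branch y))) * indicator A (branch y) * indicator (rng a) y \<partial>\<mu>)"
    by (rule nn_integral_cong) (use branch(1) in \<open>auto simp: indicator_def\<close>)
  finally show ?thesis .
qed

lemma branch_nn_measurable:
  assumes A: "A \<in> sets \<mu>"
  shows "(\<lambda>y. ennreal (exp (p (branch y))) * indicator A (branch y) * indicator (rng a) y) \<in> borel_measurable \<mu>"
proof -
  have b: "branch \<in> measurable (restrict_space \<mu> (rng a)) \<mu>"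
    by (rule measurable_compose[OF branch_measurable measurable_restrict_space1[OF measurable_ident_sets[OF refl]]])
  have "(\<lambda>y. ennreal (exp (p (branch y))) * indicator A (branch y)) \<in> borel_measurable (restrict_space \<mu> (rng a))"
    using measurable_compose[OF b p_meas] measurable_compose[OF b borel_measurable_indicator[OF A]] by measurable
  then show ?thesis using rng(1) by (subst (asm) borel_measurable_restrict_space_iff_ennreal) simp_all
qed

text \<open>For a null cell the change of variables would make the integrand vanish almost
  everywhere, but it is positive on \<open>rng a\<close>, a set of full measure.\<close>

lemma cell_pos: "measure \<mu> a > 0"
proof (rule ccontr)
  assume "\<not> measure \<mu> a > 0"
  then have "emeasure \<mu> (space \<mu> \<inter> a) = 0"
    using sets.sets_into_space[OF cells(2)[OF a]] measure_nonneg[of \<mu> a] by (simp add: Int_absorb1 emeasure_eq_measure)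
  from this[unfolded branch_change[OF sets.top]]
  have "AE y in \<mu>. ennreal (exp (p (branch y))) * indicator (space \<mu>) (branch y) * indicator (rng a) y = 0"
    by (subst (asm) nn_integral_0_iff_AE[OF branch_nn_measurable[OF sets.top]])
  then have "AE y in \<mu>. y \<notin> rng a"
    by eventually_elim (use branch(1) core(4) in \<open>auto simp: indicator_def split: if_splits\<close>)
  moreover have "AE y in \<mu>. y \<in> rng a"
    using AE_not_in[of "space \<mu> - rng a" \<mu>] rng(1,2) by (auto simp: null_sets_def)
  ultimately have "AE y in \<mu>. False" by eventually_elim simp
  then show False using prob_space by (simp add: AE_False)
qed

text \<open>Positivity of the Jacobian prevents \<open>F\<close> from inflating null subsets of a
  cell. Without this the exceptional set below could not be closed under images.\<close>

lemma image_null: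
  assumes N: "N \<in> null_sets \<mu>" shows "F ` (N \<inter> core a) \<in> null_sets \<mu>"
proof -
  have Ns: "N \<in> sets \<mu>" using N by auto
  have Nc: "N \<inter> core a \<in> sets \<mu>" "N \<inter> core a \<subseteq> core a" using N core(1) by auto
  have "emeasure \<mu> (N \<inter> a) = 0" using N cells(2)[OF a] by (metis Int_commute null_setsD1 null_set_Int1)
  from this[unfolded branch_change[OF Ns]]
  have "AE y in \<mu>. ennreal (exp (p (branch y))) * indicator N (branch y) * indicator (rng a) y = 0"
    by (subst (asm) nn_integral_0_iff_AE[OF branch_nn_measurable[OF Ns]])
  then have "AE y in \<mu>. y \<notin> F ` (N \<inter> core a)"
    by eventually_elim (use branch in \<open>auto simp: indicator_def split: if_splits\<close>)
  then show ?thesis using image_sets[OF Nc] by (simp add: AE_iff_null_sets)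
qed

end

text \<open>The initial defects are closed up under preimages of \<open>F\<close> and under images
  of each branch. The complement of the union is then invariant under \<open>F\<close> and under all
  inverse branches, and it still has full measure.\<close>

primrec exc :: "nat \<Rightarrow> 'a set" where
  "exc 0 = (space \<mu> - \<Union>\<alpha>) \<union> (\<Union>a\<in>\<alpha>. (a - core a) \<union> (space \<mu> - rng a))"
| "exc (Suc k) = exc k \<union> (F -` exc k \<inter> space \<mu>) \<union> (\<Union>a\<in>\<alpha>. F ` (exc k \<inter> core a))"

lemma exc_null: "exc k \<in> null_sets \<mu>"
proof (induction k)
  case 0
  have "\<Union>\<alpha> \<in> sets \<mu>" using cells by (intro sets.countable_Union) auto
  then have "space \<mu> - \<Union>\<alpha> \<in> null_sets \<mu>" using cells(4) by (auto simp: null_sets_def)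
  moreover have "(a - core a) \<union> (space \<mu> - rng a) \<in> null_sets \<mu>" if "a \<in> \<alpha>" for a
  proof (rule null_sets.Un)
    show "a - core a \<in> null_sets \<mu>" using core(1,3)[OF that] cells(2)[OF that] by (simp add: null_sets_def sets.Diff)
    show "space \<mu> - rng a \<in> null_sets \<mu>" using rng(1,2)[OF that] by (simp add: null_sets_def sets.Diff)
  qed
  ultimately show ?case unfolding exc.simps by (intro null_sets.Un[of "space \<mu> - \<Union>\<alpha>"] null_sets_UN' cells(1))
next
  case (Suc k)
  have "F -` exc k \<inter> space \<mu> \<in> null_sets \<mu>"
  proof -
    have "emeasure \<mu> (F -` exc k \<inter> space \<mu>) = emeasure (distr \<mu> \<mu> F) (exc k)"
      using Suc F_measurable by (subst emeasure_distr) auto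
    then show ?thesis using Suc F_distr measurable_sets[OF F_measurable, of "exc k"] by (auto simp: null_sets_def)
  qed
  then show ?case unfolding exc.simps using Suc image_null by (intro null_sets.Un null_sets_UN' cells(1)) auto
qed

definition Om :: "'a set" where "Om = space \<mu> - (\<Union>k. exc k)"

lemma exc_Union: "(\<Union>k. exc k) \<in> null_sets \<mu>"
  by (intro null_sets_UN exc_null)

lemma Om_sets: "Om \<in> sets \<mu>" unfolding Om_def using exc_Union by auto

lemma Om_AE: "AE x in \<mu>. x \<in> Om"
  using AE_not_in[OF exc_Union] AE_space by eventually_elim (simp add: Om_def)

lemma Om_core: "a \<in> \<alpha> \<Longrightarrow> x \<in> a \<Longrightarrow> x \<in> Om \<Longrightarrow> x \<in> core a"
  and Om_rng: "a \<in> \<alpha> \<Longrightarrow> x \<in> Om \<Longrightarrow> x \<in> rng a"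
  and Om_cover: "Om \<subseteq> \<Union>\<alpha>"
proof -
  have "x \<in> \<Union>\<alpha> \<and> (\<forall>a\<in>\<alpha>. (x \<in> a \<longrightarrow> x \<in> core a) \<and> x \<in> rng a)" if "x \<in> Om" for x
  proof -
    have "x \<notin> exc 0" "x \<in> space \<mu>" using that unfolding Om_def by blast+
    then show ?thesis unfolding exc.simps by blast
  qed
  then show "a \<in> \<alpha> \<Longrightarrow> x \<in> a \<Longrightarrow> x \<in> Om \<Longrightarrow> x \<in> core a"
    "a \<in> \<alpha> \<Longrightarrow> x \<in> Om \<Longrightarrow> x \<in> rng a" "Om \<subseteq> \<Union>\<alpha>" by blast+
qed

lemma F_Om: assumes x: "x \<in> Om" shows "F x \<in> Om"
proof -
  have "F x \<notin> exc k" for k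
  proof
    assume "F x \<in> exc k"
    then have "x \<in> exc (Suc k)" using x by (simp add: Om_def)
    then show False using x unfolding Om_def by blast
  qed
  moreover have "F x \<in> space \<mu>" using x measurable_space[OF F_measurable] by (simp add: Om_def)
  ultimately show ?thesis by (simp add: Om_def)
qed

lemma branch_Om: assumes a: "a \<in> \<alpha>" and y: "y \<in> Om" shows "branch a y \<in> a \<inter> Om"
proof -
  note yr = Om_rng[OF a y]
  have c: "branch a y \<in> core a" by (rule branch(1)[OF a yr])
  have "branch a y \<notin> exc k" for k
  proof
    assume "branch a y \<in> exc k"
    then have "F (branch a y) \<in> F ` (exc k \<inter> core a)" using c by blast
    then have "y \<in> exc (Suc k)" using a branch(2)[OF a yr] by auto
    then show False using y unfolding Om_def by blast
  qed
  then show ?thesis using c core(2,4)[OF a] by (auto simp: Om_def)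
qed

lemma Om_itinerary: "Om \<subseteq> itinerary_set \<alpha> F"
proof
  fix x assume x: "x \<in> Om"
  have "(F ^^ n) x \<in> Om" for n by (induction n) (use x F_Om in auto)
  then show "x \<in> itinerary_set \<alpha> F" using Om_cover by (auto simp: itinerary_set_def)
qed

text \<open>Off \<open>Om\<close> the values are defaults that keep \<open>psi a\<close> measurable;
  \<open>G a\<close> is 0 there.\<close>

definition psi :: "'a set \<Rightarrow> 'a \<Rightarrow> 'a" where "psi a y = (if y \<in> Om then branch a y else y)"
definition G :: "'a set \<Rightarrow> 'a \<Rightarrow> real" where
  "G a y = (if y \<in> Om then exp (p (branch a y)) / measure \<mu> a else 0)"

lemma branch_Om_measurable: "a \<in> \<alpha> \<Longrightarrow> branch a \<in> measurable (restrict_space \<mu> Om) \<mu>"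
proof -
  assume a: "a \<in> \<alpha>"
  have b: "branch a \<in> measurable (restrict_space \<mu> (rng a)) \<mu>"
    by (rule measurable_compose[OF branch_measurable[OF a] measurable_restrict_space1[OF measurable_ident_sets[OF refl]]])
  have "restrict_space (restrict_space \<mu> (rng a)) Om = restrict_space \<mu> (rng a \<inter> Om)"
    by (rule restrict_restrict_space) (use rng[OF a] Om_sets in auto)
  moreover have "rng a \<inter> Om = Om" using Om_rng[OF a] by auto
  ultimately show ?thesis using measurable_restrict_space1[OF b, of Om] by simp
qed

lemma psi_measurable: "a \<in> \<alpha> \<Longrightarrow> psi a \<in> measurable \<mu> \<mu>"
  unfolding psi_def[abs_def]
  by (rule measurable_If_restrict_space_iff[THEN iffD2])
     (use Om_sets branch_Om_measurable in \<open>auto intro!: measurable_restrict_space1\<close>)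

lemma G_measurable: "a \<in> \<alpha> \<Longrightarrow> G a \<in> borel_measurable \<mu>"
  unfolding G_def[abs_def]
  by (rule measurable_If_restrict_space_iff[THEN iffD2])
     (use Om_sets measurable_compose[OF branch_Om_measurable p_meas] in \<open>auto\<close>)

lemma gibbs_branch:
  assumes a: "a \<in> \<alpha>" and y: "y \<in> Om" "y' \<in> Om"
  shows "G a y \<le> C" "\<bar>G a y - G a y'\<bar> \<le> C * d_theta \<alpha> F \<theta> y y'"
    "d_theta \<alpha> F \<theta> (psi a y) (psi a y') = \<theta> * d_theta \<alpha> F \<theta> y y'"
proof -
  have b: "branch a y \<in> a \<inter> itinerary_set \<alpha> F" "branch a y' \<in> a \<inter> itinerary_set \<alpha> F"
    using branch_Om[OF a] y Om_itinerary by auto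
  note g = gibbs[OF a b]
  have pos: "measure \<mu> a > 0" by (rule cell_pos[OF a])
  have d: "d_theta \<alpha> F \<theta> (branch a y) (branch a y') = \<theta> * d_theta \<alpha> F \<theta> y y'"
    using d_theta_Suc[OF cells(3) a, of "branch a y" "branch a y'"] b branch(2)[OF a Om_rng[OF a]] y by auto
  then show "d_theta \<alpha> F \<theta> (psi a y) (psi a y') = \<theta> * d_theta \<alpha> F \<theta> y y'" using y by (simp add: psi_def)
  show "G a y \<le> C" using g pos y by (simp add: G_def field_simps)
  have "\<bar>exp (p (branch a y)) - exp (p (branch a y'))\<bar> \<le> C * measure \<mu> a * (\<theta> * d_theta \<alpha> F \<theta> y y')"
    using g d by simp
  also have "\<dots> \<le> C * measure \<mu> a * (1 * d_theta \<alpha> F \<theta> y y')"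
    using C_pos theta01 d_theta_range[OF theta01] by (intro mult_left_mono mult_right_mono) auto
  finally have "\<bar>exp (p (branch a y)) - exp (p (branch a y'))\<bar> / measure \<mu> a \<le> C * d_theta \<alpha> F \<theta> y y'"
    using pos by (simp add: field_simps)
  moreover have "\<bar>G a y - G a y'\<bar> = \<bar>exp (p (branch a y)) - exp (p (branch a y'))\<bar> / measure \<mu> a"
    using y pos by (simp add: G_def diff_divide_distrib[symmetric])
  ultimately show "\<bar>G a y - G a y'\<bar> \<le> C * d_theta \<alpha> F \<theta> y y'" by simp
qed

lemma psi_change:
  assumes a: "a \<in> \<alpha>" and A: "A \<in> sets \<mu>"
  shows "emeasure \<mu> (A \<inter> a) = ennreal (measure \<mu> a) * (\<integral>\<^sup>+ y. ennreal (G a y) * indicator A (psi a y) \<partial>\<mu>)"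
proof -
  have m: "(\<lambda>y. ennreal (G a y) * indicator A (psi a y)) \<in> borel_measurable \<mu>"
    using measurable_compose[OF psi_measurable[OF a] borel_measurable_indicator[OF A]] G_measurable[OF a] by measurable
  have pos: "measure \<mu> a > 0" by (rule cell_pos[OF a])
  have "emeasure \<mu> (A \<inter> a) = (\<integral>\<^sup>+ y. ennreal (measure \<mu> a) * (ennreal (G a y) * indicator A (psi a y)) \<partial>\<mu>)"
    unfolding branch_change[OF a A]
  proof (rule nn_integral_cong_AE)
    show "AE y in \<mu>. ennreal (exp (p (branch a y))) * indicator A (branch a y) * indicator (rng a) y =
        ennreal (measure \<mu> a) * (ennreal (G a y) * indicator A (psi a y))"
      using Om_AE
    proof eventually_elim
      case (elim y)
      have "ennreal (exp (p (branch a y))) = ennreal (measure \<mu> a) * ennreal (G a y)"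
        using elim pos by (subst ennreal_mult[symmetric]) (auto simp: G_def)
      then show ?case using elim Om_rng[OF a elim] by (simp add: psi_def mult.assoc)
    qed
  qed
  also have "\<dots> = ennreal (measure \<mu> a) * (\<integral>\<^sup>+ y. ennreal (G a y) * indicator A (psi a y) \<partial>\<mu>)"
    by (rule nn_integral_cmult[OF m])
  finally show ?thesis .
qed

sublocale full_branch \<mu> F Om \<alpha> psi G "d_theta \<alpha> F \<theta>" \<theta> C
proof
  fix a x assume "a \<in> \<alpha>" "x \<in> a" "x \<in> Om"
  then show "psi a (F x) = x" using F_Om[of x] branch(3)[OF _ Om_core] by (simp add: psi_def)
next
  fix a y assume "a \<in> \<alpha>" "y \<in> Om"
  then show "psi a y \<in> a \<inter> Om" "F (psi a y) = y" "G a y > 0"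
    using branch_Om branch(2)[OF _ Om_rng] cell_pos by (auto simp: psi_def G_def)
next
  fix a b x y assume "a \<in> \<alpha>" "b \<in> \<alpha>" "a \<noteq> b" "x \<in> a \<inter> Om" "y \<in> b \<inter> Om"
  then show "d_theta \<alpha> F \<theta> x y = 1" by (intro d_theta_diff) auto
qed (use Om_sets Om_AE cells Om_cover cell_pos F_Om psi_measurable F_measurable F_distr G_measurable gibbs_branch
      psi_change theta01 C_pos d_theta_range[OF theta01] in \<open>auto simp: G_def\<close>)

end

lemma gibbs_markov_data:
  assumes "gibbs_markov \<mu> F \<alpha> \<theta>"
  obtains p C core rng where "gibbs_markov_data \<mu> F \<alpha> \<theta> p C core rng"
proof -
  obtain p C where pC: "p \<in> borel_measurable \<mu>" "C > 0"
      "\<forall>a\<in>\<alpha>. \<exists>a' Y'. bijection_mod \<mu> F a a' Y' \<and>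
          density (image_measure \<mu> F a') (\<lambda>y. ennreal (exp (p y))) = restrict_space \<mu> a'"
      "\<forall>a\<in>\<alpha>. \<forall>y \<in> a \<inter> itinerary_set \<alpha> F. \<forall>y' \<in> a \<inter> itinerary_set \<alpha> F.
          exp (p y) \<le> C * measure \<mu> a \<and>
          \<bar>exp (p y) - exp (p y')\<bar> \<le> C * measure \<mu> a * d_theta \<alpha> F \<theta> y y'"
    using assms unfolding gibbs_markov_def by blast
  obtain core rng where "\<forall>a\<in>\<alpha>. bijection_mod \<mu> F a (core a) (rng a) \<and>
      density (image_measure \<mu> F (core a)) (\<lambda>y. ennreal (exp (p y))) = restrict_space \<mu> (core a)"
    using pC(3) by metis
  then have "gibbs_markov_data \<mu> F \<alpha> \<theta> p C core rng"
    using assms pC(1,2,4) unfolding gibbs_markov_def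
    by (intro gibbs_markov_data.intro gibbs_markov_data_axioms.intro) auto
  then show thesis by (rule that)
qed

section \<open>The Lipschitz space and the resolvent\<close>

context gibbs_markov_data
begin

abbreviation "It \<equiv> space \<mu> \<inter> itinerary_set \<alpha> F"
abbreviation "dist\<^sub>\<theta> \<equiv> d_theta \<alpha> F \<theta>"
abbreviation "N \<equiv> norm_theta \<mu> \<alpha> F \<theta>"
abbreviation "B \<equiv> B_theta \<mu> \<alpha> F \<theta>"

lemma Om_It: "x \<in> Om \<Longrightarrow> x \<in> It"
  using Om_itinerary Om_space by blast

lemma It_F: assumes "x \<in> It" shows "F x \<in> It"
proof -
  have "(F ^^ n) (F x) \<in> \<Union>\<alpha>" for n
  proof -
    have "(F ^^ Suc n) x \<in> \<Union>\<alpha>" using assms by (auto simp: itinerary_set_def simp del: funpow.simps)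
    then show ?thesis by (simp add: funpow_swap1)
  qed
  then show ?thesis using assms measurable_space[OF F_measurable] by (auto simp: itinerary_set_def)
qed

lemma It_cell: assumes "x \<in> It" shows "x \<in> cell x"
proof -
  have "(F ^^ 0) x \<in> \<Union>\<alpha>" using assms unfolding itinerary_set_def by blast
  then show ?thesis using cell_eq by auto
qed

lemma d_self: "dist\<^sub>\<theta> x x = 0"
proof -
  have "{n. \<exists>a\<in>\<alpha>. \<exists>b\<in>\<alpha>. a \<noteq> b \<and> (F ^^ n) x \<in> a \<and> (F ^^ n) x \<in> b} = {}"
    using cells(3) by (auto simp: disjoint_def)
  then show ?thesis unfolding d_theta_def separation_time_def by (simp only:) (simp add: top_enat_def)
qed

lemma psi_prj: "psi (cell x) (prj n y) \<in> cell x" "psi (cell x) (prj n y) \<in> Om" "F (psi (cell x) (prj n y)) = prj n y"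
  using psi_mem[OF cell_in prj_Om] F_psi[OF cell_in prj_Om] by auto

lemma prj_d_It: "x \<in> It \<Longrightarrow> dist\<^sub>\<theta> x (prj n x) \<le> \<theta> ^ n"
proof (induction n arbitrary: x)
  case 0
  then show ?case using d_range(2) by simp
next
  case (Suc n)
  have "dist\<^sub>\<theta> x (prj (Suc n) x) = \<theta> * dist\<^sub>\<theta> (F x) (prj n (F x))"
    using d_theta_Suc[OF cells(3) cell_in It_cell[OF Suc.prems] psi_prj(1)] by (simp add: psi_prj(3))
  also have "\<dots> \<le> \<theta> * \<theta> ^ n" using theta01 by (intro mult_left_mono Suc.IH It_F Suc.prems) simp
  finally show ?case by simp
qed

text \<open>Replacing the tails of two itineraries by the same tail does not separate the points
  earlier, so the projections do not increase distances.\<close>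

lemma prj_prj_d: "x \<in> It \<Longrightarrow> y \<in> It \<Longrightarrow> dist\<^sub>\<theta> (prj n x) (prj n y) \<le> dist\<^sub>\<theta> x y"
proof (induction n arbitrary: x y)
  case 0
  then show ?case using d_range(1) by (simp add: d_self)
next
  case (Suc n)
  show ?case
  proof (cases "cell x = cell y")
    case True
    have y: "y \<in> cell x" using It_cell[OF Suc.prems(2)] True by simp
    have "dist\<^sub>\<theta> (prj (Suc n) x) (prj (Suc n) y) = \<theta> * dist\<^sub>\<theta> (prj n (F x)) (prj n (F y))"
      using d_psi[OF cell_in prj_Om prj_Om] True by simp
    also have "\<dots> \<le> \<theta> * dist\<^sub>\<theta> (F x) (F y)" using theta01 by (intro mult_left_mono Suc.IH It_F Suc.prems) simp
    also have "\<dots> = dist\<^sub>\<theta> x y" using d_theta_Suc[OF cells(3) cell_in It_cell[OF Suc.prems(1)] y] by simp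
    finally show ?thesis .
  next
    case False
    then have "dist\<^sub>\<theta> x y = 1" by (intro d_theta_diff[OF cell_in cell_in]) (use It_cell Suc.prems in auto)
    then show ?thesis using d_range(2) by simp
  qed
qed

lemma prj_add_d: "dist\<^sub>\<theta> (prj n x) (prj (n + k) x) \<le> \<theta> ^ n"
proof (induction n arbitrary: x)
  case 0
  then show ?case using d_range(2) by simp
next
  case (Suc n)
  have "dist\<^sub>\<theta> (prj (Suc n) x) (prj (Suc n + k) x) = \<theta> * dist\<^sub>\<theta> (prj n (F x)) (prj (n + k) (F x))"
    using d_psi[OF cell_in prj_Om prj_Om] by simp
  also have "\<dots> \<le> \<theta> * \<theta> ^ n" using theta01 by (intro mult_left_mono Suc.IH) simp
  finally show ?case by simp
qed

text \<open>\<open>norm_theta\<close> inspects all points with an itinerary, while functions in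
  \<open>V\<close> are controlled on \<open>Om\<close> only. The projections lie in
  \<open>Om\<close> and converge to x, so this limit extends v from \<open>Om\<close> to
  \<open>It\<close> with the same Lipschitz constant.\<close>

definition ext :: "('a \<Rightarrow> complex) \<Rightarrow> 'a \<Rightarrow> complex" where "ext v x = lim (\<lambda>n. v (prj n x))"

lemma prj_measurable: "prj n \<in> measurable \<mu> \<mu>"
proof (induction n)
  case 0
  show ?case using Om_space[OF y0] by (simp add: measurable_const)
next
  case (Suc n)
  have "(\<lambda>x. psi (cell x) (prj n (F x))) \<in> measurable \<mu> \<mu>"
  proof (rule measurable_compose_countable'[OF _ cell_meas cells(1)])
    fix a assume "a \<in> \<alpha>"
    then show "(\<lambda>x. psi a (prj n (F x))) \<in> measurable \<mu> \<mu>"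
      by (intro measurable_compose[OF measurable_compose[OF F_measurable Suc]] psi_measurable)
  qed
  then show ?case by (simp cong: measurable_cong)
qed

lemma ext_measurable: "v \<in> borel_measurable \<mu> \<Longrightarrow> ext v \<in> borel_measurable \<mu>"
  unfolding ext_def[abs_def] by (rule borel_measurable_lim_metric) (rule measurable_compose[OF prj_measurable])

lemma geometric_null: "(\<lambda>n. s * \<theta> ^ n) \<longlonglongrightarrow> 0"
  using tendsto_mult_right_zero[OF LIMSEQ_power_zero[of \<theta>]] theta01 by simp

lemma ext_lim: assumes v: "v \<in> V" shows "(\<lambda>n. v (prj n x)) \<longlonglongrightarrow> ext v x"
proof -
  have "Cauchy (\<lambda>n. v (prj n x))"
  proof (rule CauchyI')
    fix e :: real assume e: "0 < e"
    from order_tendstoD(2)[OF geometric_null e, of "nrm v"] obtain n0 where n0: "\<And>n. n \<ge> n0 \<Longrightarrow> nrm v * \<theta> ^ n < e"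
      by (auto simp: eventually_sequentially)
    have "dist (v (prj i x)) (v (prj j x)) < e" if "n0 \<le> i" "i < j" for i j
    proof -
      have "dist (v (prj i x)) (v (prj j x)) \<le> nrm v * dist\<^sub>\<theta> (prj i x) (prj j x)"
        unfolding dist_norm by (rule nrm_lip[OF v prj_Om prj_Om])
      also have "\<dots> \<le> nrm v * \<theta> ^ i"
        using prj_add_d[of i x "j - i"] that by (intro mult_left_mono nrm_nonneg[OF v]) simp
      also have "\<dots> < e" by (rule n0[OF that(1)])
      finally show ?thesis .
    qed
    then show "\<exists>n0. \<forall>i\<ge>n0. \<forall>j>i. dist (v (prj i x)) (v (prj j x)) < e" by blast
  qed
  then show ?thesis unfolding ext_def Cauchy_convergent_iff convergent_LIMSEQ_iff .
qed

lemma lim_prj: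
  assumes "\<And>n. cmod (u x - u (prj n x)) \<le> s * dist\<^sub>\<theta> x (prj n x)" "x \<in> It" "0 \<le> s"
  shows "(\<lambda>n. u (prj n x)) \<longlonglongrightarrow> u x"
proof -
  have "(\<lambda>n. u (prj n x) - u x) \<longlonglongrightarrow> 0"
  proof (rule Lim_null_comparison[OF _ geometric_null[of s]], rule always_eventually, rule allI)
    fix n
    have "norm (u (prj n x) - u x) \<le> s * dist\<^sub>\<theta> x (prj n x)" using assms(1)[of n] by (simp add: norm_minus_commute)
    also have "\<dots> \<le> s * \<theta> ^ n" by (intro mult_left_mono prj_d_It assms)
    finally show "norm (u (prj n x) - u x) \<le> s * \<theta> ^ n" .
  qed
  then show ?thesis by (rule LIM_zero_cancel)
qed

lemma ext_Om: assumes v: "v \<in> V" and x: "x \<in> Om" shows "ext v x = v x"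
  by (rule LIMSEQ_unique[OF ext_lim[OF v] lim_prj[OF nrm_lip[OF v x prj_Om] Om_It[OF x] nrm_nonneg[OF v]]])

lemma lim_lip:
  assumes v: "v \<in> V" and x: "x \<in> It" "y \<in> It"
    and l: "(\<lambda>n. v (prj n x)) \<longlonglongrightarrow> l" "(\<lambda>n. v (prj n y)) \<longlonglongrightarrow> k"
  shows "cmod (l - k) \<le> nrm v * dist\<^sub>\<theta> x y"
proof (rule LIMSEQ_le_const2[OF tendsto_norm[OF tendsto_diff[OF l]]], intro exI allI impI)
  fix n
  have "cmod (v (prj n x) - v (prj n y)) \<le> nrm v * dist\<^sub>\<theta> (prj n x) (prj n y)"
    by (rule nrm_lip[OF v prj_Om prj_Om])
  also have "\<dots> \<le> nrm v * dist\<^sub>\<theta> x y" by (intro mult_left_mono prj_prj_d x nrm_nonneg[OF v])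
  finally show "cmod (v (prj n x) - v (prj n y)) \<le> nrm v * dist\<^sub>\<theta> x y" .
qed

definition sup_part :: "('a \<Rightarrow> complex) \<Rightarrow> ennreal" where
  "sup_part u = esssup \<mu> (\<lambda>y. ennreal (norm (u y)))"
definition lip_part :: "('a \<Rightarrow> complex) \<Rightarrow> ennreal" where
  "lip_part u = (SUP (y, y') \<in> It \<times> It. ennreal (norm (u y - u y')) / ennreal (dist\<^sub>\<theta> y y'))"

lemma N_eq: "N u = sup_part u + lip_part u"
  by (simp add: norm_theta_def sup_part_def lip_part_def)

text \<open>The factor 2 reflects that \<open>norm_theta\<close> adds the supremum and the Lipschitz
  constant, whereas s bounds each of them.\<close>

lemma N_le:
  assumes u: "u \<in> borel_measurable \<mu>" and s: "0 \<le> s" and b: "\<And>x. x \<in> Om \<Longrightarrow> cmod (u x) \<le> s"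
    and l: "\<And>x y. x \<in> It \<Longrightarrow> y \<in> It \<Longrightarrow> cmod (u x - u y) \<le> s * dist\<^sub>\<theta> x y"
  shows "N u \<le> ennreal (2 * s)"
proof -
  have "sup_part u \<le> ennreal s"
    unfolding sup_part_def
  proof (rule esssup_I)
    show "(\<lambda>y. ennreal (norm (u y))) \<in> borel_measurable \<mu>" using u by measurable
    show "AE x in \<mu>. ennreal (norm (u x)) \<le> ennreal s" using Om_AE by eventually_elim (intro ennreal_leI b)
  qed
  moreover have "lip_part u \<le> ennreal s"
    unfolding lip_part_def
  proof (rule SUP_least)
    fix i assume "i \<in> It \<times> It"
    then obtain x y where i: "i = (x, y)" and xy: "x \<in> It" "y \<in> It" by blast
    have "ennreal (norm (u x - u y)) / ennreal (dist\<^sub>\<theta> x y) \<le> ennreal s"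
    proof (cases "dist\<^sub>\<theta> x y = 0")
      case True
      then show ?thesis using l[OF xy] by simp
    next
      case False
      then have p: "dist\<^sub>\<theta> x y > 0" using d_range(1)[of x y] by simp
      then show ?thesis using l[OF xy] by (simp add: divide_ennreal pos_divide_le_eq ennreal_leI)
    qed
    then show "(case i of (y, y') \<Rightarrow> ennreal (norm (u y - u y')) / ennreal (dist\<^sub>\<theta> y y')) \<le> ennreal s" by (simp add: i)
  qed
  ultimately have "N u \<le> ennreal s + ennreal s" unfolding N_eq by (rule add_mono)
  also have "\<dots> = ennreal (2 * s)" using s by (simp add: ennreal_plus[symmetric] del: ennreal_plus)
  finally show ?thesis .
qed

lemma lip_part_lip:
  assumes "lip_part u < \<infinity>" "x \<in> It" "y \<in> It"
  shows "cmod (u x - u y) \<le> enn2real (lip_part u) * dist\<^sub>\<theta> x y"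
proof -
  have le: "ennreal (norm (u x - u y)) / ennreal (dist\<^sub>\<theta> x y) \<le> lip_part u"
    unfolding lip_part_def using assms(2,3) by (intro SUP_upper2[of "(x, y)"]) auto
  show ?thesis
  proof (cases "dist\<^sub>\<theta> x y = 0")
    \<comment> \<open>At distance 0 the quotient of a positive number would be infinite in
      \<open>ennreal\<close>, so a finite norm forces equal values.\<close>
    case True
    have "norm (u x - u y) = 0"
    proof (rule ccontr)
      assume "norm (u x - u y) \<noteq> 0"
      then have "ennreal (norm (u x - u y)) / ennreal (dist\<^sub>\<theta> x y) = \<infinity>"
        using True by (simp add: divide_ennreal_def ennreal_mult_top infinity_ennreal_def)
      then show False using le assms(1) by simp
    qed
    then show ?thesis using True by simp
  next
    case False
    then have p: "dist\<^sub>\<theta> x y > 0" using d_range(1)[of x y] by simp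
    have "ennreal (norm (u x - u y) / dist\<^sub>\<theta> x y) \<le> lip_part u" using le p by (simp add: divide_ennreal)
    then have "norm (u x - u y) / dist\<^sub>\<theta> x y \<le> enn2real (lip_part u)"
      using enn2real_mono[of "ennreal (norm (u x - u y) / dist\<^sub>\<theta> x y)" "lip_part u"] assms(1) p by simp
    then show ?thesis using p by (simp add: pos_divide_le_eq)
  qed
qed

text \<open>The essential supremum bounds u at almost every point only. One good point y of
  \<open>Om\<close> suffices: distances are at most 1, so the Lipschitz part carries the bound from
  y to x, and the two parts add up to the norm.\<close>

lemma N_bounds:
  assumes u: "u \<in> borel_measurable \<mu>" and f: "N u < \<infinity>"
  shows "x \<in> It \<Longrightarrow> y \<in> It \<Longrightarrow> cmod (u x - u y) \<le> enn2real (N u) * dist\<^sub>\<theta> x y"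
    and "x \<in> Om \<Longrightarrow> cmod (u x) \<le> enn2real (N u)"
proof -
  have fin: "sup_part u < \<infinity>" "lip_part u < \<infinity>" using f by (auto simp: N_eq)
  have N: "enn2real (N u) = enn2real (sup_part u) + enn2real (lip_part u)"
    unfolding N_eq using fin by (intro enn2real_plus) auto
  show "x \<in> It \<Longrightarrow> y \<in> It \<Longrightarrow> cmod (u x - u y) \<le> enn2real (N u) * dist\<^sub>\<theta> x y"
    by (rule order_trans[OF lip_part_lip[OF fin(2)] mult_right_mono]) (auto simp: N d_range(1))
  assume x: "x \<in> Om"
  have "\<not> (AE y in \<mu>. False)" using prob_space by (simp add: AE_False)
  moreover have "AE y in \<mu>. False" if "\<not> (\<exists>y\<in>Om. ennreal (norm (u y)) \<le> sup_part u)"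
    using Om_AE esssup_AE[of "\<lambda>y. ennreal (norm (u y))" \<mu>]
    by eventually_elim (use that in \<open>auto simp: sup_part_def\<close>)
  ultimately obtain y where y: "y \<in> Om" "ennreal (norm (u y)) \<le> sup_part u" by blast
  have "norm (u y) \<le> enn2real (sup_part u)" using enn2real_mono[OF y(2)] fin(1) by simp
  moreover have "cmod (u x - u y) \<le> enn2real (lip_part u)"
    using lip_part_lip[OF fin(2) Om_It[OF x] Om_It[OF y(1)]] mult_left_mono[OF d_range(2)[of x y], of "enn2real (lip_part u)"]
    by simp
  ultimately show "cmod (u x) \<le> enn2real (N u)" using norm_triangle_sub[of "u x" "u y"] unfolding N by simp
qed

lemma B_iff: "u \<in> B \<longleftrightarrow> u \<in> borel_measurable \<mu> \<and> N u < \<infinity>"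
  by (auto simp: B_theta_def)

lemma B_V: assumes "u \<in> B" shows "u \<in> V" "nrm u \<le> enn2real (N u)"
proof -
  have "nb (enn2real (N u)) u" using N_bounds[of u] assms Om_It unfolding B_iff nb_def by blast
  then show "u \<in> V" "nrm u \<le> enn2real (N u)" using assms nrm_le[of "enn2real (N u)" u] unfolding V_iff B_iff by blast+
qed

text \<open>Functions in \<open>B\<close> are Lipschitz on \<open>It\<close>, hence determined there
  by their values on \<open>Om\<close> through the projections. So the norm over \<open>It\<close>
  is controlled by the norm over \<open>Om\<close>.\<close>

lemma N_le_nrm: assumes u: "u \<in> B" shows "N u \<le> ennreal (2 * nrm u)"
proof (rule N_le)
  note V = B_V(1)[OF u]
  show "u \<in> borel_measurable \<mu>" "0 \<le> nrm u" using u nrm_nonneg[OF V] by (auto simp: B_iff)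
  show "cmod (u x) \<le> nrm u" if "x \<in> Om" for x by (rule nrm_pt[OF V that])
  have l: "(\<lambda>n. u (prj n x)) \<longlonglongrightarrow> u x" if "x \<in> It" for x
    by (rule lim_prj[OF N_bounds(1)[OF _ _ that Om_It[OF prj_Om]] that]) (use u in \<open>auto simp: B_iff\<close>)
  show "cmod (u x - u y) \<le> nrm u * dist\<^sub>\<theta> x y" if "x \<in> It" "y \<in> It" for x y
    by (rule lim_lip[OF V that l l]) (use that in auto)
qed

lemma ext_B: assumes v: "v \<in> V" shows "ext v \<in> B"
proof -
  have "N (ext v) \<le> ennreal (2 * nrm v)"
  proof (rule N_le)
    show "ext v \<in> borel_measurable \<mu>" by (rule ext_measurable[OF V_meas[OF v]])
    show "0 \<le> nrm v" by (rule nrm_nonneg[OF v])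
    show "cmod (ext v x) \<le> nrm v" if "x \<in> Om" for x using nrm_pt[OF v that] by (simp add: ext_Om[OF v that])
    show "cmod (ext v x - ext v y) \<le> nrm v * dist\<^sub>\<theta> x y" if "x \<in> It" "y \<in> It" for x y
      by (rule lim_lip[OF v that ext_lim[OF v] ext_lim[OF v]])
  qed
  also have "\<dots> < \<infinity>" by simp
  finally show ?thesis using ext_measurable[OF V_meas[OF v]] by (simp add: B_iff)
qed

lemma B_diff: assumes u: "u \<in> B" and v: "v \<in> B" shows "(\<lambda>x. u x - v x) \<in> B"
proof -
  let ?s = "enn2real (N u) + enn2real (N v)"
  have uv: "u \<in> borel_measurable \<mu>" "N u < \<infinity>" "v \<in> borel_measurable \<mu>" "N v < \<infinity>" using u v by (auto simp: B_iff)
  have "N (\<lambda>x. u x - v x) \<le> ennreal (2 * ?s)"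
  proof (rule N_le)
    show "(\<lambda>x. u x - v x) \<in> borel_measurable \<mu>" using uv by measurable
    show "0 \<le> ?s" by simp
    show "cmod (u x - v x) \<le> ?s" if "x \<in> Om" for x
      using N_bounds(2)[OF uv(1,2) that] N_bounds(2)[OF uv(3,4) that] norm_triangle_ineq4[of "u x" "v x"] by linarith
    show "cmod (u x - v x - (u y - v y)) \<le> ?s * dist\<^sub>\<theta> x y" if "x \<in> It" "y \<in> It" for x y
      using N_bounds(1)[OF uv(1,2) that] N_bounds(1)[OF uv(3,4) that] norm_triangle_ineq4[of "u x - u y" "v x - v y"]
      by (simp add: algebra_simps)
  qed
  also have "\<dots> < \<infinity>" by simp
  finally show ?thesis using uv by (simp add: B_iff)
qed

context
  fixes \<phi> :: "'a \<Rightarrow> nat" and z :: complex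
  assumes phi_m: "\<phi> \<in> measurable \<mu> (count_space UNIV)"
    and phi_c: "\<And>a x y. a \<in> \<alpha> \<Longrightarrow> x \<in> a \<Longrightarrow> y \<in> a \<Longrightarrow> \<phi> x = \<phi> y"
    and z: "cmod z \<le> 1"
begin

lemma twist_measurable:
  assumes v: "v \<in> borel_measurable \<mu>" shows "(\<lambda>x. z ^ \<phi> x * v x) \<in> borel_measurable \<mu>"
proof -
  have "(\<lambda>x. z ^ \<phi> x) \<in> borel_measurable \<mu>" by (rule measurable_compose[OF phi_m]) simp
  then show ?thesis using v by (rule borel_measurable_times)
qed

lemma twist_bound: "cmod (z ^ \<phi> x * y) \<le> cmod y"
proof -
  have "cmod z ^ \<phi> x \<le> 1" using z by (intro power_le_one) auto
  then show ?thesis using mult_right_mono[of "cmod z ^ \<phi> x" 1 "cmod y"] by (simp add: norm_mult norm_power)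
qed

lemma R_twist: assumes v: "v \<in> V" shows "R (\<lambda>x. z ^ \<phi> x * v x) \<in> V"
proof (rule R_lip(1)[OF twist_measurable[OF V_meas[OF v]], of "\<lambda>_. nrm v"])
  show "integrable m (\<lambda>_. nrm v)" by simp
  fix a x assume x: "a \<in> \<alpha>" "x \<in> a" "x \<in> Om"
  show "cmod (z ^ \<phi> x * v x) \<le> nrm v" by (rule order_trans[OF twist_bound nrm_pt[OF v x(3)]])
  fix x' assume x': "x' \<in> a" "x' \<in> Om"
  have "z ^ \<phi> x * v x - z ^ \<phi> x' * v x' = z ^ \<phi> x * (v x - v x')"
    using phi_c[OF x(1,2) x'(1)] by (simp add: right_diff_distrib)
  then show "cmod (z ^ \<phi> x * v x - z ^ \<phi> x' * v x') \<le> nrm v * dist\<^sub>\<theta> x x'"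
    using order_trans[OF twist_bound nrm_lip[OF v x(3) x'(2)]] by simp
qed

text \<open>The operator of the hypothesis is a Hilbert choice. \<open>ext (R q)\<close> shows that
  a candidate exists; any two candidates have the same integrals over measurable sets, hence agree
  almost everywhere, and by \<open>V_AE_zero\<close> on all of \<open>Om\<close>.\<close>

lemma twisted_transfer_op:
  assumes v: "v \<in> B"
  shows "twisted_transfer_op \<mu> F B \<phi> z v \<in> B"
    "x \<in> Om \<Longrightarrow> twisted_transfer_op \<mu> F B \<phi> z v x = R (\<lambda>x. z ^ \<phi> x * v x) x"
proof -
  let ?q = "\<lambda>x. z ^ \<phi> x * v x"
  let ?P = "\<lambda>r. r \<in> B \<and> (\<forall>A \<in> sets \<mu>. (LINT y:A|\<mu>. r y) = (LINT y:(F -` A \<inter> space \<mu>)|\<mu>. ?q y))"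
  note vV = B_V(1)[OF v]
  have qi: "integrable \<mu> ?q"
    by (rule Bochner_Integration.integrable_bound[OF V_integrable[OF vV] twist_measurable[OF V_meas[OF vV]]])
       (rule AE_I2, rule twist_bound)
  have key: "(LINT y:A|\<mu>. R ?q y) = (LINT y:(F -` A \<inter> space \<mu>)|\<mu>. ?q y)" if A: "A \<in> sets \<mu>" for A
  proof -
    have e: "indicator (F -` A \<inter> space \<mu>) x *\<^sub>R ?q x = ?q x * indicator A (F x)" if "x \<in> space \<mu>" for x
      using that by (auto simp: indicator_def)
    have "integrable \<mu> (\<lambda>x. indicator (F -` A \<inter> space \<mu>) x *\<^sub>R ?q x)"
      by (rule integrable_mult_indicator[OF measurable_sets[OF F_measurable A] qi])
    then have i: "integrable \<mu> (\<lambda>x. ?q x * indicator A (F x))"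
      by (subst (asm) Bochner_Integration.integrable_cong[OF refl e])
    have "(LINT y:A|\<mu>. R ?q y) = (\<integral>y. R ?q y * indicator A y \<partial>\<mu>)"
      unfolding set_lebesgue_integral_def by (rule Bochner_Integration.integral_cong) (auto simp: indicator_def)
    also have "\<dots> = (\<integral>x. ?q x * indicator A (F x) \<partial>\<mu>)" by (rule R_dual(2)[OF i])
    also have "\<dots> = (LINT y:(F -` A \<inter> space \<mu>)|\<mu>. ?q y)"
      unfolding set_lebesgue_integral_def by (rule Bochner_Integration.integral_cong[OF refl e[symmetric]])
    finally show ?thesis .
  qed
  have ex: "?P (ext (R ?q))"
  proof (intro conjI ballI)
    show "ext (R ?q) \<in> B" by (rule ext_B[OF R_twist[OF vV]])
    fix A assume A: "A \<in> sets \<mu>"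
    have "(LINT y:A|\<mu>. ext (R ?q) y) = (LINT y:A|\<mu>. R ?q y)"
      unfolding set_lebesgue_integral_def
    proof (rule integral_cong_AE)
      show "AE x in \<mu>. indicat_real A x *\<^sub>R ext (R ?q) x = indicat_real A x *\<^sub>R R ?q x"
        using Om_AE by eventually_elim (simp only: ext_Om[OF R_twist[OF vV]])
    qed (intro borel_measurable_scaleR borel_measurable_indicator A ext_measurable V_meas[OF R_twist[OF vV]])+
    then show "(LINT y:A|\<mu>. ext (R ?q) y) = (LINT y:(F -` A \<inter> space \<mu>)|\<mu>. ?q y)" using key[OF A] by simp
  qed
  have P: "?P (twisted_transfer_op \<mu> F B \<phi> z v)"
    unfolding twisted_transfer_op_def transfer_op_def by (rule someI[of ?P, OF ex])
  then show tB: "twisted_transfer_op \<mu> F B \<phi> z v \<in> B" by blast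
  have "AE x in \<mu>. twisted_transfer_op \<mu> F B \<phi> z v x = R ?q x"
  proof (rule density_unique_banach[OF V_integrable[OF B_V(1)[OF tB]] R_integral(1)[OF qi]])
    show "(LINT x:A|\<mu>. twisted_transfer_op \<mu> F B \<phi> z v x) = (LINT x:A|\<mu>. R ?q x)" if "A \<in> sets \<mu>" for A
      using P that key[OF that] by simp
  qed
  then have "AE x in \<mu>. (twisted_transfer_op \<mu> F B \<phi> z v - R ?q) x = 0" by simp
  from V_AE_zero[OF V_diff[OF B_V(1)[OF tB] R_twist[OF vV]] this]
  show "x \<in> Om \<Longrightarrow> twisted_transfer_op \<mu> F B \<phi> z v x = R ?q x" by simp
qed

text \<open>If S inverts 1 - R(z), then v = S (v - R(z) v) up to norm 0, so the bound on S is the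
  required lower bound. The factor 2 converts between the two norms, and \<open>max K 0\<close>
  guards against a negative K.\<close>

lemma resolvent_bound:
  assumes "1 \<notin> spectrum_on B N (twisted_transfer_op \<mu> F B \<phi> z)"
  shows "\<exists>K. \<forall>v\<in>V. nrm v \<le> K * nrm (v - R (\<lambda>x. z ^ \<phi> x * v x))"
proof -
  let ?T = "twisted_transfer_op \<mu> F B \<phi> z"
  obtain S where S: "bounded_linear_on B N S" "\<And>v. v \<in> B \<Longrightarrow> N (\<lambda>x. S (\<lambda>x. 1 * v x - ?T v x) x - v x) = 0"
    using assms unfolding spectrum_on_def by blast
  obtain K where K: "\<And>u. u \<in> B \<Longrightarrow> N (S u) \<le> ennreal K * N u" using S(1) unfolding bounded_linear_on_def by blast
  have SB: "\<And>u. u \<in> B \<Longrightarrow> S u \<in> B" using S(1) unfolding bounded_linear_on_def by blast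
  have "nrm v \<le> (max K 0 * 2) * nrm (v - R (\<lambda>x. z ^ \<phi> x * v x))" if v: "v \<in> V" for v
  proof -
    let ?v = "ext v"
    define u where "u = (\<lambda>x. ?v x - ?T ?v x)"
    have vB: "?v \<in> B" by (rule ext_B[OF v])
    have uB: "u \<in> B" unfolding u_def by (rule B_diff[OF vB twisted_transfer_op(1)[OF vB]])
    have SuB: "S u \<in> B" by (rule SB[OF uB])
    have "N (\<lambda>x. S u x - ?v x) = 0" using S(2)[OF vB] by (simp add: u_def)
    then have "cmod (S u x - ?v x) \<le> 0" if "x \<in> Om" for x
      using N_bounds(2)[of "\<lambda>x. S u x - ?v x" x] that B_diff[OF SuB vB] by (simp add: B_iff)
    then have "nrm v = nrm (S u)" by (intro nrm_cong) (simp add: ext_Om[OF v])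
    also have "\<dots> \<le> enn2real (N (S u))" by (rule B_V(2)[OF SuB])
    also have "\<dots> \<le> max K 0 * (2 * nrm u)"
    proof (rule enn2real_leI)
      show "0 \<le> max K 0 * (2 * nrm u)" using nrm_nonneg[OF B_V(1)[OF uB]] by simp
      have "N (S u) \<le> ennreal K * N u" by (rule K[OF uB])
      also have "\<dots> \<le> ennreal (max K 0) * ennreal (2 * nrm u)" by (intro mult_mono ennreal_leI N_le_nrm[OF uB]) auto
      also have "\<dots> = ennreal (max K 0 * (2 * nrm u))" by (rule ennreal_mult'[symmetric]) simp
      finally show "N (S u) \<le> ennreal (max K 0 * (2 * nrm u))" .
    qed
    also have "nrm u = nrm (v - R (\<lambda>x. z ^ \<phi> x * v x))"
    proof (rule nrm_cong)
      fix x assume x: "x \<in> Om"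
      have "R (\<lambda>x. z ^ \<phi> x * ?v x) x = R (\<lambda>x. z ^ \<phi> x * v x) x" by (rule R_cong) (simp add: ext_Om[OF v])
      then show "u x = (v - R (\<lambda>x. z ^ \<phi> x * v x)) x"
        unfolding u_def using twisted_transfer_op(2)[OF vB x] ext_Om[OF v x] by simp
    qed
    finally show ?thesis by (simp only: mult.assoc)
  qed
  then show ?thesis by blast
qed

end
end

section \<open>Inducing schemes\<close>

lemma Least_agree:
  fixes P Q :: "nat \<Rightarrow> bool"
  assumes "\<And>l. l \<le> n \<Longrightarrow> P l = Q l" "P n" shows "(LEAST l. P l) = (LEAST l. Q l)"
proof (rule Least_equality)
  have Q: "Q n" using assms by simp
  have "(LEAST l. Q l) \<le> n" by (rule Least_le[of Q, OF Q])
  then show "P (LEAST l. Q l)" using assms(1) LeastI[of Q, OF Q] by simp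
  show "(LEAST l. Q l) \<le> l" if "P l" for l
    by (cases "l \<le> n") (use assms that \<open>(LEAST l. Q l) \<le> n\<close> in \<open>auto intro: Least_le\<close>)
qed

lemma integral_scale_measure:
  fixes h :: "'a \<Rightarrow> real"
  assumes "0 \<le> c" "h \<in> borel_measurable M"
  shows "(\<integral>x. h x \<partial>scale_measure (ennreal c) M) = c * (\<integral>x. h x \<partial>M)"
proof -
  have "scale_measure (ennreal c) M = density M (\<lambda>_. ennreal c)"
    by (rule measure_eqI) (simp_all add: emeasure_density_const)
  then show ?thesis using assms by (simp add: integral_density)
qed

context inducing_scheme
begin

abbreviation "F \<equiv> return_map f \<phi>"

lemma space_mu0: "space \<mu>\<^sub>0 = Y"
  using sets_eq_imp_space_eq[OF sets_mu0] Y_sets sets.sets_into_space by (auto simp: space_restrict_space)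

lemma Y_space: "y \<in> Y \<Longrightarrow> y \<in> space M"
  using sets.sets_into_space[OF Y_sets] by blast

lemma f_measurable: "f \<in> measurable M M" and funpow_M: "(f ^^ j) \<in> measurable M M"
proof -
  show f: "f \<in> measurable M M" using invariant by (simp add: measure_preserving_map_def)
  show "(f ^^ j) \<in> measurable M M" using f by (induction j) auto
qed

lemma funpow_mu0: "(f ^^ j) \<in> measurable \<mu>\<^sub>0 M"
  using measurable_restrict_space1[OF funpow_M] by (simp cong: measurable_cong_sets add: sets_mu0)

lemma phi_compose:
  fixes g :: "nat \<Rightarrow> 'a \<Rightarrow> 'b::topological_space"
  assumes "\<And>i. g i \<in> borel_measurable \<mu>\<^sub>0" shows "(\<lambda>x. g (\<phi> x) x) \<in> borel_measurable \<mu>\<^sub>0"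
  by (rule measurable_compose_countable[OF assms phi_measurable])

lemma F_in: "y \<in> Y \<Longrightarrow> (f ^^ \<phi> y) y \<in> Y"
  using phi_return by (simp add: return_map_def)

lemma hits_Y: "y \<in> Y \<Longrightarrow> \<exists>i. (f ^^ i) ((f ^^ k) y) \<in> Y"
proof (induction k arbitrary: y rule: less_induct)
  case (less k)
  show ?case
  proof (cases "k \<le> \<phi> y")
    case True
    then have "(f ^^ (\<phi> y - k)) ((f ^^ k) y) = (f ^^ \<phi> y) y" by (simp flip: funpow_add comp_apply[of "f ^^ _"])
    then show ?thesis using F_in[OF less.prems] by metis
  next
    case False
    then have "(f ^^ k) y = (f ^^ (k - \<phi> y)) ((f ^^ \<phi> y) y)" by (simp flip: funpow_add comp_apply[of "f ^^ _"])
    then show ?thesis using less.IH[of "k - \<phi> y" "(f ^^ \<phi> y) y"] False phi_pos[OF less.prems] F_in[OF less.prems] by simp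
  qed
qed

lemma first_return: assumes "y \<in> Y" shows "1 \<le> first_return f Y y" "(f ^^ first_return f Y y) y \<in> Y"
proof -
  have "1 \<le> \<phi> y \<and> (f ^^ \<phi> y) y \<in> Y" using phi_pos F_in assms by blast
  from LeastI[of "\<lambda>n. 1 \<le> n \<and> (f ^^ n) y \<in> Y", OF this]
  show "1 \<le> first_return f Y y" "(f ^^ first_return f Y y) y \<in> Y" by (auto simp: first_return_def)
qed

lemma kth_return_in: "y \<in> Y \<Longrightarrow> (f ^^ kth_return f Y k y) y \<in> Y"
proof (induction k)
  case (Suc k)
  have "(f ^^ kth_return f Y (Suc k) y) y = (f ^^ first_return f Y ((f ^^ kth_return f Y k y) y)) ((f ^^ kth_return f Y k y) y)"
    by (simp add: add.commute[of "kth_return f Y k y"] funpow_add)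
  then show ?case using first_return(2)[OF Suc.IH[OF Suc.prems]] by simp
qed simp

lemma kth_return_mono: "y \<in> Y \<Longrightarrow> strict_mono (\<lambda>k. kth_return f Y k y)"
  unfolding strict_mono_Suc_iff using first_return(1)[OF kth_return_in] by (simp add: Suc_le_eq)

definition weight :: "real \<Rightarrow> nat \<Rightarrow> 'a \<Rightarrow> real" where
  "weight \<epsilon> i x = real (tau_star f Y ((f ^^ i) x)) powr - (1 + \<epsilon>)"

lemma tau_star_ge: "1 \<le> tau_star f Y x"
  by (simp add: tau_star_def)

lemma weight_eq: "weight \<epsilon> i x = 1 / real (tau_star f Y ((f ^^ i) x)) powr (1 + \<epsilon>)"
  unfolding weight_def powr_minus_divide ..

lemma weight_range: "0 < \<epsilon> \<Longrightarrow> 0 \<le> weight \<epsilon> i x" "0 < \<epsilon> \<Longrightarrow> weight \<epsilon> i x \<le> 1"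
proof -
  have "1 \<le> real (tau_star f Y ((f ^^ i) x))" using tau_star_ge[of "(f ^^ i) x"] by linarith
  then show "0 < \<epsilon> \<Longrightarrow> weight \<epsilon> i x \<le> 1"
    unfolding weight_eq using ge_one_powr_ge_zero[of "real (tau_star f Y ((f ^^ i) x))" "1 + \<epsilon>"] by simp
qed (simp add: weight_def)

lemma tau_star_measurable: "tau_star f Y \<in> measurable M (count_space UNIV)"
proof -
  have "(\<lambda>x. LEAST i. (f ^^ i) x \<in> Y) \<in> measurable M (count_space UNIV)"
    by (rule measurable_Least) (rule pred_sets2[OF Y_sets funpow_M])
  then show ?thesis unfolding tau_star_def[abs_def] by measurable
qed

lemma weight_measurable: "weight \<epsilon> i \<in> borel_measurable \<mu>\<^sub>0"
proof -
  have "(\<lambda>x. tau_star f Y ((f ^^ i) x)) \<in> measurable \<mu>\<^sub>0 (count_space UNIV)"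
    by (rule measurable_compose[OF funpow_mu0 tau_star_measurable])
  then show ?thesis unfolding weight_def[abs_def] by (rule measurable_compose) simp
qed

lemma cell_in_Y: "a \<in> \<alpha> \<Longrightarrow> x \<in> a \<Longrightarrow> x \<in> Y"
proof -
  have "\<alpha> \<subseteq> sets \<mu>\<^sub>0" using gibbs_markov by (simp add: gibbs_markov_def countable_partition_mod_def)
  then show "a \<in> \<alpha> \<Longrightarrow> x \<in> a \<Longrightarrow> x \<in> Y" using sets.sets_into_space[of a \<mu>\<^sub>0] space_mu0 by auto
qed

text \<open>Below the time \<phi>, \<open>levels\<close> decides for the whole cell at once whether
  it lies in Y, and at time \<phi> every point does. The next visit to Y thus happens at the same
  time for x and y.\<close>

lemma weight_const:
  assumes a: "a \<in> \<alpha>" "x \<in> a" "y \<in> a" and i: "i < \<phi> x"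
  shows "weight \<epsilon> i x = weight \<epsilon> i y"
proof -
  have ph: "\<phi> x = \<phi> y" by (rule phi_const[OF a])
  have eq: "(f ^^ j) x \<in> Y \<longleftrightarrow> (f ^^ j) y \<in> Y" if "j \<le> \<phi> x" for j
  proof (cases "j = \<phi> x")
    case True
    then show ?thesis using F_in[OF cell_in_Y[OF a(1,2)]] F_in[OF cell_in_Y[OF a(1,3)]] ph by simp
  next
    case False
    then show ?thesis using levels[OF a(1,2), of j] that a(2,3) by (auto simp: image_subset_iff)
  qed
  have "(LEAST l. (f ^^ l) ((f ^^ i) x) \<in> Y) = (LEAST l. (f ^^ l) ((f ^^ i) y) \<in> Y)"
  proof (rule Least_agree[of "\<phi> x - i"])
    have e: "(f ^^ l) ((f ^^ i) u) = (f ^^ (l + i)) u" for l u by (simp add: funpow_add)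
    show "((f ^^ l) ((f ^^ i) x) \<in> Y) = ((f ^^ l) ((f ^^ i) y) \<in> Y)" if "l \<le> \<phi> x - i" for l
      unfolding e using that i by (intro eq) linarith
    show "(f ^^ (\<phi> x - i)) ((f ^^ i) x) \<in> Y" unfolding e using i F_in[OF cell_in_Y[OF a(1,2)]] by simp
  qed
  then show ?thesis by (simp add: weight_def tau_star_def)
qed

definition zeta :: "real \<Rightarrow> real" where "zeta \<epsilon> = (\<Sum>n. (real n + 1) powr - (1 + \<epsilon>))"

lemma zeta_summable: assumes "0 < \<epsilon>" shows "summable (\<lambda>n. (real n + 1) powr - (1 + \<epsilon>))"
proof -
  have "summable (\<lambda>n. real (Suc n) powr - (1 + \<epsilon>))"
    by (subst summable_Suc_iff) (use assms in \<open>simp add: summable_real_powr_iff\<close>)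
  then show ?thesis by (simp add: add.commute)
qed

lemma zeta_partial: assumes "0 < \<epsilon>" shows "(\<Sum>j<n. (real j + 1) powr - (1 + \<epsilon>)) \<le> zeta \<epsilon>"
  unfolding zeta_def by (rule sum_le_suminf[OF zeta_summable[OF assms]]) auto

lemma zeta_pos: "0 < \<epsilon> \<Longrightarrow> 0 < zeta \<epsilon>"
  using zeta_partial[of \<epsilon> 1] by simp

text \<open>Between two consecutive entries to Y the weights run through the inverse powers of
  1, 2, 3, ..., so each excursion contributes at most a constant.\<close>

lemma weight_sum:
  assumes e: "0 < \<epsilon>" and y: "y \<in> Y" and n: "(f ^^ n) y \<in> Y"
  shows "\<exists>k. kth_return f Y k y = n \<and> (\<Sum>i<n. weight \<epsilon> i y) \<le> zeta \<epsilon> * real k"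
  using n
proof (induction n rule: less_induct)
  case (less n)
  show ?case
  proof (cases "n = 0")
    case True
    then show ?thesis by (intro exI[of _ 0]) simp
  next
    case False
    \<comment> \<open>The last visit to Y before n; the induction covers the time up to l, and one
      excursion from l to n remains.\<close>
    define l where "l = Max {i. i < n \<and> (f ^^ i) y \<in> Y}"
    have fin: "finite {i. i < n \<and> (f ^^ i) y \<in> Y}" by simp
    have "0 \<in> {i. i < n \<and> (f ^^ i) y \<in> Y}" using False y by simp
    then have "l \<in> {i. i < n \<and> (f ^^ i) y \<in> Y}" unfolding l_def by (intro Max_in fin) auto
    then have l: "l < n" "(f ^^ l) y \<in> Y" by auto
    have none: "(f ^^ i) y \<notin> Y" if "l < i" "i < n" for i
      using Max_ge[OF fin, of i] that by (auto simp: l_def[symmetric])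
    obtain k where k: "kth_return f Y k y = l" "(\<Sum>i<l. weight \<epsilon> i y) \<le> zeta \<epsilon> * real k"
      using less.IH[OF l] by blast
    have shift: "(f ^^ j) ((f ^^ i) y) = (f ^^ (j + i)) y" for i j by (simp add: funpow_add)
    have "first_return f Y ((f ^^ l) y) = n - l"
      unfolding first_return_def
    proof (rule Least_equality)
      show "1 \<le> n - l \<and> (f ^^ (n - l)) ((f ^^ l) y) \<in> Y" using l less.prems by (simp add: shift)
      fix j assume "1 \<le> j \<and> (f ^^ j) ((f ^^ l) y) \<in> Y"
      then show "n - l \<le> j" using none[of "j + l"] by (cases "j + l < n") (auto simp: shift)
    qed
    then have kk: "kth_return f Y (Suc k) y = n" using k l by simp
    have ts: "tau_star f Y ((f ^^ i) y) = 1 + (n - i)" if "l < i" "i < n" for i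
    proof -
      have "(LEAST j. (f ^^ j) ((f ^^ i) y) \<in> Y) = n - i"
      proof (rule Least_equality)
        show "(f ^^ (n - i)) ((f ^^ i) y) \<in> Y" using that less.prems by (simp add: shift)
        fix j assume "(f ^^ j) ((f ^^ i) y) \<in> Y"
        then show "n - i \<le> j" using none[of "j + i"] that by (cases "j + i < n") (auto simp: shift)
      qed
      then show ?thesis by (simp add: tau_star_def)
    qed
    have "(LEAST j. (f ^^ j) ((f ^^ l) y) \<in> Y) = 0" using l by (intro Least_equality) auto
    then have wl: "weight \<epsilon> l y = 1" by (simp add: weight_def tau_star_def)
    have "(\<Sum>i\<in>{l<..<n}. weight \<epsilon> i y) = (\<Sum>i\<in>{l<..<n}. (real (n - i) + 1) powr - (1 + \<epsilon>))"
      by (rule sum.cong) (auto simp: weight_def ts add.commute)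
    also have "\<dots> = (\<Sum>j\<in>{1..<n - l}. (real j + 1) powr - (1 + \<epsilon>))"
      by (rule sum.reindex_bij_witness[of _ "\<lambda>j. n - j" "\<lambda>i. n - i"]) auto
    finally have mid: "(\<Sum>i\<in>{l<..<n}. weight \<epsilon> i y) = (\<Sum>j\<in>{1..<n - l}. (real j + 1) powr - (1 + \<epsilon>))" .
    have s: "{..<n} = {..<l} \<union> insert l {l<..<n}" using l by auto
    have "(\<Sum>i<n. weight \<epsilon> i y) = (\<Sum>i\<in>{..<l} \<union> insert l {l<..<n}. weight \<epsilon> i y)" by (simp only: s)
    also have "\<dots> = (\<Sum>i<l. weight \<epsilon> i y) + (\<Sum>i\<in>insert l {l<..<n}. weight \<epsilon> i y)"
      by (rule sum.union_disjoint) auto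
    also have "(\<Sum>i\<in>insert l {l<..<n}. weight \<epsilon> i y) = 1 + (\<Sum>i\<in>{l<..<n}. weight \<epsilon> i y)" by (simp add: wl)
    \<comment> \<open>\<open>tau_star\<close> is 1 at l and 1 + (n - i) at l < i < n, so over the
      excursion it takes each of the values 1, ..., n - l once.\<close>
    also have "1 + (\<Sum>i\<in>{l<..<n}. weight \<epsilon> i y) = (\<Sum>j<n - l. (real j + 1) powr - (1 + \<epsilon>))"
      unfolding mid using l by (simp add: sum.atLeast_Suc_lessThan[of 0 "n - l"] flip: atLeast0LessThan)
    also have "\<dots> \<le> zeta \<epsilon>" by (rule zeta_partial[OF e])
    finally have "(\<Sum>i<n. weight \<epsilon> i y) \<le> zeta \<epsilon> * real (Suc k)" using k(2) by (simp add: algebra_simps)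
    then show ?thesis using kk by blast
  qed
qed

lemma weight_sum_reinduce:
  assumes e: "0 < \<epsilon>" and y: "y \<in> Y"
  shows "(\<Sum>i<\<phi> y. weight \<epsilon> i y) \<le> zeta \<epsilon> * real (reinduce_time f Y \<phi> y)"
proof -
  obtain k where k: "kth_return f Y k y = \<phi> y" "(\<Sum>i<\<phi> y. weight \<epsilon> i y) \<le> zeta \<epsilon> * real k"
    using weight_sum[OF e y F_in[OF y]] by blast
  have "reinduce_time f Y \<phi> y = k"
    unfolding reinduce_time_def
    by (rule the_equality) (use k(1) strict_mono_eq[OF kth_return_mono[OF y]] in auto)
  then show ?thesis using k(2) by simp
qed

text \<open>\<open>mu_X\<close> is the push-forward of the product of \<open>\<mu>\<^sub>0\<close>
  and counting measure, restricted to the tower j < \<phi> y. Integrating over y first recovers the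
  defining series, and integrating over j first gives the column sums.\<close>

lemma nn_integral_mu_X:
  assumes g: "g \<in> borel_measurable M"
  shows "(\<integral>\<^sup>+x. g x \<partial>mu_X M f \<phi> \<mu>\<^sub>0) = (\<integral>\<^sup>+y. (\<Sum>j<\<phi> y. g ((f ^^ j) y)) \<partial>\<mu>\<^sub>0)"
proof -
  interpret prob_space \<mu>\<^sub>0 using gibbs_markov by (simp add: gibbs_markov_def)
  interpret P: pair_sigma_finite \<mu>\<^sub>0 "count_space (UNIV :: nat set)"
    by (intro pair_sigma_finite.intro sigma_finite_measure_count_space) (rule sigma_finite_measure_axioms)
  let ?P = "\<mu>\<^sub>0 \<Otimes>\<^sub>M count_space (UNIV :: nat set)"
  let ?w = "\<lambda>z. indicator {j. j < \<phi> (fst z)} (snd z) :: ennreal"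
  let ?h = "\<lambda>z. (f ^^ snd z) (fst z)"
  let ?D = "distr (density ?P ?w) M ?h"
  have h: "?h \<in> measurable ?P M"
    by (rule measurable_compose_countable[OF _ measurable_snd]) (rule measurable_compose[OF measurable_fst funpow_mu0])
  have phi_fst: "(\<lambda>z. \<phi> (fst z)) \<in> measurable ?P (count_space UNIV)"
    by (rule measurable_compose[OF measurable_fst phi_measurable])
  have w: "?w \<in> borel_measurable ?P"
    by (rule measurable_compose_countable[OF _ phi_fst, of "\<lambda>i z. indicator {j. j < i} (snd z)"])
       (rule measurable_compose[OF measurable_snd], simp)
  have D: "(\<integral>\<^sup>+x. k x \<partial>?D) = (\<integral>\<^sup>+y. (\<Sum>j<\<phi> y. k ((f ^^ j) y)) \<partial>\<mu>\<^sub>0)"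
    "(\<integral>\<^sup>+x. k x \<partial>?D) = (\<Sum>j. \<integral>\<^sup>+y. indicator {j. j < \<phi> y} j * k ((f ^^ j) y) \<partial>\<mu>\<^sub>0)"
    if k: "k \<in> borel_measurable M" for k
  proof -
    have kh: "(\<lambda>z. k (?h z)) \<in> borel_measurable ?P" by (rule measurable_compose[OF h k])
    have "(\<integral>\<^sup>+x. k x \<partial>?D) = (\<integral>\<^sup>+z. k (?h z) \<partial>density ?P ?w)" by (rule nn_integral_distr) (use h k in simp_all)
    also have "\<dots> = (\<integral>\<^sup>+z. ?w z * k (?h z) \<partial>?P)" by (rule nn_integral_density[OF w kh])
    finally have e: "(\<integral>\<^sup>+x. k x \<partial>?D) = (\<integral>\<^sup>+z. ?w z * k (?h z) \<partial>?P)" .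
    have wm: "(\<lambda>z. ?w z * k (?h z)) \<in> borel_measurable ?P" by (rule borel_measurable_times_ennreal[OF w kh])
    have "(\<integral>\<^sup>+x. k x \<partial>?D) = (\<integral>\<^sup>+y. (\<integral>\<^sup>+j. indicator {j. j < \<phi> y} j * k ((f ^^ j) y) \<partial>count_space UNIV) \<partial>\<mu>\<^sub>0)"
      unfolding e using P.M2.nn_integral_fst[OF wm] by simp
    also have "\<dots> = (\<integral>\<^sup>+y. (\<Sum>j<\<phi> y. k ((f ^^ j) y)) \<partial>\<mu>\<^sub>0)"
    proof (rule nn_integral_cong)
      fix y
      have "(\<integral>\<^sup>+j. indicator {j. j < \<phi> y} j * k ((f ^^ j) y) \<partial>count_space UNIV) = (\<Sum>j. indicator {j. j < \<phi> y} j * k ((f ^^ j) y))"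
        by (rule nn_integral_count_space_nat)
      also have "\<dots> = (\<Sum>j<\<phi> y. indicator {j. j < \<phi> y} j * k ((f ^^ j) y))" by (rule suminf_finite) auto
      finally show "(\<integral>\<^sup>+j. indicator {j. j < \<phi> y} j * k ((f ^^ j) y) \<partial>count_space UNIV) = (\<Sum>j<\<phi> y. k ((f ^^ j) y))" by simp
    qed
    finally show "(\<integral>\<^sup>+x. k x \<partial>?D) = (\<integral>\<^sup>+y. (\<Sum>j<\<phi> y. k ((f ^^ j) y)) \<partial>\<mu>\<^sub>0)" .
    show "(\<integral>\<^sup>+x. k x \<partial>?D) = (\<Sum>j. \<integral>\<^sup>+y. indicator {j. j < \<phi> y} j * k ((f ^^ j) y) \<partial>\<mu>\<^sub>0)"
      unfolding e using P.nn_integral_snd[OF wm]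
      by (simp add: nn_integral_count_space_nat)
  qed
  have "mu_X M f \<phi> \<mu>\<^sub>0 = ?D"
  proof (rule measure_eqI)
    show "sets (mu_X M f \<phi> \<mu>\<^sub>0) = sets ?D" by (simp add: mu_X_def sets.space_closed sets.sigma_sets_eq)
    fix A assume "A \<in> sets (mu_X M f \<phi> \<mu>\<^sub>0)"
    then have A: "A \<in> sets M" by (simp add: mu_X_def sets.space_closed sets.sigma_sets_eq)
    have s: "(f ^^ j) -` A \<inter> {y \<in> space \<mu>\<^sub>0. \<phi> y > j} \<in> sets \<mu>\<^sub>0" for j
    proof -
      have "((f ^^ j) -` A \<inter> space \<mu>\<^sub>0) \<inter> (\<phi> -` {j<..} \<inter> space \<mu>\<^sub>0) \<in> sets \<mu>\<^sub>0"
        using measurable_sets[OF funpow_mu0 A] measurable_sets[OF phi_measurable] by simp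
      also have "((f ^^ j) -` A \<inter> space \<mu>\<^sub>0) \<inter> (\<phi> -` {j<..} \<inter> space \<mu>\<^sub>0) = (f ^^ j) -` A \<inter> {y \<in> space \<mu>\<^sub>0. \<phi> y > j}" by auto
      finally show ?thesis .
    qed
    have "emeasure ?D A = (\<integral>\<^sup>+x. indicator A x \<partial>?D)" using A by simp
    also have "\<dots> = (\<Sum>j. \<integral>\<^sup>+y. indicator {j. j < \<phi> y} j * indicator A ((f ^^ j) y) \<partial>\<mu>\<^sub>0)"
      by (rule D(2)) (use A in simp)
    also have "\<dots> = (\<Sum>j. \<integral>\<^sup>+y. indicator ((f ^^ j) -` A \<inter> {y \<in> space \<mu>\<^sub>0. \<phi> y > j}) y \<partial>\<mu>\<^sub>0)"
      by (intro suminf_cong nn_integral_cong) (auto simp: indicator_def)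
    also have "\<dots> = emeasure (mu_X M f \<phi> \<mu>\<^sub>0) A" using s by (simp add: emeasure_mu_X[OF A])
    finally show "emeasure (mu_X M f \<phi> \<mu>\<^sub>0) A = emeasure ?D A" by simp
  qed
  then show ?thesis using D(1)[OF g] by simp
qed

lemma tower_sum_measurable:
  fixes v :: "'a \<Rightarrow> real"
  assumes "v \<in> borel_measurable M" shows "(\<lambda>y. \<Sum>j<\<phi> y. v ((f ^^ j) y)) \<in> borel_measurable \<mu>\<^sub>0"
  by (rule phi_compose[of "\<lambda>i y. \<Sum>j<i. v ((f ^^ j) y)"])
     (intro borel_measurable_sum measurable_compose[OF funpow_mu0 assms])

lemma integral_mu_X:
  fixes v :: "'a \<Rightarrow> real"
  assumes v: "v \<in> borel_measurable M" and i: "integrable \<mu>\<^sub>0 (\<lambda>y. \<Sum>j<\<phi> y. \<bar>v ((f ^^ j) y)\<bar>)"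
  shows "(\<integral>x. v x \<partial>mu_X M f \<phi> \<mu>\<^sub>0) = (\<integral>y. (\<Sum>j<\<phi> y. v ((f ^^ j) y)) \<partial>\<mu>\<^sub>0)"
proof -
  have sets: "sets (mu_X M f \<phi> \<mu>\<^sub>0) = sets M" by (simp add: mu_X_def sets.space_closed sets.sigma_sets_eq)
  have vX: "u \<in> borel_measurable (mu_X M f \<phi> \<mu>\<^sub>0)" if "u \<in> borel_measurable M" for u :: "'a \<Rightarrow> real"
    using that by (simp cong: measurable_cong_sets add: sets)
  have pos: "integrable (mu_X M f \<phi> \<mu>\<^sub>0) u \<and> integrable \<mu>\<^sub>0 (\<lambda>y. \<Sum>j<\<phi> y. u ((f ^^ j) y)) \<and>
      (\<integral>x. u x \<partial>mu_X M f \<phi> \<mu>\<^sub>0) = (\<integral>y. (\<Sum>j<\<phi> y. u ((f ^^ j) y)) \<partial>\<mu>\<^sub>0)"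
    if u: "u \<in> borel_measurable M" "\<And>x. 0 \<le> u x" "\<And>x. u x \<le> \<bar>v x\<bar>" for u :: "'a \<Rightarrow> real"
  proof -
    have iu: "integrable \<mu>\<^sub>0 (\<lambda>y. \<Sum>j<\<phi> y. u ((f ^^ j) y))"
    proof (rule Bochner_Integration.integrable_bound[OF i tower_sum_measurable[OF u(1)]], rule AE_I2)
      fix y
      have "0 \<le> (\<Sum>j<\<phi> y. u ((f ^^ j) y))" "(\<Sum>j<\<phi> y. u ((f ^^ j) y)) \<le> (\<Sum>j<\<phi> y. \<bar>v ((f ^^ j) y)\<bar>)"
        by (intro sum_nonneg sum_mono u)+
      then show "norm (\<Sum>j<\<phi> y. u ((f ^^ j) y)) \<le> norm (\<Sum>j<\<phi> y. \<bar>v ((f ^^ j) y)\<bar>)" by simp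
    qed
    have "(\<integral>\<^sup>+x. ennreal (u x) \<partial>mu_X M f \<phi> \<mu>\<^sub>0) = (\<integral>\<^sup>+y. (\<Sum>j<\<phi> y. ennreal (u ((f ^^ j) y))) \<partial>\<mu>\<^sub>0)"
      by (rule nn_integral_mu_X) (use u(1) in measurable)
    also have "\<dots> = (\<integral>\<^sup>+y. ennreal (\<Sum>j<\<phi> y. u ((f ^^ j) y)) \<partial>\<mu>\<^sub>0)"
      by (intro nn_integral_cong sum_ennreal u)
    also have "\<dots> = ennreal (\<integral>y. (\<Sum>j<\<phi> y. u ((f ^^ j) y)) \<partial>\<mu>\<^sub>0)"
      by (rule nn_integral_eq_integral[OF iu]) (intro AE_I2 sum_nonneg u)
    finally have nn: "(\<integral>\<^sup>+x. ennreal (u x) \<partial>mu_X M f \<phi> \<mu>\<^sub>0) = ennreal (\<integral>y. (\<Sum>j<\<phi> y. u ((f ^^ j) y)) \<partial>\<mu>\<^sub>0)" .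
    have "0 \<le> (\<integral>y. (\<Sum>j<\<phi> y. u ((f ^^ j) y)) \<partial>\<mu>\<^sub>0)" by (intro integral_nonneg_AE AE_I2 sum_nonneg u)
    moreover have "integrable (mu_X M f \<phi> \<mu>\<^sub>0) u"
      by (rule integrableI_nonneg[OF vX[OF u(1)]]) (use nn u(2) in auto)
    ultimately show ?thesis using iu nn nn_integral_eq_integral[of "mu_X M f \<phi> \<mu>\<^sub>0" u] u(2)
      by (simp add: integral_nonneg_AE)
  qed
  have p: "(\<lambda>x. max 0 (v x)) \<in> borel_measurable M" "(\<lambda>x. max 0 (- v x)) \<in> borel_measurable M" using v by measurable
  note p1 = pos[OF p(1)] and p2 = pos[OF p(2)]
  have split: "v x = max 0 (v x) - max 0 (- v x)" for x by simp
  have "(\<integral>x. v x \<partial>mu_X M f \<phi> \<mu>\<^sub>0) = (\<integral>x. max 0 (v x) - max 0 (- v x) \<partial>mu_X M f \<phi> \<mu>\<^sub>0)" using split by simp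
  also have "\<dots> = (\<integral>x. max 0 (v x) \<partial>mu_X M f \<phi> \<mu>\<^sub>0) - (\<integral>x. max 0 (- v x) \<partial>mu_X M f \<phi> \<mu>\<^sub>0)"
    by (rule Bochner_Integration.integral_diff) (use p1 p2 in auto)
  also have "\<dots> = (\<integral>y. (\<Sum>j<\<phi> y. max 0 (v ((f ^^ j) y))) \<partial>\<mu>\<^sub>0) - (\<integral>y. (\<Sum>j<\<phi> y. max 0 (- v ((f ^^ j) y))) \<partial>\<mu>\<^sub>0)"
    using p1 p2 by auto
  also have "\<dots> = (\<integral>y. (\<Sum>j<\<phi> y. max 0 (v ((f ^^ j) y))) - (\<Sum>j<\<phi> y. max 0 (- v ((f ^^ j) y))) \<partial>\<mu>\<^sub>0)"
    by (rule Bochner_Integration.integral_diff[symmetric]) (use p1 p2 in auto)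
  also have "\<dots> = (\<integral>y. (\<Sum>j<\<phi> y. v ((f ^^ j) y)) \<partial>\<mu>\<^sub>0)" using split by (simp flip: sum_subtractf)
  finally show ?thesis .
qed

lemma integral_mu_normalized:
  fixes v :: "'a \<Rightarrow> real"
  assumes v: "v \<in> borel_measurable M" and i: "integrable \<mu>\<^sub>0 (\<lambda>y. \<Sum>j<\<phi> y. \<bar>v ((f ^^ j) y)\<bar>)"
    and p: "0 < phi_bar \<mu>\<^sub>0 \<phi>"
  shows "(\<integral>x. v x \<partial>mu_normalized M f \<phi> \<mu>\<^sub>0) = (\<integral>y. (\<Sum>j<\<phi> y. v ((f ^^ j) y)) \<partial>\<mu>\<^sub>0) / phi_bar \<mu>\<^sub>0 \<phi>"
proof -
  have sets: "sets (mu_X M f \<phi> \<mu>\<^sub>0) = sets M" by (simp add: mu_X_def sets.space_closed sets.sigma_sets_eq)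
  have "v \<in> borel_measurable (mu_X M f \<phi> \<mu>\<^sub>0)" using v by (simp cong: measurable_cong_sets add: sets)
  then show ?thesis unfolding mu_normalized_def using p by (simp add: integral_scale_measure integral_mu_X[OF v i])
qed

lemma norm_inf_star_bound:
  assumes f: "norm_inf_star M f Y \<epsilon> v < \<infinity>" and e: "0 < \<epsilon>" and y: "y \<in> Y"
  shows "\<bar>v ((f ^^ i) y)\<bar> \<le> enn2real (norm_inf_star M f Y \<epsilon> v) * weight \<epsilon> i y"
proof -
  let ?x = "(f ^^ i) y" and ?t = "real (tau_star f Y ((f ^^ i) y)) powr (1 + \<epsilon>)"
  have x: "?x \<in> {x \<in> space M. \<exists>i. (f ^^ i) x \<in> Y}"
    using hits_Y[OF y] measurable_space[OF funpow_M Y_space[OF y]] by simp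
  have t: "?t > 0" using tau_star_ge[of ?x] by simp
  have "ennreal (\<bar>v ?x\<bar> * ?t) \<le> norm_inf_star M f Y \<epsilon> v" unfolding norm_inf_star_def by (rule SUP_upper[OF x])
  then have "\<bar>v ?x\<bar> * ?t \<le> enn2real (norm_inf_star M f Y \<epsilon> v)"
    using enn2real_mono[of "ennreal (\<bar>v ?x\<bar> * ?t)"] f by simp
  then show ?thesis unfolding weight_eq using t by (simp add: pos_le_divide_eq)
qed

lemma seminorm_theta_star_bound:
  assumes f: "seminorm_theta_star f Y \<phi> \<alpha> \<theta> \<epsilon> v < \<infinity>" and a: "a \<in> \<alpha>"
    and x: "x \<in> a \<inter> itinerary_set \<alpha> F" "x' \<in> a \<inter> itinerary_set \<alpha> F" and i: "i < \<phi> x"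
    and d0: "0 \<le> d_theta \<alpha> F \<theta> x x'"
  shows "\<bar>v ((f ^^ i) x) - v ((f ^^ i) x')\<bar>
    \<le> enn2real (seminorm_theta_star f Y \<phi> \<alpha> \<theta> \<epsilon> v) * weight \<epsilon> i x * d_theta \<alpha> F \<theta> x x'"
proof -
  let ?t = "real (tau_star f Y ((f ^^ i) x)) powr (1 + \<epsilon>)" and ?d = "d_theta \<alpha> F \<theta> x x'"
    and ?v = "\<bar>v ((f ^^ i) x) - v ((f ^^ i) x')\<bar>" and ?S = "seminorm_theta_star f Y \<phi> \<alpha> \<theta> \<epsilon> v"
  have t: "?t > 0" using tau_star_ge[of "(f ^^ i) x"] by simp
  have le: "ennreal ?t / ennreal ?d * ennreal ?v \<le> ?S"
    unfolding seminorm_theta_star_def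
    by (rule SUP_upper2[OF a], rule SUP_upper2[OF x(1)], rule SUP_upper2[OF x(2)], rule SUP_upper2[of i]) (use i in auto)
  show ?thesis
  proof (cases "?d = 0")
    case True
    have "?v = 0"
    proof (rule ccontr)
      assume "?v \<noteq> 0"
      then have "ennreal ?t / ennreal ?d * ennreal ?v = \<infinity>"
        using True t by (simp add: divide_ennreal_def ennreal_mult_top infinity_ennreal_def ennreal_top_mult)
      then show False using le f by simp
    qed
    then show ?thesis using True by simp
  next
    case False
    then have p: "?d > 0" using d0 by simp
    have "ennreal (?t / ?d * ?v) \<le> ?S"
      using le p t by (simp add: divide_ennreal ennreal_mult'[symmetric] del: times_divide_eq_left)
    then have "?t / ?d * ?v \<le> enn2real ?S" using enn2real_mono[of "ennreal (?t / ?d * ?v)" ?S] f p t by simp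
    then show ?thesis unfolding weight_eq using p t by (simp add: field_simps)
  qed
qed

end

section \<open>Correlation asymptotics for inducing schemes\<close>

text \<open>The asymptotic bound becomes one for all n since the finitely many small n are absorbed
  by the bound 1 on t.\<close>

lemma bigo_tail_bound:
  fixes t :: "nat \<Rightarrow> real"
  assumes O: "t \<in> O(\<lambda>n. real n powr - \<beta>)" and \<beta>: "\<beta> > 1" and t: "\<And>n. 0 \<le> t n" "\<And>n. t n \<le> 1"
  shows "\<exists>C. \<forall>n. t n \<le> C * (real n + 1) powr - \<beta>"
proof -
  obtain c where c: "c > 0" "eventually (\<lambda>n. norm (t n) \<le> c * norm (real n powr - \<beta>)) at_top"
    using landau_o.bigE[OF O] by blast
  obtain n0 where n0: "\<And>n. n \<ge> n0 \<Longrightarrow> norm (t n) \<le> c * norm (real n powr - \<beta>)"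
    using c(2) by (auto simp: eventually_sequentially)
  have "t n \<le> (c * 2 powr \<beta> + (real n0 + 1) powr \<beta>) * (real n + 1) powr - \<beta>" for n
  \<comment> \<open>n = 0 is kept out of the asymptotic case because \<open>0 powr - \<beta>\<close>
    is 0.\<close>
  proof (cases "n \<ge> n0 \<and> n \<ge> 1")
    case True
    have "t n \<le> c * real n powr - \<beta>" using n0[of n] True t(1)[of n] by simp
    also have "real n powr - \<beta> \<le> 2 powr \<beta> * (real n + 1) powr - \<beta>"
    proof -
      have "(real n + 1) powr \<beta> \<le> (2 * real n) powr \<beta>" using True \<beta> by (intro powr_mono2) auto
      then show ?thesis using True by (simp add: powr_mult powr_minus_divide field_simps)
    qed
    finally have "t n \<le> c * (2 powr \<beta> * (real n + 1) powr - \<beta>)" using c(1) by simp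
    moreover have "0 \<le> (real n0 + 1) powr \<beta> * (real n + 1) powr - \<beta>" by simp
    ultimately show ?thesis unfolding distrib_right mult.assoc by linarith
  next
    case False
    have "(real n + 1) powr \<beta> \<le> (real n0 + 1) powr \<beta>" using False \<beta> by (intro powr_mono2) auto
    then have "1 \<le> (real n0 + 1) powr \<beta> * (real n + 1) powr - \<beta>" by (simp add: powr_minus_divide)
    moreover have "0 \<le> c * 2 powr \<beta> * (real n + 1) powr - \<beta>" using c(1) by simp
    ultimately show ?thesis using t(2)[of n] unfolding distrib_right mult.assoc by linarith
  qed
  then show ?thesis by blast
qed

context inducing_scheme
begin

text \<open>Column sums of the weights are at most \<open>zeta \<epsilon>\<close> times the reinduce
  time, so condition (ii) bounds their integral over \<phi> > n by the measure of that set. The case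
  n = 0 gives integrability.\<close>

lemma weight_sum_tail:
  assumes e: "0 < \<epsilon>" and C: "C > 0"
    and r: "\<And>n. (\<integral>\<^sup>+ y \<in> {y \<in> space \<mu>\<^sub>0. \<phi> y > n}. ennreal (real (reinduce_time f Y \<phi> y)) \<partial>\<mu>\<^sub>0)
        \<le> ennreal (C * measure \<mu>\<^sub>0 {y \<in> space \<mu>\<^sub>0. \<phi> y > n})"
  shows "integrable \<mu>\<^sub>0 (\<lambda>y. \<Sum>i<\<phi> y. weight \<epsilon> i y)"
    "(\<integral>y. (if n < \<phi> y then \<Sum>i<\<phi> y. weight \<epsilon> i y else 0) \<partial>\<mu>\<^sub>0)
      \<le> zeta \<epsilon> * C * measure \<mu>\<^sub>0 {y \<in> space \<mu>\<^sub>0. \<phi> y > n}"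
proof -
  define h where "h n y = (if n < \<phi> y then \<Sum>i<\<phi> y. weight \<epsilon> i y else 0)" for n y
  have h0: "0 \<le> h n y" for n y using weight_range(1)[OF e] by (auto simp: h_def intro: sum_nonneg)
  have hm: "h n \<in> borel_measurable \<mu>\<^sub>0" for n
    unfolding h_def[abs_def]
  proof (rule phi_compose[of "\<lambda>i y. if n < i then \<Sum>j<i. weight \<epsilon> j y else 0"])
    show "(\<lambda>y. if n < i then \<Sum>j<i. weight \<epsilon> j y else 0) \<in> borel_measurable \<mu>\<^sub>0" for i
      by (cases "n < i") (auto intro!: borel_measurable_sum weight_measurable)
  qed
  have nn: "(\<integral>\<^sup>+y. ennreal (h n y) \<partial>\<mu>\<^sub>0) \<le> ennreal (zeta \<epsilon> * C * measure \<mu>\<^sub>0 {y \<in> space \<mu>\<^sub>0. \<phi> y > n})" for n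
  proof -
    note z = zeta_pos[OF e]
    \<comment> \<open>The constant is pulled out of h before the comparison, so that measurability
      is asked of the column sum and not of the reinduce time.\<close>
    have "(\<integral>\<^sup>+y. ennreal (h n y) \<partial>\<mu>\<^sub>0) = (\<integral>\<^sup>+y. ennreal (zeta \<epsilon>) * ennreal (h n y / zeta \<epsilon>) \<partial>\<mu>\<^sub>0)"
      using z h0 by (intro nn_integral_cong) (simp add: ennreal_mult[symmetric])
    also have "\<dots> = ennreal (zeta \<epsilon>) * (\<integral>\<^sup>+y. ennreal (h n y / zeta \<epsilon>) \<partial>\<mu>\<^sub>0)"
      by (rule nn_integral_cmult) (use hm[of n] in measurable)
    also have "(\<integral>\<^sup>+y. ennreal (h n y / zeta \<epsilon>) \<partial>\<mu>\<^sub>0) \<le>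
        (\<integral>\<^sup>+ y \<in> {y \<in> space \<mu>\<^sub>0. \<phi> y > n}. ennreal (real (reinduce_time f Y \<phi> y)) \<partial>\<mu>\<^sub>0)"
    proof (rule nn_integral_mono)
      fix y assume y: "y \<in> space \<mu>\<^sub>0"
      show "ennreal (h n y / zeta \<epsilon>) \<le> ennreal (real (reinduce_time f Y \<phi> y)) * indicator {y \<in> space \<mu>\<^sub>0. \<phi> y > n} y"
      proof (cases "n < \<phi> y")
        case True
        then have "h n y / zeta \<epsilon> \<le> real (reinduce_time f Y \<phi> y)"
          using weight_sum_reinduce[OF e, of y] y z by (simp add: h_def space_mu0 pos_divide_le_eq mult.commute)
        then show ?thesis using True y by (simp add: ennreal_leI)
      qed (simp add: h_def)
    qed
    also have "\<dots> \<le> ennreal (C * measure \<mu>\<^sub>0 {y \<in> space \<mu>\<^sub>0. \<phi> y > n})" by (rule r)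
    also have "ennreal (zeta \<epsilon>) * \<dots> = ennreal (zeta \<epsilon> * C * measure \<mu>\<^sub>0 {y \<in> space \<mu>\<^sub>0. \<phi> y > n})"
      using z C by (simp add: ennreal_mult[symmetric] mult.assoc)
    finally show ?thesis by (simp add: mult_left_mono)
  qed
  have hi: "integrable \<mu>\<^sub>0 (h n)" for n
    by (rule integrableI_nonneg[OF hm]) (use h0 le_less_trans[OF nn[of n]] in auto)
  have "h 0 = (\<lambda>y. \<Sum>i<\<phi> y. weight \<epsilon> i y)" by (rule ext) (simp add: h_def)
  with hi[of 0] show "integrable \<mu>\<^sub>0 (\<lambda>y. \<Sum>i<\<phi> y. weight \<epsilon> i y)" by (simp only:)
  have "(\<integral>y. h n y \<partial>\<mu>\<^sub>0) = enn2real (\<integral>\<^sup>+y. ennreal (h n y) \<partial>\<mu>\<^sub>0)"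
    by (rule integral_eq_nn_integral[OF hm]) (simp add: h0)
  also have "\<dots> \<le> zeta \<epsilon> * C * measure \<mu>\<^sub>0 {y \<in> space \<mu>\<^sub>0. \<phi> y > n}"
    by (rule enn2real_leI[OF _ nn]) (use zeta_pos[OF e] C in simp)
  finally show "(\<integral>y. (if n < \<phi> y then \<Sum>i<\<phi> y. weight \<epsilon> i y else 0) \<partial>\<mu>\<^sub>0)
      \<le> zeta \<epsilon> * C * measure \<mu>\<^sub>0 {y \<in> space \<mu>\<^sub>0. \<phi> y > n}" by (simp only: h_def)
qed

lemma phi_bar_eq:
  assumes s: "summable (\<lambda>n. measure \<mu>\<^sub>0 {y \<in> space \<mu>\<^sub>0. \<phi> y > n})"
  shows "phi_bar \<mu>\<^sub>0 \<phi> = (\<Sum>n. measure \<mu>\<^sub>0 {y \<in> space \<mu>\<^sub>0. \<phi> y > n})"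
proof -
  interpret prob_space \<mu>\<^sub>0 using gibbs_markov by (simp add: gibbs_markov_def)
  have m: "(\<lambda>y. real (\<phi> y)) \<in> borel_measurable \<mu>\<^sub>0" by (rule measurable_compose[OF phi_measurable]) simp
  have "phi_bar \<mu>\<^sub>0 \<phi> = enn2real (\<integral>\<^sup>+y. ennreal (real (\<phi> y)) \<partial>\<mu>\<^sub>0)"
    unfolding phi_bar_def by (rule integral_eq_nn_integral[OF m]) simp
  also have "(\<integral>\<^sup>+y. ennreal (real (\<phi> y)) \<partial>\<mu>\<^sub>0) = (\<Sum>n. emeasure \<mu>\<^sub>0 {y \<in> space \<mu>\<^sub>0. \<phi> y > n})"
    using nn_integral_nat_function[OF phi_measurable] by (simp add: ennreal_of_nat_eq_real_of_nat)
  also have "\<dots> = ennreal (\<Sum>n. measure \<mu>\<^sub>0 {y \<in> space \<mu>\<^sub>0. \<phi> y > n})"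
    unfolding emeasure_eq_measure by (rule suminf_ennreal2[OF _ s]) simp
  finally show ?thesis using suminf_nonneg[OF s] by simp
qed

lemma tower_sum_integrable:
  fixes u :: "'a \<Rightarrow> real"
  assumes u: "u \<in> borel_measurable M" and i: "integrable \<mu>\<^sub>0 (\<lambda>y. \<Sum>i<\<phi> y. weight \<epsilon> i y)"
    and b: "\<And>y i. y \<in> Y \<Longrightarrow> \<bar>u ((f ^^ i) y)\<bar> \<le> c * weight \<epsilon> i y"
  shows "integrable \<mu>\<^sub>0 (\<lambda>y. \<Sum>j<\<phi> y. \<bar>u ((f ^^ j) y)\<bar>)"
proof (rule Bochner_Integration.integrable_bound)
  show "integrable \<mu>\<^sub>0 (\<lambda>y. c * (\<Sum>i<\<phi> y. weight \<epsilon> i y))" using i by simp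
  show "(\<lambda>y. \<Sum>j<\<phi> y. \<bar>u ((f ^^ j) y)\<bar>) \<in> borel_measurable \<mu>\<^sub>0"
    by (rule tower_sum_measurable[of "\<lambda>x. \<bar>u x\<bar>"]) (use u in measurable)
  show "AE y in \<mu>\<^sub>0. norm (\<Sum>j<\<phi> y. \<bar>u ((f ^^ j) y)\<bar>) \<le> norm (c * (\<Sum>i<\<phi> y. weight \<epsilon> i y))"
  proof (rule AE_I2)
    fix y assume "y \<in> space \<mu>\<^sub>0"
    then have "(\<Sum>j<\<phi> y. \<bar>u ((f ^^ j) y)\<bar>) \<le> c * (\<Sum>i<\<phi> y. weight \<epsilon> i y)"
      unfolding sum_distrib_left by (intro sum_mono b) (simp add: space_mu0)
    moreover have "0 \<le> (\<Sum>j<\<phi> y. \<bar>u ((f ^^ j) y)\<bar>)" by (intro sum_nonneg) simp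
    ultimately show "norm (\<Sum>j<\<phi> y. \<bar>u ((f ^^ j) y)\<bar>) \<le> norm (c * (\<Sum>i<\<phi> y. weight \<epsilon> i y))" by simp
  qed
qed

text \<open>The constant \<open>zeta \<epsilon> * C * C\<^sub>\<tau>\<close> multiplies the cost of
  one excursion, the constant of condition (ii) and the constant of the tail of \<phi>.\<close>

lemma tower_instance:
  assumes spectral: "\<And>z::complex. norm z \<le> 1 \<Longrightarrow> z \<noteq> 1 \<Longrightarrow>
      1 \<notin> spectrum_on (B_theta \<mu>\<^sub>0 \<alpha> F \<theta>) (norm_theta \<mu>\<^sub>0 \<alpha> F \<theta>) (twisted_transfer_op \<mu>\<^sub>0 F (B_theta \<mu>\<^sub>0 \<alpha> F \<theta>) \<phi> z)"
    and eps: "\<epsilon> > 0" and beta: "\<beta> > 1"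
    and tail: "\<And>n. measure \<mu>\<^sub>0 {y \<in> space \<mu>\<^sub>0. \<phi> y > n} \<le> C\<^sub>\<tau> * (real n + 1) powr - \<beta>"
    and r: "C > 0" "\<And>n. (\<integral>\<^sup>+ y \<in> {y \<in> space \<mu>\<^sub>0. \<phi> y > n}. ennreal (real (reinduce_time f Y \<phi> y)) \<partial>\<mu>\<^sub>0)
        \<le> ennreal (C * measure \<mu>\<^sub>0 {y \<in> space \<mu>\<^sub>0. \<phi> y > n})"
  obtains \<Omega> \<psi> G C\<^sub>1 where "\<Omega> \<subseteq> itinerary_set \<alpha> F"
    "tower \<mu>\<^sub>0 F \<Omega> \<alpha> \<psi> G (d_theta \<alpha> F \<theta>) \<theta> C\<^sub>1 \<phi> \<beta> C\<^sub>\<tau> f (weight \<epsilon>) (zeta \<epsilon> * C * C\<^sub>\<tau>)"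
proof -
  obtain p C1 core rng where "gibbs_markov_data \<mu>\<^sub>0 F \<alpha> \<theta> p C1 core rng" using gibbs_markov_data[OF gibbs_markov] by blast
  then interpret D: gibbs_markov_data \<mu>\<^sub>0 F \<alpha> \<theta> p C1 core rng .
  have ren: "renewal_axioms \<mu>\<^sub>0 D.Om \<alpha> D.psi D.G (d_theta \<alpha> F \<theta>) \<phi> \<beta> C\<^sub>\<tau>"
  proof
    show "\<exists>K. \<forall>v\<in>D.V. D.nrm v \<le> K * D.nrm (v - D.R (\<lambda>x. z ^ \<phi> x * v x))" if "cmod z \<le> 1" "z \<noteq> 1" for z
      by (rule D.resolvent_bound[OF phi_measurable phi_const that(1) spectral[OF that]])
    show "1 \<le> \<phi> x" if "x \<in> D.Om" for x using phi_pos D.Om_space[OF that] by (simp add: space_mu0)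
    show "\<phi> x = \<phi> y" if "a \<in> \<alpha>" "x \<in> a" "y \<in> a" for a x y by (rule phi_const[OF that])
  qed (use phi_measurable beta tail in auto)
  interpret Rn: renewal \<mu>\<^sub>0 F D.Om \<alpha> D.psi D.G "d_theta \<alpha> F \<theta>" \<theta> C1 \<phi> \<beta> C\<^sub>\<tau>
    by (rule renewal.intro[OF D.full_branch_axioms ren])
  have "tower_axioms \<mu>\<^sub>0 F D.Om \<alpha> \<phi> \<beta> f (weight \<epsilon>) (zeta \<epsilon> * C * C\<^sub>\<tau>)"
  proof
    show "F x = (f ^^ \<phi> x) x" for x by (simp add: return_map_def)
    show "weight \<epsilon> i \<in> borel_measurable \<mu>\<^sub>0" for i by (rule weight_measurable)
    show "0 \<le> weight \<epsilon> i x" "weight \<epsilon> i x \<le> 1" for i x by (rule weight_range[OF eps])+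
    show "weight \<epsilon> i x = weight \<epsilon> i y" if "a \<in> \<alpha>" "x \<in> a" "y \<in> a" "i < \<phi> x" for a x y i by (rule weight_const[OF that])
    show "integrable \<mu>\<^sub>0 (\<lambda>x. \<Sum>i<\<phi> x. weight \<epsilon> i x)" by (rule weight_sum_tail(1)[OF eps r])
    show "(\<integral>x. (if n < \<phi> x then \<Sum>i<\<phi> x. weight \<epsilon> i x else 0) \<partial>\<mu>\<^sub>0) \<le> zeta \<epsilon> * C * C\<^sub>\<tau> * (real n + 1) powr - \<beta>" for n
    proof -
      have "(\<integral>x. (if n < \<phi> x then \<Sum>i<\<phi> x. weight \<epsilon> i x else 0) \<partial>\<mu>\<^sub>0) \<le> zeta \<epsilon> * C * measure \<mu>\<^sub>0 {y \<in> space \<mu>\<^sub>0. \<phi> y > n}"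
        by (rule weight_sum_tail(2)[OF eps r])
      also have "\<dots> \<le> zeta \<epsilon> * C * (C\<^sub>\<tau> * (real n + 1) powr - \<beta>)"
        using zeta_pos[OF eps] r(1) by (intro mult_left_mono tail) simp
      finally show ?thesis by (simp only: mult.assoc)
    qed
  qed
  then have "tower \<mu>\<^sub>0 F D.Om \<alpha> D.psi D.G (d_theta \<alpha> F \<theta>) \<theta> C1 \<phi> \<beta> C\<^sub>\<tau> f (weight \<epsilon>) (zeta \<epsilon> * C * C\<^sub>\<tau>)"
    by (rule tower.intro[OF Rn.renewal_axioms])
  then show thesis by (rule that[OF D.Om_itinerary])
qed

end

theorem theorem4p2:
  fixes M :: "'a measure" and f :: "'a \<Rightarrow> 'a" and Y :: "'a set" and \<phi> :: "'a \<Rightarrow> nat"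
    and \<mu>\<^sub>0 :: "'a measure" and \<alpha> :: "'a set set" and \<theta> \<epsilon> \<beta> :: real
  assumes scheme: "inducing_scheme M f Y \<phi> \<mu>\<^sub>0 \<alpha> \<theta>"
    and spectral: "\<And>z::complex. norm z \<le> 1 \<Longrightarrow> z \<noteq> 1 \<Longrightarrow>
      1 \<notin> spectrum_on (B_theta \<mu>\<^sub>0 \<alpha> (return_map f \<phi>) \<theta>)
            (norm_theta \<mu>\<^sub>0 \<alpha> (return_map f \<phi>) \<theta>)
            (twisted_transfer_op \<mu>\<^sub>0 (return_map f \<phi>)
              (B_theta \<mu>\<^sub>0 \<alpha> (return_map f \<phi>) \<theta>) \<phi> z)"
    and eps: "\<epsilon> > 0"
    and beta: "\<beta> > 1"
    and tail: "(\<lambda>n::nat. measure \<mu>\<^sub>0 {y \<in> space \<mu>\<^sub>0. \<phi> y > n}) \<in> O(\<lambda>n. real n powr (- \<beta>))"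
    and reinduce: "\<exists>C::real. C > 0 \<and> (\<forall>n::nat.
      (\<integral>\<^sup>+ y \<in> {y \<in> space \<mu>\<^sub>0. \<phi> y > n}. ennreal (real (reinduce_time f Y \<phi> y)) \<partial>\<mu>\<^sub>0)
        \<le> ennreal (C * measure \<mu>\<^sub>0 {y \<in> space \<mu>\<^sub>0. \<phi> y > n}))"
  shows "\<exists>K::real. \<forall>v w :: 'a \<Rightarrow> real. \<forall>n::nat.
    v \<in> borel_measurable M \<longrightarrow> w \<in> borel_measurable M \<longrightarrow>
    norm_theta_star M f Y \<phi> \<alpha> \<theta> \<epsilon> v < \<infinity> \<longrightarrow> norm_inf_star M f Y \<epsilon> w < \<infinity> \<longrightarrow> 2 \<le> n \<longrightarrow>
    \<bar>((\<integral>x. v x * w ((f ^^ n) x) \<partial>mu_normalized M f \<phi> \<mu>\<^sub>0)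
        - (\<integral>x. v x \<partial>mu_normalized M f \<phi> \<mu>\<^sub>0) * (\<integral>x. w x \<partial>mu_normalized M f \<phi> \<mu>\<^sub>0))
      - 1 / phi_bar \<mu>\<^sub>0 \<phi> * (\<Sum>j. measure \<mu>\<^sub>0 {y \<in> space \<mu>\<^sub>0. \<phi> y > n + 1 + j})
        * (\<integral>x. v x \<partial>mu_normalized M f \<phi> \<mu>\<^sub>0) * (\<integral>x. w x \<partial>mu_normalized M f \<phi> \<mu>\<^sub>0)\<bar>
    \<le> K * enn2real (norm_theta_star M f Y \<phi> \<alpha> \<theta> \<epsilon> v) * enn2real (norm_inf_star M f Y \<epsilon> w)
        * decay_rate \<beta> n"
proof -
  interpret S: inducing_scheme M f Y \<phi> \<mu>\<^sub>0 \<alpha> \<theta> by (rule scheme)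
  interpret prob_space \<mu>\<^sub>0 using S.gibbs_markov by (simp add: gibbs_markov_def)
  obtain C\<^sub>\<tau> where tail': "\<And>n. measure \<mu>\<^sub>0 {y \<in> space \<mu>\<^sub>0. \<phi> y > n} \<le> C\<^sub>\<tau> * (real n + 1) powr - \<beta>"
    using bigo_tail_bound[OF tail beta] by auto
  obtain C where C: "C > 0" "\<And>n. (\<integral>\<^sup>+ y \<in> {y \<in> space \<mu>\<^sub>0. \<phi> y > n}. ennreal (real (reinduce_time f Y \<phi> y)) \<partial>\<mu>\<^sub>0)
        \<le> ennreal (C * measure \<mu>\<^sub>0 {y \<in> space \<mu>\<^sub>0. \<phi> y > n})" using reinduce by blast
  obtain \<Omega> \<psi> G C\<^sub>1 where Om: "\<Omega> \<subseteq> itinerary_set \<alpha> (return_map f \<phi>)"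
    and "tower \<mu>\<^sub>0 (return_map f \<phi>) \<Omega> \<alpha> \<psi> G (d_theta \<alpha> (return_map f \<phi>) \<theta>) \<theta> C\<^sub>1 \<phi> \<beta> C\<^sub>\<tau> f (S.weight \<epsilon>) (S.zeta \<epsilon> * C * C\<^sub>\<tau>)"
    using S.tower_instance[OF spectral eps beta tail' C] by metis
  then interpret T: tower \<mu>\<^sub>0 "return_map f \<phi>" \<Omega> \<alpha> \<psi> G "d_theta \<alpha> (return_map f \<phi>) \<theta>" \<theta> C\<^sub>1 \<phi> \<beta> C\<^sub>\<tau> f "S.weight \<epsilon>" "S.zeta \<epsilon> * C * C\<^sub>\<tau>"
    by blast
  let ?b = "phi_bar \<mu>\<^sub>0 \<phi>"
  have b: "?b = T.phibar" using S.phi_bar_eq T.ts.tau_sum by (simp add: T.phibar_def T.\<tau>_def[abs_def])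
  have b_pos: "?b > 0" unfolding b by (rule T.phibar_pos)
  have wi: "integrable \<mu>\<^sub>0 (\<lambda>y. \<Sum>i<\<phi> y. S.weight \<epsilon> i y)" by (rule T.kappa_int)
  obtain K where K: "\<And>v w V0 W n. (\<And>i. (\<lambda>x. v ((f ^^ i) x)) \<in> borel_measurable \<mu>\<^sub>0) \<Longrightarrow> 0 \<le> V0 \<Longrightarrow>
    (\<And>i x. x \<in> \<Omega> \<Longrightarrow> i < \<phi> x \<Longrightarrow> cmod (v ((f ^^ i) x)) \<le> V0 * S.weight \<epsilon> i x) \<Longrightarrow>
    (\<And>a x x' i. a \<in> \<alpha> \<Longrightarrow> x \<in> a \<Longrightarrow> x \<in> \<Omega> \<Longrightarrow> x' \<in> a \<Longrightarrow> x' \<in> \<Omega> \<Longrightarrow> i < \<phi> x \<Longrightarrow>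
      cmod (v ((f ^^ i) x) - v ((f ^^ i) x')) \<le> V0 * S.weight \<epsilon> i x * d_theta \<alpha> (return_map f \<phi>) \<theta> x x') \<Longrightarrow>
    (\<And>i. (\<lambda>x. w ((f ^^ i) x)) \<in> borel_measurable \<mu>\<^sub>0) \<Longrightarrow> 0 \<le> W \<Longrightarrow>
    (\<And>i x. x \<in> \<Omega> \<Longrightarrow> i < \<phi> x \<Longrightarrow> cmod (w ((f ^^ i) x)) \<le> W * S.weight \<epsilon> i x) \<Longrightarrow>
    cmod ((\<integral>x. (\<Sum>j<\<phi> x. v ((f ^^ j) x) * w ((f ^^ (j + n)) x)) \<partial>\<mu>\<^sub>0)
      - of_real (1 / T.phibar + T.ts.t n / T.phibar\<^sup>2) * (\<integral>x. (\<Sum>j<\<phi> x. v ((f ^^ j) x)) \<partial>\<mu>\<^sub>0) * (\<integral>x. (\<Sum>j<\<phi> x. w ((f ^^ j) x)) \<partial>\<mu>\<^sub>0))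
    \<le> K * V0 * W * T.ts.dd n"
    using T.correlation_bound by blast
  show ?thesis
  \<comment> \<open>The factor 2 comes from \<open>dd_shift\<close>, the division from the
    normalisation of the measure, and \<open>max K 0\<close> allows the rate to be enlarged under
    the constant.\<close>
  proof (intro exI[of _ "max K 0 * 2 / ?b"] allI impI)
    fix v w :: "'a \<Rightarrow> real" and n :: nat
    assume v: "v \<in> borel_measurable M" and w: "w \<in> borel_measurable M"
      and vf: "norm_theta_star M f Y \<phi> \<alpha> \<theta> \<epsilon> v < \<infinity>" and wf: "norm_inf_star M f Y \<epsilon> w < \<infinity>" and n: "2 \<le> n"
    define V0 where "V0 = enn2real (norm_theta_star M f Y \<phi> \<alpha> \<theta> \<epsilon> v)"
    define W where "W = enn2real (norm_inf_star M f Y \<epsilon> w)"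
    have fin: "norm_inf_star M f Y \<epsilon> v < \<infinity>" "seminorm_theta_star f Y \<phi> \<alpha> \<theta> \<epsilon> v < \<infinity>"
      using vf by (auto simp: norm_theta_star_def)
    have V0: "V0 = enn2real (norm_inf_star M f Y \<epsilon> v) + enn2real (seminorm_theta_star f Y \<phi> \<alpha> \<theta> \<epsilon> v)"
      unfolding V0_def norm_theta_star_def using fin by (intro enn2real_plus) auto
    have pos: "0 \<le> V0" "0 \<le> W" by (simp_all add: V0_def W_def)
    have vb: "\<bar>v ((f ^^ i) y)\<bar> \<le> V0 * S.weight \<epsilon> i y" if "y \<in> Y" for i y
      by (rule order_trans[OF S.norm_inf_star_bound[OF fin(1) eps that] mult_right_mono])
         (simp_all add: V0 S.weight_range(1)[OF eps])
    have wb: "\<bar>w ((f ^^ i) y)\<bar> \<le> W * S.weight \<epsilon> i y" if "y \<in> Y" for i y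
      unfolding W_def by (rule S.norm_inf_star_bound[OF wf eps that])
    have wW: "\<bar>w ((f ^^ i) y)\<bar> \<le> W" if "y \<in> Y" for i y
      using order_trans[OF wb[OF that] mult_left_mono[OF S.weight_range(2)[OF eps] pos(2)]] by simp
    have vl: "\<bar>v ((f ^^ i) x) - v ((f ^^ i) x')\<bar> \<le> V0 * S.weight \<epsilon> i x * d_theta \<alpha> (return_map f \<phi>) \<theta> x x'"
      if "a \<in> \<alpha>" "x \<in> a" "x \<in> \<Omega>" "x' \<in> a" "x' \<in> \<Omega>" "i < \<phi> x" for a x x' i
      by (rule order_trans[OF S.seminorm_theta_star_bound[OF fin(2) that(1) _ _ that(6) T.d_range(1)]])
         (use that Om T.d_range(1) S.weight_range(1)[OF eps] in \<open>auto simp: V0 intro!: mult_right_mono\<close>)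
    have OmY: "x \<in> \<Omega> \<Longrightarrow> x \<in> Y" for x using T.Om_space S.space_mu0 by blast
    have comp: "(\<lambda>x. complex_of_real (u ((f ^^ i) x))) \<in> borel_measurable \<mu>\<^sub>0" if "u \<in> borel_measurable M" for u :: "'a \<Rightarrow> real" and i
      by (rule measurable_compose[OF measurable_compose[OF S.funpow_mu0 that]]) measurable
    let ?vw = "\<lambda>x. v x * w ((f ^^ n) x)"
    have vw: "?vw \<in> borel_measurable M" by (intro borel_measurable_times v measurable_compose[OF S.funpow_M w])
    have shift: "(f ^^ n) ((f ^^ j) x) = (f ^^ (j + n)) x" for j x by (simp add: add.commute[of j] funpow_add)
    have vwb: "\<bar>?vw ((f ^^ i) y)\<bar> \<le> (V0 * W) * S.weight \<epsilon> i y" if "y \<in> Y" for i y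
    proof -
      have "\<bar>?vw ((f ^^ i) y)\<bar> \<le> (V0 * S.weight \<epsilon> i y) * W"
        unfolding shift abs_mult by (intro mult_mono vb wW that mult_nonneg_nonneg pos S.weight_range[OF eps]) simp
      then show ?thesis by (simp only: mult_ac)
    qed
    define Iv where "Iv = (\<integral>x. (\<Sum>j<\<phi> x. v ((f ^^ j) x)) \<partial>\<mu>\<^sub>0)"
    define Iw where "Iw = (\<integral>x. (\<Sum>j<\<phi> x. w ((f ^^ j) x)) \<partial>\<mu>\<^sub>0)"
    define Ic where "Ic = (\<integral>x. (\<Sum>j<\<phi> x. v ((f ^^ j) x) * w ((f ^^ (j + n)) x)) \<partial>\<mu>\<^sub>0)"
    have X: "(\<integral>x. v x \<partial>mu_normalized M f \<phi> \<mu>\<^sub>0) = Iv / ?b" "(\<integral>x. w x \<partial>mu_normalized M f \<phi> \<mu>\<^sub>0) = Iw / ?b"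
      "(\<integral>x. v x * w ((f ^^ n) x) \<partial>mu_normalized M f \<phi> \<mu>\<^sub>0) = Ic / ?b"
      unfolding Iv_def Iw_def Ic_def
      using S.integral_mu_normalized[OF v S.tower_sum_integrable[OF v wi vb] b_pos]
        S.integral_mu_normalized[OF w S.tower_sum_integrable[OF w wi wb] b_pos]
        S.integral_mu_normalized[OF vw S.tower_sum_integrable[OF vw wi vwb] b_pos] by (simp_all only: shift)
    have cI: "(\<integral>x. (\<Sum>j<\<phi> x. complex_of_real (v ((f ^^ j) x)) * complex_of_real (w ((f ^^ (j + n)) x))) \<partial>\<mu>\<^sub>0) = of_real Ic"
      "(\<integral>x. (\<Sum>j<\<phi> x. complex_of_real (v ((f ^^ j) x))) \<partial>\<mu>\<^sub>0) = of_real Iv"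
      "(\<integral>x. (\<Sum>j<\<phi> x. complex_of_real (w ((f ^^ j) x))) \<partial>\<mu>\<^sub>0) = of_real Iw"
      unfolding Iv_def Iw_def Ic_def by (simp_all flip: of_real_mult of_real_sum integral_complex_of_real)
    have "cmod (of_real Ic - of_real (1 / T.phibar + T.ts.t n / T.phibar\<^sup>2) * of_real Iv * of_real Iw) \<le> K * V0 * W * T.ts.dd n"
      unfolding cI[symmetric]
    proof (rule K)
      show "cmod (complex_of_real (v ((f ^^ i) x)) - complex_of_real (v ((f ^^ i) x')))
          \<le> V0 * S.weight \<epsilon> i x * d_theta \<alpha> (return_map f \<phi>) \<theta> x x'"
        if "a \<in> \<alpha>" "x \<in> a" "x \<in> \<Omega>" "x' \<in> a" "x' \<in> \<Omega>" "i < \<phi> x" for a x x' i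
        unfolding of_real_diff[symmetric] norm_of_real by (rule vl[OF that])
    qed (use vb[OF OmY] wb[OF OmY] pos comp[OF v] comp[OF w] in auto)
    then have main: "\<bar>Ic - (1 / ?b + T.ts.t n / ?b\<^sup>2) * Iv * Iw\<bar> \<le> K * V0 * W * T.ts.dd n"
      unfolding b of_real_mult[symmetric] of_real_diff[symmetric] norm_of_real .
    have tn: "(\<Sum>j. measure \<mu>\<^sub>0 {y \<in> space \<mu>\<^sub>0. \<phi> y > n + 1 + j}) = T.ts.t n"
      by (simp add: T.ts.t_def T.\<tau>_def)
    \<comment> \<open>After normalisation the term 1/phibar of the expansion becomes the product of
      the means, and t_n/phibar^2 becomes the stated correction.\<close>
    have "Ic / ?b - Iv / ?b * (Iw / ?b) - 1 / ?b * T.ts.t n * (Iv / ?b) * (Iw / ?b)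
        = (Ic - (1 / ?b + T.ts.t n / ?b\<^sup>2) * Iv * Iw) / ?b"
      using b_pos by (simp add: field_simps power2_eq_square)
    then have "\<bar>Ic / ?b - Iv / ?b * (Iw / ?b) - 1 / ?b * T.ts.t n * (Iv / ?b) * (Iw / ?b)\<bar>
        = \<bar>Ic - (1 / ?b + T.ts.t n / ?b\<^sup>2) * Iv * Iw\<bar> / ?b" using b_pos by (simp add: abs_divide)
    also have "\<dots> \<le> max K 0 * (V0 * W) * (2 * decay_rate \<beta> n) / ?b"
    proof (intro divide_right_mono order_trans[OF main])
      have dd0: "0 \<le> T.ts.dd n" using T.ts.dd_pos[of n] by simp
      have "K * V0 * W * T.ts.dd n = K * ((V0 * W) * T.ts.dd n)" by (simp only: mult.assoc)
      also have "\<dots> \<le> max K 0 * ((V0 * W) * T.ts.dd n)" using pos dd0 by (intro mult_right_mono) auto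
      also have "\<dots> \<le> max K 0 * ((V0 * W) * (2 * decay_rate \<beta> n))"
        using pos by (intro mult_left_mono T.ts.dd_shift n) auto
      finally show "K * V0 * W * T.ts.dd n \<le> max K 0 * (V0 * W) * (2 * decay_rate \<beta> n)" by (simp only: mult.assoc)
    qed (use b_pos in simp)
    also have "\<dots> = max K 0 * 2 / ?b * V0 * W * decay_rate \<beta> n" by simp
    finally show "\<bar>((\<integral>x. v x * w ((f ^^ n) x) \<partial>mu_normalized M f \<phi> \<mu>\<^sub>0)
        - (\<integral>x. v x \<partial>mu_normalized M f \<phi> \<mu>\<^sub>0) * (\<integral>x. w x \<partial>mu_normalized M f \<phi> \<mu>\<^sub>0))
      - 1 / phi_bar \<mu>\<^sub>0 \<phi> * (\<Sum>j. measure \<mu>\<^sub>0 {y \<in> space \<mu>\<^sub>0. \<phi> y > n + 1 + j})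
        * (\<integral>x. v x \<partial>mu_normalized M f \<phi> \<mu>\<^sub>0) * (\<integral>x. w x \<partial>mu_normalized M f \<phi> \<mu>\<^sub>0)\<bar>
      \<le> max K 0 * 2 / phi_bar \<mu>\<^sub>0 \<phi> * enn2real (norm_theta_star M f Y \<phi> \<alpha> \<theta> \<epsilon> v) * enn2real (norm_inf_star M f Y \<epsilon> w)
        * decay_rate \<beta> n"
      unfolding X tn V0_def[symmetric] W_def[symmetric] .
  qed
qed

end
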